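(* Starting from the empty graph, the total time spent by the Topology Tree Algorithm (described in the context) to process $\ell$ updates, each an insertion of an isolated vertex or of an edge between two existing vertices, while keeping the weighted simplification $G_s$ of the current graph $G$ up to date, is $O(\ell\log\ell)$.
   Context: Let $G=(V,E,\lambda)$ be a finite undirected graph without self-loops, with edge weights $\lambda:E\to\mathbb{R}^+$. A vertex is regular if it is incident to exactly two edges, and singular otherwise; $V_r$ denotes the set of regular vertices. A regular path is a path between two singular vertices all of whose internal vertices are regular; $G$ is assumed never to have a cycle consisting only of regular vertices. The simplification $G_s$ is the multigraph whose vertices are the singular vertices of $G$, whose edges ("topological edges") are the regular paths of $G$, with weight equal to the sum of the edge weights on the path. Maintaining $G_s$ under an edge insertion requires inserting, extending, merging, or splitting topological edges; a split at a regular vertex $x$ requires finding the topological edge whose regular path contains $x$ and the weights of the two resulting parts. A regular cluster is a set of at most two adjacent regular vertices. A regular partition of $G$ is a partition of $V_r$ into regular clusters such that any two adjacent regular vertices either lie in the same cluster or lie in different clusters at least one of which has size two. A regular multilevel partition is a family of partitions of $V_r$ at levels $0,\dots,k$ with level $0$ a regular partition and level $i$ a regular partition when clusters of level $i-1$ are viewed as regular vertices. The regular forest has one tree per regular path, whose level-$i$ nodes are the level-$i$ clusters, a node at level $i>0$ having as children the level-$(i-1)$ clusters composing it. The Topology Tree Algorithm (a direct adaptation of Frederickson's topology tree maintenance procedure) updates the level-$0$ clusters locally after each edge insertion and then propagates the constantly many changed, inserted and deleted clusters level by level upward, maintaining adjacency information, a pointer from each regular vertex to its level-$0$ cluster, a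 pointer from each root to its topological edge, and cluster weights (the weight of a cluster being the total weight of the edges of $G$ inside it, with weights of connecting edges stored with adjacency information); the topological edge of a regular vertex is found by walking to the root, and its weight is the root weight plus the weights stored with its adjacencies to the two singular endpoints. Time is measured in the unit-cost RAM model. *)

theory Defs
  imports
    Complex_Main
    "HOL-Library.Disjoint_Sets"
    "HOL-Library.Landau_Symbols"
    "HOL-Library.Monad_Syntax"
begin

section \<open>Weighted graphs, regular vertices and the simplification\<close>

record wgraph =
  verts :: "nat set"
  edges :: "nat set set"
  weight :: "nat set \<Rightarrow> real"

definition incident :: "wgraph \<Rightarrow> nat \<Rightarrow> nat set set" where
  "incident G v = {e \<in> edges G. v \<in> e}"

definition regulars :: "wgraph \<Rightarrow> nat set" where
  "regulars G = {v \<in> verts G. card (incident G v) = 2}"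

definition singulars :: "wgraph \<Rightarrow> nat set" where
  "singulars G = verts G - regulars G"

definition path_edges :: "'v list \<Rightarrow> 'v set list" where
  "path_edges p = map (\<lambda>(a, b). {a, b}) (zip p (tl p))"

definition interior :: "'v list \<Rightarrow> 'v list" where
  "interior p = butlast (tl p)"

text \<open>The two singular ends of a regular path may coincide; the path is then a loop of the
  simplification.  A single edge between two singular vertices is a regular path.\<close>

definition regular_path :: "wgraph \<Rightarrow> nat list \<Rightarrow> bool" where
  "regular_path G p \<longleftrightarrow>
     length p \<ge> 2 \<and> set (path_edges p) \<subseteq> edges G \<and>
     distinct (path_edges p) \<and> distinct (interior p) \<and>
     hd p \<in> singulars G \<and> last p \<in> singulars G \<and> set (interior p) \<subseteq> regulars G"

definition regular_cycle :: "wgraph \<Rightarrow> nat list \<Rightarrow> bool" where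
  "regular_cycle G c \<longleftrightarrow>
     length c \<ge> 3 \<and> distinct c \<and> set c \<subseteq> regulars G \<and>
     set (path_edges (c @ [hd c])) \<subseteq> edges G"

record ('v, 'e) wmultigraph =
  mverts :: "'v set"
  medges :: "'e set"
  mends :: "'e \<Rightarrow> 'v set"
  mweight :: "'e \<Rightarrow> real"

text \<open>A topological edge is represented by the set of edges of a regular path, which is the same
  for both directions of traversal.  Its ends are the singular vertices lying on it.\<close>

definition simplification :: "wgraph \<Rightarrow> (nat, nat set set) wmultigraph" where
  "simplification G =
     \<lparr> mverts = singulars G,
       medges = {set (path_edges p) | p. regular_path G p},
       mends = (\<lambda>t. \<Union> t \<inter> singulars G),
       mweight = (\<lambda>t. \<Sum>e\<in>t. weight G e) \<rparr>"

text \<open>Equality of multigraphs up to the names of the edges.\<close>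

definition same_multigraph ::
  "('v, 'e) wmultigraph \<Rightarrow> ('v, 'f) wmultigraph \<Rightarrow> bool" where
  "same_multigraph H K \<longleftrightarrow>
     mverts H = mverts K \<and>
     (\<exists>f. bij_betw f (medges H) (medges K) \<and>
        (\<forall>e \<in> medges H. mends K (f e) = mends H e \<and> mweight K (f e) = mweight H e))"


section \<open>Update sequences\<close>

datatype update = InsVertex nat | InsEdge nat nat real

definition empty_graph :: wgraph where
  "empty_graph = \<lparr> verts = {}, edges = {}, weight = (\<lambda>_. 0) \<rparr>"

fun apply_update :: "update \<Rightarrow> wgraph \<Rightarrow> wgraph" where
  "apply_update (InsVertex v) G = G\<lparr>verts := insert v (verts G)\<rparr>"
| "apply_update (InsEdge x y w) G =
     G\<lparr>edges := insert {x, y} (edges G), weight := (weight G)({x, y} := w)\<rparr>"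

fun valid_update :: "wgraph \<Rightarrow> update \<Rightarrow> bool" where
  "valid_update G (InsVertex v) \<longleftrightarrow> v \<notin> verts G"
| "valid_update G (InsEdge x y w) \<longleftrightarrow>
     x \<in> verts G \<and> y \<in> verts G \<and> x \<noteq> y \<and> {x, y} \<notin> edges G \<and> w > 0"

definition graph_of :: "update list \<Rightarrow> wgraph" where
  "graph_of us = fold apply_update us empty_graph"

definition admissible :: "update list \<Rightarrow> bool" where
  "admissible us \<longleftrightarrow>
     (\<forall>i < length us. valid_update (graph_of (take i us)) (us ! i) \<and>
        (\<nexists>c. regular_cycle (graph_of (take (Suc i) us)) c))"


section \<open>Regular multilevel partitions\<close>

text \<open>The first two arguments are the adjacency relation and the set of (regular) vertices.  They
  are parameters since at higher levels clusters take the place of vertices.\<close>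

definition regular_partition :: "('a \<Rightarrow> 'a \<Rightarrow> bool) \<Rightarrow> 'a set \<Rightarrow> 'a set set \<Rightarrow> bool" where
  "regular_partition adj X P \<longleftrightarrow>
     partition_on X P \<and>
     (\<forall>C \<in> P. finite C \<and> card C \<le> 2 \<and> (\<forall>a \<in> C. \<forall>b \<in> C. a \<noteq> b \<longrightarrow> adj a b)) \<and>
     (\<forall>C \<in> P. \<forall>D \<in> P. \<forall>a \<in> C. \<forall>b \<in> D. adj a b \<longrightarrow> C = D \<or> card C = 2 \<or> card D = 2)"

definition vertex_adj :: "wgraph \<Rightarrow> nat \<Rightarrow> nat \<Rightarrow> bool" where
  "vertex_adj G x y \<longleftrightarrow> {x, y} \<in> edges G"

definition cluster_adj :: "wgraph \<Rightarrow> nat set \<Rightarrow> nat set \<Rightarrow> bool" where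
  "cluster_adj G C D \<longleftrightarrow> C \<noteq> D \<and> (\<exists>x \<in> C. \<exists>y \<in> D. vertex_adj G x y)"

definition regular_multilevel_partition ::
  "wgraph \<Rightarrow> nat \<Rightarrow> (nat \<Rightarrow> nat set set) \<Rightarrow> bool" where
  "regular_multilevel_partition G k P \<longleftrightarrow>
     regular_partition (vertex_adj G) (regulars G) (P 0) \<and>
     (\<forall>i < k. \<exists>Q. regular_partition (cluster_adj G) (P i) Q \<and> P (Suc i) = \<Union> ` Q)"


section \<open>Random access memory with unit cost\<close>

text \<open>The neighbour of a cluster on one of its two sides is a cluster of the same level or a
  singular vertex; it is stored together with the weight of the connecting edge.\<close>

datatype nbr = Cluster nat | Singular nat

type_synonym side = "nbr \<times> real"

text \<open>Nodes without children are regular vertices; the level of a cluster is the number of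
  generations between it and the regular vertices below it, minus one.\<close>

record node =
  parent :: "nat option"
  kids :: "nat list"
  sides :: "side \<times> side"
  wt :: real
  top_edge :: "nat option"

text \<open>The list of incident edges is a linked list.  The program only conses to it and inspects its
  first three constructors.\<close>

record vertex =
  inc :: "nat list"
  vnode :: "nat option"

text \<open>The last field is used for edges whose two ends are singular.\<close>

record edge =
  eends :: "nat \<times> nat"
  ewt :: real
  etop :: "nat option"

record tedge =
  tends :: "nat \<times> nat"
  twt :: real

text \<open>Four arrays of records of constant size, and allocation counters for three of them.  The
  array of vertices is indexed by the vertex names occurring in the updates.\<close>

record mem =
  vtab :: "nat \<Rightarrow> vertex option"
  etab :: "nat \<Rightarrow> edge option"
  ntab :: "nat \<Rightarrow> node option"
  ttab :: "nat \<Rightarrow> tedge option"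
  ecnt :: nat
  ncnt :: nat
  tcnt :: nat

definition empty_mem :: mem where
  "empty_mem = \<lparr> vtab = Map.empty, etab = Map.empty, ntab = Map.empty, ttab = Map.empty,
                 ecnt = 0, ncnt = 0, tcnt = 0 \<rparr>"

text \<open>A computation returns a result, the number of elapsed time units and the new memory;
  \<open>None\<close> stands for nontermination or an access to an unallocated record.  One time unit is charged
  for each access to a record, for each iteration of a loop and for each exit from a loop.  The
  program below touches memory only through these operations and performs only boundedly many
  arithmetic operations, comparisons and list constructor operations between two of them.\<close>

type_synonym 'a ram = "mem \<Rightarrow> ('a \<times> nat \<times> mem) option"

definition ret :: "'a \<Rightarrow> 'a ram" where
  "ret x = (\<lambda>m. Some (x, 0, m))"

definition ram_bind :: "'a ram \<Rightarrow> ('a \<Rightarrow> 'b ram) \<Rightarrow> 'b ram" where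
  "ram_bind f g = (\<lambda>m. case f m of None \<Rightarrow> None
     | Some (x, t, m') \<Rightarrow> (case g x m' of None \<Rightarrow> None | Some (y, t', m'') \<Rightarrow> Some (y, t + t', m'')))"

adhoc_overloading Monad_Syntax.bind == ram_bind

lemma ram_bind_mono [partial_function_mono]:
  fixes B :: "('f \<Rightarrow> 'r option) \<Rightarrow> 'x ram"
  assumes "\<And>m. mono_option (\<lambda>f. B f m)" and "\<And>x m. mono_option (\<lambda>f. C x f m)"
  shows "mono_option (\<lambda>f. ram_bind (B f) (\<lambda>x. C x f) m)"
proof (rule monotoneI)
  fix f g :: "'f \<Rightarrow> 'r option"
  assume fg: "fun_ord option_ord f g"
  have B: "option_ord (B f m) (B g m)" for m
    using assms(1) fg unfolding monotone_on_def by blast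
  have C: "option_ord (C x f m) (C x g m)" for x m
    using assms(2) fg unfolding monotone_on_def by blast
  show "option_ord (ram_bind (B f) (\<lambda>x. C x f) m) (ram_bind (B g) (\<lambda>x. C x g) m)"
  proof (cases "B f m")
    case None
    then show ?thesis by (simp add: ram_bind_def flat_ord_def)
  next
    case (Some r)
    obtain x t m' where r: "r = (x, t, m')" by (cases r)
    have "B g m = Some (x, t, m')"
      using B[of m] Some r by (auto simp: flat_ord_def)
    then show ?thesis
      using C[of x m'] Some r by (auto simp: ram_bind_def flat_ord_def split: option.splits)
  qed
qed

definition tick :: "unit ram" where
  "tick = (\<lambda>m. Some ((), 1, m))"

definition read_vertex :: "nat \<Rightarrow> vertex ram" where
  "read_vertex v = (\<lambda>m. map_option (\<lambda>r. (r, 1, m)) (vtab m v))"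

definition write_vertex :: "nat \<Rightarrow> vertex \<Rightarrow> unit ram" where
  "write_vertex v r = (\<lambda>m. Some ((), 1, m\<lparr>vtab := (vtab m)(v \<mapsto> r)\<rparr>))"

definition read_edge :: "nat \<Rightarrow> edge ram" where
  "read_edge e = (\<lambda>m. map_option (\<lambda>r. (r, 1, m)) (etab m e))"

definition write_edge :: "nat \<Rightarrow> edge \<Rightarrow> unit ram" where
  "write_edge e r = (\<lambda>m. Some ((), 1, m\<lparr>etab := (etab m)(e \<mapsto> r)\<rparr>))"

definition new_edge :: "edge \<Rightarrow> nat ram" where
  "new_edge r = (\<lambda>m. Some (ecnt m, 1, m\<lparr>etab := (etab m)(ecnt m \<mapsto> r), ecnt := Suc (ecnt m)\<rparr>))"

definition read_node :: "nat \<Rightarrow> node ram" where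
  "read_node p = (\<lambda>m. map_option (\<lambda>r. (r, 1, m)) (ntab m p))"

definition write_node :: "nat \<Rightarrow> node \<Rightarrow> unit ram" where
  "write_node p r = (\<lambda>m. Some ((), 1, m\<lparr>ntab := (ntab m)(p \<mapsto> r)\<rparr>))"

definition new_node :: "node \<Rightarrow> nat ram" where
  "new_node r = (\<lambda>m. Some (ncnt m, 1, m\<lparr>ntab := (ntab m)(ncnt m \<mapsto> r), ncnt := Suc (ncnt m)\<rparr>))"

definition free_node :: "nat \<Rightarrow> unit ram" where
  "free_node p = (\<lambda>m. Some ((), 1, m\<lparr>ntab := (ntab m)(p := None)\<rparr>))"

definition is_live :: "nat \<Rightarrow> bool ram" where
  "is_live p = (\<lambda>m. Some (ntab m p \<noteq> None, 1, m))"

definition new_tedge :: "tedge \<Rightarrow> nat ram" where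
  "new_tedge r = (\<lambda>m. Some (tcnt m, 1, m\<lparr>ttab := (ttab m)(tcnt m \<mapsto> r), tcnt := Suc (tcnt m)\<rparr>))"

definition free_tedge :: "nat \<Rightarrow> unit ram" where
  "free_tedge t = (\<lambda>m. Some ((), 1, m\<lparr>ttab := (ttab m)(t := None)\<rparr>))"

partial_function (option) while_do :: "('s \<Rightarrow> bool) \<Rightarrow> ('s \<Rightarrow> 's ram) \<Rightarrow> 's \<Rightarrow> 's ram" where
  "while_do b c s m =
     (if b s then (do { tick; s' \<leftarrow> c s; while_do b c s' }) m else (do { tick; ret s }) m)"

fun foreach :: "'x list \<Rightarrow> ('x \<Rightarrow> 's \<Rightarrow> 's ram) \<Rightarrow> 's \<Rightarrow> 's ram" where
  "foreach [] c s = do { tick; ret s }"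
| "foreach (x # xs) c s = do { tick; s' \<leftarrow> c x s; foreach xs c s' }"


section \<open>The Topology Tree Algorithm\<close>

text \<open>The topological edge of a regular vertex is found by walking from its node to the root.\<close>

definition topological_edge_of :: "nat \<Rightarrow> nat ram" where
  "topological_edge_of p = do {
     r \<leftarrow> read_node p;
     r \<leftarrow> while_do (\<lambda>r. parent r \<noteq> None) (\<lambda>r. read_node (the (parent r))) r;
     ret (the (top_edge r)) }"

subsection \<open>One level of the propagation\<close>

definition side_to :: "nat \<Rightarrow> side \<times> side \<Rightarrow> side" where
  "side_to q s = (if fst (fst s) = Cluster q then fst s else snd s)"

definition side_away :: "nat \<Rightarrow> side \<times> side \<Rightarrow> side" where
  "side_away q s = (if fst (fst s) = Cluster q then snd s else fst s)"

definition parent_side :: "side \<Rightarrow> side ram" where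
  "parent_side s = (case fst s of
     Singular v \<Rightarrow> ret s
   | Cluster q \<Rightarrow> do { r \<leftarrow> read_node q; ret (Cluster (the (parent r)), snd s) })"

definition update_sides :: "nat \<Rightarrow> unit ram" where
  "update_sides p = do {
     r \<leftarrow> read_node p;
     (case kids r of
        [c] \<Rightarrow> do {
          rc \<leftarrow> read_node c;
          s1 \<leftarrow> parent_side (fst (sides rc));
          s2 \<leftarrow> parent_side (snd (sides rc));
          write_node p (r\<lparr>sides := (s1, s2)\<rparr>) }
      | [c, d] \<Rightarrow> do {
          rc \<leftarrow> read_node c;
          rd \<leftarrow> read_node d;
          s1 \<leftarrow> parent_side (side_away d (sides rc));
          s2 \<leftarrow> parent_side (side_away c (sides rd));
          write_node p (r\<lparr>sides := (s1, s2)\<rparr>) }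
      | _ \<Rightarrow> ret ()) }"

text \<open>The adjacencies of a new cluster are filled in by \<open>settle\<close> once its whole level is known.\<close>

definition new_single :: "nat \<Rightarrow> nat ram" where
  "new_single c = do {
     rc \<leftarrow> read_node c;
     p \<leftarrow> new_node \<lparr> parent = None, kids = [c], sides = sides rc, wt = wt rc, top_edge = None \<rparr>;
     write_node c (rc\<lparr>parent := Some p\<rparr>);
     ret p }"

definition new_pair :: "nat \<Rightarrow> nat \<Rightarrow> nat ram" where
  "new_pair c d = do {
     rc \<leftarrow> read_node c;
     rd \<leftarrow> read_node d;
     p \<leftarrow> new_node \<lparr> parent = None, kids = [c, d], sides = sides rc,
                      wt = wt rc + snd (side_to d (sides rc)) + wt rd, top_edge = None \<rparr>;
     write_node c (rc\<lparr>parent := Some p\<rparr>);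
     write_node d (rd\<lparr>parent := Some p\<rparr>);
     ret p }"

definition push_opt :: "'a option \<Rightarrow> 'a list \<Rightarrow> 'a list" where
  "push_opt x xs = (case x of None \<Rightarrow> xs | Some a \<Rightarrow> a # xs)"

text \<open>The loop state of the propagation at level \<open>i\<close> consists of a list \<open>A\<close> of clusters of level \<open>i\<close>
  which are new or have lost their parent, and a list \<open>K\<close> of clusters of level \<open>i + 1\<close> which are to
  be deleted since one of their children was deleted or changed.  Each step first deletes the
  clusters in \<open>K\<close>, which orphans their surviving children.\<close>

definition orphan :: "nat \<Rightarrow> nat list \<Rightarrow> nat list ram" where
  "orphan c A = do {
     l \<leftarrow> is_live c;
     if l then do { r \<leftarrow> read_node c; write_node c (r\<lparr>parent := None\<rparr>); ret (c # A) } else ret A }"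

definition delete_cluster :: "nat \<Rightarrow> nat list \<times> nat list \<Rightarrow> (nat list \<times> nat list) ram" where
  "delete_cluster p = (\<lambda>(A, K). do {
     l \<leftarrow> is_live p;
     if l then do {
       r \<leftarrow> read_node p;
       free_node p;
       A \<leftarrow> foreach (kids r) orphan A;
       ret (A, push_opt (parent r) K) }
     else ret (A, K) })"

text \<open>A neighbouring cluster on the given side with which an orphan can be joined: one that has no
  parent either, or one that is the only child of its parent, which is deleted in this case.\<close>

definition find_mate :: "side \<Rightarrow> nat list \<Rightarrow> (nat option \<times> nat list) ram" where
  "find_mate s K = (case fst s of
     Singular v \<Rightarrow> ret (None, K)
   | Cluster q \<Rightarrow> do {
       r \<leftarrow> read_node q;
       (case parent r of
          None \<Rightarrow> ret (Some q, K)
        | Some p \<Rightarrow> do {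
            rp \<leftarrow> read_node p;
            if kids rp = [q] then do { free_node p; ret (Some q, push_opt (parent rp) K) }
            else ret (None, K) }) })"

text \<open>A cluster without adjacent clusters comprises all of a regular path.  It becomes the root of
  its tree and receives the topological edge.  (A regular vertex is first put into a cluster of
  level 0.)  In the loop state of \<open>place\<close>, \<open>B\<close> collects the new clusters of level \<open>i + 1\<close> and \<open>K\<close>
  the clusters of level \<open>i + 2\<close> to be deleted.\<close>

definition place :: "nat \<Rightarrow> nat list \<times> nat list \<Rightarrow> (nat list \<times> nat list) ram" where
  "place n = (\<lambda>(B, K). do {
     l \<leftarrow> is_live n;
     if \<not> l then ret (B, K)
     else do {
       r \<leftarrow> read_node n;
       if parent r \<noteq> None then ret (B, K)
       else (case (kids r, sides r) of
         (_ # _, ((Singular u, a), (Singular v, b))) \<Rightarrow> do {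
           t \<leftarrow> new_tedge \<lparr> tends = (u, v), twt = wt r + a + b \<rparr>;
           write_node n (r\<lparr>top_edge := Some t\<rparr>);
           ret (B, K) }
       | _ \<Rightarrow> do {
           (q, K) \<leftarrow> find_mate (fst (sides r)) K;
           (q, K) \<leftarrow> (if q = None then find_mate (snd (sides r)) K else ret (q, K));
           p \<leftarrow> (case q of None \<Rightarrow> new_single n | Some q \<Rightarrow> new_pair n q);
           ret (p # B, K) }) } })"

definition settle_nbr :: "side \<Rightarrow> unit ram" where
  "settle_nbr s = (case fst s of Singular v \<Rightarrow> ret () | Cluster q \<Rightarrow> update_sides q)"

definition settle :: "nat \<Rightarrow> unit \<Rightarrow> unit ram" where
  "settle p _ = do {
     l \<leftarrow> is_live p;
     if l then do {
       update_sides p;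
       r \<leftarrow> read_node p;
       settle_nbr (fst (sides r));
       settle_nbr (snd (sides r)) }
     else ret () }"

definition level_step :: "nat list \<times> nat list \<Rightarrow> (nat list \<times> nat list) ram" where
  "level_step = (\<lambda>(A, K). do {
     (A, K) \<leftarrow> foreach K delete_cluster (A, []);
     (B, K) \<leftarrow> foreach A place ([], K);
     foreach B settle ();
     ret (B, K) })"

definition propagate :: "nat list \<Rightarrow> nat list \<Rightarrow> unit ram" where
  "propagate A K = do {
     while_do (\<lambda>(A, K). A \<noteq> [] \<or> K \<noteq> []) level_step (A, K);
     ret () }"

subsection \<open>Edge insertion\<close>

definition other_end :: "nat \<Rightarrow> edge \<Rightarrow> nat" where
  "other_end v e = (if fst (eends e) = v then snd (eends e) else fst (eends e))"

definition replace_nbr :: "nbr \<Rightarrow> nbr \<Rightarrow> node \<Rightarrow> node" where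
  "replace_nbr x y r =
     r\<lparr>sides := map_prod (apfst (\<lambda>z. if z = x then y else z)) (apfst (\<lambda>z. if z = x then y else z))
                  (sides r)\<rparr>"

definition new_direct :: "nat \<Rightarrow> unit ram" where
  "new_direct e = do {
     re \<leftarrow> read_edge e;
     t \<leftarrow> new_tedge \<lparr> tends = eends re, twt = ewt re \<rparr>;
     write_edge e (re\<lparr>etop := Some t\<rparr>) }"

text \<open>Splitting: the regular vertex \<open>v\<close> with node \<open>l\<close> becomes singular.\<close>

definition split_off :: "nat \<Rightarrow> nat \<Rightarrow> nat \<Rightarrow> nat list \<Rightarrow> nat list ram" where
  "split_off v l e K = do {
     re \<leftarrow> read_edge e;
     u \<leftarrow> read_vertex (other_end v re);
     (case vnode u of
        None \<Rightarrow> do { new_direct e; ret K }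
      | Some n \<Rightarrow> do {
          r \<leftarrow> read_node n;
          write_node n (replace_nbr (Cluster l) (Singular v) r);
          ret (push_opt (parent r) K) }) }"

definition make_singular :: "nat \<Rightarrow> unit ram" where
  "make_singular v = do {
     rv \<leftarrow> read_vertex v;
     (case (inc rv, vnode rv) of
        ([e1, e2], Some l) \<Rightarrow> do {
          t \<leftarrow> topological_edge_of l;
          free_tedge t;
          r \<leftarrow> read_node l;
          free_node l;
          write_vertex v (rv\<lparr>vnode := None\<rparr>);
          K \<leftarrow> split_off v l e1 (push_opt (parent r) []);
          K \<leftarrow> split_off v l e2 K;
          propagate [] K }
      | _ \<Rightarrow> ret ()) }"

text \<open>Merging (or extending): the singular vertex \<open>v\<close> of degree two becomes regular, with node \<open>l\<close>.\<close>

definition join :: "nat \<Rightarrow> nat \<Rightarrow> nat \<Rightarrow> nat list \<Rightarrow> (side \<times> nat list) ram" where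
  "join v l e K = do {
     re \<leftarrow> read_edge e;
     u \<leftarrow> read_vertex (other_end v re);
     (case vnode u of
        None \<Rightarrow> do {
          free_tedge (the (etop re));
          write_edge e (re\<lparr>etop := None\<rparr>);
          ret ((Singular (other_end v re), ewt re), K) }
      | Some n \<Rightarrow> do {
          t \<leftarrow> topological_edge_of n;
          free_tedge t;
          r \<leftarrow> read_node n;
          write_node n (replace_nbr (Singular v) (Cluster l) r);
          ret ((Cluster n, ewt re), push_opt (parent r) K) }) }"

definition make_regular :: "nat \<Rightarrow> unit ram" where
  "make_regular v = do {
     rv \<leftarrow> read_vertex v;
     (case (inc rv, vnode rv) of
        ([e1, e2], None) \<Rightarrow> do {
          l \<leftarrow> new_node \<lparr> parent = None, kids = [], sides = ((Singular v, 0), (Singular v, 0)),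
                           wt = 0, top_edge = None \<rparr>;
          (s1, K) \<leftarrow> join v l e1 [];
          (s2, K) \<leftarrow> join v l e2 K;
          write_node l \<lparr> parent = None, kids = [], sides = (s1, s2), wt = 0, top_edge = None \<rparr>;
          write_vertex v (rv\<lparr>vnode := Some l\<rparr>);
          propagate [l] K }
      | _ \<Rightarrow> ret ()) }"

definition add_incidence :: "nat \<Rightarrow> nat \<Rightarrow> unit ram" where
  "add_incidence v e = do { rv \<leftarrow> read_vertex v; write_vertex v (rv\<lparr>inc := e # inc rv\<rparr>) }"

definition insert_edge :: "nat \<Rightarrow> nat \<Rightarrow> real \<Rightarrow> unit ram" where
  "insert_edge x y w = do {
     make_singular x;
     make_singular y;
     e \<leftarrow> new_edge \<lparr> eends = (x, y), ewt = w, etop = None \<rparr>;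
     add_incidence x e;
     add_incidence y e;
     new_direct e;
     make_regular x;
     make_regular y }"

fun process :: "update \<Rightarrow> unit \<Rightarrow> unit ram" where
  "process (InsVertex v) _ = write_vertex v \<lparr> inc = [], vnode = None \<rparr>"
| "process (InsEdge x y w) _ = insert_edge x y w"

definition topology_tree_algorithm :: "update list \<Rightarrow> unit ram" where
  "topology_tree_algorithm us = foreach us process ()"


section \<open>What is stored in the memory\<close>

definition stored_simplification :: "mem \<Rightarrow> (nat, nat) wmultigraph" where
  "stored_simplification m =
     \<lparr> mverts = {v. \<exists>r. vtab m v = Some r \<and> vnode r = None},
       medges = dom (ttab m),
       mends = (\<lambda>t. {fst (tends (the (ttab m t))), snd (tends (the (ttab m t)))}),
       mweight = (\<lambda>t. twt (the (ttab m t))) \<rparr>"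

text \<open>Since a root is its own image here, the cluster stored at the root of a low tree counts for
  all higher levels as well.\<close>

definition up :: "mem \<Rightarrow> nat \<Rightarrow> nat" where
  "up m p = (case ntab m p of None \<Rightarrow> p
     | Some r \<Rightarrow> (case parent r of None \<Rightarrow> p | Some q \<Rightarrow> q))"

definition stored_cluster :: "mem \<Rightarrow> nat \<Rightarrow> nat \<Rightarrow> nat" where
  "stored_cluster m i v = (up m ^^ Suc i) (the (vnode (the (vtab m v))))"

definition stored_level :: "wgraph \<Rightarrow> mem \<Rightarrow> nat \<Rightarrow> nat set set" where
  "stored_level G m i =
     {{w \<in> regulars G. stored_cluster m i w = stored_cluster m i v} | v. v \<in> regulars G}"

text \<open>The trees of the regular forest correspond to the regular paths with at least one regular
  vertex.\<close>

definition stores_regular_forest :: "wgraph \<Rightarrow> mem \<Rightarrow> bool" where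
  "stores_regular_forest G m \<longleftrightarrow>
     (\<exists>k. regular_multilevel_partition G k (stored_level G m) \<and>
          stored_level G m k = {set (interior p) | p. regular_path G p \<and> interior p \<noteq> []})"

end

theory Submission
  imports Defs
begin

text \<open>
  A tree of the regular forest has logarithmic height: of two adjacent clusters at least one has two
  children, so the number of pairs of adjacent clusters shrinks by a factor of \<open>2/3\<close> from one level to the
  next.  A change at a vertex affects, at every level, only clusters inside a connected neighbourhood
  of the change.  Regular vertices have degree two, so this region has at most four outgoing edges;
  enlarging it by its neighbouring clusters therefore adds a bounded number of clusters, and since
  single clusters in it are at most as numerous as pairs (up to the boundary), going up one level
  divides their number by about \<open>3/2\<close>.  Hence the work per level is bounded, except for deletions,
  which are paid for by a potential proportional to the number of nodes.

  The stored data are determined by the vertex sets of the nodes: the root of a tree comprises a set of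
  regular vertices closed under adjacency with exactly two outgoing edges, and such a set is the
  interior of exactly one regular path because there are no regular cycles.
\<close>


section \<open>Running times and postconditions\<close>

text \<open>The obstacle is the state in the middle of a propagation: the table is right below the
  current level, wrong near the change and stale above it. Three devices describe it. Claims about a
  cluster are made only if its level is already repaired or it avoids the changed vertices
  (\<open>ok\<close>). Elsewhere above the repaired level a side must merely not contradict the live
  clusters (\<open>weak\<close>), which is enough to make it exact once the level below is complete.
  Orphans and clusters due for deletion are explicit exceptions (\<open>Or\<close>,
  \<open>D\<close>). The region has a second task: it stays within components that contain a change
  (\<open>theta\<close>), so that untouched roots are never deleted. Its size bound 26 is the value
  that one level reproduces: three enlargements by at most 4 clusters give 38, and 38 clusters have
  at most 26 parents. The height bound \<open>H\<close> is fixed in advance from the length of the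
  whole update sequence. It limits the number of iterations, and new clusters respect it because
  above the leaves a parent is only made for a cluster that still has a neighbour.\<close>

definition runs :: "'a ram \<Rightarrow> mem \<Rightarrow> ('a \<Rightarrow> nat \<Rightarrow> mem \<Rightarrow> bool) \<Rightarrow> bool" where
  "runs f m Q \<longleftrightarrow> (\<exists>x t m'. f m = Some (x, t, m') \<and> Q x t m')"

lemma runs_mono: "runs f m Q \<Longrightarrow> (\<And>x t m'. Q x t m' \<Longrightarrow> Q' x t m') \<Longrightarrow> runs f m Q'"
  by (auto simp: runs_def)

lemma runs_bind: "runs (ram_bind f g) m Q \<longleftrightarrow>
    runs f m (\<lambda>x t m'. runs (g x) m' (\<lambda>y t' m''. Q y (t + t') m''))"
  by (auto simp: runs_def ram_bind_def split: option.splits prod.splits)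

lemma runs_ret: "runs (ret x) m Q \<longleftrightarrow> Q x 0 m"
  by (auto simp: runs_def ret_def)

lemma runs_tick: "runs tick m Q \<longleftrightarrow> Q () 1 m"
  by (auto simp: runs_def tick_def)

lemma runs_read_vertex: "runs (read_vertex v) m Q \<longleftrightarrow> (\<exists>r. vtab m v = Some r \<and> Q r 1 m)"
  by (auto simp: runs_def read_vertex_def)

lemma runs_write_vertex: "runs (write_vertex v r) m Q \<longleftrightarrow> Q () 1 (m\<lparr>vtab := (vtab m)(v \<mapsto> r)\<rparr>)"
  by (auto simp: runs_def write_vertex_def)

lemma runs_read_edge: "runs (read_edge v) m Q \<longleftrightarrow> (\<exists>r. etab m v = Some r \<and> Q r 1 m)"
  by (auto simp: runs_def read_edge_def)

lemma runs_write_edge: "runs (write_edge v r) m Q \<longleftrightarrow> Q () 1 (m\<lparr>etab := (etab m)(v \<mapsto> r)\<rparr>)"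
  by (auto simp: runs_def write_edge_def)

lemma runs_new_edge: "runs (new_edge r) m Q \<longleftrightarrow>
    Q (ecnt m) 1 (m\<lparr>etab := (etab m)(ecnt m \<mapsto> r), ecnt := Suc (ecnt m)\<rparr>)"
  by (auto simp: runs_def new_edge_def)

lemma runs_read_node: "runs (read_node v) m Q \<longleftrightarrow> (\<exists>r. ntab m v = Some r \<and> Q r 1 m)"
  by (auto simp: runs_def read_node_def)

lemma runs_write_node: "runs (write_node v r) m Q \<longleftrightarrow> Q () 1 (m\<lparr>ntab := (ntab m)(v \<mapsto> r)\<rparr>)"
  by (auto simp: runs_def write_node_def)

lemma runs_new_node: "runs (new_node r) m Q \<longleftrightarrow>
    Q (ncnt m) 1 (m\<lparr>ntab := (ntab m)(ncnt m \<mapsto> r), ncnt := Suc (ncnt m)\<rparr>)"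
  by (auto simp: runs_def new_node_def)

lemma runs_free_node: "runs (free_node p) m Q \<longleftrightarrow> Q () 1 (m\<lparr>ntab := (ntab m)(p := None)\<rparr>)"
  by (auto simp: runs_def free_node_def)

lemma runs_is_live: "runs (is_live p) m Q \<longleftrightarrow> Q (ntab m p \<noteq> None) 1 m"
  by (auto simp: runs_def is_live_def)

lemma runs_new_tedge: "runs (new_tedge r) m Q \<longleftrightarrow>
    Q (tcnt m) 1 (m\<lparr>ttab := (ttab m)(tcnt m \<mapsto> r), tcnt := Suc (tcnt m)\<rparr>)"
  by (auto simp: runs_def new_tedge_def)

lemma runs_free_tedge: "runs (free_tedge p) m Q \<longleftrightarrow> Q () 1 (m\<lparr>ttab := (ttab m)(p := None)\<rparr>)"
  by (auto simp: runs_def free_tedge_def)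

lemmas runs_simps = runs_bind runs_ret runs_tick runs_read_vertex runs_write_vertex runs_read_edge
  runs_write_edge runs_new_edge runs_read_node runs_write_node runs_new_node runs_free_node
  runs_is_live runs_new_tedge runs_free_tedge

lemma runs_foreach:
  assumes step: "\<And>x xs s m. I (x # xs) s m \<Longrightarrow> runs (c x s) m (\<lambda>s' t m'. t \<le> k \<and> I xs s' m')"
    and init: "I xs s m"
  shows "runs (foreach xs c s) m (\<lambda>s' t m'. t \<le> (k + 1) * length xs + 1 \<and> I [] s' m')"
  using init
proof (induction xs arbitrary: s m)
  case Nil
  then show ?case by (simp add: runs_simps)
next
  case (Cons x xs)
  show ?case
    apply (simp add: runs_simps)
    apply (rule runs_mono[OF step[OF Cons.prems]])
    apply (elim conjE)
    apply (rule runs_mono[OF Cons.IH], assumption)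
    apply auto
    done
qed

text \<open>The invariant carries the iteration number \<open>i\<close>, and entering the body
  implies \<open>i \<le> n\<close>; this replaces a termination measure. In the propagation
  \<open>i\<close> is the level. Work beyond \<open>k\<close> in an iteration must be paid by a drop
  of \<open>pot\<close>; the last unit is the exit from the loop.\<close>

lemma runs_while_do:
  assumes step: "\<And>i s m. I i s m \<Longrightarrow> b s \<Longrightarrow>
      i \<le> n \<and> runs (c s) m (\<lambda>s' t m'. I (Suc i) s' m' \<and> t + pot s' m' \<le> pot s m + k)"
    and init: "I i s m"
  shows "runs (while_do b c s) m (\<lambda>s' t m'. \<not> b s' \<and> (\<exists>j. I j s' m') \<and>
      t + pot s' m' \<le> pot s m + (k + 1) * (n + 1 - i) + 1)"
  using init
proof (induction "n + 1 - i" arbitrary: i s m)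
  case 0
  have "\<not> b s" using step[OF 0(2)] 0(1) by auto
  moreover have "runs (while_do b c s) m Q = runs (do {tick; ret s}) m Q" if "\<not> b s" for Q
    using that by (simp add: runs_def while_do.simps)
  ultimately show ?case using 0 by (auto simp: runs_simps)
next
  case (Suc d)
  show ?case
  proof (cases "b s")
    case False
    moreover have "runs (while_do b c s) m Q = runs (do {tick; ret s}) m Q" if "\<not> b s" for Q
      using that by (simp add: runs_def while_do.simps)
    ultimately show ?thesis using Suc.prems by (auto simp: runs_simps)
  next
    case True
    have *: "runs (while_do b c s) m Q = runs (do {tick; s' \<leftarrow> c s; while_do b c s'}) m Q" for Q
      using True by (simp add: runs_def while_do.simps)
    have st: "i \<le> n" "runs (c s) m (\<lambda>s' t m'. I (Suc i) s' m' \<and> t + pot s' m' \<le> pot s m + k)"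
      using step[OF Suc.prems True] by auto
    have d: "d = n + 1 - Suc i" using Suc(2) by simp
    show ?thesis unfolding * runs_bind runs_tick
    proof (rule runs_mono[OF st(2)], elim conjE)
      fix s' t m' assume I: "I (Suc i) s' m'" and t: "t + pot s' m' \<le> pot s m + k"
      have e: "n + 1 - i = Suc (n + 1 - Suc i)" using st(1) by simp
      show "runs (while_do b c s') m' (\<lambda>s'' t' m''. \<not> b s'' \<and> (\<exists>j. I j s'' m'') \<and>
          1 + (t + t') + pot s'' m'' \<le> pot s m + (k + 1) * (n + 1 - i) + 1)"
        apply (rule runs_mono[OF Suc.hyps(1)[OF d I]])
        using t unfolding e by auto
    qed
  qed
qed


section \<open>Edges leaving a set of vertices\<close>

text \<open>Ordered pairs (inner end, outer end) instead of edges, because a stored side stands for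
  an edge together with the end that lies outside. An edge between two disjoint sets leaves both,
  with the pair reversed (\<open>out_flip\<close>).\<close>

definition out :: "nat set set \<Rightarrow> nat set \<Rightarrow> (nat \<times> nat) set" where
  "out E X = {(x, y). x \<in> X \<and> y \<notin> X \<and> {x, y} \<in> E}"

definition conn :: "nat set set \<Rightarrow> nat set \<Rightarrow> bool" where
  "conn E X \<longleftrightarrow> (\<forall>Y. Y \<noteq> {} \<longrightarrow> Y \<subset> X \<longrightarrow> (\<exists>x\<in>Y. \<exists>y\<in>X - Y. {x, y} \<in> E))"

definition simple_edges :: "nat set set \<Rightarrow> bool" where
  "simple_edges E \<longleftrightarrow> finite E \<and> (\<forall>e\<in>E. \<exists>a b. a \<noteq> b \<and> e = {a, b})"

text \<open>Absence of regular cycles in terms of sets. In this form it passes to subsets of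
  \<open>R\<close> and applies directly to unions of clusters; \<open>acyclic_on_regulars\<close>
  derives it from the definition with lists.\<close>

definition acyclic_on :: "nat set set \<Rightarrow> nat set \<Rightarrow> bool" where
  "acyclic_on E R \<longleftrightarrow> (\<forall>X\<subseteq>R. X \<noteq> {} \<longrightarrow> out E X \<noteq> {})"

lemma finite_out: "simple_edges E \<Longrightarrow> finite (out E X)"
proof -
  assume E: "simple_edges E"
  then have "finite (\<Union>E)" by (auto simp: simple_edges_def)
  then have "finite (\<Union>E \<times> \<Union>E)" by simp
  moreover have "out E X \<subseteq> \<Union>E \<times> \<Union>E" by (auto simp: out_def)
  ultimately show ?thesis by (rule rev_finite_subset)
qed

lemma out_flip: "(x, y) \<in> out E X \<Longrightarrow> y \<in> Y \<Longrightarrow> X \<inter> Y = {} \<Longrightarrow> (y, x) \<in> out E Y"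
  using insert_commute[of y x "{}"] by (auto simp: out_def)

lemma conn_singleton: "conn E {x}"
  by (auto simp: conn_def)

lemma conn_Un:
  assumes "conn E X" "conn E Y" "x \<in> X" "y \<in> Y" "{x, y} \<in> E"
  shows "conn E (X \<union> Y)"
  unfolding conn_def
proof (intro allI impI)
  fix Z assume Z: "Z \<noteq> {}" "Z \<subset> X \<union> Y"
  show "\<exists>a\<in>Z. \<exists>b\<in>X \<union> Y - Z. {a, b} \<in> E"
  proof (cases "Z \<inter> X = {} \<or> X \<subseteq> Z")
    case False
    then have "Z \<inter> X \<noteq> {}" "Z \<inter> X \<subset> X" by auto
    then obtain a b where "a \<in> Z \<inter> X" "b \<in> X - Z \<inter> X" "{a, b} \<in> E"
      using assms(1) unfolding conn_def by metis
    then show ?thesis by blast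
  next
    case 1: True
    show ?thesis
    proof (cases "Z \<inter> Y = {} \<or> Y \<subseteq> Z")
      case False
      then have "Z \<inter> Y \<noteq> {}" "Z \<inter> Y \<subset> Y" by auto
      then obtain a b where "a \<in> Z \<inter> Y" "b \<in> Y - Z \<inter> Y" "{a, b} \<in> E"
        using assms(2) unfolding conn_def by metis
      then show ?thesis by blast
    next
      case 2: True
      have "{y, x} \<in> E" using assms(5) by (simp add: insert_commute)
      then show ?thesis using 1 2 Z assms by blast
    qed
  qed
qed

text \<open>Two sets with two exits each cannot be joined by two edges, since their union would have
  no exit, contrary to acyclicity. So exactly one edge disappears inside the union, which has two
  exits again.\<close>

lemma out_Un_pair:
  assumes "acyclic_on E R" "X \<union> Y \<subseteq> R" "X \<inter> Y = {}"
    and X: "out E X = {a, (x, y)}" "a \<noteq> (x, y)" and y: "y \<in> Y"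
    and Y: "out E Y = {b, (y', x')}" "b \<noteq> (y', x')" and x': "x' \<in> X"
  shows "y' = y \<and> x' = x \<and> out E (X \<union> Y) = {a, b} \<and> a \<noteq> b \<and> snd a \<notin> Y \<and> snd b \<notin> X"
proof -
  have flip: "(q, p) \<in> out E Y" if "(p, q) \<in> out E X" "q \<in> Y" for p q
    using that assms(3) by (rule out_flip)
  have flip': "(q, p) \<in> out E X" if "(p, q) \<in> out E Y" "q \<in> X" for p q
    using that assms(3) by (blast intro: out_flip)
  have U: "out E (X \<union> Y) = {d \<in> out E X. snd d \<notin> Y} \<union> {d \<in> out E Y. snd d \<notin> X}"
    by (auto simp: out_def)
  have ne: "out E (X \<union> Y) \<noteq> {}"
    using assms(1,2) y unfolding acyclic_on_def by (metis UnCI empty_iff)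
  obtain a1 a2 where a: "a = (a1, a2)" by (cases a)
  obtain b1 b2 where b: "b = (b1, b2)" by (cases b)
  have a1: "a1 \<in> X" using X a by (auto simp: out_def)
  have b1: "b1 \<in> Y" using Y b by (auto simp: out_def)
  have xy: "(y, x) \<in> out E Y" using flip[of x y] X y by auto
  have xy': "(x', y') \<in> out E X" using flip'[of y' x'] Y x' by auto
  have xX: "x \<in> X" using X(1) by (auto simp: out_def)
  \<comment> \<open>Otherwise both exits of \<open>X\<close> would end in \<open>Y\<close> and,
    reversed, be the two exits of \<open>Y\<close>.\<close>
  have aY: "a2 \<notin> Y"
  proof
    assume A: "a2 \<in> Y"
    then have "(a2, a1) \<in> out E Y" using flip[of a1 a2] X a by auto
    then have oY: "out E Y = {(a2, a1), (y, x)}"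
      using xy Y X(2) a by auto
    have "out E (X \<union> Y) = {}" unfolding U oY X using A y a a1 xX by auto
    then show False using ne by simp
  qed
  have "(x', y') = (x, y)"
  proof (rule ccontr)
    assume "\<not> ?thesis"
    then have "(x', y') = a" using xy' X by auto
    then have "y' \<notin> Y" using aY a by auto
    then show False using Y(1) by (auto simp: out_def)
  qed
  then have e: "x' = x" "y' = y" by auto
  have bX: "b2 \<notin> X"
  using flip' Y b X e aY a b1 by auto
  have "out E (X \<union> Y) = {a, b}" unfolding U X Y e using aY bX y xX a b by auto
  moreover have "a \<noteq> b" using a1 b1 a b assms(3) by auto
  ultimately show ?thesis using e aY bX a b by auto
qed

text \<open>Each absorbed neighbour uses up an exit of \<open>U\<close> of its own (the injective
  choice \<open>f\<close>) and brings at most one new exit. So the number of exits does not grow,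
  and there are at most as many neighbours as exits.\<close>

lemma expand_out:
  assumes E: "simple_edges E" and fin: "finite N"
    and N: "\<And>d. d \<in> N \<Longrightarrow> L d \<inter> U = {} \<and> card (out E (L d)) = 2 \<and> (\<exists>x\<in>U. \<exists>y\<in>L d. {x, y} \<in> E)"
    and disj: "\<And>c d. c \<in> N \<Longrightarrow> d \<in> N \<Longrightarrow> c \<noteq> d \<Longrightarrow> L c \<inter> L d = {}"
  shows "card (out E (U \<union> \<Union>(L ` N))) \<le> card (out E U) \<and> card N \<le> card (out E U)"
proof -
  have "\<forall>d\<in>N. \<exists>z. z \<in> out E U \<and> snd z \<in> L d"
  using N by (fastforce simp: out_def)
  then obtain f where f: "\<And>d. d \<in> N \<Longrightarrow> f d \<in> out E U \<and> snd (f d) \<in> L d" by metis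
  have inj: "inj_on f N" using f disj by (fastforce simp: inj_on_def)
  have fN: "f ` N \<subseteq> out E U" using f by auto
  have c1: "card (f ` N) = card N" using inj by (rule card_image)
  \<comment> \<open>Of the two exits of \<open>L d\<close>, the reverse of \<open>f d\<close> leads
    back into \<open>U\<close>; at most one remains in \<open>?r d\<close>.\<close>
  let ?r = "\<lambda>d. out E (L d) - {prod.swap (f d)}"
  have sub: "out E (U \<union> \<Union>(L ` N)) \<subseteq> (out E U - f ` N) \<union> (\<Union>d\<in>N. ?r d)"
  proof
    fix z assume z: "z \<in> out E (U \<union> \<Union>(L ` N))"
    obtain x y where xy: "z = (x, y)" by (cases z)
    have y: "y \<notin> U" "y \<notin> \<Union>(L ` N)" "{x, y} \<in> E" using z xy by (auto simp: out_def)
    show "z \<in> (out E U - f ` N) \<union> (\<Union>d\<in>N. ?r d)"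
    proof (cases "x \<in> U")
      case True
      then have "z \<in> out E U" using y xy by (auto simp: out_def)
      moreover have "z \<notin> f ` N" using y(2) f xy by (metis (no_types, lifting) UN_I imageE snd_conv)
      ultimately show ?thesis by simp
    next
      case False
      then obtain d where d: "d \<in> N" "x \<in> L d" using z xy by (auto simp: out_def)
      have "fst (f d) \<in> U" using f[OF d(1)] by (auto simp: out_def)
      then have "z \<noteq> prod.swap (f d)" using y xy by (cases "f d") auto
      moreover have "z \<in> out E (L d)" using d y xy by (auto simp: out_def)
      ultimately show ?thesis using d by auto
    qed
  qed
  have r1: "card (?r d) \<le> 1" if "d \<in> N" for d
  proof -
    obtain x y where xy: "f d = (x, y)" by (cases "f d")
    have "(y, x) \<in> out E (L d)"
      using f[OF that] N[OF that] xy by (auto simp: out_def insert_commute)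
    then show ?thesis using N[OF that] xy finite_out[OF E] by (simp add: card_Diff_singleton)
  qed
  have "card (out E (U \<union> \<Union>(L ` N))) \<le> card ((out E U - f ` N) \<union> (\<Union>d\<in>N. ?r d))"
    by (rule card_mono[OF _ sub]) (auto intro: finite_out[OF E] fin)
  also have "\<dots> \<le> card (out E U - f ` N) + card (\<Union>d\<in>N. ?r d)" by (rule card_Un_le)
  also have "card (out E U - f ` N) = card (out E U) - card N"
    using c1 fN fin by (simp add: card_Diff_subset)
  also have "card (\<Union>d\<in>N. ?r d) \<le> (\<Sum>d\<in>N. card (?r d))" using fin by (rule card_UN_le)
  also have "\<dots> \<le> (\<Sum>d\<in>N. 1)" by (rule sum_mono) (use r1 in auto)
  finally have "card (out E (U \<union> \<Union>(L ` N))) \<le> card (out E U) - card N + card N" by simp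
  moreover have "card N \<le> card (out E U)"
    using card_mono[OF finite_out[OF E] fN] c1 by simp
  ultimately show ?thesis by simp
qed

lemma card_UN_out:
  assumes E: "simple_edges E" and fin: "finite N"
    and N: "\<And>d. d \<in> N \<Longrightarrow> card (out E (L d)) = 2"
    and disj: "\<And>c d. c \<in> N \<Longrightarrow> d \<in> N \<Longrightarrow> c \<noteq> d \<Longrightarrow> L c \<inter> L d = {}"
  shows "card (\<Union>d\<in>N. out E (L d)) = 2 * card N"
proof -
  have "card (\<Union>d\<in>N. out E (L d)) = (\<Sum>d\<in>N. card (out E (L d)))"
  proof (rule card_UN_disjoint)
    show "\<forall>c\<in>N. \<forall>d\<in>N. c \<noteq> d \<longrightarrow> out E (L c) \<inter> out E (L d) = {}"
      using disj unfolding out_def by blast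
  qed (use fin finite_out[OF E] in auto)
  then show ?thesis using N by simp
qed

text \<open>Every outgoing edge of a singleton cluster leads out of the region or to a cluster of size two.\<close>

lemma singles_le_pairs:
  assumes E: "simple_edges E" and fin: "finite S" "finite P"
    and two: "\<And>d. d \<in> S \<union> P \<Longrightarrow> card (out E (L d)) = 2"
    and disj: "\<And>c d. c \<in> S \<union> P \<Longrightarrow> d \<in> S \<union> P \<Longrightarrow> c \<noteq> d \<Longrightarrow> L c \<inter> L d = {}"
    and sub: "\<Union>(L ` S) \<subseteq> U"
    and pair: "\<And>p x y. p \<in> S \<Longrightarrow> (x, y) \<in> out E (L p) \<Longrightarrow> y \<in> U \<Longrightarrow> \<exists>q\<in>P. y \<in> L q \<and> p \<noteq> q"
  shows "2 * card S \<le> card (out E U) + 2 * card P"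
proof -
  have "(\<Union>d\<in>S. out E (L d)) \<subseteq> out E U \<union> prod.swap ` (\<Union>d\<in>P. out E (L d))"
  proof (rule subsetI, elim UN_E)
    fix z p assume p: "p \<in> S" and z: "z \<in> out E (L p)"
    obtain x y where xy: "z = (x, y)" by (cases z)
    show "z \<in> out E U \<union> prod.swap ` (\<Union>d\<in>P. out E (L d))"
    proof (cases "y \<in> U")
      case False
      then show ?thesis using z xy p sub by (auto simp: out_def)
    next
      case True
      then obtain q where q: "q \<in> P" "y \<in> L q" "p \<noteq> q" using pair p z xy by blast
      have "x \<in> L p" using z xy by (auto simp: out_def)
      then have "x \<notin> L q" using disj[of p q] p q by auto
      then have "(y, x) \<in> out E (L q)" using z xy q by (auto simp: out_def insert_commute)
      then have "prod.swap (y, x) \<in> prod.swap ` (\<Union>d\<in>P. out E (L d))" using q by blast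
      then show ?thesis using xy by simp
    qed
  qed
  then have "card (\<Union>d\<in>S. out E (L d)) \<le> card (out E U \<union> prod.swap ` (\<Union>d\<in>P. out E (L d)))"
    by (rule card_mono[rotated]) (auto intro: finite_out[OF E] fin)
  also have "\<dots> \<le> card (out E U) + card (prod.swap ` (\<Union>d\<in>P. out E (L d)))" by (rule card_Un_le)
  also have "card (prod.swap ` (\<Union>d\<in>P. out E (L d))) \<le> card (\<Union>d\<in>P. out E (L d))"
    by (rule card_image_le) (auto intro: finite_out[OF E] fin)
  also have "\<dots> = 2 * card P" by (rule card_UN_out) (use E fin two disj in auto)
  also have "card (\<Union>d\<in>S. out E (L d)) = 2 * card S"
    by (rule card_UN_out) (use E fin two disj in auto)
  finally show ?thesis by simp
qed

text \<open>Every edge counts twice, once per direction. At level 0 the links are among the pairs of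
  adjacent regular vertices counted in the assumption \<open>depth\<close>.\<close>

definition links :: "nat set set \<Rightarrow> (nat \<Rightarrow> nat set) \<Rightarrow> nat set \<Rightarrow> (nat \<times> nat) set" where
  "links E L N = {(x, y). {x, y} \<in> E \<and> (\<exists>p\<in>N. \<exists>q\<in>N. p \<noteq> q \<and> x \<in> L p \<and> y \<in> L q)}"

lemma finite_links: "simple_edges E \<Longrightarrow> finite (links E L N)"
proof -
  assume E: "simple_edges E"
  then have "finite (\<Union>E)" by (auto simp: simple_edges_def)
  then have "finite (\<Union>E \<times> \<Union>E)" by simp
  moreover have "links E L N \<subseteq> \<Union>E \<times> \<Union>E" by (auto simp: links_def)
  ultimately show ?thesis by (rule rev_finite_subset)
qed

text \<open>Every remaining link starts or ends in a cluster of \<open>P\<close>, which has two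
  exits, so |F'| <= 4|P|. Every cluster of \<open>P\<close> has swallowed the two links between its
  children, so 2|P| <= |F| - |F'|. Together |F'| <= 2(|F| - |F'|).\<close>

lemma links_shrink:
  assumes E: "simple_edges E" and fin: "finite N'"
    and disj: "\<And>c d. c \<in> N \<Longrightarrow> d \<in> N \<Longrightarrow> c \<noteq> d \<Longrightarrow> L c \<inter> L d = {}"
    and disj': "\<And>c d. c \<in> N' \<Longrightarrow> d \<in> N' \<Longrightarrow> c \<noteq> d \<Longrightarrow> L c \<inter> L d = {}"
    and two: "\<And>d. d \<in> N' \<Longrightarrow> card (out E (L d)) = 2"
    and P: "P \<subseteq> N'" and pair: "\<And>p. p \<in> P \<Longrightarrow> \<exists>c\<in>N. \<exists>d\<in>N. c \<noteq> d \<and> L p = L c \<union> L d \<and>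
        (\<exists>x\<in>L c. \<exists>y\<in>L d. {x, y} \<in> E)"
    and cover: "\<And>p. p \<in> N' \<Longrightarrow> \<exists>K\<subseteq>N. L p = \<Union>(L ` K)"
    and reg: "\<And>p q x y. p \<in> N' \<Longrightarrow> q \<in> N' \<Longrightarrow> p \<noteq> q \<Longrightarrow> x \<in> L p \<Longrightarrow> y \<in> L q \<Longrightarrow> {x, y} \<in> E \<Longrightarrow>
        p \<in> P \<or> q \<in> P"
  shows "3 * card (links E L N') \<le> 2 * card (links E L N)"
proof -
  let ?F = "links E L N" and ?F' = "links E L N'"
  have finP: "finite P" using P fin finite_subset by blast
  have sub: "?F' \<subseteq> ?F"
  proof
    fix z assume "z \<in> ?F'"
    then obtain x y p q where z: "z = (x, y)" "{x, y} \<in> E" "p \<in> N'" "q \<in> N'" "p \<noteq> q" "x \<in> L p" "y \<in> L q"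
      by (auto simp: links_def)
    obtain c where c: "c \<in> N" "x \<in> L c" "L c \<subseteq> L p" using cover[OF z(3)] z by blast
    obtain d where d: "d \<in> N" "y \<in> L d" "L d \<subseteq> L q" using cover[OF z(4)] z by blast
    have "c \<noteq> d" using c d disj'[of p q] z by auto
    then show "z \<in> ?F" using c d z by (auto simp: links_def)
  qed
  have "?F' \<subseteq> (\<Union>d\<in>P. out E (L d)) \<union> prod.swap ` (\<Union>d\<in>P. out E (L d))"
  proof
    fix z assume "z \<in> ?F'"
    then obtain x y p q where z: "z = (x, y)" "{x, y} \<in> E" "p \<in> N'" "q \<in> N'" "p \<noteq> q" "x \<in> L p" "y \<in> L q"
      by (auto simp: links_def)
    have ne: "y \<notin> L p" "x \<notin> L q" using disj'[of p q] z by auto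
    have "p \<in> P \<or> q \<in> P" using reg z by blast
    then show "z \<in> (\<Union>d\<in>P. out E (L d)) \<union> prod.swap ` (\<Union>d\<in>P. out E (L d))"
    using z ne by (auto simp: out_def insert_commute)
  qed
  then have "card ?F' \<le> card ((\<Union>d\<in>P. out E (L d)) \<union> prod.swap ` (\<Union>d\<in>P. out E (L d)))"
    by (rule card_mono[rotated]) (auto intro: finite_out[OF E] finP)
  also have "\<dots> \<le> card (\<Union>d\<in>P. out E (L d)) + card (prod.swap ` (\<Union>d\<in>P. out E (L d)))"
    by (rule card_Un_le)
  also have "card (prod.swap ` (\<Union>d\<in>P. out E (L d))) \<le> card (\<Union>d\<in>P. out E (L d))"
    by (rule card_image_le) (auto intro: finite_out[OF E] finP)
  also have "card (\<Union>d\<in>P. out E (L d)) = 2 * card P"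
    by (rule card_UN_out) (use E finP two disj' P in auto)
  finally have 1: "card ?F' \<le> 4 * card P" by simp
  let ?I = "\<lambda>p. {(x, y). (x, y) \<in> ?F \<and> x \<in> L p \<and> y \<in> L p}"
  have finI: "finite (?I p)" for p
    by (rule finite_subset[OF _ finite_links[OF E]]) auto
  have I2: "2 \<le> card (?I p)" if p: "p \<in> P" for p
  proof -
    obtain c d x y where c: "c \<in> N" "d \<in> N" "c \<noteq> d" "L p = L c \<union> L d" "x \<in> L c" "y \<in> L d" "{x, y} \<in> E"
      using pair[OF p] by blast
    have "x \<noteq> y" using c disj[of c d] by auto
    have "{y, x} \<in> E" using c(7) by (simp add: insert_commute)
    then have "{(x, y), (y, x)} \<subseteq> ?I p" 
      using c by (simp add: links_def) metis
    then have "card {(x, y), (y, x)} \<le> card (?I p)" by (rule card_mono[OF finI])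
    then show ?thesis using \<open>x \<noteq> y\<close> by simp
  qed
  have disjI: "?I p \<inter> ?I q = {}" if "p \<in> P" "q \<in> P" "p \<noteq> q" for p q
    using disj'[of p q] that P by auto
  have "2 * card P \<le> (\<Sum>p\<in>P. card (?I p))"
    using sum_mono[of P "\<lambda>_. 2" "\<lambda>p. card (?I p)"] I2 by simp
  also have "\<dots> = card (\<Union>p\<in>P. ?I p)"
    by (rule card_UN_disjoint[symmetric]) (use finP finI disjI in auto)
  also have "\<dots> \<le> card (?F - ?F')"
  proof (rule card_mono)
    show "finite (?F - ?F')" using finite_links[OF E] by auto
    show "(\<Union>p\<in>P. ?I p) \<subseteq> ?F - ?F'"
    proof (rule subsetI, elim UN_E)
      fix z p assume p: "p \<in> P" and z: "z \<in> ?I p"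
      have "z \<notin> ?F'"
      proof
        assume "z \<in> ?F'"
        then obtain x y r s where r: "z = (x, y)" "r \<in> N'" "s \<in> N'" "r \<noteq> s" "x \<in> L r" "y \<in> L s"
          by (auto simp: links_def)
        have "r = p" using disj'[of r p] r z p P by auto
        moreover have "s = p" using disj'[of s p] r z p P by auto
        ultimately show False using r by simp
      qed
      then show "z \<in> ?F - ?F'" using z by auto
    qed
  qed
  also have "\<dots> = card ?F - card ?F'"
    by (rule card_Diff_subset) (use sub finite_links[OF E] in auto)
  finally have "2 * card P \<le> card ?F - card ?F'" .
  moreover have "card ?F' \<le> card ?F" using sub finite_links[OF E] by (rule card_mono[rotated])
  ultimately show ?thesis using 1 by linarith
qed


section \<open>Clusters in memory\<close>

definition pa :: "(nat \<Rightarrow> node option) \<Rightarrow> nat \<Rightarrow> nat option" where "pa nt p = parent (the (nt p))"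
definition kd :: "(nat \<Rightarrow> node option) \<Rightarrow> nat \<Rightarrow> nat list" where "kd nt p = kids (the (nt p))"
definition sd :: "(nat \<Rightarrow> node option) \<Rightarrow> nat \<Rightarrow> side \<times> side" where "sd nt p = sides (the (nt p))"
definition ww :: "(nat \<Rightarrow> node option) \<Rightarrow> nat \<Rightarrow> real" where "ww nt p = wt (the (nt p))"
definition te :: "(nat \<Rightarrow> node option) \<Rightarrow> nat \<Rightarrow> nat option" where "te nt p = top_edge (the (nt p))"

lemma view_upd [simp]:
  "pa (nt(c \<mapsto> r)) p = (if p = c then parent r else pa nt p)"
  "kd (nt(c \<mapsto> r)) p = (if p = c then kids r else kd nt p)"
  "sd (nt(c \<mapsto> r)) p = (if p = c then sides r else sd nt p)"
  "ww (nt(c \<mapsto> r)) p = (if p = c then wt r else ww nt p)"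
  "te (nt(c \<mapsto> r)) p = (if p = c then top_edge r else te nt p)"
  by (auto simp: pa_def kd_def sd_def ww_def te_def)

lemma view_del [simp]:
  "p \<noteq> c \<Longrightarrow> pa (nt(c := None)) p = pa nt p"
  "p \<noteq> c \<Longrightarrow> kd (nt(c := None)) p = kd nt p"
  "p \<noteq> c \<Longrightarrow> sd (nt(c := None)) p = sd nt p"
  "p \<noteq> c \<Longrightarrow> ww (nt(c := None)) p = ww nt p"
  "p \<noteq> c \<Longrightarrow> te (nt(c := None)) p = te nt p"
  by (auto simp: pa_def kd_def sd_def ww_def te_def)

lemma view_Some:
  "nt p = Some r \<Longrightarrow> parent r = pa nt p"
  "nt p = Some r \<Longrightarrow> kids r = kd nt p"
  "nt p = Some r \<Longrightarrow> sides r = sd nt p"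
  "nt p = Some r \<Longrightarrow> wt r = ww nt p"
  "nt p = Some r \<Longrightarrow> top_edge r = te nt p"
  by (auto simp: pa_def kd_def sd_def ww_def te_def)

definition live :: "(nat \<Rightarrow> 'a option) \<Rightarrow> nat set" where "live nt = dom nt"

lemma live_upd [simp]: "live (nt(c \<mapsto> r)) = insert c (live nt)" "live (nt(c := None)) = live nt - {c}"
  by (auto simp: live_def)

lemma image_inj_cong:
  assumes "\<And>q. q \<in> S \<Longrightarrow> f q = g q"
  shows "f ` S = g ` S" "inj_on f S = inj_on g S"
  using assms by (auto simp: inj_on_def image_iff)

definition same_node :: "(nat \<Rightarrow> node option) \<Rightarrow> (nat \<Rightarrow> node option) \<Rightarrow> nat \<Rightarrow> bool" where
  "same_node nt nt' q \<longleftrightarrow> kd nt' q = kd nt q \<and> sd nt' q = sd nt q \<and> ww nt' q = ww nt q \<and> te nt' q = te nt q"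

text \<open>The levels \<open>lv\<close> and vertex sets \<open>L\<close> of the nodes are not stored; they are carried along in the
  invariants.  Regular vertices have level 0 here, so that the clusters of level \<open>i\<close> have level
  \<open>i + 1\<close>.  While a change is propagated, \<open>Ch\<close> contains the vertices at which the graph has changed,
  \<open>Rx\<close> the regular vertices before and after the change, \<open>TE\<close> and \<open>TT\<close> describe the topological edges
  without regular vertices, and \<open>Z\<close> lists the nodes to which the vertices point.\<close>

locale env =
  fixes E :: "nat set set" and W :: "nat set \<Rightarrow> real" and R Rx Ch :: "nat set" and H :: nat
    and TE :: "nat set" and TT :: "nat \<Rightarrow> tedge option" and Z :: "(nat \<times> nat) set"
begin

definition srep :: "nat set \<Rightarrow> (nat \<Rightarrow> nat) \<Rightarrow> (nat \<Rightarrow> nat set) \<Rightarrow> nat \<Rightarrow> nat \<times> nat \<Rightarrow> side \<Rightarrow> bool" where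
  "srep S lv L j d s \<longleftrightarrow> snd s = W {fst d, snd d} \<and>
     (case fst s of Singular u \<Rightarrow> u = snd d \<and> snd d \<notin> R
      | Cluster q \<Rightarrow> q \<in> S \<and> lv q = j \<and> snd d \<in> L q)"

text \<open>Above the level that has been repaired, a side may still name a deleted cluster, but never a wrong
  one.\<close>

definition wrep :: "nat set \<Rightarrow> (nat \<Rightarrow> nat) \<Rightarrow> (nat \<Rightarrow> nat set) \<Rightarrow> nat \<Rightarrow> nat \<times> nat \<Rightarrow> side \<Rightarrow> bool" where
  "wrep S lv L j d s \<longleftrightarrow> snd s = W {fst d, snd d} \<and>
     (case fst s of Singular u \<Rightarrow> u = snd d \<and> snd d \<notin> R
      | Cluster q \<Rightarrow> snd d \<in> R \<and> (\<forall>r\<in>S. lv r = j \<longrightarrow> snd d \<in> L r \<longrightarrow> r = q))"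

text \<open>A stored side does not say for which edge it stands, and no order of the two sides is
  maintained. Hence the existential choice of a matching between sides and exits.\<close>

definition sok :: "(nat \<times> nat \<Rightarrow> side \<Rightarrow> bool) \<Rightarrow> nat set \<Rightarrow> side \<times> side \<Rightarrow> bool" where
  "sok rp X s \<longleftrightarrow> (\<exists>d1 d2. d1 \<noteq> d2 \<and> out E X = {d1, d2} \<and> rp d1 (fst s) \<and> rp d2 (snd s))"

definition strong where
  "strong lv L nt p \<longleftrightarrow> sok (srep (live nt) lv L (lv p)) (L p) (sd nt p)"

definition weak where
  "weak lv L nt B p \<longleftrightarrow> sok (wrep (live nt - B) lv L (lv p)) (L p) (sd nt p)"

definition inner :: "nat set \<Rightarrow> real" where
  "inner X = (\<Sum>e | e \<in> E \<and> e \<subseteq> X. W e)"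

definition shape :: "(nat \<Rightarrow> nat) \<Rightarrow> (nat \<Rightarrow> nat set) \<Rightarrow> nat list \<Rightarrow> nat \<Rightarrow> bool" where
  "shape lv L ks p \<longleftrightarrow>
     (ks = [] \<and> lv p = 0 \<and> (\<exists>v. L p = {v})) \<or>
     (\<exists>c. ks = [c] \<and> lv p = Suc (lv c) \<and> L p = L c) \<or>
     (\<exists>c d. ks = [c, d] \<and> lv p = Suc (lv c) \<and> lv d = lv c \<and> L p = L c \<union> L d \<and> L c \<inter> L d = {} \<and>
        (\<exists>x\<in>L c. \<exists>y\<in>L d. {x, y} \<in> E))"

text \<open>A listed child may already be deleted, hence the guards \<open>c \<in> live nt\<close>.
  The bound \<open>c < nc\<close> holds for dead children too: node numbers are never reused, so a
  new node cannot be mistaken for one of them.\<close>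

definition base :: "(nat \<Rightarrow> nat) \<Rightarrow> (nat \<Rightarrow> nat set) \<Rightarrow> (nat \<Rightarrow> node option) \<Rightarrow> nat \<Rightarrow> bool" where
  "base lv L nt nc \<longleftrightarrow> finite (live nt) \<and>
     (\<forall>p\<in>live nt. p < nc \<and> (\<forall>c\<in>set (kd nt p). c < nc) \<and> shape lv L (kd nt p) p \<and> lv p \<le> H \<and>
        L p \<noteq> {} \<and> L p \<subseteq> Rx) \<and>
     (\<forall>p\<in>live nt. \<forall>q\<in>live nt. lv p = lv q \<longrightarrow> p \<noteq> q \<longrightarrow> L p \<inter> L q = {}) \<and>
     (\<forall>p\<in>live nt. \<forall>q. pa nt p = Some q \<longrightarrow> q \<in> live nt \<and> p \<in> set (kd nt q)) \<and>
     (\<forall>q\<in>live nt. \<forall>c\<in>set (kd nt q). c \<in> live nt \<longrightarrow> pa nt c = Some q) \<and>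
     (\<forall>p x. (p, x) \<in> Z \<longrightarrow> p \<in> live nt \<and> lv p = 0 \<and> L p = {x})"

text \<open>From level \<open>k\<close> upwards nothing is claimed about a cluster that contains a
  changed vertex; it will be deleted when the propagation reaches its level.\<close>

definition ok :: "nat \<Rightarrow> (nat \<Rightarrow> nat) \<Rightarrow> (nat \<Rightarrow> nat set) \<Rightarrow> nat \<Rightarrow> bool" where
  "ok k lv L p \<longleftrightarrow> lv p < k \<or> L p \<inter> Ch = {}"

definition contents where
  "contents k lv L nt \<longleftrightarrow> (\<forall>p\<in>live nt. ok k lv L p \<longrightarrow>
     L p \<subseteq> R \<and> conn E (L p) \<and> ww nt p = inner (L p))"

definition reg where
  "reg k lv L nt \<longleftrightarrow> (\<forall>p\<in>live nt. \<forall>q\<in>live nt. ok k lv L p \<longrightarrow> ok k lv L q \<longrightarrow> p \<noteq> q \<longrightarrow>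
     lv p = lv q \<longrightarrow> length (kd nt p) = 1 \<longrightarrow> length (kd nt q) = 1 \<longrightarrow>
     (\<forall>x\<in>L p. \<forall>y\<in>L q. {x, y} \<notin> E))"

text \<open>The parentless clusters that carry a topological edge at the moment. Those in
  \<open>Or\<close> still wait for a parent or for becoming a root, and those that are not
  \<open>ok\<close> belonged to a tree that is being taken apart.\<close>

definition own where
  "own k lv L nt Or = {p \<in> live nt. pa nt p = None \<and> p \<notin> Or \<and> ok k lv L p}"

definition is_root where
  "is_root lv nt tt p \<longleftrightarrow> 0 < lv p \<and> (\<exists>u a v b t. sd nt p = ((Singular u, a), (Singular v, b)) \<and>
     te nt p = Some t \<and> t \<notin> TE \<and> tt t = Some \<lparr> tends = (u, v), twt = ww nt p + a + b \<rparr>)"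

definition roots where
  "roots k lv L nt Or tt tc \<longleftrightarrow>
     (\<forall>p\<in>own k lv L nt Or. is_root lv nt tt p) \<and>
     inj_on (te nt) (own k lv L nt Or) \<and>
     dom tt = TE \<union> {t. Some t \<in> te nt ` own k lv L nt Or} \<and>
     (\<forall>t\<in>TE. tt t = TT t) \<and> (\<forall>t\<in>dom tt. t < tc)"

text \<open>\<open>D\<close> are the clusters due for deletion, the only ones that may list a dead
  child. What a dead child covered lies in the region \<open>Ud\<close>, so that deleting its parent
  does not carry the change out of the region.\<close>

definition kids_ok where
  "kids_ok L nt D Ud \<longleftrightarrow>
     (\<forall>q\<in>live nt. \<forall>c\<in>set (kd nt q). (q \<notin> D \<longrightarrow> c \<in> live nt) \<and> (c \<notin> live nt \<longrightarrow> L c \<inter> R \<subseteq> Ud))"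

definition core where
  "core k lv L nt nc Or D Ud tt tc \<longleftrightarrow>
     base lv L nt nc \<and> contents k lv L nt \<and> reg k lv L nt \<and> roots k lv L nt Or tt tc \<and> kids_ok L nt D Ud"

section \<open>Elementary changes of the node table\<close>

lemma baseD:
  assumes "base lv L nt nc"
  shows "finite (live nt)"
    "p \<in> live nt \<Longrightarrow> p < nc" "p \<in> live nt \<Longrightarrow> c \<in> set (kd nt p) \<Longrightarrow> c < nc"
    "p \<in> live nt \<Longrightarrow> shape lv L (kd nt p) p" "p \<in> live nt \<Longrightarrow> lv p \<le> H" "p \<in> live nt \<Longrightarrow> L p \<noteq> {}"
    "p \<in> live nt \<Longrightarrow> L p \<subseteq> Rx"
    "p \<in> live nt \<Longrightarrow> q \<in> live nt \<Longrightarrow> lv p = lv q \<Longrightarrow> p \<noteq> q \<Longrightarrow> L p \<inter> L q = {}"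
    "p \<in> live nt \<Longrightarrow> pa nt p = Some q \<Longrightarrow> q \<in> live nt"
    "p \<in> live nt \<Longrightarrow> pa nt p = Some q \<Longrightarrow> p \<in> set (kd nt q)"
    "q \<in> live nt \<Longrightarrow> c \<in> set (kd nt q) \<Longrightarrow> c \<in> live nt \<Longrightarrow> pa nt c = Some q"
    "(p, x) \<in> Z \<Longrightarrow> p \<in> live nt \<and> lv p = 0 \<and> L p = {x}"
  using assms unfolding base_def by meson+

lemma base_cong:
  assumes "base lv L nt nc" "live nt' = live nt"
    "\<And>q. q \<in> live nt \<Longrightarrow> kd nt' q = kd nt q" "\<And>q. q \<in> live nt \<Longrightarrow> pa nt' q = pa nt q"
  shows "base lv L nt' nc"
  unfolding base_def assms(2)
proof (intro conjI ballI allI impI)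
  note b = assms(1)
  show "finite (live nt)" by (rule baseD(1)[OF b])
  show "p \<in> live nt" "lv p = 0" "L p = {x}" if "(p, x) \<in> Z" for p x using baseD(12)[OF b that] by auto
  fix q assume q: "q \<in> live nt"
  note s = assms(3,4)[OF q]
  show "q < nc" "lv q \<le> H" "L q \<noteq> {}" "L q \<subseteq> Rx" "shape lv L (kd nt' q) q"
    using baseD(2,4-7)[OF b q] s by simp_all
  show "c < nc" if "c \<in> set (kd nt' q)" for c using baseD(3)[OF b q] s that by simp
  show "L q \<inter> L r = {}" if "r \<in> live nt" "lv q = lv r" "q \<noteq> r" for r
    by (rule baseD(8)[OF b q that])
  show "pa nt' c = Some q" if "c \<in> set (kd nt' q)" "c \<in> live nt" for c
    using baseD(11)[OF b q _ that(2)] assms(4)[OF that(2)] s that by simp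
  fix r assume "pa nt' q = Some r"
  then have r: "pa nt q = Some r" using s by simp
  show rl: "r \<in> live nt" by (rule baseD(9)[OF b q r])
  show "q \<in> set (kd nt' r)" using baseD(10)[OF b q r] assms(3)[OF rl] by simp
qed

lemma shape_kid:
  assumes "shape lv L ks p" "c \<in> set ks"
  shows "lv p = Suc (lv c)" "L c \<subseteq> L p"
  using assms unfolding shape_def by (elim disjE exE conjE; force)+

lemma shape_Union: "shape lv L ks p \<Longrightarrow> ks \<noteq> [] \<Longrightarrow> L p = \<Union>(L ` set ks)"
  unfolding shape_def by (elim disjE exE conjE; simp)

lemma shape_cong:
  assumes "\<And>c. c \<in> set ks \<Longrightarrow> lv' c = lv c \<and> L' c = L c" "lv' p = lv p" "L' p = L p"
  shows "shape lv' L' ks p = shape lv L ks p"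
  unfolding shape_def using assms by auto

lemma base_pa_lv:
  assumes "base lv L nt nc" "p \<in> live nt" "pa nt p = Some q"
  shows "lv q = Suc (lv p)" "L p \<subseteq> L q"
  using shape_kid[OF baseD(4)[OF assms(1) baseD(9)[OF assms]] baseD(10)[OF assms]] by auto

lemma regD:
  assumes "reg k lv L nt" "p \<in> live nt" "q \<in> live nt" "ok k lv L p" "ok k lv L q" "p \<noteq> q" "lv p = lv q"
    "length (kd nt p) = 1" "length (kd nt q) = 1" "x \<in> L p" "y \<in> L q"
  shows "{x, y} \<notin> E"
  using assms unfolding reg_def by blast

lemma base_delete:
  assumes b: "base lv L nt nc" and p: "p \<in> live nt" and dom: "live nt' = live nt - {p}"
    and Z: "\<And>x. (p, x) \<notin> Z"
    and kd: "\<And>q. q \<in> live nt' \<Longrightarrow> kd nt' q = kd nt q"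
    and pa: "\<And>q. q \<in> live nt' \<Longrightarrow> pa nt' q = (if q \<in> set (kd nt p) then None else pa nt q)"
  shows "base lv L nt' nc"
  unfolding base_def
proof (intro conjI ballI allI impI)
  show "finite (live nt')" using baseD(1)[OF b] dom by simp
  show "q \<in> live nt'" "lv q = 0" "L q = {x}" if "(q, x) \<in> Z" for q x using baseD(12)[OF b that] dom Z that by auto
next
  fix q assume q: "q \<in> live nt'"
  then have q': "q \<in> live nt" "q \<noteq> p" using dom by auto
  show "q < nc" "lv q \<le> H" "L q \<noteq> {}" "L q \<subseteq> Rx" "shape lv L (kd nt' q) q" using baseD(2,4-7)[OF b q'(1)] kd[OF q] by simp_all
  show "c < nc" if "c \<in> set (kd nt' q)" for c using baseD(3)[OF b] q' kd[OF q] that by auto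
  show "L q \<inter> L r = {}" if "r \<in> live nt'" "lv q = lv r" "q \<noteq> r" for r
    using baseD(8)[OF b] q' that dom by auto
  show "pa nt' c = Some q" if "c \<in> set (kd nt' q)" "c \<in> live nt'" for c
  using baseD(11)[OF b q'(1)] that kd[OF q] dom baseD(11)[OF b p] q' pa by fastforce
  fix r assume r: "pa nt' q = Some r"
  then have r': "pa nt q = Some r" "q \<notin> set (kd nt p)" using pa[OF q] by (auto split: if_splits)
  have "r \<noteq> p" using r' baseD(10)[OF b q'(1)] by auto
  then show "r \<in> live nt'" using baseD(9)[OF b q'(1) r'(1)] dom by auto
  then show "q \<in> set (kd nt' r)" using kd baseD(10)[OF b q'(1) r'(1)] by auto
qed

text \<open>A deletion leaves two traces, both absorbed by the exception sets: the live children
  become orphans (\<open>Or'\<close>), and the parent now lists a dead child (\<open>D'\<close>).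
  The cluster must not be an own root, since its topological edge would lose its tree.\<close>

lemma core_delete:
  assumes c: "core k lv L nt nc Or D Ud tt tc" and p: "p \<in> live nt" "0 < lv p" and dom: "live nt' = live nt - {p}"
    and same: "\<And>q. q \<in> live nt' \<Longrightarrow> same_node nt nt' q"
    and pa: "\<And>q. q \<in> live nt' \<Longrightarrow> pa nt' q = (if q \<in> set (kd nt p) then None else pa nt q)"
    and nroot: "p \<notin> own k lv L nt Or" and Ud: "Ud \<subseteq> Ud'" "L p \<inter> R \<subseteq> Ud'"
    and D': "D - {p} \<union> set_option (pa nt p) \<subseteq> D'" and Or': "Or' = Or \<union> (set (kd nt p) \<inter> live nt)"
  shows "core k lv L nt' nc Or' D' Ud' tt tc"
proof -
  have b: "base lv L nt nc" using c by (simp add: core_def)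
  have s: "kd nt' q = kd nt q" "sd nt' q = sd nt q" "ww nt' q = ww nt q" "te nt' q = te nt q"
    if "q \<in> live nt'" for q using same[OF that] by (auto simp: same_node_def)
  have sub: "live nt' \<subseteq> live nt" using dom by auto
  have "(p, x) \<notin> Z" for x using baseD(12)[OF b, of p x] p by auto
  then have 1: "base lv L nt' nc" by (rule base_delete[OF b p(1) dom _ s(1) pa])
  have 2: "contents k lv L nt'" using c s(3) subsetD[OF sub] by (simp add: core_def contents_def)
  have 3: "reg k lv L nt'" 
    unfolding reg_def
  using c regD s(1) sub by (fastforce simp: core_def)
  have own: "own k lv L nt' Or' = own k lv L nt Or"
  proof (intro equalityI subsetI)
    fix q assume "q \<in> own k lv L nt' Or'"
    then show "q \<in> own k lv L nt Or" using pa[of q] sub Or' by (auto simp: own_def split: if_splits)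
  next
    fix q assume q: "q \<in> own k lv L nt Or"
    then have qd: "q \<in> live nt" "q \<noteq> p" using nroot unfolding own_def by blast+
    then have "q \<in> live nt'" using dom by simp
    moreover have "q \<notin> set (kd nt p)" using baseD(11)[OF b p(1), of q] q by (auto simp: own_def)
    ultimately show "q \<in> own k lv L nt' Or'" using q pa[of q] Or' by (auto simp: own_def)
  qed
  have od: "own k lv L nt Or \<subseteq> live nt'" unfolding own[symmetric] by (auto simp: own_def)
  have te: "te nt' ` own k lv L nt Or = te nt ` own k lv L nt Or" "inj_on (te nt') (own k lv L nt Or) = inj_on (te nt) (own k lv L nt Or)"
    by (rule image_inj_cong; use s(4) od in blast)+
  have 4: "roots k lv L nt' Or' tt tc"
    unfolding roots_def own te
  proof (intro conjI ballI)
    fix q assume q: "q \<in> own k lv L nt Or"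
    then have "q \<in> live nt'" using own by (auto simp: own_def)
    moreover have "is_root lv nt tt q" using c q by (auto simp: core_def roots_def)
    ultimately show "is_root lv nt' tt q" using s[of q] by (simp add: is_root_def)
  qed (use c in \<open>auto simp: core_def roots_def\<close>)
  have 5: "kids_ok L nt' D' Ud'"
    unfolding kids_ok_def
  proof (intro ballI conjI impI)
    fix q c' assume q: "q \<in> live nt'" and c': "c' \<in> set (kd nt' q)"
    then have q': "q \<in> live nt" "q \<noteq> p" "c' \<in> set (kd nt q)" using dom s by auto
    show "c' \<in> live nt'" if "q \<notin> D'"
    using that D' q' c baseD(11)[OF b q'(1,3)] dom by (fastforce simp: core_def kids_ok_def)
    show "L c' \<inter> R \<subseteq> Ud'" if "c' \<notin> live nt'"
      using that c q' Ud dom unfolding core_def kids_ok_def by blast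
  qed
  show ?thesis using 1 2 3 4 5 by (simp add: core_def)
qed

lemma own_cong_k:
  assumes "\<And>p. p \<in> live nt \<Longrightarrow> ok k' lv L p = ok k lv L p"
  shows "own k' lv L nt Or = own k lv L nt Or"
  using assms by (auto simp: own_def)

text \<open>Serves to raise \<open>k\<close> by one when no cluster of the level concerned meets
  \<open>Ch\<close> any more.\<close>

lemma core_cong_k:
  assumes "core k lv L nt nc Or D Ud tt tc" "\<And>p. p \<in> live nt \<Longrightarrow> ok k' lv L p = ok k lv L p"
  shows "core k' lv L nt nc Or D Ud tt tc"
  using assms(1) own_cong_k[of nt k' lv L k Or, OF assms(2)] assms(2)
  by (simp add: core_def contents_def reg_def roots_def)

lemma core_mono:
  assumes "core k lv L nt nc Or D Ud tt tc" "\<And>q. q \<in> live nt \<Longrightarrow> q \<in> D \<Longrightarrow> q \<in> D'" "Ud \<subseteq> Ud'"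
  shows "core k lv L nt nc Or D' Ud' tt tc"
  using assms unfolding core_def kids_ok_def by blast

lemma base_add:
  assumes b: "base lv L nt nc" and dom: "live nt' = insert nc (live nt)" and kd: "\<And>q. q \<in> live nt \<Longrightarrow> kd nt' q = kd nt q"
    and pa: "\<And>q. q \<in> live nt \<Longrightarrow> pa nt' q = (if q \<in> set ks then Some nc else pa nt q)"
    and new: "pa nt' nc = None" "kd nt' nc = ks" and ks: "\<And>d. d \<in> set ks \<Longrightarrow> d \<in> live nt \<and> pa nt d = None"
    and lv': "lv' = lv(nc := j)" and L': "L' = L(nc := X)" and sh: "shape lv' L' ks nc"
    and X: "X \<noteq> {}" "X \<subseteq> Rx" and H: "j \<le> H" and disj: "\<And>q. q \<in> live nt \<Longrightarrow> lv q = j \<Longrightarrow> X \<inter> L q = {}"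
  shows "base lv' L' nt' (Suc nc)"
proof -
  have nc: "nc \<notin> live nt" using baseD(2)[OF b] by blast
  have g: "lv' q = lv q" "L' q = L q" if "q < nc" for q using that lv' L' by auto
  have gd: "lv' q = lv q" "L' q = L q" if "q \<in> live nt" for q using g baseD(2)[OF b that] by auto
  have gn: "lv' nc = j" "L' nc = X" using lv' L' by auto
  show ?thesis
    unfolding base_def
  proof (intro conjI ballI allI impI)
    show "finite (live nt')" using baseD(1)[OF b] dom by simp
    show "q \<in> live nt'" "lv' q = 0" "L' q = {x}" if "(q, x) \<in> Z" for q x using baseD(12)[OF b that] gd[of q] dom by auto
  next
    fix q assume q: "q \<in> live nt'"
    have kk: "kd nt' q = (if q = nc then ks else kd nt q)" using new kd q dom nc by auto
    have ksn: "c < nc" if "c \<in> set ks" for c using ks[OF that] baseD(2)[OF b] by auto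
    have kn: "c < nc" if "c \<in> set (kd nt' q)" for c
      using that kk baseD(3)[OF b, of q c] ksn q dom by (auto split: if_splits)
    show "q < Suc nc" using q dom baseD(2)[OF b, of q] by auto
    show "lv' q \<le> H" using q dom baseD(5)[OF b, of q] gd gn H by auto
    show "L' q \<noteq> {}" using q dom baseD(6)[OF b, of q] gd gn X by auto
    show "L' q \<subseteq> Rx" using q dom baseD(7)[OF b, of q] gd gn X by auto
    show "c < Suc nc" if "c \<in> set (kd nt' q)" for c using kn[OF that] by simp
    show "shape lv' L' (kd nt' q) q"
    proof (cases "q = nc")
      case True then show ?thesis using kk sh by simp
    next
      case False
      then have qd: "q \<in> live nt" using q dom by auto
      have "shape lv' L' (kd nt q) q = shape lv L (kd nt q) q"
        by (rule shape_cong) (use g gd[OF qd] baseD(3)[OF b qd] in auto)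
      then show ?thesis using kk False baseD(4)[OF b qd] by simp
    qed
    show "L' q \<inter> L' r = {}" if r: "r \<in> live nt'" "lv' q = lv' r" "q \<noteq> r" for r
    proof (cases "q = nc")
      case True
      then have "r \<in> live nt" using r dom by auto
      then show ?thesis using True disj[of r] gn gd r by auto
    next
      case False
      then have qd: "q \<in> live nt" using q dom by auto
      show ?thesis
      proof (cases "r = nc")
        case True
        then show ?thesis using qd disj[of q] gn gd r by auto
      next
        case False
        then have "r \<in> live nt" using r dom by auto
        then show ?thesis using qd baseD(8)[OF b, of q r] gd r by auto
      qed
    qed
    show "pa nt' c = Some q" if cq: "c \<in> set (kd nt' q)" "c \<in> live nt'" for c
    proof -
      have cd: "c \<in> live nt" using cq dom kn[OF cq(1)] by auto
      show ?thesis
      proof (cases "q = nc")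
        case True then show ?thesis using kk cq pa[OF cd] by auto
      next
        case False
        then have qd: "q \<in> live nt" using q dom by auto
        have "pa nt c = Some q" using baseD(11)[OF b qd _ cd] kk cq False by auto
        moreover then have "c \<notin> set ks" using ks by auto
        ultimately show ?thesis using pa[OF cd] by auto
      qed
    qed
    fix r assume r: "pa nt' q = Some r"
    then have qd: "q \<in> live nt" using q dom new by auto
    show "r \<in> live nt'" using r pa[OF qd] baseD(9)[OF b qd] dom by (auto split: if_splits)
    show "q \<in> set (kd nt' r)"
    proof (cases "q \<in> set ks")
      case True then show ?thesis using r pa[OF qd] new by auto
    next
      case False
      then have "pa nt q = Some r" using r pa[OF qd] by auto
      then show ?thesis using baseD(9,10)[OF b qd] kd by auto
    qed
  qed
qed

text \<open>The new vertex set is disjoint from those of its level: the children in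
  \<open>ks\<close> are parentless, while the children of another cluster of that level are live and
  have it as their parent. For this \<open>live\<close> excludes dead children at level
  \<open>Suc i\<close>. The new node joins \<open>Or'\<close>, being an orphan of the next
  level.\<close>

lemma core_add:
  assumes c: "core k lv L nt nc Or D Ud tt tc" and dom: "live nt' = insert nc (live nt)"
    and same: "\<And>q. q \<in> live nt \<Longrightarrow> same_node nt nt' q"
    and pa: "\<And>q. q \<in> live nt \<Longrightarrow> pa nt' q = (if q \<in> set ks then Some nc else pa nt q)"
    and new: "pa nt' nc = None" "kd nt' nc = ks" "ww nt' nc = inner X"
    and ks: "\<And>d. d \<in> set ks \<Longrightarrow> d \<in> live nt \<and> pa nt d = None \<and> d \<in> Or \<and> lv d = i"
    and lv': "lv' = lv(nc := Suc i)" and L': "L' = L(nc := X)"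
    and sh: "shape lv' L' ks nc" "ks \<noteq> []" and X: "conn E X" "X \<subseteq> R" and RRx: "R \<subseteq> Rx" and H: "Suc i \<le> H"
    and reg: "\<And>q x y. length ks = 1 \<Longrightarrow> q \<in> live nt \<Longrightarrow> lv q = Suc i \<Longrightarrow> length (kd nt q) = 1 \<Longrightarrow> x \<in> X \<Longrightarrow> y \<in> L q \<Longrightarrow> {x, y} \<notin> E"
    and Or': "nc \<in> Or'" "Or - set ks \<subseteq> Or'" "Or' \<subseteq> insert nc Or"
    and D: "\<And>q. q \<in> D \<Longrightarrow> q < nc"
    and live: "\<And>q. q \<in> live nt \<Longrightarrow> lv q = Suc i \<Longrightarrow> set (kd nt q) \<subseteq> live nt"
  shows "core k lv' L' nt' (Suc nc) Or' D Ud tt tc"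
proof -
  have b: "base lv L nt nc" using c by (simp add: core_def)
  have nc: "nc \<notin> live nt" using baseD(2)[OF b] by blast
  have s: "kd nt' q = kd nt q" "sd nt' q = sd nt q" "ww nt' q = ww nt q" "te nt' q = te nt q"
    if "q \<in> live nt" for q using same[OF that] by (auto simp: same_node_def)
  have g: "lv' q = lv q" "L' q = L q" if "q < nc" for q using that lv' L' by auto
  have gd: "lv' q = lv q" "L' q = L q" if "q \<in> live nt" for q using g baseD(2)[OF b that] by auto
  have gn: "lv' nc = Suc i" "L' nc = X" using lv' L' by auto
  have XU: "X = \<Union>(L ` set ks)"
    using shape_Union[OF sh] gn ks gd by auto
  have okd: "ok k lv' L' q = ok k lv L q" if "q \<in> live nt" for q using gd[OF that] by (simp add: ok_def)
  have disj: "X \<inter> L q = {}" if q: "q \<in> live nt" "lv q = Suc i" for q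
  proof -
    have sq: "shape lv L (kd nt q) q" using baseD(4)[OF b q(1)] .
    have ne: "kd nt q \<noteq> []" using sq q unfolding shape_def by auto
    have "L d \<inter> L e = {}" if d: "d \<in> set ks" and e: "e \<in> set (kd nt q)" for d e
    proof -
      have e': "e \<in> live nt" using live[OF q] e by auto
      have "pa nt e = Some q" using baseD(11)[OF b q(1) e e'] .
      then have "d \<noteq> e" using ks[OF d] by auto
      moreover have "lv e = i" using shape_kid[OF sq e] q by auto
      ultimately show ?thesis using baseD(8)[OF b _ e', of d] ks[OF d] by auto
    qed
    then show ?thesis unfolding XU shape_Union[OF sq ne] by blast
  qed
  have 1: "base lv' L' nt' (Suc nc)"
  proof (rule base_add[OF b dom s(1) pa new(1,2) _ lv' L' sh(1)])
    show "X \<noteq> {}" using XU sh(2) ks baseD(6)[OF b] by (cases ks) auto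
  qed (use ks X RRx H disj in auto)
  have 2: "contents k lv' L' nt'"
    unfolding contents_def
  using gn X new dom c okd gd s by (auto simp: core_def contents_def)
  have 3: "reg k lv' L' nt'"
    unfolding reg_def
  proof (intro ballI impI)
    fix p q x y
    assume p: "p \<in> live nt'" and q: "q \<in> live nt'" and o: "ok k lv' L' p" "ok k lv' L' q" and pq: "p \<noteq> q"
      and l: "lv' p = lv' q" and ln: "length (kd nt' p) = 1" "length (kd nt' q) = 1" and xy: "x \<in> L' p" "y \<in> L' q"
    show "{x, y} \<notin> E"
    proof (cases "p = nc")
      case True
      then have qd: "q \<in> live nt" using q pq dom by auto
      show ?thesis using reg[of q x y] True ln new s[OF qd] gn gd[OF qd] xy qd l by auto
    next
      case False
      then have pd: "p \<in> live nt" using p dom by auto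
      show ?thesis
      proof (cases "q = nc")
        case True
        have "{y, x} \<notin> E" using reg[of p y x] True ln new s[OF pd] gn gd[OF pd] xy pd l by auto
        then show ?thesis by (simp add: insert_commute)
      next
        case False
        then have qd: "q \<in> live nt" using q dom by auto
        have "reg k lv L nt" using c by (simp add: core_def)
        then show ?thesis using o okd[OF pd] okd[OF qd] pd qd gd[OF pd] gd[OF qd] s[OF pd] s[OF qd] pq l ln xy
          unfolding reg_def by metis
      qed
    qed
  qed
  have own: "own k lv' L' nt' Or' = own k lv L nt Or"
  proof (intro equalityI subsetI)
    fix q assume q: "q \<in> own k lv' L' nt' Or'"
    then have "q \<noteq> nc" using Or' by (auto simp: own_def)
    then have qd: "q \<in> live nt" using q dom by (auto simp: own_def)
    then have "q \<notin> set ks" using q pa[OF qd] by (auto simp: own_def)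
    then show "q \<in> own k lv L nt Or" using q qd pa[OF qd] okd[OF qd] Or' by (auto simp: own_def)
  next
    fix q assume q: "q \<in> own k lv L nt Or"
    then have qd: "q \<in> live nt" by (auto simp: own_def)
    moreover have "q \<notin> set ks" using ks q by (auto simp: own_def)
    ultimately show "q \<in> own k lv' L' nt' Or'" using q pa[OF qd] okd[OF qd] dom Or' nc by (auto simp: own_def)
  qed
  have od: "own k lv L nt Or \<subseteq> live nt" by (auto simp: own_def)
  have te: "te nt' ` own k lv L nt Or = te nt ` own k lv L nt Or" "inj_on (te nt') (own k lv L nt Or) = inj_on (te nt) (own k lv L nt Or)"
    by (rule image_inj_cong; use s(4) od in blast)+
  have 4: "roots k lv' L' nt' Or' tt tc"
    unfolding roots_def own te
  using od c s gd by (auto simp: core_def roots_def is_root_def)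
  have 5: "kids_ok L' nt' D Ud"
    unfolding kids_ok_def
  using new ks dom s baseD(3)[OF b] c g(2) by (auto simp: core_def kids_ok_def)
  show ?thesis using 1 2 3 4 5 by (simp add: core_def)
qed

text \<open>The number \<open>tc\<close> exceeds all edge numbers in use, so the new root disturbs
  neither the injectivity of \<open>te\<close> on roots nor the separation from
  \<open>TE\<close>.\<close>

lemma core_root:
  assumes c: "core k lv L nt nc Or D Ud tt tc" and n: "n \<in> live nt" "pa nt n = None" "n \<in> Or" "0 < lv n" "ok k lv L n"
    and dom: "live nt' = live nt" and sm: "\<And>q. q \<in> live nt \<Longrightarrow> kd nt' q = kd nt q \<and> sd nt' q = sd nt q \<and> ww nt' q = ww nt q \<and> pa nt' q = pa nt q"
    and te: "\<And>q. q \<in> live nt \<Longrightarrow> te nt' q = (if q = n then Some tc else te nt q)"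
    and sdn: "sd nt n = ((Singular u, a), (Singular v, b))"
    and tt': "tt' = tt(tc \<mapsto> \<lparr> tends = (u, v), twt = ww nt n + a + b \<rparr>)"
    and Or': "Or' = Or - {n}" and TE: "\<And>t. t \<in> TE \<Longrightarrow> t < tc"
  shows "core k lv L nt' nc Or' D Ud tt' (Suc tc)"
proof -
  have s: "kd nt' q = kd nt q" "sd nt' q = sd nt q" "ww nt' q = ww nt q" "pa nt' q = pa nt q" if "q \<in> live nt" for q
    using sm[OF that] by auto
  have b: "base lv L nt nc" and r: "roots k lv L nt Or tt tc" using c by (auto simp: core_def)
  have 1: "base lv L nt' nc" by (rule base_cong[OF b dom s(1,4)])
  have 2: "contents k lv L nt'" using c s unfolding core_def contents_def dom by metis
  have 3: "reg k lv L nt'" using c s unfolding core_def reg_def dom by metis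
  have own: "own k lv L nt' Or' = insert n (own k lv L nt Or)"
    using n Or' s(4) dom by (auto simp: own_def)
  have nn: "n \<notin> own k lv L nt Or" using n by (auto simp: own_def)
  have od: "own k lv L nt Or \<subseteq> live nt" by (auto simp: own_def)
  have tn: "te nt' q = te nt q" if "q \<in> own k lv L nt Or" for q using te[OF subsetD[OF od that]] that nn by auto
  have told: "t < tc" if "q \<in> own k lv L nt Or" "te nt q = Some t" for q t
    using r that unfolding roots_def by (metis (mono_tags, lifting) UnI2 imageI mem_Collect_eq)
  have rt: "is_root lv nt tt q" if "q \<in> own k lv L nt Or" for q using r that by (auto simp: roots_def)
  have TEt: "tc \<notin> TE" using TE by blast
  have 4: "roots k lv L nt' Or' tt' (Suc tc)"
    unfolding roots_def own
  proof (intro conjI ballI)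
    fix q assume q: "q \<in> insert n (own k lv L nt Or)"
    show "is_root lv nt' tt' q"
    using n te s sdn tt' TEt q rt told subsetD[OF od] by (fastforce simp: is_root_def)
  next
    have "inj_on (te nt') (own k lv L nt Or)" using r tn inj_on_cong[of "own k lv L nt Or" "te nt'" "te nt"]
      by (auto simp: roots_def)
    moreover have "te nt' n \<notin> te nt' ` own k lv L nt Or"
      using te[OF n(1)] tn told by fastforce
    ultimately show "inj_on (te nt') (insert n (own k lv L nt Or))" using nn by simp
  next
    have im: "te nt' ` own k lv L nt Or = te nt ` own k lv L nt Or" using tn by (rule image_cong[OF refl])
    have "dom tt = TE \<union> {t. Some t \<in> te nt ` own k lv L nt Or}" using r by (simp add: roots_def)
    then show "dom tt' = TE \<union> {t. Some t \<in> te nt' ` insert n (own k lv L nt Or)}"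
      unfolding image_insert im using te[OF n(1)] tt' by auto
  next
    fix t assume "t \<in> TE" then show "tt' t = TT t" using r tt' TEt by (auto simp: roots_def)
  next
    fix t assume "t \<in> dom tt'" then show "t < Suc tc" using r tt' by (auto simp: roots_def less_Suc_eq)
  qed
  have 5: "kids_ok L nt' D Ud" using c s unfolding core_def kids_ok_def dom by metis
  show ?thesis using 1 2 3 4 5 by (simp add: core_def)
qed

text \<open>Within \<open>core\<close> only \<open>is_root\<close> reads the sides. So they may be
  rewritten freely except at own roots.\<close>

lemma core_sides:
  assumes c: "core k lv L nt nc Or D Ud tt tc" and dom: "live nt' = live nt"
    and sm: "\<And>q. q \<in> live nt \<Longrightarrow> kd nt' q = kd nt q \<and> te nt' q = te nt q \<and> ww nt' q = ww nt q \<and> pa nt' q = pa nt q"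
    and sd: "\<And>q. q \<in> own k lv L nt Or \<Longrightarrow> sd nt' q = sd nt q"
  shows "core k lv L nt' nc Or D Ud tt tc"
proof -
  have s: "kd nt' q = kd nt q" "te nt' q = te nt q" "ww nt' q = ww nt q" "pa nt' q = pa nt q" if "q \<in> live nt" for q
    using sm[OF that] by auto
  have r: "roots k lv L nt Or tt tc" using c by (auto simp: core_def)
  have own: "own k lv L nt' Or = own k lv L nt Or" using s dom by (auto simp: own_def)
  have od: "own k lv L nt Or \<subseteq> live nt" by (auto simp: own_def)
  have te: "te nt' ` own k lv L nt Or = te nt ` own k lv L nt Or" "inj_on (te nt') (own k lv L nt Or) = inj_on (te nt) (own k lv L nt Or)"
    by (rule image_inj_cong; use s(2) od in blast)+
  have 4: "roots k lv L nt' Or tt tc"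
    unfolding roots_def own te
  using r s sd od by (auto simp: roots_def is_root_def)
  have "base lv L nt nc" using c by (simp add: core_def)
  then have "base lv L nt' nc" by (rule base_cong) (use s dom in auto)
  moreover have "contents k lv L nt'" using c s unfolding core_def contents_def dom by metis
  moreover have "reg k lv L nt'" using c s unfolding core_def reg_def dom by metis
  moreover have "kids_ok L nt' D Ud" using c s unfolding core_def kids_ok_def dom by metis
  ultimately show ?thesis using 4 by (simp add: core_def)
qed

end


lemmas view_mem = view_Some[of "ntab m" for m]

lemma card_2_other:
  assumes "card S = 2" "z \<in> S"
  shows "\<exists>a. S = {a, z} \<and> a \<noteq> z"
proof -
  obtain x y where "S = {x, y}" "x \<noteq> y" using assms(1) by (auto simp: card_2_iff)
  then show ?thesis using assms(2) by (cases "z = x") auto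
qed

context env
begin

lemma sok_card: "sok rp X s \<Longrightarrow> card (out E X) = 2"
  by (auto simp: sok_def)

lemma sok_dart: "sok rp X s \<Longrightarrow> d \<in> out E X \<Longrightarrow> rp d (fst s) \<or> rp d (snd s)"
  by (auto simp: sok_def)

lemma sokI: "d1 \<noteq> d2 \<Longrightarrow> out E X = {d1, d2} \<Longrightarrow> rp d1 s1 \<Longrightarrow> rp d2 s2 \<Longrightarrow> sok rp X (s1, s2)"
  unfolding sok_def by (metis fst_conv snd_conv)

lemma sok_fst: "sok rp X s \<Longrightarrow> \<exists>d \<in> out E X. rp d (fst s)"
  by (auto simp: sok_def)

lemma sok_snd: "sok rp X s \<Longrightarrow> \<exists>d \<in> out E X. rp d (snd s)"
  by (auto simp: sok_def)

lemma sok_mono: "sok rp X s \<Longrightarrow> (\<And>d s. d \<in> out E X \<Longrightarrow> rp d s \<Longrightarrow> rp' d s) \<Longrightarrow> sok rp' X s"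
  unfolding sok_def by (metis insertI1 insertI2)

lemma srep_cong:
  assumes "srep S lv L j d s" "\<And>q. q \<in> S \<Longrightarrow> lv q = j \<Longrightarrow> q \<in> S' \<and> lv' q = j \<and> L' q = L q"
  shows "srep S' lv' L' j d s"
  using assms unfolding srep_def by (cases "fst s") auto

lemma wrep_cong:
  assumes "wrep S lv L j d s" "\<And>q. q \<in> S' \<Longrightarrow> lv' q = j \<Longrightarrow> q \<in> S \<and> lv q = j \<and> L' q = L q"
  shows "wrep S' lv' L' j d s"
  using assms unfolding wrep_def by (cases "fst s") auto

lemma strong_cong:
  assumes "strong lv L nt p" "sd nt' p = sd nt p" "lv' p = lv p" "L' p = L p"
    "\<And>q. q \<in> live nt \<Longrightarrow> lv q = lv p \<Longrightarrow> q \<in> live nt' \<and> lv' q = lv q \<and> L' q = L q"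
  shows "strong lv' L' nt' p"
  unfolding strong_def assms(2-4)
  by (rule sok_mono[OF assms(1)[unfolded strong_def]], erule srep_cong) (use assms(5) in simp)

lemma weak_cong:
  assumes "weak lv L nt B p" "sd nt' p = sd nt p" "lv' p = lv p" "L' p = L p"
    "\<And>q. q \<in> live nt' \<Longrightarrow> q \<notin> B' \<Longrightarrow> lv' q = lv p \<Longrightarrow> q \<in> live nt \<and> q \<notin> B \<and> lv' q = lv q \<and> L' q = L q"
  shows "weak lv' L' nt' B' p"
  unfolding weak_def assms(2-4)
  by (rule sok_mono[OF assms(1)[unfolded weak_def]], erule wrep_cong) (use assms(5) in auto)

end

section \<open>Regions of changed vertices\<close>

definition near :: "nat set set \<Rightarrow> nat set \<Rightarrow> nat set \<Rightarrow> bool" where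
  "near E U X \<longleftrightarrow> X \<inter> U = {} \<and> (\<exists>x\<in>U. \<exists>y\<in>X. {x, y} \<in> E)"

definition grow :: "nat set set \<Rightarrow> (nat \<Rightarrow> nat set) \<Rightarrow> nat set \<Rightarrow> nat set \<Rightarrow> nat set" where
  "grow E L N U = U \<union> \<Union>(L ` {d \<in> N. near E U (L d)})"

text \<open>\<open>depth\<close> says that \<open>H\<close> levels with a decay of 2/3 each leave
  less than one link. \<open>ChE\<close> confines the effect of a vertex that has lost its
  regularity to its neighbours.\<close>

locale arena = env +
  assumes E: "simple_edges E" and finR: "finite R" and acyc: "acyclic_on E R" and RRx: "R \<subseteq> Rx" and H1: "1 \<le> H"
    and depth: "card {(x, y). x \<in> R \<and> y \<in> R \<and> {x, y} \<in> E} * 2 ^ H < 3 ^ H"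
    and ChE: "\<And>x y. x \<in> Rx - R \<Longrightarrow> y \<in> R \<Longrightarrow> {x, y} \<in> E \<Longrightarrow> y \<in> Ch"
begin

text \<open>Protects untouched roots from deletion: their vertex sets are closed under adjacency in
  \<open>R\<close> and avoid \<open>Ch\<close>, so the region does not reach them.\<close>

definition theta :: "nat set \<Rightarrow> bool" where
  "theta U \<longleftrightarrow> (\<forall>X\<subseteq>R. (\<forall>x\<in>X. \<forall>y\<in>R. {x, y} \<in> E \<longrightarrow> y \<in> X) \<longrightarrow> X \<inter> Ch = {} \<longrightarrow> X \<inter> U = {})"

lemma grow_props:
  assumes fin: "finite N" and U: "U \<subseteq> R"
    and disj: "\<And>c d. c \<in> N \<Longrightarrow> d \<in> N \<Longrightarrow> c \<noteq> d \<Longrightarrow> L c \<inter> L d = {}"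
    and two: "\<And>d. d \<in> N \<Longrightarrow> card (out E (L d)) = 2"
    and N: "\<And>d. d \<in> N \<Longrightarrow> L d \<subseteq> R \<and> conn E (L d) \<and> L d \<noteq> {}"
    and sat: "\<And>d. d \<in> N \<Longrightarrow> L d \<subseteq> U \<or> L d \<inter> U = {}"
    and S: "S \<subseteq> {d \<in> N. near E U (L d)}" and U': "U' = U \<union> \<Union>(L ` S)"
  shows "card (out E U') \<le> card (out E U)"
    and "card {d \<in> N. L d \<inter> U' \<noteq> {}} \<le> card {d \<in> N. L d \<inter> U \<noteq> {}} + card (out E U)"
    and "U' \<subseteq> R" and "\<And>d. d \<in> N \<Longrightarrow> L d \<subseteq> U' \<or> L d \<inter> U' = {}" and "theta U \<Longrightarrow> theta U'"
proof -
  have finS: "finite S" using S fin finite_subset by fastforce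
  have SN: "S \<subseteq> N" using S by auto
  have S1: "d \<in> N" "L d \<inter> U = {}" "\<exists>x\<in>U. \<exists>y\<in>L d. {x, y} \<in> E" if "d \<in> S" for d
    using S that by (auto simp: near_def)
  have ex: "card (out E (U \<union> \<Union>(L ` S))) \<le> card (out E U) \<and> card S \<le> card (out E U)"
    by (rule expand_out[OF E finS]) (use S1 two disj in auto)
  then show "card (out E U') \<le> card (out E U)" using U' by simp
  have mem: "d \<in> S" if "d \<in> N" "x \<in> L d" "e \<in> S" "x \<in> L e" for d e x
    using disj[of d e] that SN by auto
  have "{d \<in> N. L d \<inter> U' \<noteq> {}} \<subseteq> {d \<in> N. L d \<inter> U \<noteq> {}} \<union> S"
    unfolding U' using mem by blast
  then have "card {d \<in> N. L d \<inter> U' \<noteq> {}} \<le> card ({d \<in> N. L d \<inter> U \<noteq> {}} \<union> S)"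
    by (rule card_mono[rotated]) (use fin finS in auto)
  also have "\<dots> \<le> card {d \<in> N. L d \<inter> U \<noteq> {}} + card S" by (rule card_Un_le)
  finally show "card {d \<in> N. L d \<inter> U' \<noteq> {}} \<le> card {d \<in> N. L d \<inter> U \<noteq> {}} + card (out E U)"
    using ex by simp
  show "U' \<subseteq> R" using U N SN unfolding U' by blast
  show "L d \<subseteq> U' \<or> L d \<inter> U' = {}" if d: "d \<in> N" for d
  using mem[OF d] sat[OF d] by (auto simp: U')
  show "theta U'" if th: "theta U"
    unfolding theta_def
  proof (intro allI impI)
    fix X assume X: "X \<subseteq> R" and cl: "\<forall>x\<in>X. \<forall>y\<in>R. {x, y} \<in> E \<longrightarrow> y \<in> X" and ch: "X \<inter> Ch = {}"
    have XU: "X \<inter> U = {}" using th X cl ch unfolding theta_def by blast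
    have "X \<inter> L d = {}" if d: "d \<in> S" for d
    proof (rule ccontr)
      assume ne: "X \<inter> L d \<noteq> {}"
      \<comment> \<open>A connected cluster that meets a closed set lies in it. Then so does its
        neighbour in \<open>U\<close>, which contradicts \<open>theta U\<close>.\<close>
      have "L d \<subseteq> X"
      proof (rule ccontr)
        assume "\<not> L d \<subseteq> X"
        then have "X \<inter> L d \<subset> L d" by auto
        then obtain x y where "x \<in> X \<inter> L d" "y \<in> L d - X \<inter> L d" "{x, y} \<in> E"
          using N[OF S1(1)[OF d]] ne unfolding conn_def by metis
        then show False using cl N[OF S1(1)[OF d]] by auto
      qed
      moreover obtain x y where "x \<in> U" "y \<in> L d" "{x, y} \<in> E" using S1(3)[OF d] by auto
      moreover then have "{y, x} \<in> E" by (simp add: insert_commute)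
      ultimately have "x \<in> X" using cl U by blast
      then show False using XU \<open>x \<in> U\<close> by auto
    qed
    then show "X \<inter> U' = {}" using XU unfolding U' by blast
  qed
qed

lemma strong_nbr:
  assumes b: "base lv L nt nc" and s: "strong lv L nt p"
    and xy: "x \<in> L p" "y \<in> R" "y \<notin> L p" "{x, y} \<in> E"
  shows "\<exists>q\<in>live nt. lv q = lv p \<and> y \<in> L q \<and> q \<noteq> p \<and> (fst (fst (sd nt p)) = Cluster q \<or> fst (snd (sd nt p)) = Cluster q)"
proof -
  have "(x, y) \<in> out E (L p)" using xy by (auto simp: out_def)
  from sok_dart[OF s[unfolded strong_def] this]
  show ?thesis using xy unfolding srep_def by (auto split: nbr.splits)
qed

lemma strong_side:
  assumes s: "strong lv L nt p" and q: "fst (fst (sd nt p)) = Cluster q \<or> fst (snd (sd nt p)) = Cluster q"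
  shows "q \<in> live nt" "lv q = lv p" "\<exists>x\<in>L p. \<exists>y\<in>L q. y \<notin> L p \<and> {x, y} \<in> E"
proof -
  obtain d where d: "d \<in> out E (L p)" "snd d \<in> L q" "q \<in> live nt" "lv q = lv p"
    using q sok_fst[OF s[unfolded strong_def]] sok_snd[OF s[unfolded strong_def]]
    unfolding srep_def by (auto split: nbr.splits)
  show "q \<in> live nt" "lv q = lv p" using d by simp_all
  have "fst d \<in> L p" "snd d \<notin> L p" "{fst d, snd d} \<in> E" using d(1) by (auto simp: out_def)
  then show "\<exists>x\<in>L p. \<exists>y\<in>L q. y \<notin> L p \<and> {x, y} \<in> E" using d(2) by blast
qed

text \<open>\<open>side_to\<close> and \<open>side_away\<close> test only the first side. They
  select correctly if the other exit does not lead to \<open>d\<close> as well; this is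
  \<open>uniq\<close>, which \<open>out_Un_pair\<close> provides.\<close>

lemma side_split:
  assumes b: "base lv L nt nc" and d: "d \<in> live nt" "lv d = lv c" and s: "strong lv L nt c" and LR: "L d \<subseteq> R"
    and xy: "(x, y) \<in> out E (L c)" "y \<in> L d"
    and uniq: "\<And>a. out E (L c) = {a, (x, y)} \<Longrightarrow> a \<noteq> (x, y) \<Longrightarrow> snd a \<notin> L d"
  shows "\<exists>a. out E (L c) = {a, (x, y)} \<and> a \<noteq> (x, y) \<and> srep (live nt) lv L (lv c) a (side_away d (sd nt c)) \<and>
     srep (live nt) lv L (lv c) (x, y) (side_to d (sd nt c))"
proof -
  obtain d1 d2 where dd: "d1 \<noteq> d2" "out E (L c) = {d1, d2}" "srep (live nt) lv L (lv c) d1 (fst (sd nt c))"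
    "srep (live nt) lv L (lv c) d2 (snd (sd nt c))"
    using s unfolding strong_def sok_def by blast
  have cl: "fst s' = Cluster d" if sr: "srep (live nt) lv L (lv c) (x, y) s'" for s'
  proof -
    obtain q where q: "fst s' = Cluster q" "q \<in> live nt" "lv q = lv c" "y \<in> L q"
      using sr xy LR unfolding srep_def by (auto split: nbr.splits)
    then have "q = d" using baseD(8)[OF b q(2) d(1)] d(2) xy(2) by auto
    then show ?thesis using q by simp
  qed
  show ?thesis
  proof (cases "(x, y) = d1")
    case True
    then have "fst (fst (sd nt c)) = Cluster d" using cl dd by auto
    then have "side_to d (sd nt c) = fst (sd nt c)" "side_away d (sd nt c) = snd (sd nt c)"
      by (simp_all add: side_to_def side_away_def)
    then show ?thesis using True dd by (metis insert_commute)
  next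
    case False
    then have d2: "(x, y) = d2" using xy dd by auto
    have "snd d1 \<notin> L d" using uniq[of d1] dd d2 by auto
    then have "fst (fst (sd nt c)) \<noteq> Cluster d" using dd(3) unfolding srep_def by auto
    then have "side_to d (sd nt c) = snd (sd nt c)" "side_away d (sd nt c) = fst (sd nt c)"
      by (simp_all add: side_to_def side_away_def)
    then show ?thesis using d2 dd by metis
  qed
qed

text \<open>All three claims rest on the uniqueness of the edge between the clusters
  (\<open>out_Un_pair\<close>): it is the only inner edge of the union that lies in neither part,
  and \<open>new_pair\<close> adds its weight.\<close>

lemma pair_sides:
  assumes b: "base lv L nt nc" and c: "c \<in> live nt" "strong lv L nt c" "L c \<subseteq> R"
    and d: "d \<in> live nt" "strong lv L nt d" "L d \<subseteq> R" and cd: "lv d = lv c" "c \<noteq> d"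
    and e: "x \<in> L c" "y \<in> L d" "{x, y} \<in> E"
  shows "sok (srep (live nt) lv L (lv c)) (L c \<union> L d) (side_away d (sd nt c), side_away c (sd nt d))"
    and "snd (side_to d (sd nt c)) = W {x, y}"
    and "inner (L c \<union> L d) = inner (L c) + W {x, y} + inner (L d)"
proof -
  have disj: "L c \<inter> L d = {}" using baseD(8)[OF b c(1) d(1)] cd by auto
  have xy: "(x, y) \<in> out E (L c)" "(y, x) \<in> out E (L d)"
    using e disj insert_commute[of y x "{}"] unfolding out_def by auto
  obtain a where a: "out E (L c) = {a, (x, y)}" "a \<noteq> (x, y)"
    using card_2_other[OF sok_card[OF c(2)[unfolded strong_def]] xy(1)] by blast
  obtain a' where a': "out E (L d) = {a', (y, x)}" "a' \<noteq> (y, x)"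
    using card_2_other[OF sok_card[OF d(2)[unfolded strong_def]] xy(2)] by blast
  have U: "out E (L c \<union> L d) = {a, a'} \<and> a \<noteq> a' \<and> snd a \<notin> L d \<and> snd a' \<notin> L c"
    using out_Un_pair[OF acyc _ disj a e(2) a' e(1)] c d by auto
  obtain a2 where a2: "out E (L c) = {a2, (x, y)}" "a2 \<noteq> (x, y)" "srep (live nt) lv L (lv c) a2 (side_away d (sd nt c))"
     "srep (live nt) lv L (lv c) (x, y) (side_to d (sd nt c))"
    using side_split[OF b d(1) cd(1) c(2) d(3) xy(1) e(2)] U a by (metis doubleton_eq_iff)
  obtain a3 where a3: "out E (L d) = {a3, (y, x)}" "a3 \<noteq> (y, x)" "srep (live nt) lv L (lv d) a3 (side_away c (sd nt d))"
    using side_split[OF b c(1) cd(1)[symmetric] d(2) c(3) xy(2) e(1)] U a' by (metis doubleton_eq_iff)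
  have "a2 = a" "a3 = a'" using a a2 a' a3 by (metis doubleton_eq_iff)+
  then show "sok (srep (live nt) lv L (lv c)) (L c \<union> L d) (side_away d (sd nt c), side_away c (sd nt d))"
    unfolding sok_def using U a2(3) a3(3) cd(1) by (metis fst_conv snd_conv)
  show "snd (side_to d (sd nt c)) = W {x, y}" using a2 unfolding srep_def by auto
  let ?I = "\<lambda>X. {e \<in> E. e \<subseteq> X}"
  have fE: "finite E" using E by (simp add: simple_edges_def)
  have cross: "e = {x, y}" if ee: "e \<in> E" "e \<subseteq> L c \<union> L d" "\<not> e \<subseteq> L c" "\<not> e \<subseteq> L d" for e
  proof -
    obtain p q where pq: "e = {p, q}" using E ee(1) unfolding simple_edges_def by blast
    have "(p \<in> L c \<and> q \<in> L d) \<or> (q \<in> L c \<and> p \<in> L d)" using ee pq by blast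
    then obtain p' q' where pq': "e = {p', q'}" "p' \<in> L c" "q' \<in> L d" using pq by (metis insert_commute)
    then have "(p', q') \<in> out E (L c)" using ee disj unfolding out_def by auto
    then have "(p', q') = (x, y)" using a U pq' by auto
    then show ?thesis using pq' by simp
  qed
  have I: "?I (L c \<union> L d) = ?I (L c) \<union> ({{x, y}} \<union> ?I (L d))"
    using cross e by blast
  have 1: "?I (L c) \<inter> ({{x, y}} \<union> ?I (L d)) = {}" "{{x, y}} \<inter> ?I (L d) = {}"
  proof -
    have "e = {}" if "e \<subseteq> L c" "e \<subseteq> L d" for e using that disj by blast
    moreover have "{} \<notin> E" using E unfolding simple_edges_def by auto
    ultimately show "?I (L c) \<inter> ({{x, y}} \<union> ?I (L d)) = {}" using e disj by blast
    show "{{x, y}} \<inter> ?I (L d) = {}" using e disj by blast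
  qed
  show "inner (L c \<union> L d) = inner (L c) + W {x, y} + inner (L d)"
    unfolding inner_def I using 1 fE by (subst sum.union_disjoint; simp)+
qed

lemma parent_side_runs:
  assumes b: "base lv L (ntab m) nc" and s: "srep (live (ntab m)) lv L j d s"
    and q: "\<And>q. fst s = Cluster q \<Longrightarrow> pa (ntab m) q \<noteq> None"
  shows "runs (parent_side s) m (\<lambda>s' t m'. m' = m \<and> t \<le> 1 \<and> srep (live (ntab m)) lv L (Suc j) d s')"
proof (cases "fst s")
  case (Singular u)
  then show ?thesis using s by (simp add: parent_side_def runs_simps srep_def)
next
  case (Cluster q)
  then have ql: "q \<in> live (ntab m)" "lv q = j" "snd d \<in> L q" using s by (auto simp: srep_def live_def)
  obtain q' where q': "pa (ntab m) q = Some q'" using q[OF Cluster] by auto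
  obtain r where r: "ntab m q = Some r" using ql by (auto simp: live_def)
  have "q' \<in> live (ntab m)" "lv q' = Suc j" "snd d \<in> L q'"
    using baseD(9)[OF b ql(1) q'] base_pa_lv[OF b ql(1) q'] ql by auto
  then show ?thesis using Cluster r q' s view_mem(1)[OF r]
    by (auto simp: parent_side_def runs_simps srep_def live_def)
qed

text \<open>A side of \<open>p\<close> is a side of a child, with the neighbouring cluster replaced
  by its parent. That parent must exist, which is \<open>cov\<close>: a cluster with a regular
  neighbour has a parent. The 6 units occur for two children: three reads, two translations and one
  write.\<close>

lemma update_sides_runs:
  assumes b: "base lv L (ntab m) nc" and p: "p \<in> live (ntab m)" "lv p = Suc i" "set (kd (ntab m) p) \<subseteq> live (ntab m)"
    and str: "\<And>c. c \<in> live (ntab m) \<Longrightarrow> lv c = i \<Longrightarrow> strong lv L (ntab m) c \<and> L c \<subseteq> R"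
    and cov: "\<And>c x y. c \<in> live (ntab m) \<Longrightarrow> lv c = i \<Longrightarrow> x \<in> L c \<Longrightarrow> y \<in> R \<Longrightarrow> y \<notin> L c \<Longrightarrow> {x, y} \<in> E \<Longrightarrow> pa (ntab m) c \<noteq> None"
  shows "runs (update_sides p) m (\<lambda>_ t m'. t \<le> 6 \<and> (\<exists>r s. ntab m p = Some r \<and> m' = m\<lparr>ntab := (ntab m)(p \<mapsto> r\<lparr>sides := s\<rparr>)\<rparr> \<and>
     sok (srep (live (ntab m)) lv L (lv p)) (L p) s))"
proof -
  let ?nt = "ntab m"
  obtain r where r: "?nt p = Some r" using p by (auto simp: live_def)
  have par: "pa ?nt q \<noteq> None" if c: "c \<in> live ?nt" "lv c = i" and d: "d \<in> out E (L c)" "srep (live ?nt) lv L i d s" "fst s = Cluster q" for c d s q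
  proof -
    have q: "q \<in> live ?nt" "lv q = i" "snd d \<in> L q" using d by (auto simp: srep_def live_def)
    have dd: "fst d \<in> L c" "snd d \<notin> L c" "{snd d, fst d} \<in> E" using d by (auto simp: out_def insert_commute)
    have "q \<noteq> c" using dd q by auto
    then have "L q \<inter> L c = {}" using baseD(8)[OF b q(1) c(1)] q c by auto
    then show ?thesis using cov[OF q(1,2) q(3), of "fst d"] dd str[OF c] by auto
  qed
  consider (one) c where "kd ?nt p = [c]" "lv c = i" "L p = L c"
    | (two) c d where "kd ?nt p = [c, d]" "lv c = i" "lv d = i" "L p = L c \<union> L d" "L c \<inter> L d = {}" "\<exists>x\<in>L c. \<exists>y\<in>L d. {x, y} \<in> E"
    using baseD(4)[OF b p(1), unfolded shape_def] p(2) by (elim disjE exE conjE) auto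
  then show ?thesis
  proof cases
    case one
    have c: "c \<in> live ?nt" using p one by auto
    obtain rc where rc: "?nt c = Some rc" using c by (auto simp: live_def)
    obtain d1 d2 where dd: "d1 \<noteq> d2" "out E (L c) = {d1, d2}" "srep (live ?nt) lv L i d1 (fst (sd ?nt c))"
      "srep (live ?nt) lv L i d2 (snd (sd ?nt c))"
      using str[OF c one(2)] one(2) unfolding strong_def sok_def by blast
    have p1: "\<And>q. fst (fst (sd ?nt c)) = Cluster q \<Longrightarrow> pa ?nt q \<noteq> None" by (rule par[OF c one(2) _ dd(3)]) (use dd in auto)
    have p2: "\<And>q. fst (snd (sd ?nt c)) = Cluster q \<Longrightarrow> pa ?nt q \<noteq> None" by (rule par[OF c one(2) _ dd(4)]) (use dd in auto)
    have kr: "kids r = [c]" using one view_mem(2)[OF r] by simp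
    have sc: "sides rc = sd ?nt c" using view_mem(3)[OF rc] by simp
    show ?thesis
      apply (simp add: update_sides_def runs_simps r kr rc sc del: split_paired_Ex)
      apply (rule runs_mono[OF parent_side_runs[OF b dd(3) p1]], assumption)
      apply (elim conjE, simp del: split_paired_Ex)
      apply (rule runs_mono[OF parent_side_runs[OF b dd(4) p2]], assumption)
      apply (elim conjE, simp del: split_paired_Ex)
      subgoal for s1 t1 s2 t2
        apply (rule exI[of _ "(s1, s2)"])
        by (simp add: one p sokI[OF dd(1,2)])
      done
  next
    case two
    have c: "c \<in> live ?nt" "d \<in> live ?nt" using p two by auto
    have "c \<noteq> d" using two baseD(6)[OF b c(1)] by auto
    obtain rc where rc: "?nt c = Some rc" using c by (auto simp: live_def)
    obtain rd where rd: "?nt d = Some rd" using c by (auto simp: live_def)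
    obtain x y where xy: "x \<in> L c" "y \<in> L d" "{x, y} \<in> E" using two by auto
    have "sok (srep (live ?nt) lv L (lv c)) (L c \<union> L d) (side_away d (sd ?nt c), side_away c (sd ?nt d))"
      by (rule pair_sides(1)[OF b c(1) _ _ c(2) _ _ _ \<open>c \<noteq> d\<close> xy]) (use str c two in auto)
    then obtain d1 d2 where dd: "d1 \<noteq> d2" "out E (L c \<union> L d) = {d1, d2}" "srep (live ?nt) lv L i d1 (side_away d (sd ?nt c))"
      "srep (live ?nt) lv L i d2 (side_away c (sd ?nt d))"
      using two(2) unfolding sok_def by (metis fst_conv snd_conv)
    have in_out: "z \<in> out E (L c) \<or> z \<in> out E (L d)" if "z \<in> out E (L c \<union> L d)" for z using that by (auto simp: out_def)
    have p1: "\<And>q. fst (side_away d (sd ?nt c)) = Cluster q \<Longrightarrow> pa ?nt q \<noteq> None"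
      using in_out[of d1] dd(2) par[OF c(1) two(2) _ dd(3)] par[OF c(2) two(3) _ dd(3)] by auto
    have p2: "\<And>q. fst (side_away c (sd ?nt d)) = Cluster q \<Longrightarrow> pa ?nt q \<noteq> None"
      using in_out[of d2] dd(2) par[OF c(1) two(2) _ dd(4)] par[OF c(2) two(3) _ dd(4)] by auto
    have kr: "kids r = [c, d]" using two view_mem(2)[OF r] by simp
    have sc: "sides rc = sd ?nt c" using view_mem(3)[OF rc] by simp
    have sd': "sides rd = sd ?nt d" using view_mem(3)[OF rd] by simp
    show ?thesis
      apply (simp add: update_sides_def runs_simps r kr rc rd sc sd' del: split_paired_Ex)
      apply (rule runs_mono[OF parent_side_runs[OF b dd(3) p1]], assumption)
      apply (elim conjE, simp del: split_paired_Ex)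
      apply (rule runs_mono[OF parent_side_runs[OF b dd(4) p2]], assumption)
      apply (elim conjE, simp del: split_paired_Ex)
      subgoal for s1 t1 s2 t2
        apply (rule exI[of _ "(s1, s2)"])
        by (simp add: two p sokI[OF dd(1,2)])
      done
  qed
qed

end


section \<open>One level of the propagation\<close>

definition level :: "(nat \<Rightarrow> nat) \<Rightarrow> (nat \<Rightarrow> node option) \<Rightarrow> nat \<Rightarrow> nat set" where
  "level lv nt i = {p \<in> live nt. lv p = i}"

lemma live_ex: "p \<in> live nt \<Longrightarrow> \<exists>r. nt p = Some r"
  by (auto simp: live_def)

lemma foreach_orphan_runs:
  "runs (foreach ks orphan A) m (\<lambda>A' t m'. t \<le> 4 * length ks + 1 \<and> m' = m\<lparr>ntab := ntab m'\<rparr> \<and>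
     live (ntab m') = live (ntab m) \<and> (\<forall>q\<in>live (ntab m). same_node (ntab m) (ntab m') q) \<and>
     (\<forall>q\<in>live (ntab m). pa (ntab m') q = (if q \<in> set ks then None else pa (ntab m) q)) \<and>
     A' = rev (filter (\<lambda>c. c \<in> live (ntab m)) ks) @ A)"
proof (induction ks arbitrary: A m)
  case Nil
  then show ?case by (simp add: runs_simps same_node_def)
next
  case (Cons c ks)
  show ?case
  proof (cases "c \<in> live (ntab m)")
    case False
    then have nc: "ntab m c = None" by (auto simp: live_def)
    show ?thesis
      apply (simp add: runs_simps orphan_def[of c A] nc False)
      apply (rule runs_mono[OF Cons.IH])
      using False by auto
  next
    case True
    then obtain r where r: "ntab m c = Some r" using live_ex by blast
    define nt where "nt = (ntab m)(c \<mapsto> r\<lparr>parent := None\<rparr>)"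
    have sm: "same_node (ntab m) nt q" for q using view_mem[OF r] by (simp add: same_node_def nt_def)
    have pa: "pa nt q = (if q = c then None else pa (ntab m) q)" for q by (simp add: nt_def)
    have lv: "live nt = live (ntab m)" using True by (auto simp: nt_def)
    show ?thesis
      apply (simp add: runs_simps orphan_def[of c A] r True nt_def[symmetric])
      apply (rule runs_mono[OF Cons.IH])
      using True sm by (auto simp: same_node_def lv pa)
  qed
qed

section \<open>Deleting the marked clusters\<close>

context arena
begin

text \<open>Entries may be dead, hence \<open>q < nc\<close> instead of liveness. The bound
  \<open>j \<le> H\<close>, claimed only for nonempty \<open>K\<close>, limits the number of levels
  visited.\<close>

definition dirty where
  "dirty lv nc j K \<longleftrightarrow> (\<forall>q\<in>set K. lv q = j \<and> q < nc \<and> j \<le> H)"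

text \<open>Ties the deletions to the region. The intersection with \<open>R\<close> is taken
  because a child may be the removed leaf of a vertex that is no longer regular.\<close>

definition covered_kid where
  "covered_kid L nt K U \<longleftrightarrow> (\<forall>q\<in>set K \<inter> live nt. \<exists>c\<in>set (kd nt q). L c \<inter> R \<subseteq> U)"

definition sides_ok where
  "sides_ok i k B lv L nt \<longleftrightarrow> (\<forall>p\<in>live nt. lv p \<le> i \<longrightarrow> strong lv L nt p) \<and>
     (\<forall>p\<in>live nt. i < lv p \<longrightarrow> ok k lv L p \<longrightarrow> p \<notin> B \<longrightarrow> weak lv L nt B p)"

text \<open>All clusters touched at a level lie in the region \<open>U\<close>.  Since \<open>U\<close> has at most four outgoing edges, it
  meets only boundedly many further clusters when it is enlarged by its neighbours; passing to
  the next level then reduces the number of clusters again to the initial bound.\<close>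

definition zone where
  "zone L N U n \<longleftrightarrow> Ch \<inter> R \<subseteq> U \<and> U \<subseteq> R \<and> (\<forall>p\<in>N. L p \<subseteq> U \<or> L p \<inter> U = {}) \<and> card (out E U) \<le> 4 \<and>
     card {p \<in> N. L p \<inter> U \<noteq> {}} \<le> n \<and> theta U"

text \<open>The loop invariant of the propagation, with loop state \<open>A\<close> and
  \<open>K\<close>. The bound 26 is reproduced by \<open>settled_zone\<close>; the last conjunct is
  the decay of the links by 2/3 per level, written without division.\<close>

definition stage where
  "stage i A K lv L U nt nc tt tc \<longleftrightarrow>
     core (Suc i) lv L nt nc (set A) (set K) U tt tc \<and> sides_ok i (Suc i) {} lv L nt \<and>
     dirty lv nc (Suc i) K \<and> covered_kid L nt K U \<and>
     (\<forall>q\<in>live nt. lv q = Suc i \<longrightarrow> L q \<inter> Ch \<noteq> {} \<longrightarrow> q \<in> set K) \<and>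
     distinct A \<and> (\<forall>p\<in>set A. p \<in> live nt \<and> lv p = i \<and> pa nt p = None \<and> L p \<subseteq> U) \<and>
     zone L (level lv nt i) U 26 \<and>
     card (links E L (level lv nt i)) * 3 ^ i \<le> 2 ^ i * card {(x, y). x \<in> R \<and> y \<in> R \<and> {x, y} \<in> E}"

text \<open>\<open>Krem\<close> are the deletions still to be made, \<open>K\<close> those ordered
  for the next level. A deletion removes one node and orders at most one more, hence the last
  conjunct, which makes the number of nodes usable as a potential.\<close>

definition phase1 where
  "phase1 i U N n0 Krem A K lv L nt nc tt tc \<longleftrightarrow>
     core (Suc i) lv L nt nc (set A) (set Krem \<union> set K) (grow E L N U) tt tc \<and> sides_ok i (Suc i) {} lv L nt \<and>
     (\<forall>q\<in>set Krem. lv q = Suc i) \<and> covered_kid L nt Krem U \<and>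
     dirty lv nc (Suc (Suc i)) K \<and> covered_kid L nt K (grow E L N U) \<and>
     (\<forall>q\<in>live nt. lv q = Suc i \<longrightarrow> L q \<inter> Ch \<noteq> {} \<longrightarrow> q \<in> set Krem) \<and>
     distinct A \<and> (\<forall>p\<in>set A. p \<in> live nt \<and> lv p = i \<and> pa nt p = None \<and> L p \<subseteq> grow E L N U) \<and>
     level lv nt i = N \<and> length K + card (live nt) \<le> n0"

text \<open>The two children of a pair are adjacent, so if one is covered by \<open>U\<close>, the
  other lies in \<open>U\<close> or next to it. If the connecting edge starts at a vertex that is no
  longer regular, \<open>ChE\<close> puts its other end into \<open>Ch\<close> and thus into
  \<open>U\<close>.\<close>

lemma kid_in_grow:
  assumes b: "base lv L nt nc" and ct: "contents (Suc i) lv L nt" and N: "level lv nt i = N"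
    and z: "zone L N U n" and p: "p \<in> live nt" "lv p = Suc i" and k: "\<exists>c\<in>set (kd nt p). L c \<inter> R \<subseteq> U"
    and d: "d \<in> set (kd nt p)" "d \<in> live nt"
  shows "L d \<subseteq> grow E L N U"
proof -
  have lvd: "lv d = i" using shape_kid[OF baseD(4)[OF b p(1)] d(1)] p by simp
  have dN: "d \<in> N" using N d lvd by (auto simp: level_def)
  have dR: "L d \<subseteq> R" using ct d lvd by (simp add: contents_def ok_def)
  have sat: "L d \<subseteq> U \<or> L d \<inter> U = {}" using z dN by (simp add: zone_def)
  have Usub: "U \<subseteq> grow E L N U" by (auto simp: grow_def)
  have edge: "L d \<subseteq> grow E L N U" if c: "L c \<inter> R \<subseteq> U" "L c \<subseteq> L p" and xy: "x \<in> L c" "y \<in> L d" "{x, y} \<in> E" for c x y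
  proof (cases "L d \<inter> U = {}")
    case False then show ?thesis using sat Usub by blast
  next
    case True
    have "x \<in> R"
    proof (rule ccontr)
      assume "x \<notin> R"
      then have "x \<in> Rx - R" using c xy baseD(7)[OF b p(1)] by blast
      then have "y \<in> Ch" using ChE xy dR by blast
      then show False using True z dR xy unfolding zone_def by blast
    qed
    then have "x \<in> U" using c xy by blast
    then have "near E U (L d)" using True xy unfolding near_def by blast
    then show ?thesis using dN unfolding grow_def by blast
  qed
  from baseD(4)[OF b p(1), unfolded shape_def] p(2)
  consider (one) c where "kd nt p = [c]" | (two) c e x y where "kd nt p = [c, e]" "L p = L c \<union> L e" "x \<in> L c" "y \<in> L e" "{x, y} \<in> E"
    by (elim disjE exE conjE) auto
  then show ?thesis
  proof cases
    case one
    then show ?thesis using k d dR Usub by auto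
  next
    case two
    have "{y, x} \<in> E" using two by (simp add: insert_commute)
    show ?thesis
    proof (cases "L d \<inter> R \<subseteq> U")
      case True then show ?thesis using dR Usub by blast
    next
      case False
      then consider "d = c" "L e \<inter> R \<subseteq> U" | "d = e" "L c \<inter> R \<subseteq> U" using d k two by auto
      then show ?thesis
      proof cases
        case 1 then show ?thesis using edge[of e y x] two \<open>{y, x} \<in> E\<close> by auto
      next
        case 2 then show ?thesis using edge[of c x y] two by auto
      qed
    qed
  qed
qed

text \<open>Weak sides suffice: even \<open>wrep\<close> never takes a regular end for a singular
  one.\<close>

lemma closed_root:
  assumes sd: "sd nt p = ((Singular u, a), (Singular v, b))" and s: "strong lv L nt p \<or> weak lv L nt B p"
  shows "\<forall>x\<in>L p. \<forall>y\<in>R. {x, y} \<in> E \<longrightarrow> y \<in> L p"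
proof (intro ballI impI, rule ccontr)
  fix x y assume "x \<in> L p" "y \<in> R" "{x, y} \<in> E" "y \<notin> L p"
  then have "(x, y) \<in> out E (L p)" by (auto simp: out_def)
  moreover have "sok (\<lambda>d s. (case fst s of Singular u \<Rightarrow> snd d \<notin> R | Cluster q \<Rightarrow> True)) (L p) (sd nt p)"
    using s
  proof
    assume "strong lv L nt p"
    then show ?thesis unfolding strong_def
      by (rule sok_mono) (auto simp: srep_def split: nbr.splits)
  next
    assume "weak lv L nt B p"
    then show ?thesis unfolding weak_def
      by (rule sok_mono) (auto simp: wrep_def split: nbr.splits)
  qed
  ultimately have "y \<notin> R" using sd sok_dart[of _ "L p" "sd nt p" "(x, y)"] by fastforce
  then show False using \<open>y \<in> R\<close> by simp
qed

lemma shape_kid_nonempty: "shape lv L ks p \<Longrightarrow> L p \<noteq> {} \<Longrightarrow> c \<in> set ks \<Longrightarrow> L c \<noteq> {}"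
  unfolding shape_def by (elim disjE exE conjE) auto

lemma shape_distinct: "shape lv L ks p \<Longrightarrow> distinct ks"
  unfolding shape_def by (elim disjE exE conjE) auto

lemma shape_length: "shape lv L ks p \<Longrightarrow> length ks \<le> 2"
  unfolding shape_def by (elim disjE exE conjE) auto

text \<open>An own root of this level avoids \<open>Ch\<close> and is closed in \<open>R\<close>, so
  by \<open>theta\<close> it misses the region. A cluster to be deleted has a nonempty child covered
  by the region.\<close>

lemma phase1_not_own:
  assumes P: "phase1 i U N n0 (p # Krem) A K lv L nt nc tt tc" and z: "zone L N U n" and p: "p \<in> live nt"
  shows "p \<notin> own (Suc i) lv L nt (set A)"
proof
  assume o: "p \<in> own (Suc i) lv L nt (set A)"
  have core: "core (Suc i) lv L nt nc (set A) (set (p # Krem) \<union> set K) (grow E L N U) tt tc"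
    and so: "sides_ok i (Suc i) {} lv L nt" and lvp: "lv p = Suc i" and cov: "covered_kid L nt (p # Krem) U"
    using P by (auto simp: phase1_def)
  have b: "base lv L nt nc" and ct: "contents (Suc i) lv L nt" and r: "roots (Suc i) lv L nt (set A) tt tc"
    using core by (auto simp: core_def)
  have okp: "ok (Suc i) lv L p" using o by (simp add: own_def)
  then have unt: "L p \<inter> Ch = {}" using lvp by (simp add: ok_def)
  have LR: "L p \<subseteq> R" using ct okp p by (simp add: contents_def)
  have "weak lv L nt {} p" using so p okp lvp by (simp add: sides_ok_def)
  moreover obtain u a v b where "sd nt p = ((Singular u, a), (Singular v, b))"
    using r o unfolding roots_def is_root_def by blast
  ultimately have "\<forall>x\<in>L p. \<forall>y\<in>R. {x, y} \<in> E \<longrightarrow> y \<in> L p" using closed_root by blast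
  then have "L p \<inter> U = {}" using z LR unt unfolding zone_def theta_def by blast
  moreover obtain c where c: "c \<in> set (kd nt p)" "L c \<inter> R \<subseteq> U" using cov p unfolding covered_kid_def by auto
  moreover have "L c \<noteq> {}" "L c \<subseteq> L p"
    using shape_kid_nonempty[OF baseD(4)[OF b p] baseD(6)[OF b p] c(1)] shape_kid[OF baseD(4)[OF b p] c(1)] by auto
  ultimately show False using LR by blast
qed

lemma sides_ok_cong:
  assumes "sides_ok i k B lv L nt" "\<And>q. q \<in> live nt' \<Longrightarrow> q \<in> live nt \<and> sd nt' q = sd nt q"
    "\<And>q. q \<in> live nt \<Longrightarrow> lv q \<le> i \<Longrightarrow> q \<in> live nt'"
  shows "sides_ok i k B lv L nt'"
  unfolding sides_ok_def
  by (metis assms(1,2) strong_cong assms(2,3) weak_cong sides_ok_def)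

lemma phase1_step:
  assumes P: "phase1 i U N n0 (p # Krem) A K lv L nt nc tt tc" and z: "zone L N U n" and p: "p \<in> live nt"
    and dom: "live nt' = live nt - {p}"
    and same: "\<And>q. q \<in> live nt' \<Longrightarrow> same_node nt nt' q"
    and pa: "\<And>q. q \<in> live nt' \<Longrightarrow> pa nt' q = (if q \<in> set (kd nt p) then None else pa nt q)"
    and A': "A' = rev (filter (\<lambda>c. c \<in> live nt') (kd nt p)) @ A"
  shows "phase1 i U N n0 Krem A' (push_opt (pa nt p) K) lv L nt' nc tt tc"
proof -
  let ?U = "grow E L N U" and ?K = "push_opt (pa nt p) K"
  have core: "core (Suc i) lv L nt nc (set A) (set (p # Krem) \<union> set K) ?U tt tc"
    and so: "sides_ok i (Suc i) {} lv L nt" and lvp: "lv p = Suc i" and cov: "covered_kid L nt (p # Krem) U"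
    and lvK: "\<forall>q\<in>set Krem. lv q = Suc i"
    and dK: "dirty lv nc (Suc (Suc i)) K" and cK: "covered_kid L nt K ?U"
    and tch: "\<forall>q\<in>live nt. lv q = Suc i \<longrightarrow> L q \<inter> Ch \<noteq> {} \<longrightarrow> q \<in> set (p # Krem)"
    and A: "distinct A" "\<forall>p\<in>set A. p \<in> live nt \<and> lv p = i \<and> pa nt p = None \<and> L p \<subseteq> ?U"
    and N: "level lv nt i = N" and n0: "length K + card (live nt) \<le> n0"
    using P by (auto simp: phase1_def)
  have b: "base lv L nt nc" and ct: "contents (Suc i) lv L nt" and ko: "kids_ok L nt (set (p # Krem) \<union> set K) ?U"
    using core by (auto simp: core_def)
  note sh = baseD(4)[OF b p]
  have ps: "set ?K = set K \<union> set_option (pa nt p)" by (auto simp: push_opt_def split: option.splits)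
  have kp: "p \<notin> set (kd nt p)" using shape_kid(1)[OF sh] lvp by auto
  have kids: "kd nt p \<noteq> []" using sh lvp unfolding shape_def by auto
  have kidc: "\<exists>c\<in>set (kd nt p). L c \<inter> R \<subseteq> U" using cov p by (auto simp: covered_kid_def)
  have kidU: "L d \<subseteq> ?U" if "d \<in> set (kd nt p)" "d \<in> live nt" for d
    by (rule kid_in_grow[OF b ct N z p lvp kidc that])
  have LpU: "L p \<inter> R \<subseteq> ?U"
  using kidU ko p by (auto simp: kids_ok_def shape_Union[OF sh kids])
  have sA': "set A' = set A \<union> (set (kd nt p) \<inter> live nt)"
    unfolding A' using dom kp by auto
  have core': "core (Suc i) lv L nt' nc (set A') (set Krem \<union> set ?K) ?U tt tc"
    by (rule core_delete[OF core p _ dom same pa phase1_not_own[OF P z p] subset_refl LpU])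
      (use ps sA' lvp in auto)
  have lvk: "lv c = i" "pa nt c = Some p" if "c \<in> set (kd nt p)" "c \<in> live nt" for c
    using shape_kid(1)[OF sh that(1)] lvp baseD(11)[OF b p that] by auto
  have so': "sides_ok i (Suc i) {} lv L nt'"
    by (rule sides_ok_cong[OF so]) (use dom same lvp in \<open>auto simp: same_node_def\<close>)
  have kd': "kd nt' q = kd nt q" if "q \<in> live nt'" for q using same[OF that] by (simp add: same_node_def)
  have sub: "live nt' \<subseteq> live nt" using dom by auto
  have cov': "covered_kid L nt' Krem U" using cov sub kd' unfolding covered_kid_def by auto
  have dK': "dirty lv nc (Suc (Suc i)) ?K"
  using base_pa_lv[OF b p] lvp baseD(9)[OF b p] baseD(2,5)[OF b] dK ps by (fastforce simp: dirty_def)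
  have cK': "covered_kid L nt' ?K ?U"
    unfolding covered_kid_def
  using baseD(10)[OF b p] kd' LpU ps sub cK by (auto simp: covered_kid_def)
  have "set (kd nt p) \<inter> set A = {}" using A(2) lvk(2) by (metis disjoint_iff option.distinct(1))
  then have dA: "distinct A'" unfolding A' using A(1) shape_distinct[OF sh] by auto
  have A2: "\<forall>q\<in>set A'. q \<in> live nt' \<and> lv q = i \<and> pa nt' q = None \<and> L q \<subseteq> ?U"
  using sA' lvk kidU dom lvp pa A(2) by fastforce
  have N': "level lv nt' i = N" unfolding N[symmetric] level_def dom using lvp by auto
  have "card (live nt') = card (live nt) - 1" "card (live nt) \<ge> 1"
    using dom p baseD(1)[OF b] by (auto simp: Suc_le_eq card_gt_0_iff)
  moreover have "length ?K \<le> Suc (length K)" by (auto simp: push_opt_def split: option.splits)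
  ultimately have n0': "length ?K + card (live nt') \<le> n0" using n0 by linarith
  have tch': "\<forall>q\<in>live nt'. lv q = Suc i \<longrightarrow> L q \<inter> Ch \<noteq> {} \<longrightarrow> q \<in> set Krem" using tch dom by auto
  show ?thesis unfolding phase1_def
    using core' so' lvK cov' dK' cK' tch' dA A2 N' n0' by blast
qed

text \<open>A cluster may have been ordered for deletion twice, once for each child; the second time
  it is dead.\<close>

lemma phase1_skip:
  assumes P: "phase1 i U N n0 (p # Krem) A K lv L nt nc tt tc" and p: "p \<notin> live nt"
  shows "phase1 i U N n0 Krem A K lv L nt nc tt tc"
  using P core_mono p by (fastforce simp: phase1_def covered_kid_def)

text \<open>The 12 units: three accesses to the cluster, and a loop over at most two children that
  costs 4 for each and 1 for its exit.\<close>

lemma delete_cluster_runs: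
  assumes P: "phase1 i U N n0 (p # Krem) A K lv L (ntab m) nc tt tc" and z: "zone L N U n"
  shows "runs (delete_cluster p (A, K)) m (\<lambda>s t m'. t \<le> 12 \<and> m' = m\<lparr>ntab := ntab m'\<rparr> \<and>
     phase1 i U N n0 Krem (fst s) (snd s) lv L (ntab m') nc tt tc)"
proof (cases "p \<in> live (ntab m)")
  case False
  then have "ntab m p = None" by (auto simp: live_def)
  then show ?thesis using phase1_skip[OF P False] by (simp add: delete_cluster_def runs_simps)
next
  case True
  then obtain r where r: "ntab m p = Some r" using live_ex by blast
  let ?m = "m\<lparr>ntab := (ntab m)(p := None)\<rparr>"
  have b: "base lv L (ntab m) nc" and lvp: "lv p = Suc i" using P by (auto simp: phase1_def core_def)
  note sh = baseD(4)[OF b True]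
  have kr: "kids r = kd (ntab m) p" "parent r = pa (ntab m) p" using view_mem[OF r] by auto
  have kp: "p \<notin> set (kd (ntab m) p)" using shape_kid(1)[OF sh] lvp by auto
  have len: "length (kd (ntab m) p) \<le> 2" by (rule shape_length[OF sh])
  have flt: "filter (\<lambda>c. c \<in> live (ntab m) \<and> c \<noteq> p) (kd (ntab m) p) = filter (\<lambda>c. c \<in> live (ntab m) - {p}) (kd (ntab m) p)"
    by simp
  show ?thesis
    apply (simp add: delete_cluster_def runs_simps r kr)
    apply (rule runs_mono[OF foreach_orphan_runs])
    apply (elim conjE)
    subgoal for A' t m'
    proof -
      assume a: "t \<le> 4 * length (kd (ntab m) p) + 1" "m' = ?m\<lparr>ntab := ntab m'\<rparr>" "live (ntab m') = live (ntab ?m)"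
        "\<forall>q\<in>live (ntab ?m). same_node (ntab ?m) (ntab m') q"
        "\<forall>q\<in>live (ntab ?m). pa (ntab m') q = (if q \<in> set (kd (ntab m) p) then None else pa (ntab ?m) q)"
        "A' = rev (filter (\<lambda>c. c \<in> live (ntab ?m)) (kd (ntab m) p)) @ A"
      have l: "live (ntab m') = live (ntab m) - {p}" using a(3) by simp
      have "phase1 i U N n0 Krem A' (push_opt (pa (ntab m) p) K) lv L (ntab m') nc tt tc"
        by (rule phase1_step[OF P z True l]) (use a l in \<open>auto simp: same_node_def\<close>)
      moreover have "m' = m\<lparr>ntab := ntab m'\<rparr>" using a(2) by simp
      ultimately show ?thesis using a(1) len by simp
    qed
    done
qed

lemma phase1_runs:
  assumes S: "stage i A K lv L U (ntab m) nc tt tc"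
  shows "runs (foreach K delete_cluster (A, [])) m (\<lambda>s t m'. t \<le> 13 * length K + 1 \<and> m' = m\<lparr>ntab := ntab m'\<rparr> \<and>
     phase1 i U (level lv (ntab m) i) (card (live (ntab m))) [] (fst s) (snd s) lv L (ntab m') nc tt tc)"
proof -
  let ?N = "level lv (ntab m) i" and ?n = "card (live (ntab m))"
  have z: "zone L ?N U 26" using S by (simp add: stage_def)
  have sub: "U \<subseteq> grow E L ?N U" by (auto simp: grow_def)
  have "core (Suc i) lv L (ntab m) nc (set A) (set K \<union> set []) (grow E L ?N U) tt tc"
    by (rule core_mono[of _ _ _ _ _ _ "set K" U]) (use S sub in \<open>auto simp: stage_def\<close>)
  then have P: "phase1 i U ?N ?n K A [] lv L (ntab m) nc tt tc"
    using S subset_trans[OF _ sub] unfolding phase1_def stage_def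
    by (simp add: dirty_def covered_kid_def)
  have "runs (foreach K delete_cluster (A, [])) m (\<lambda>s t m'. t \<le> (12 + 1) * length K + 1 \<and>
     (m' = m\<lparr>ntab := ntab m'\<rparr> \<and> phase1 i U ?N ?n [] (fst s) (snd s) lv L (ntab m') nc tt tc))"
  proof (rule runs_foreach[where I = "\<lambda>Kr s m'. m' = m\<lparr>ntab := ntab m'\<rparr> \<and> phase1 i U ?N ?n Kr (fst s) (snd s) lv L (ntab m') nc tt tc"])
    fix p Kr s m' assume a: "m' = m\<lparr>ntab := ntab m'\<rparr> \<and> phase1 i U ?N ?n (p # Kr) (fst s) (snd s) lv L (ntab m') nc tt tc"
    obtain A1 K1 where s: "s = (A1, K1)" by (cases s)
    have P': "phase1 i U ?N ?n (p # Kr) A1 K1 lv L (ntab m') nc tt tc" using a s by simp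
    show "runs (delete_cluster p s) m' (\<lambda>s' t m''. t \<le> 12 \<and> m'' = m\<lparr>ntab := ntab m''\<rparr> \<and>
        phase1 i U ?N ?n Kr (fst s') (snd s') lv L (ntab m'') nc tt tc)"
      unfolding s
    proof (rule runs_mono[OF delete_cluster_runs[OF P' z]], elim conjE, intro conjI)
      fix t and m'' :: mem assume e: "m'' = m'\<lparr>ntab := ntab m''\<rparr>"
      have "m'\<lparr>ntab := ntab m''\<rparr> = m\<lparr>ntab := ntab m''\<rparr>" using a by (metis mem.update_convs(3) mem.surjective)
      then show "m'' = m\<lparr>ntab := ntab m''\<rparr>" using e by simp
    qed
  next
    show "m = m\<lparr>ntab := ntab m\<rparr> \<and> phase1 i U ?N ?n K (fst (A, [])) (snd (A, [])) lv L (ntab m) nc tt tc" using P by simp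
  qed
  then show ?thesis by simp
qed

end


definition frame :: "mem \<Rightarrow> mem \<Rightarrow> bool" where
  "frame m m' \<longleftrightarrow> vtab m' = vtab m \<and> etab m' = etab m \<and> ecnt m' = ecnt m"

lemma set_push_opt: "set (push_opt x xs) = set_option x \<union> set xs"
  by (auto simp: push_opt_def split: option.splits)

lemma length_push_opt: "length (push_opt x xs) \<le> Suc (length xs)"
  by (auto simp: push_opt_def split: option.splits)

lemma linksI: "{x, y} \<in> E \<Longrightarrow> p \<in> N \<Longrightarrow> q \<in> N \<Longrightarrow> p \<noteq> q \<Longrightarrow> x \<in> L p \<Longrightarrow> y \<in> L q \<Longrightarrow> (x, y) \<in> links E L N"
  by (auto simp: links_def)

section \<open>Giving the orphans new parents\<close>

context arena
begin

text \<open>\<open>U1\<close> contains the orphans, \<open>U2\<close> also all clusters next to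
  them, which is everything that \<open>place\<close> can touch. As long as there are links the
  level is below \<open>H\<close>, so that new parents respect the height bound.\<close>

definition surround where
  "surround i U1 U2 N L0 \<longleftrightarrow> U1 \<subseteq> U2 \<and> U2 \<subseteq> R \<and>
     (\<forall>d\<in>N. \<forall>x\<in>U1. \<forall>y\<in>L0 d. {x, y} \<in> E \<longrightarrow> L0 d \<subseteq> U2) \<and> (links E L0 N \<noteq> {} \<longrightarrow> i < H)"

text \<open>Ensures that \<open>find_mate\<close> never dissolves a cluster made in the same round:
  the only child of a new cluster is not adjacent to an orphan, except possibly to the mate in
  \<open>X\<close> that is just being moved.\<close>

definition lonely_ok where
  "lonely_ok i X B lv L nt \<longleftrightarrow> (\<forall>p\<in>set B. \<forall>c. kd nt p = [c] \<longrightarrow> (\<forall>d\<in>live nt. lv d = i \<longrightarrow> d \<noteq> c \<longrightarrow>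
      (\<exists>x\<in>L c. \<exists>y\<in>L d. {x, y} \<in> E) \<longrightarrow> pa nt d \<noteq> None \<or> d \<in> X))"

text \<open>\<open>X\<close> contains the mate whose parent has been freed, until
  \<open>new_pair\<close> gives it a new one. The index \<open>k\<close> is already
  \<open>i + 2\<close>, since after the deletions no old cluster of level \<open>i + 1\<close> meets
  \<open>Ch\<close>. \<open>L0\<close> keeps the vertex sets of level \<open>i\<close> fixed while
  \<open>L\<close> is extended by new nodes.\<close>

definition phase2 where
  "phase2 i U1 U2 N L0 a n0 X Ar B K lv L nt nc tt tc \<longleftrightarrow>
     core (Suc (Suc i)) lv L nt nc (set Ar \<union> set B \<union> X) (set K) U2 tt tc \<and>
     sides_ok i (Suc (Suc i)) (set B) lv L nt \<and>
     dirty lv nc (Suc (Suc i)) K \<and> covered_kid L nt K U2 \<and>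
     (\<forall>q\<in>live nt. lv q = Suc (Suc i) \<longrightarrow> L q \<inter> Ch \<noteq> {} \<longrightarrow> q \<in> set K) \<and>
     distinct Ar \<and> (\<forall>p\<in>set Ar. p \<in> live nt \<and> lv p = i \<and> L p \<subseteq> U1) \<and>
     distinct B \<and> (\<forall>p\<in>set B. p \<in> live nt \<and> lv p = Suc i \<and> pa nt p = None \<and> L p \<subseteq> U2) \<and>
     lonely_ok i X B lv L nt \<and>
     level lv nt i = N \<and> (\<forall>p\<in>N. L p = L0 p) \<and>
     length B + length Ar \<le> a \<and> length K + card (live nt) \<le> n0 + length B"

lemma phase2D:
  assumes "phase2 i U1 U2 N L0 a n0 X Ar B K lv L nt nc tt tc"
  shows "core (Suc (Suc i)) lv L nt nc (set Ar \<union> set B \<union> X) (set K) U2 tt tc"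
    "sides_ok i (Suc (Suc i)) (set B) lv L nt"
    "dirty lv nc (Suc (Suc i)) K" "covered_kid L nt K U2"
    "\<forall>q\<in>live nt. lv q = Suc (Suc i) \<longrightarrow> L q \<inter> Ch \<noteq> {} \<longrightarrow> q \<in> set K"
    "distinct Ar" "\<forall>p\<in>set Ar. p \<in> live nt \<and> lv p = i \<and> L p \<subseteq> U1"
    "distinct B" "\<forall>p\<in>set B. p \<in> live nt \<and> lv p = Suc i \<and> pa nt p = None \<and> L p \<subseteq> U2"
    "lonely_ok i X B lv L nt" "level lv nt i = N" "\<forall>p\<in>N. L p = L0 p"
    "length B + length Ar \<le> a" "length K + card (live nt) \<le> n0 + length B"
    "base lv L nt nc" "contents (Suc (Suc i)) lv L nt" "roots (Suc (Suc i)) lv L nt (set Ar \<union> set B \<union> X) tt tc"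
    "kids_ok L nt (set K) U2"
    "\<And>p. p \<in> live nt \<Longrightarrow> lv p \<le> Suc i \<Longrightarrow> L p \<subseteq> R \<and> conn E (L p) \<and> ww nt p = inner (L p)"
    "\<And>p. p \<in> live nt \<Longrightarrow> lv p \<le> i \<Longrightarrow> strong lv L nt p"
    "\<And>q. q \<in> live nt \<Longrightarrow> lv q = Suc i \<Longrightarrow> set (kd nt q) \<subseteq> live nt"
proof -
  show c: "core (Suc (Suc i)) lv L nt nc (set Ar \<union> set B \<union> X) (set K) U2 tt tc"
    and so: "sides_ok i (Suc (Suc i)) (set B) lv L nt" and d: "dirty lv nc (Suc (Suc i)) K"
    and "covered_kid L nt K U2"
    "\<forall>q\<in>live nt. lv q = Suc (Suc i) \<longrightarrow> L q \<inter> Ch \<noteq> {} \<longrightarrow> q \<in> set K"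
    "distinct Ar" "\<forall>p\<in>set Ar. p \<in> live nt \<and> lv p = i \<and> L p \<subseteq> U1"
    "distinct B" "\<forall>p\<in>set B. p \<in> live nt \<and> lv p = Suc i \<and> pa nt p = None \<and> L p \<subseteq> U2"
    "lonely_ok i X B lv L nt" "level lv nt i = N" "\<forall>p\<in>N. L p = L0 p"
    "length B + length Ar \<le> a" "length K + card (live nt) \<le> n0 + length B"
    using assms unfolding phase2_def by simp_all
  show "base lv L nt nc" and ct: "contents (Suc (Suc i)) lv L nt" and
    "roots (Suc (Suc i)) lv L nt (set Ar \<union> set B \<union> X) tt tc" and ko: "kids_ok L nt (set K) U2"
    using c by (simp_all add: core_def)
  show "L p \<subseteq> R \<and> conn E (L p) \<and> ww nt p = inner (L p)" if "p \<in> live nt" "lv p \<le> Suc i" for p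
    using ct that by (simp add: contents_def ok_def)
  show "strong lv L nt p" if "p \<in> live nt" "lv p \<le> i" for p using so that by (simp add: sides_ok_def)
  show "set (kd nt q) \<subseteq> live nt" if "q \<in> live nt" "lv q = Suc i" for q
  proof -
    have "q \<notin> set K" using d that by (auto simp: dirty_def)
    then show ?thesis using ko that by (auto simp: kids_ok_def)
  qed
qed

text \<open>Own roots are closed in \<open>R\<close>, which is known even while their sides are only
  weak. So neither adopting a neighbour of an orphan nor dissolving its parent affects a topological
  edge.\<close>

lemma adjacent_not_own:
  assumes P: "phase2 i U1 U2 N L0 a n0 X Ar B K lv L nt nc tt tc"
    and q: "q \<in> live nt" "lv q \<le> Suc i" "q \<notin> set B" and y: "y \<in> L q" "x \<in> R" "x \<notin> L q" "{y, x} \<in> E"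
  shows "q \<notin> own (Suc (Suc i)) lv L nt (set Ar \<union> set B \<union> X)"
proof
  assume o: "q \<in> own (Suc (Suc i)) lv L nt (set Ar \<union> set B \<union> X)"
  obtain u a v b where sd: "sd nt q = ((Singular u, a), (Singular v, b))"
    using phase2D(17)[OF P] o unfolding roots_def is_root_def by blast
  have "strong lv L nt q \<or> weak lv L nt (set B) q"
  using phase2D(2)[OF P] q by (auto simp: sides_ok_def ok_def)
  then have "\<forall>x\<in>L q. \<forall>y\<in>R. {x, y} \<in> E \<longrightarrow> y \<in> L q" by (rule closed_root[OF sd])
  then show False using y by blast
qed

lemma phase2_detach:
  assumes P: "phase2 i U1 U2 N L0 a n0 {} (n # Ar) B K lv L nt nc tt tc" and S: "surround i U1 U2 N L0"
    and n: "pa nt n = None" and c: "c \<in> live nt" "lv c = i" "c \<noteq> n" "pa nt c = Some p" "kd nt p = [c]"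
    and xy: "x \<in> L n" "y \<in> L c" "{x, y} \<in> E"
    and dom: "live nt' = live nt - {p}" and same: "\<And>q. q \<in> live nt' \<Longrightarrow> same_node nt nt' q"
    and pa: "\<And>q. q \<in> live nt' \<Longrightarrow> pa nt' q = (if q = c then None else pa nt q)"
  shows "phase2 i U1 U2 N L0 a n0 {c} (n # Ar) B (push_opt (pa nt p) K) lv L nt' nc tt tc"
proof -
  let ?K = "push_opt (pa nt p) K"
  note D = phase2D[OF P]
  have b: "base lv L nt nc" by (rule D(15))
  have p: "p \<in> live nt" "lv p = Suc i" "L p = L c"
    using baseD(9)[OF b c(1,4)] base_pa_lv[OF b c(1,4)] c baseD(4)[OF b baseD(9)[OF b c(1,4)]]
    unfolding shape_def by auto
  have nl: "n \<in> live nt" "lv n = i" "L n \<subseteq> U1" using D(7) by auto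
  have nR: "L n \<subseteq> R" using D(19)[OF nl(1)] nl by simp
  have disj: "L n \<inter> L c = {}" using baseD(8)[OF b nl(1) c(1)] nl c by auto
  have yx: "{y, x} \<in> E" using xy by (simp add: insert_commute)
  \<comment> \<open>\<open>n\<close> is parentless and adjacent to the only child of
    \<open>p\<close>; \<open>lonely_ok\<close> excludes this for a new cluster.\<close>
  have pB: "p \<notin> set B"
  proof
    assume "p \<in> set B"
    then have "pa nt n \<noteq> None \<or> n \<in> {}"
      using D(10) c nl xy yx unfolding lonely_ok_def by blast
    then show False using n by simp
  qed
  have nown: "p \<notin> own (Suc (Suc i)) lv L nt (set (n # Ar) \<union> set B \<union> {})"
    by (rule adjacent_not_own[OF P p(1) _ pB, of y x]) (use p xy yx disj nR in auto)
  have cN: "c \<in> N" using D(11) c by (auto simp: level_def)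
  have cU: "L c \<subseteq> U2" using S cN D(12) nl xy unfolding surround_def by (metis subsetD)
  have core': "core (Suc (Suc i)) lv L nt' nc (set (n # Ar) \<union> set B \<union> {c}) (set ?K) U2 tt tc"
    by (rule core_delete[OF D(1) p(1) _ dom same _ nown subset_refl])
      (use pa c p cU in \<open>auto simp: set_push_opt\<close>)
  have kd': "kd nt' q = kd nt q" if "q \<in> live nt'" for q using same[OF that] by (simp add: same_node_def)
  have sub: "live nt' \<subseteq> live nt" using dom by auto
  have so': "sides_ok i (Suc (Suc i)) (set B) lv L nt'"
    by (rule sides_ok_cong[OF D(2)]) (use dom same p in \<open>auto simp: same_node_def\<close>)
  have dK': "dirty lv nc (Suc (Suc i)) ?K"
  using base_pa_lv[OF b p(1)] p baseD(9)[OF b p(1)] baseD(2,5)[OF b] D(3) by (fastforce simp: dirty_def set_push_opt)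
  have cK': "covered_kid L nt' ?K U2"
    unfolding covered_kid_def
  proof
    fix q assume q: "q \<in> set ?K \<inter> live nt'"
    show "\<exists>c\<in>set (kd nt' q). L c \<inter> R \<subseteq> U2"
    proof (cases "pa nt p = Some q")
      case True
      then have "p \<in> set (kd nt q)" using baseD(10)[OF b p(1)] by blast
      then show ?thesis using q kd' cU p(3) by auto
    next
      case False
      then have "q \<in> set K \<inter> live nt" using q sub by (auto simp: set_push_opt)
      then show ?thesis using D(4) q kd' unfolding covered_kid_def by auto
    qed
  qed
  have Bl: "q \<in> live nt'" "q \<noteq> c" if "q \<in> set B" for q using D(9) that pB dom c by auto
  have B': "\<forall>p\<in>set B. p \<in> live nt' \<and> lv p = Suc i \<and> pa nt' p = None \<and> L p \<subseteq> U2"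
    using D(9) Bl pa by auto
  have lo: "lonely_ok i {c} B lv L nt'"
    unfolding lonely_ok_def
  proof (intro ballI allI impI)
    fix q e d assume q: "q \<in> set B" "kd nt' q = [e]" and d: "d \<in> live nt'" "lv d = i" "d \<noteq> e" "\<exists>x\<in>L e. \<exists>y\<in>L d. {x, y} \<in> E"
    have "kd nt q = [e]" using q kd' Bl by auto
    then have "pa nt d \<noteq> None" using D(10) q d sub unfolding lonely_ok_def by blast
    then show "pa nt' d \<noteq> None \<or> d \<in> {c}" using pa[OF d(1)] by auto
  qed
  have N': "level lv nt' i = N" unfolding D(11)[symmetric] level_def dom using p by auto
  have "card (live nt') = card (live nt) - 1" "card (live nt) \<ge> 1"
    using dom p baseD(1)[OF b] by (auto simp: Suc_le_eq card_gt_0_iff)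
  then have n0': "length ?K + card (live nt') \<le> n0 + length B"
    using D(14) length_push_opt[of "pa nt p" K] by linarith
  have Ar': "\<forall>p\<in>set (n # Ar). p \<in> live nt' \<and> lv p = i \<and> L p \<subseteq> U1" using D(7) dom p by auto
  have t': "\<forall>q\<in>live nt'. lv q = Suc (Suc i) \<longrightarrow> L q \<inter> Ch \<noteq> {} \<longrightarrow> q \<in> set ?K"
    using D(5) sub unfolding set_push_opt by blast
  show ?thesis unfolding phase2_def
    using core' so' dK' cK' t' D(6) Ar' D(8) B' lo N' D(12,13) n0' by blast
qed

text \<open>An orphan is adopted alone only if all its neighbours already have parents with other
  children as well, which is what \<open>reg\<close> asks of the new cluster. A pair needs no such
  check, since \<open>reg\<close> compares clusters with one child. By \<open>adj\<close> a cluster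
  above the leaves that gets a parent has a neighbour; this link yields
  \<open>i < H\<close>.\<close>

lemma phase2_add:
  assumes P: "phase2 i U1 U2 N L0 a n0 X (n # Ar) B K lv L nt nc tt tc" and S: "surround i U1 U2 N L0"
    and n: "pa nt n = None"
    and ks: "(ks = [n] \<and> X = {} \<and> Lp = L n \<and> wp = ww nt n \<and>
         (\<forall>d\<in>live nt. lv d = i \<longrightarrow> d \<noteq> n \<longrightarrow> (\<exists>x\<in>L n. \<exists>y\<in>L d. {x, y} \<in> E) \<longrightarrow> (\<exists>p. pa nt d = Some p \<and> kd nt p \<noteq> [d]))) \<or>
       (\<exists>c x y. ks = [n, c] \<and> c \<in> live nt \<and> lv c = i \<and> c \<noteq> n \<and> pa nt c = None \<and> x \<in> L n \<and> y \<in> L c \<and> {x, y} \<in> E \<and>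
         X \<subseteq> {c} \<and> Lp = L n \<union> L c \<and> wp = ww nt n + snd (side_to c (sd nt n)) + ww nt c)"
    and adj: "0 < i \<Longrightarrow> \<exists>d\<in>live nt. lv d = i \<and> d \<noteq> n \<and> (\<exists>x\<in>L n. \<exists>y\<in>L d. {x, y} \<in> E)"
    and dom: "live nt' = insert nc (live nt)" and same: "\<And>q. q \<in> live nt \<Longrightarrow> same_node nt nt' q"
    and pa: "\<And>q. q \<in> live nt \<Longrightarrow> pa nt' q = (if q \<in> set ks then Some nc else pa nt q)"
    and new: "pa nt' nc = None" "kd nt' nc = ks" "ww nt' nc = wp"
  shows "phase2 i U1 U2 N L0 a n0 {} Ar (nc # B) K (lv(nc := Suc i)) (L(nc := Lp)) nt' (Suc nc) tt tc"
proof -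
  let ?lv = "lv(nc := Suc i)" and ?L = "L(nc := Lp)"
  note D = phase2D[OF P]
  have b: "base lv L nt nc" by (rule D(15))
  have nl: "n \<in> live nt" "lv n = i" "L n \<subseteq> U1" using D(7) by auto
  note nR = D(19)[OF nl(1)]
  have nnc: "q \<noteq> nc" if "q \<in> live nt" for q using baseD(2)[OF b that] by simp
  have ncl: "nc \<notin> live nt" using nnc by blast
  have ksl: "d \<in> live nt \<and> pa nt d = None \<and> d \<in> set (n # Ar) \<union> set B \<union> X \<and> lv d = i" if d: "d \<in> set ks" for d
  proof (cases "d = n")
    case True then show ?thesis using nl n by simp
  next
    case False
    obtain x y where c: "d \<in> live nt" "lv d = i" "d \<noteq> n" "pa nt d = None" "x \<in> L n" "y \<in> L d" "{x, y} \<in> E"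
      using d False ks by auto
    have disj: "L d \<inter> L n = {}" using baseD(8)[OF b c(1) nl(1)] nl c by auto
    have dB: "d \<notin> set B" using D(9) c by auto
    have "d \<notin> own (Suc (Suc i)) lv L nt (set (n # Ar) \<union> set B \<union> X)"
      by (rule adjacent_not_own[OF P c(1) _ dB, of y x]) (use c disj nR nl in \<open>auto simp: insert_commute\<close>)
    then show ?thesis using c by (auto simp: own_def ok_def)
  qed
  have LpU: "Lp = \<Union>(L ` set ks)" using ks by auto
  have ksU: "L d \<subseteq> U2" if d: "d \<in> set ks" for d
  proof (cases "d = n")
    case True then show ?thesis using nl S by (auto simp: surround_def)
  next
    case False
    obtain x y where c: "d \<in> live nt" "lv d = i" "x \<in> L n" "y \<in> L d" "{x, y} \<in> E" using d False ks by auto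
    have "d \<in> N" using D(11) c by (auto simp: level_def)
    then show ?thesis using S D(12) nl c unfolding surround_def by (metis subsetD)
  qed
  have LpR: "Lp \<subseteq> U2" "Lp \<subseteq> R" using LpU ksU S by (auto simp: surround_def)
  have shape: "shape ?lv ?L ks nc" and conn: "conn E Lp" and wp: "wp = inner Lp"
  proof -
    show "shape ?lv ?L ks nc"
    proof -
      from ks consider (1) "ks = [n]" "Lp = L n" | (2) c x y where "ks = [n, c]" "c \<in> live nt" "lv c = i" "c \<noteq> n"
        "x \<in> L n" "y \<in> L c" "{x, y} \<in> E" "Lp = L n \<union> L c" by blast
      then show ?thesis
      proof cases
        case 1 then show ?thesis using nl nnc[OF nl(1)] by (auto simp: shape_def)
      next
        case 2
        have "L n \<inter> L c = {}" using baseD(8)[OF b nl(1) 2(2)] nl 2 by auto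
        then show ?thesis using 2 nl nnc[OF nl(1)] nnc[OF 2(2)] unfolding shape_def by auto
      qed
    qed
    from ks consider (1) "ks = [n]" "Lp = L n" "wp = ww nt n" | (2) c x y where "c \<in> live nt" "lv c = i" "c \<noteq> n"
      "x \<in> L n" "y \<in> L c" "{x, y} \<in> E" "Lp = L n \<union> L c" "wp = ww nt n + snd (side_to c (sd nt n)) + ww nt c" by blast
    then have "conn E Lp \<and> wp = inner Lp"
    proof cases
      case 1 then show ?thesis using nR nl by auto
    next
      case 2
      have cR: "L c \<subseteq> R \<and> conn E (L c) \<and> ww nt c = inner (L c)" using D(19)[OF 2(1)] 2 by simp
      have st: "strong lv L nt n" "strong lv L nt c" using D(20)[OF nl(1)] D(20)[OF 2(1)] nl 2 by auto
      have "n \<noteq> c" using 2 by auto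
      have nR': "L n \<subseteq> R" using nR nl by auto
      have "inner (L n \<union> L c) = inner (L n) + W {x, y} + inner (L c)" "snd (side_to c (sd nt n)) = W {x, y}"
        using pair_sides(2,3)[OF b nl(1) st(1) nR' 2(1) st(2) _ _ \<open>n \<noteq> c\<close> 2(4,5,6)] cR nl 2 by auto
      then show ?thesis using 2 nR nl cR conn_Un[of E "L n" "L c" x y] by auto
    qed
    then show "conn E Lp" "wp = inner Lp" by auto
  qed
  \<comment> \<open>A leaf gets a parent even without neighbours; here \<open>1 \<le> H\<close> is
    used.\<close>
  have ihH: "Suc i \<le> H"
  proof (cases "i = 0")
    case True then show ?thesis using H1 by simp
  next
    case False
    then obtain d x y where d: "d \<in> live nt" "lv d = i" "d \<noteq> n" "x \<in> L n" "y \<in> L d" "{x, y} \<in> E" using adj by auto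
    have "n \<in> N" "d \<in> N" using D(11) d nl by (auto simp: level_def)
    moreover have "x \<in> L0 n" "y \<in> L0 d" using d D(12) calculation by auto
    ultimately have "(x, y) \<in> links E L0 N" using d(3,6) linksI[of x y E n N d L0] by blast
    then show ?thesis using S unfolding surround_def by auto
  qed
  have rg: "{x, y} \<notin> E" if l: "length ks = 1" and q: "q \<in> live nt" "lv q = Suc i" "length (kd nt q) = 1" and xy: "x \<in> Lp" "y \<in> L q" for q x y
  using l ks q(3) D(21)[OF q(1,2)] baseD(11)[OF b q(1)] baseD(4)[OF b q(1)] q(1,2) n xy by (auto simp: shape_def)
  have core': "core (Suc (Suc i)) ?lv ?L nt' (Suc nc) (set Ar \<union> set (nc # B) \<union> {}) (set K) U2 tt tc"
    by (rule core_add[OF D(1) dom same pa new(1,2) _ ksl refl refl shape _ conn LpR(2) RRx ihH rg])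
      (use new wp ks D(3) D(21) in \<open>auto simp: dirty_def\<close>)
  have kd': "kd nt' q = kd nt q" "sd nt' q = sd nt q" if "q \<in> live nt" for q using same[OF that] by (auto simp: same_node_def)
  have so': "sides_ok i (Suc (Suc i)) (set (nc # B)) ?lv ?L nt'"
    unfolding sides_ok_def
  proof (intro conjI ballI impI)
    fix p assume p: "p \<in> live nt'" "?lv p \<le> i"
    then have pl: "p \<in> live nt" "lv p \<le> i" using dom nnc by (auto split: if_splits)
    have "strong lv L nt p" by (rule D(20)[OF pl])
    then show "strong ?lv ?L nt' p" by (rule strong_cong) (use kd' pl nnc dom in auto)
  next
    fix p assume p: "p \<in> live nt'" "i < ?lv p" "ok (Suc (Suc i)) ?lv ?L p" "p \<notin> set (nc # B)"
    then have pl: "p \<in> live nt" "i < lv p" "ok (Suc (Suc i)) lv L p" "p \<notin> set B" using dom by (auto simp: ok_def)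
    have "weak lv L nt (set B) p" using D(2) pl unfolding sides_ok_def by blast
    then show "weak ?lv ?L nt' (set (nc # B)) p" by (rule weak_cong) (use kd' pl nnc dom in auto)
  qed
  have dK': "dirty ?lv (Suc nc) (Suc (Suc i)) K" using D(3) by (auto simp: dirty_def)
  have cK': "covered_kid ?L nt' K U2"
    unfolding covered_kid_def
  proof
    fix q assume q: "q \<in> set K \<inter> live nt'"
    have "q < nc" using q D(3) by (auto simp: dirty_def)
    then have ql: "q \<in> live nt" using q dom by auto
    then obtain c where c: "c \<in> set (kd nt q)" "L c \<inter> R \<subseteq> U2" using D(4) q unfolding covered_kid_def by blast
    have "c \<noteq> nc" using baseD(3)[OF b ql c(1)] by simp
    then show "\<exists>c\<in>set (kd nt' q). ?L c \<inter> R \<subseteq> U2" using c kd'[OF ql] by auto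
  qed
  have t': "\<forall>q\<in>live nt'. ?lv q = Suc (Suc i) \<longrightarrow> ?L q \<inter> Ch \<noteq> {} \<longrightarrow> q \<in> set K"
    using D(5) dom by auto
  have Ar': "\<forall>p\<in>set Ar. p \<in> live nt' \<and> ?lv p = i \<and> ?L p \<subseteq> U1" using D(7) dom nnc by auto
  have ncB: "nc \<notin> set B" using D(9) ncl by auto
  have B': "\<forall>p\<in>set (nc # B). p \<in> live nt' \<and> ?lv p = Suc i \<and> pa nt' p = None \<and> ?L p \<subseteq> U2"
  using dom new LpR D(9) ksl pa by auto
  have lo: "lonely_ok i {} (nc # B) ?lv ?L nt'"
    unfolding lonely_ok_def
  proof (intro ballI allI impI)
    fix q e d assume q: "q \<in> set (nc # B)" "kd nt' q = [e]" and d: "d \<in> live nt'" "?lv d = i" "d \<noteq> e" "\<exists>x\<in>?L e. \<exists>y\<in>?L d. {x, y} \<in> E"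
    have dl: "d \<in> live nt" "lv d = i" "d \<noteq> nc" using d dom by (auto split: if_splits)
    have "pa nt' d \<noteq> None"
    proof (cases "q = nc")
      case True
      then have kse: "ks = [e]" using q new by simp
      then have en: "e = n" using ks by auto
      have "\<exists>x\<in>L n. \<exists>y\<in>L d. {x, y} \<in> E" using d(4) en nnc[OF nl(1)] dl by auto
      then have "pa nt d \<noteq> None" using ks kse dl d en by auto
      then show ?thesis using pa[OF dl(1)] by auto
    next
      case False
      then have qB: "q \<in> set B" "q \<in> live nt" using q D(9) by auto
      then have "kd nt q = [e]" "e \<noteq> nc" using q kd' baseD(3)[OF b qB(2), of e] by auto
      then have "pa nt d \<noteq> None \<or> d \<in> X" using D(10) qB dl d unfolding lonely_ok_def by auto
      moreover have "X \<subseteq> set ks" using ks by auto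
      ultimately show ?thesis using pa[OF dl(1)] by auto
    qed
    then show "pa nt' d \<noteq> None \<or> d \<in> {}" by simp
  qed
  have N': "level ?lv nt' i = N" unfolding D(11)[symmetric] level_def dom using nnc by auto
  have NL: "\<forall>p\<in>N. ?L p = L0 p" using D(12) D(11) nnc by (auto simp: level_def)
  have cd: "card (live nt') = Suc (card (live nt))" using dom ncl baseD(1)[OF b] by simp
  have n1: "length (nc # B) + length Ar \<le> a" "length K + card (live nt') \<le> n0 + length (nc # B)" using D(13,14) cd by auto
  show ?thesis unfolding phase2_def
    using core' so' dK' cK' t' D(6) Ar' D(8) ncB B' lo N' NL n1 by auto
qed

text \<open>The case of an orphan that has meanwhile been adopted as the mate of an earlier
  one.\<close>

lemma phase2_skip:
  assumes P: "phase2 i U1 U2 N L0 a n0 {} (n # Ar) B K lv L nt nc tt tc" and n: "pa nt n \<noteq> None"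
  shows "phase2 i U1 U2 N L0 a n0 {} Ar B K lv L nt nc tt tc"
proof -
  have own: "own (Suc (Suc i)) lv L nt (set Ar \<union> set B \<union> {}) = own (Suc (Suc i)) lv L nt (set (n # Ar) \<union> set B \<union> {})"
    using n by (auto simp: own_def)
  have "core (Suc (Suc i)) lv L nt nc (set Ar \<union> set B \<union> {}) (set K) U2 tt tc"
    using phase2D(1)[OF P] unfolding core_def roots_def own by blast
  then show ?thesis using P unfolding phase2_def by auto
qed

lemma phase2_root:
  assumes P: "phase2 i U1 U2 N L0 a n0 {} (n # Ar) B K lv L nt nc tt tc" and n: "pa nt n = None" "kd nt n \<noteq> []"
    and sdn: "sd nt n = ((Singular u, a1), (Singular v, b1))"
    and dom: "live nt' = live nt" and sm: "\<And>q. q \<in> live nt \<Longrightarrow> kd nt' q = kd nt q \<and> sd nt' q = sd nt q \<and> ww nt' q = ww nt q \<and> pa nt' q = pa nt q"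
    and te: "\<And>q. q \<in> live nt \<Longrightarrow> te nt' q = (if q = n then Some tc else te nt q)"
  shows "phase2 i U1 U2 N L0 a n0 {} Ar B K lv L nt' nc (tt(tc \<mapsto> \<lparr> tends = (u, v), twt = ww nt n + a1 + b1 \<rparr>)) (Suc tc)"
proof -
  note D = phase2D[OF P]
  have nl: "n \<in> live nt" "lv n = i" "L n \<subseteq> U1" using D(7) by auto
  have lvn: "0 < lv n" using baseD(4)[OF D(15) nl(1)] n(2) unfolding shape_def by auto
  have nB: "n \<notin> set B" using D(9) nl by auto
  have nAr: "n \<notin> set Ar" using D(6) by simp
  have TE: "t < tc" if "t \<in> TE" for t using D(17) that unfolding roots_def by blast
  have core': "core (Suc (Suc i)) lv L nt' nc (set Ar \<union> set B \<union> {}) (set K) U2 (tt(tc \<mapsto> \<lparr> tends = (u, v), twt = ww nt n + a1 + b1 \<rparr>)) (Suc tc)"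
    by (rule core_root[OF D(1) nl(1) n(1) _ lvn _ dom sm te sdn refl _ TE]) (use nl nB nAr in \<open>auto simp: ok_def\<close>)
  have so': "sides_ok i (Suc (Suc i)) (set B) lv L nt'"
    by (rule sides_ok_cong[OF D(2)]) (use dom sm in auto)
  have s: "kd nt' q = kd nt q" "pa nt' q = pa nt q" if "q \<in> live nt" for q using sm[OF that] by auto
  have cK': "covered_kid L nt' K U2" using D(4) s(1) dom unfolding covered_kid_def by auto
  have lo: "lonely_ok i {} B lv L nt'" using D(10) D(9) s dom unfolding lonely_ok_def by auto
  have B': "\<forall>p\<in>set B. p \<in> live nt' \<and> lv p = Suc i \<and> pa nt' p = None \<and> L p \<subseteq> U2" using D(9) s dom by auto
  show ?thesis unfolding phase2_def
    using core' so' cK' lo B' D(3,5,6,7,8,11,12,13,14) dom by (auto simp: level_def)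
qed

lemma find_mate_runs:
  assumes "\<And>q. fst s = Cluster q \<Longrightarrow> q \<in> live (ntab m)"
    and "\<And>q p. fst s = Cluster q \<Longrightarrow> pa (ntab m) q = Some p \<Longrightarrow> p \<in> live (ntab m)"
  shows "runs (find_mate s K) m (\<lambda>z t m'. t \<le> 3 \<and>
     ((z = (None, K) \<and> m' = m \<and> (\<forall>q. fst s = Cluster q \<longrightarrow> (\<exists>p. pa (ntab m) q = Some p \<and> kd (ntab m) p \<noteq> [q]))) \<or>
      (\<exists>q. z = (Some q, K) \<and> fst s = Cluster q \<and> m' = m \<and> pa (ntab m) q = None) \<or>
      (\<exists>q p. z = (Some q, push_opt (pa (ntab m) p) K) \<and> fst s = Cluster q \<and> pa (ntab m) q = Some p \<and> kd (ntab m) p = [q] \<and>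
         m' = m\<lparr>ntab := (ntab m)(p := None)\<rparr>)))"
proof (cases "fst s")
  case (Singular v)
  then show ?thesis by (simp add: find_mate_def runs_simps)
next
  case (Cluster q)
  obtain r where r: "ntab m q = Some r" using live_ex[OF assms(1)[OF Cluster]] by blast
  show ?thesis
  proof (cases "pa (ntab m) q")
    case None
    then show ?thesis using Cluster r view_mem(1)[OF r] by (simp add: find_mate_def runs_simps)
  next
    case (Some p)
    obtain rp where rp: "ntab m p = Some rp" using live_ex[OF assms(2)[OF Cluster Some]] by blast
    show ?thesis using Cluster Some r rp view_mem(1)[OF r] view_mem(1,2)[OF rp]
      by (auto simp: find_mate_def runs_simps)
  qed
qed

end


lemma frame_refl: "frame m m" and frame_ntab: "frame m (m\<lparr>ntab := nt\<rparr>)"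
  and frame_trans: "frame m m' \<Longrightarrow> frame m' m'' \<Longrightarrow> frame m m''"
  by (auto simp: frame_def)

text \<open>Merges the branches into which the overlapping patterns of the \<open>case\<close> in
  \<open>place\<close> are split, so that the default branch needs to be treated once.\<close>

lemma place_nonroot:
  assumes r: "ntab m n = Some r" "parent r = None"
    and nr: "\<not> (kids r \<noteq> [] \<and> (\<exists>u a v b. sides r = ((Singular u, a), (Singular v, b))))"
  shows "runs (place n (B, K)) m Q \<longleftrightarrow> runs (do {
     (q, K) \<leftarrow> find_mate (fst (sides r)) K;
     (q, K) \<leftarrow> (if q = None then find_mate (snd (sides r)) K else ret (q, K));
     p \<leftarrow> (case q of None \<Rightarrow> new_single n | Some q \<Rightarrow> new_pair n q);
     ret (p # B, K) }) m (\<lambda>x t m'. Q x (2 + t) m')"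
proof -
  obtain n1 a n2 b where s: "sides r = ((n1, a), (n2, b))" by (metis prod.collapse)
  consider (1) "kids r = []" | (2) k ks q where "kids r = k # ks" "n1 = Cluster q"
    | (3) k ks u q where "kids r = k # ks" "n1 = Singular u" "n2 = Cluster q"
    using nr s by (cases "kids r"; cases n1; cases n2) auto
  then show ?thesis
    by cases (simp_all add: place_def runs_bind[of "is_live n"] runs_bind[of "read_node n"] runs_is_live runs_read_node r s)
qed

context arena
begin

lemma place_single:
  assumes P: "phase2 i U1 U2 N L0 a n0 {} (n # Ar) B K lv L (ntab m) (ncnt m) (ttab m) (tcnt m)"
    and S: "surround i U1 U2 N L0" and n: "pa (ntab m) n = None"
    and nb: "\<forall>d\<in>live (ntab m). lv d = i \<longrightarrow> d \<noteq> n \<longrightarrow> (\<exists>x\<in>L n. \<exists>y\<in>L d. {x, y} \<in> E) \<longrightarrow> (\<exists>p. pa (ntab m) d = Some p \<and> kd (ntab m) p \<noteq> [d])"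
    and adj: "0 < i \<Longrightarrow> \<exists>d\<in>live (ntab m). lv d = i \<and> d \<noteq> n \<and> (\<exists>x\<in>L n. \<exists>y\<in>L d. {x, y} \<in> E)"
  shows "runs (new_single n) m (\<lambda>p t m'. t \<le> 5 \<and> frame m m' \<and> (\<exists>lv' L'.
     phase2 i U1 U2 N L0 a n0 {} Ar (p # B) K lv' L' (ntab m') (ncnt m') (ttab m') (tcnt m')))"
proof -
  have nl: "n \<in> live (ntab m)" using phase2D(7)[OF P] by simp
  have b: "base lv L (ntab m) (ncnt m)" by (rule phase2D(15)[OF P])
  have nn: "n \<noteq> ncnt m" using baseD(2)[OF b nl] by simp
  obtain r where r: "ntab m n = Some r" using live_ex[OF nl] by blast
  define nd where "nd = \<lparr> parent = None, kids = [n], sides = sides r, wt = wt r, top_edge = None \<rparr>"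
  define nt' where "nt' = (ntab m)(ncnt m \<mapsto> nd, n \<mapsto> r\<lparr>parent := Some (ncnt m)\<rparr>)"
  have ncl: "ncnt m \<notin> live (ntab m)" using baseD(2)[OF b] by blast
  have "phase2 i U1 U2 N L0 a n0 {} Ar (ncnt m # B) K (lv(ncnt m := Suc i)) (L(ncnt m := L n)) nt' (Suc (ncnt m)) (ttab m) (tcnt m)"
  proof (rule phase2_add[OF P S n, where ks = "[n]" and wp = "ww (ntab m) n"])
    show "live nt' = insert (ncnt m) (live (ntab m))" using nl by (auto simp: nt'_def)
    show "same_node (ntab m) nt' q" if "q \<in> live (ntab m)" for q
      using view_mem[OF r] that ncl by (auto simp: same_node_def nt'_def)
    show "pa nt' q = (if q \<in> set [n] then Some (ncnt m) else pa (ntab m) q)" if "q \<in> live (ntab m)" for q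
      using that ncl by (auto simp: nt'_def)
  qed (use nb adj nn view_mem[OF r] in \<open>auto simp: nt'_def nd_def\<close>)
  then show ?thesis
    by (auto simp: new_single_def runs_simps r frame_def nd_def[symmetric] nt'_def[symmetric])
qed

text \<open>\<open>nt\<close> is a fictitious table. When \<open>find_mate\<close> has freed the
  parent of \<open>c\<close>, the memory still holds the dangling parent pointer of
  \<open>c\<close>, while in \<open>nt\<close> it is cleared and the invariant holds.
  \<open>new_pair\<close> overwrites this pointer, so the difference vanishes.\<close>

lemma place_pair:
  assumes P: "phase2 i U1 U2 N L0 a n0 X (n # Ar) B K lv L nt (ncnt m) (ttab m) (tcnt m)"
    and S: "surround i U1 U2 N L0" and n: "pa nt n = None"
    and c: "c \<in> live nt" "lv c = i" "c \<noteq> n" "pa nt c = None" "x \<in> L n" "y \<in> L c" "{x, y} \<in> E" and X: "X \<subseteq> {c}"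
    and nt: "live (ntab m) = live nt" "\<And>q. q \<in> live nt \<Longrightarrow> same_node nt (ntab m) q" "\<And>q. q \<in> live nt \<Longrightarrow> q \<noteq> c \<Longrightarrow> pa (ntab m) q = pa nt q"
  shows "runs (new_pair n c) m (\<lambda>p t m'. t \<le> 5 \<and> frame m m' \<and> (\<exists>lv' L'.
     phase2 i U1 U2 N L0 a n0 {} Ar (p # B) K lv' L' (ntab m') (ncnt m') (ttab m') (tcnt m')))"
proof -
  have nl: "n \<in> live nt" "lv n = i" using phase2D(7)[OF P] by auto
  have b: "base lv L nt (ncnt m)" by (rule phase2D(15)[OF P])
  have nn: "n \<noteq> ncnt m" "c \<noteq> ncnt m" using baseD(2)[OF b nl(1)] baseD(2)[OF b c(1)] by auto
  obtain r where r: "ntab m n = Some r" using live_ex[of n "ntab m"] nl nt by auto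
  obtain rc where rc: "ntab m c = Some rc" using live_ex[of c "ntab m"] c nt by auto
  define nd where "nd = \<lparr> parent = None, kids = [n, c], sides = sides r, wt = wt r + snd (side_to c (sides r)) + wt rc, top_edge = None \<rparr>"
  define nt' where "nt' = (ntab m)(ncnt m \<mapsto> nd, n \<mapsto> r\<lparr>parent := Some (ncnt m)\<rparr>, c \<mapsto> rc\<lparr>parent := Some (ncnt m)\<rparr>)"
  have ncl: "ncnt m \<notin> live nt" using baseD(2)[OF b] by blast
  have vn: "sides r = sd nt n" "wt r = ww nt n" "wt rc = ww nt c"
    using view_mem[OF r] view_mem[OF rc] nt(2)[OF nl(1)] nt(2)[OF c(1)] by (auto simp: same_node_def)
  have "phase2 i U1 U2 N L0 a n0 {} Ar (ncnt m # B) K (lv(ncnt m := Suc i)) (L(ncnt m := L n \<union> L c)) nt' (Suc (ncnt m)) (ttab m) (tcnt m)"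
  proof (rule phase2_add[OF P S n, where ks = "[n, c]" and wp = "ww nt n + snd (side_to c (sd nt n)) + ww nt c"])
    show "live nt' = insert (ncnt m) (live nt)" using nl c nt by (auto simp: nt'_def)
    show "same_node nt nt' q" if "q \<in> live nt" for q
      using view_mem[OF r] view_mem[OF rc] nt(2)[OF that] that ncl by (auto simp: same_node_def nt'_def)
    show "pa nt' q = (if q \<in> set [n, c] then Some (ncnt m) else pa nt q)" if "q \<in> live nt" for q
      using that ncl nt by (auto simp: nt'_def)
    show "\<exists>d\<in>live nt. lv d = i \<and> d \<noteq> n \<and> (\<exists>x\<in>L n. \<exists>y\<in>L d. {x, y} \<in> E)" using c by blast
    show "pa nt' (ncnt m) = None" "kd nt' (ncnt m) = [n, c]" "ww nt' (ncnt m) = ww nt n + snd (side_to c (sd nt n)) + ww nt c"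
      using nn vn by (auto simp: nt'_def nd_def)
    show "([n, c] = [n] \<and> X = {} \<and> L n \<union> L c = L n \<and> ww nt n + snd (side_to c (sd nt n)) + ww nt c = ww nt n \<and>
         (\<forall>d\<in>live nt. lv d = i \<longrightarrow> d \<noteq> n \<longrightarrow> (\<exists>x\<in>L n. \<exists>y\<in>L d. {x, y} \<in> E) \<longrightarrow> (\<exists>p. pa nt d = Some p \<and> kd nt p \<noteq> [d]))) \<or>
       (\<exists>c' x y. [n, c] = [n, c'] \<and> c' \<in> live nt \<and> lv c' = i \<and> c' \<noteq> n \<and> pa nt c' = None \<and> x \<in> L n \<and> y \<in> L c' \<and> {x, y} \<in> E \<and>
         X \<subseteq> {c'} \<and> L n \<union> L c = L n \<union> L c' \<and> ww nt n + snd (side_to c (sd nt n)) + ww nt c = ww nt n + snd (side_to c' (sd nt n)) + ww nt c')"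
      using c X by blast
  qed
  then show ?thesis using c(3)
    by (auto simp: new_pair_def runs_simps r rc frame_def nd_def[symmetric] nt'_def[symmetric])
qed

text \<open>The 13 units: the test for liveness and one read, two searches for a mate at 3 each, and
  5 for building a pair.\<close>

lemma place_runs:
  assumes P: "phase2 i U1 U2 N L0 a n0 {} (n # Ar) B K lv L (ntab m) (ncnt m) (ttab m) (tcnt m)"
    and S: "surround i U1 U2 N L0"
  shows "runs (place n (B, K)) m (\<lambda>s t m'. t \<le> 13 \<and> frame m m' \<and> (\<exists>lv' L'.
     phase2 i U1 U2 N L0 a n0 {} Ar (fst s) (snd s) lv' L' (ntab m') (ncnt m') (ttab m') (tcnt m')))"
proof -
  let ?nt = "ntab m"
  note D = phase2D[OF P]
  have nl: "n \<in> live ?nt" "lv n = i" using D(7) by auto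
  have b: "base lv L ?nt (ncnt m)" by (rule D(15))
  have str: "strong lv L ?nt n" using D(20) nl by simp
  obtain r where r: "ntab m n = Some r" using live_ex[OF nl(1)] by blast
  have vr: "parent r = pa ?nt n" "kids r = kd ?nt n" "sides r = sd ?nt n" "wt r = ww ?nt n" using view_mem[OF r] by auto
  show ?thesis
  proof (cases "pa ?nt n")
    case (Some p)
    then show ?thesis using phase2_skip[OF P] vr nl
      by (auto simp: place_def runs_simps r frame_def)
  next
    case None
    show ?thesis
    proof (cases "kd ?nt n \<noteq> [] \<and> (\<exists>u a v b. sd ?nt n = ((Singular u, a), (Singular v, b)))")
      case True
      then obtain u a1 v b1 where sdn: "sd ?nt n = ((Singular u, a1), (Singular v, b1))" and kn: "kd ?nt n \<noteq> []" by blast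
      then obtain k ks where kk: "kd ?nt n = k # ks" by (cases "kd ?nt n") auto
      define nt' where "nt' = ?nt(n \<mapsto> r\<lparr>top_edge := Some (tcnt m)\<rparr>)"
      have "phase2 i U1 U2 N L0 a n0 {} Ar B K lv L nt' (ncnt m) ((ttab m)(tcnt m \<mapsto> \<lparr> tends = (u, v), twt = ww ?nt n + a1 + b1 \<rparr>)) (Suc (tcnt m))"
        by (rule phase2_root[OF P None kn sdn]) (use nl vr in \<open>auto simp: nt'_def\<close>)
      then show ?thesis using vr nl None
        by (auto simp: place_def runs_simps r frame_def sdn kk nt'_def[symmetric])
    next
      case False
      have cl: "q \<in> live ?nt" if "fst (fst (sd ?nt n)) = Cluster q \<or> fst (snd (sd ?nt n)) = Cluster q" for q
        using strong_side(1)[OF str that] .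
      have pl: "p \<in> live ?nt" if "fst (fst (sd ?nt n)) = Cluster q \<or> fst (snd (sd ?nt n)) = Cluster q" "pa ?nt q = Some p" for q p
        using baseD(9)[OF b cl[OF that(1)] that(2)] .
      have nbr: "q \<in> live ?nt \<and> lv q = i \<and> q \<noteq> n \<and> (\<exists>x\<in>L n. \<exists>y\<in>L q. {x, y} \<in> E)"
        if "fst (fst (sd ?nt n)) = Cluster q \<or> fst (snd (sd ?nt n)) = Cluster q" for q
        using strong_side[OF str that] nl by auto
      have adj: "\<exists>d\<in>live ?nt. lv d = i \<and> d \<noteq> n \<and> (\<exists>x\<in>L n. \<exists>y\<in>L d. {x, y} \<in> E)" if "0 < i"
      proof -
        have "kd ?nt n \<noteq> []" using baseD(4)[OF b nl(1)] nl that unfolding shape_def by auto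
        then have "\<exists>q. fst (fst (sd ?nt n)) = Cluster q \<or> fst (snd (sd ?nt n)) = Cluster q"
          using False by (metis nbr.exhaust prod.collapse)
        then show ?thesis using nbr by blast
      qed
      \<comment> \<open>Strong sides name every adjacent cluster, so what holds for the named
        clusters holds for all neighbours.\<close>
      have nbs: "\<exists>p. pa ?nt d = Some p \<and> kd ?nt p \<noteq> [d]"
        if d: "d \<in> live ?nt" "lv d = i" "d \<noteq> n" "\<exists>x\<in>L n. \<exists>y\<in>L d. {x, y} \<in> E"
          and h: "\<And>q. fst (fst (sd ?nt n)) = Cluster q \<or> fst (snd (sd ?nt n)) = Cluster q \<Longrightarrow> \<exists>p. pa ?nt q = Some p \<and> kd ?nt p \<noteq> [q]" for d
      proof -
        obtain x y where xy: "x \<in> L n" "y \<in> L d" "{x, y} \<in> E" using d by auto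
        have disj: "L n \<inter> L d = {}" using baseD(8)[OF b nl(1) d(1)] nl d by auto
        have dR: "L d \<subseteq> R" using D(19)[OF d(1)] d by simp
        obtain q where q: "q \<in> live ?nt" "lv q = lv n" "y \<in> L q" "fst (fst (sd ?nt n)) = Cluster q \<or> fst (snd (sd ?nt n)) = Cluster q"
          using strong_nbr[OF b str xy(1) _ _ xy(3)] xy disj dR by blast
        have "q = d" using baseD(8)[OF b q(1) d(1)] q d nl xy by auto
        then show ?thesis using h q by auto
      qed
      have pair: "runs (new_pair n c) m' (\<lambda>p t m''. t \<le> 5 \<and> frame m m'' \<and> (\<exists>lv' L'.
         phase2 i U1 U2 N L0 a n0 {} Ar (p # B) K' lv' L' (ntab m'') (ncnt m'') (ttab m'') (tcnt m'')))"
        if c: "fst (fst (sd ?nt n)) = Cluster c \<or> fst (snd (sd ?nt n)) = Cluster c"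
          and m': "(K' = K \<and> m' = m \<and> pa ?nt c = None) \<or>
           (\<exists>p. K' = push_opt (pa ?nt p) K \<and> pa ?nt c = Some p \<and> kd ?nt p = [c] \<and> m' = m\<lparr>ntab := ?nt(p := None)\<rparr>)" for c K' m'
      proof -
        obtain x y where xy: "c \<in> live ?nt" "lv c = i" "c \<noteq> n" "x \<in> L n" "y \<in> L c" "{x, y} \<in> E" using nbr[OF c] by blast
        from m' show ?thesis
        proof (elim disjE exE conjE)
          assume k: "K' = K" "m' = m" "pa ?nt c = None"
          show ?thesis unfolding k(1,2)
            by (rule place_pair[OF P S None xy(1,2,3) k(3) xy(4,5,6)]) (auto simp: same_node_def)
        next
          fix p assume k: "K' = push_opt (pa ?nt p) K" "pa ?nt c = Some p" "kd ?nt p = [c]" "m' = m\<lparr>ntab := ?nt(p := None)\<rparr>"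
          obtain rc where rc: "?nt c = Some rc" using live_ex[OF xy(1)] by blast
          have pc: "p \<noteq> c" "lv p = Suc i" using base_pa_lv[OF b xy(1) k(2)] xy by auto
          \<comment> \<open>The fictitious table for \<open>place_pair\<close>: besides the deletion
            of \<open>p\<close> it contains the clearing of the parent of \<open>c\<close>, which
            the program omits.\<close>
          define nt1 where "nt1 = ?nt(p := None, c \<mapsto> rc\<lparr>parent := None\<rparr>)"
          have l1: "live nt1 = live ?nt - {p}" using xy pc by (auto simp: nt1_def)
          have qp: "q \<noteq> p" if "q \<in> live nt1" for q using that l1 by blast
          have s1: "same_node ?nt nt1 q" if "q \<in> live nt1" for q
            using qp[OF that] view_mem[OF rc] by (simp add: nt1_def same_node_def)
          have p1: "pa nt1 q = (if q = c then None else pa ?nt q)" if "q \<in> live nt1" for q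
            using qp[OF that] by (simp add: nt1_def)
          have P1: "phase2 i U1 U2 N L0 a n0 {c} (n # Ar) B K' lv L nt1 (ncnt m) (ttab m) (tcnt m)"
            unfolding k(1) by (rule phase2_detach[OF P S None xy(1,2,3) k(2,3) xy(4,5,6) l1 s1 p1])
          have nl1: "n \<in> live nt1" "c \<in> live nt1" unfolding l1 using nl xy pc by auto
          have P2: "phase2 i U1 U2 N L0 a n0 {c} (n # Ar) B K' lv L nt1 (ncnt m') (ttab m') (tcnt m')" using P1 k by simp
          have "runs (new_pair n c) m' (\<lambda>p t m''. t \<le> 5 \<and> frame m' m'' \<and> (\<exists>lv' L'.
             phase2 i U1 U2 N L0 a n0 {} Ar (p # B) K' lv' L' (ntab m'') (ncnt m'') (ttab m'') (tcnt m'')))"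
          proof (rule place_pair[OF P2 S _ nl1(2) xy(2,3) _ xy(4,5,6)])
            show "live (ntab m') = live nt1" using k l1 by simp
            show "same_node nt1 (ntab m') q" if "q \<in> live nt1" for q
              using s1[OF that] qp[OF that] k by (simp add: same_node_def)
            show "pa (ntab m') q = pa nt1 q" if "q \<in> live nt1" "q \<noteq> c" for q
              using p1[OF that(1)] that qp[OF that(1)] k by simp
          qed (use p1 nl1 None xy in auto)
          then show ?thesis by (rule runs_mono) (use k in \<open>auto simp: frame_def\<close>)
        qed
      qed
      have single: "runs (new_single n) m (\<lambda>p t m'. t \<le> 5 \<and> frame m m' \<and> (\<exists>lv' L'.
         phase2 i U1 U2 N L0 a n0 {} Ar (p # B) K lv' L' (ntab m') (ncnt m') (ttab m') (tcnt m')))"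
        if "\<And>q. fst (fst (sd ?nt n)) = Cluster q \<or> fst (snd (sd ?nt n)) = Cluster q \<Longrightarrow> \<exists>p. pa ?nt q = Some p \<and> kd ?nt p \<noteq> [q]"
        by (rule place_single[OF P S None]) (use nbs that adj in blast)+
      have c1: "\<And>q. fst (fst (sd ?nt n)) = Cluster q \<Longrightarrow> q \<in> live ?nt"
        and c2: "\<And>q. fst (snd (sd ?nt n)) = Cluster q \<Longrightarrow> q \<in> live ?nt" using cl by blast+
      have p1: "\<And>q p. fst (fst (sd ?nt n)) = Cluster q \<Longrightarrow> pa ?nt q = Some p \<Longrightarrow> p \<in> live ?nt"
        and p2: "\<And>q p. fst (snd (sd ?nt n)) = Cluster q \<Longrightarrow> pa ?nt q = Some p \<Longrightarrow> p \<in> live ?nt" using pl by blast+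
      note fm1 = find_mate_runs[OF c1 p1] and fm2 = find_mate_runs[OF c2 p2]
      have False': "\<not> (kids r \<noteq> [] \<and> (\<exists>u a v b. sides r = ((Singular u, a), (Singular v, b))))"
        using False vr by simp
      have pr: "parent r = None" using vr None by simp
      show ?thesis
        unfolding place_nonroot[OF r pr False'] runs_bind vr
        apply (rule runs_mono[OF fm1], assumption, assumption, assumption)
        apply (elim conjE disjE exE)
        subgoal for z t m'
          apply (simp add: runs_simps)
          apply (rule runs_mono[OF fm2], assumption, assumption, assumption)
          apply (elim conjE disjE exE)
          subgoal for z' t' m''
            apply (simp add: runs_simps)
            apply (rule runs_mono[OF single])
            by auto
          subgoal for z' t' m'' q
            apply (simp add: runs_simps)
            apply (rule runs_mono[OF pair, of q])
            by auto
          subgoal for z' t' m'' q p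
            apply (simp add: runs_simps)
            apply (rule runs_mono[OF pair, of q])
            by auto
          done
        subgoal for z t m' q
          apply (simp add: runs_simps)
          apply (rule runs_mono[OF pair, of q])
          by auto
        subgoal for z t m' q p
          apply (simp add: runs_simps)
          apply (rule runs_mono[OF pair, of q])
          by auto
        done
    qed
  qed
qed

end


section \<open>Bounds on the region and the height, and the loop over the orphans\<close>

context arena
begin

lemma level_props:
  assumes b: "base lv L nt nc" and ct: "contents k lv L nt" and i: "i < k"
    and str: "\<And>p. p \<in> live nt \<Longrightarrow> lv p = i \<Longrightarrow> strong lv L nt p"
  shows "finite (level lv nt i)"
    "\<And>c d. c \<in> level lv nt i \<Longrightarrow> d \<in> level lv nt i \<Longrightarrow> c \<noteq> d \<Longrightarrow> L c \<inter> L d = {}"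
    "\<And>d. d \<in> level lv nt i \<Longrightarrow> card (out E (L d)) = 2"
    "\<And>d. d \<in> level lv nt i \<Longrightarrow> L d \<subseteq> R \<and> conn E (L d) \<and> L d \<noteq> {}"
proof -
  show "finite (level lv nt i)" using baseD(1)[OF b] by (auto simp: level_def)
  show "L c \<inter> L d = {}" if "c \<in> level lv nt i" "d \<in> level lv nt i" "c \<noteq> d" for c d
    by (rule baseD(8)[OF b]) (use that in \<open>auto simp: level_def\<close>)
  show "card (out E (L d)) = 2" if "d \<in> level lv nt i" for d
    using str[of d] that sok_card unfolding strong_def level_def by blast
  show "L d \<subseteq> R \<and> conn E (L d) \<and> L d \<noteq> {}" if "d \<in> level lv nt i" for d
    using ct i that baseD(6)[OF b, of d] unfolding contents_def ok_def level_def by auto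
qed

text \<open>By \<open>expand_out\<close> at most one cluster is added per exit of \<open>U\<close>,
  and \<open>U\<close> has at most four exits.\<close>

lemma zone_grow:
  assumes z: "zone L N U n" and fin: "finite N"
    and disj: "\<And>c d. c \<in> N \<Longrightarrow> d \<in> N \<Longrightarrow> c \<noteq> d \<Longrightarrow> L c \<inter> L d = {}"
    and two: "\<And>d. d \<in> N \<Longrightarrow> card (out E (L d)) = 2"
    and N: "\<And>d. d \<in> N \<Longrightarrow> L d \<subseteq> R \<and> conn E (L d) \<and> L d \<noteq> {}"
    and S: "S \<subseteq> {d \<in> N. near E U (L d)}"
  shows "zone L N (U \<union> \<Union>(L ` S)) (n + 4)"
proof -
  have U: "U \<subseteq> R" "\<And>d. d \<in> N \<Longrightarrow> L d \<subseteq> U \<or> L d \<inter> U = {}" "card (out E U) \<le> 4" "theta U"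
    "card {p \<in> N. L p \<inter> U \<noteq> {}} \<le> n" "Ch \<inter> R \<subseteq> U"
    using z by (auto simp: zone_def)
  let ?U = "U \<union> \<Union>(L ` S)"
  have g1: "card (out E ?U) \<le> card (out E U)"
    by (rule grow_props(1)[OF fin U(1) _ _ _ _ S refl]) (use disj two N U(2) in blast)+
  have g2: "card {d \<in> N. L d \<inter> ?U \<noteq> {}} \<le> card {d \<in> N. L d \<inter> U \<noteq> {}} + card (out E U)"
    by (rule grow_props(2)[OF fin U(1) _ _ _ _ S refl]) (use disj two N U(2) in blast)+
  have g3: "?U \<subseteq> R"
    by (rule grow_props(3)[OF fin U(1) _ _ _ _ S refl]) (use disj two N U(2) in blast)+
  have g4: "L d \<subseteq> ?U \<or> L d \<inter> ?U = {}" if "d \<in> N" for d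
    by (rule grow_props(4)[OF fin U(1) _ _ _ _ S refl that]) (use disj two N U(2) in blast)+
  have g5: "theta ?U"
    by (rule grow_props(5)[OF fin U(1) _ _ _ _ S refl U(4)]) (use disj two N U(2) in blast)+
  show ?thesis unfolding zone_def
  proof (intro conjI ballI)
    show "card (out E (U \<union> \<Union>(L ` S))) \<le> 4" using g1 U(3) by simp
    show "card {p \<in> N. L p \<inter> (U \<union> \<Union>(L ` S)) \<noteq> {}} \<le> n + 4" using g2 U(3,5) by simp
    show "L d \<subseteq> U \<union> \<Union>(L ` S) \<or> L d \<inter> (U \<union> \<Union>(L ` S)) = {}" if "d \<in> N" for d by (rule g4[OF that])
  qed (use g3 g5 U(6) in blast)+
qed

text \<open>Let F be the number of adjacent pairs of regular vertices. From level \<open>H\<close>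
  on, the number of links times 3^i is at most 2^i F < 3^i, so there is no link.\<close>

lemma depth_bound:
  assumes "card (links E L N) * 3 ^ i \<le> 2 ^ i * card {(x, y). x \<in> R \<and> y \<in> R \<and> {x, y} \<in> E}" "links E L N \<noteq> {}"
  shows "i < H"
proof (rule ccontr)
  let ?F = "card {(x, y). x \<in> R \<and> y \<in> R \<and> {x, y} \<in> E}"
  assume "\<not> i < H"
  then obtain k where k: "i = H + k" using le_Suc_ex not_less by blast
  have "1 \<le> card (links E L N)" using assms(2) finite_links[OF E] by (simp add: Suc_le_eq card_gt_0_iff)
  then have "3 ^ i \<le> card (links E L N) * 3 ^ i" by simp
  also have "\<dots> \<le> 2 ^ i * ?F" by (rule assms(1))
  also have "\<dots> = (?F * 2 ^ H) * 2 ^ k" unfolding k by (simp add: power_add)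
  also have "\<dots> < 3 ^ H * 2 ^ k" using depth by simp
  also have "\<dots> \<le> 3 ^ H * 3 ^ k" by (simp add: power_mono)
  also have "\<dots> = 3 ^ i" unfolding k by (simp add: power_add)
  finally show False by simp
qed

text \<open>Two enlargements, from 26 to 30 to 34 clusters. The orphans are distinct nonempty
  clusters inside \<open>U1\<close>, hence at most 30; their neighbours are inside
  \<open>U2\<close>.\<close>

lemma phase2_init:
  assumes P: "phase1 i U N n0 [] A K lv L nt nc tt tc" and z: "zone L N U 26"
    and F: "card (links E L N) * 3 ^ i \<le> 2 ^ i * card {(x, y). x \<in> R \<and> y \<in> R \<and> {x, y} \<in> E}"
    and U1: "U1 = grow E L N U" and U2: "U2 = grow E L N U1"
  shows "phase2 i U1 U2 N L (length A) n0 {} A [] K lv L nt nc tt tc" "surround i U1 U2 N L" "zone L N U2 34" "length A \<le> 30"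
proof -
  have core: "core (Suc i) lv L nt nc (set A) (set K) U1 tt tc" and so: "sides_ok i (Suc i) {} lv L nt"
    and dK: "dirty lv nc (Suc (Suc i)) K" and cK: "covered_kid L nt K U1"
    and tch: "\<forall>q\<in>live nt. lv q = Suc i \<longrightarrow> L q \<inter> Ch = {}"
    and A: "distinct A" "\<forall>p\<in>set A. p \<in> live nt \<and> lv p = i \<and> pa nt p = None \<and> L p \<subseteq> U1"
    and N: "level lv nt i = N" and n0: "length K + card (live nt) \<le> n0"
    using P by (auto simp: phase1_def U1)
  have b: "base lv L nt nc" and ct: "contents (Suc i) lv L nt" and ko: "kids_ok L nt (set K) U1"
    using core by (auto simp: core_def)
  have str: "strong lv L nt p" if "p \<in> live nt" "lv p = i" for p using so that by (simp add: sides_ok_def)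
  have lp: "finite N" "\<And>c d. c \<in> N \<Longrightarrow> d \<in> N \<Longrightarrow> c \<noteq> d \<Longrightarrow> L c \<inter> L d = {}"
    "\<And>d. d \<in> N \<Longrightarrow> card (out E (L d)) = 2" "\<And>d. d \<in> N \<Longrightarrow> L d \<subseteq> R \<and> conn E (L d) \<and> L d \<noteq> {}"
    using level_props[OF b ct lessI] str unfolding N by blast+
  have "zone L N U1 (26 + 4)"
    unfolding U1 grow_def by (rule zone_grow[OF z lp(1)]) (use lp(2-4) in blast)+
  then have z1: "zone L N U1 30" by simp
  have "zone L N U2 (30 + 4)"
    unfolding U2 grow_def by (rule zone_grow[OF z1 lp(1)]) (use lp(2-4) in blast)+
  then show z2: "zone L N U2 34" by simp
  have U12: "U1 \<subseteq> U2" unfolding U2 grow_def by blast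
  show "surround i U1 U2 N L"
    unfolding surround_def
  proof (intro conjI ballI impI)
    show "U1 \<subseteq> U2" by (rule U12)
    show "U2 \<subseteq> R" using z2 by (simp add: zone_def)
    show "i < H" if "links E L N \<noteq> {}" by (rule depth_bound[OF F that])
    fix d x y assume d: "d \<in> N" "x \<in> U1" "y \<in> L d" "{x, y} \<in> E"
    show "L d \<subseteq> U2"
    proof (cases "L d \<inter> U1 = {}")
      case True
      then have "near E U1 (L d)" using d unfolding near_def by blast
      then show ?thesis using d unfolding U2 grow_def by blast
    next
      case False
      then have "L d \<subseteq> U1" using z1 d unfolding zone_def by blast
      then show ?thesis using U12 by blast
    qed
  qed
  have "set A \<subseteq> {p \<in> N. L p \<inter> U1 \<noteq> {}}"
  using A N lp(4) by (fastforce simp: level_def)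
  then have "card (set A) \<le> card {p \<in> N. L p \<inter> U1 \<noteq> {}}" by (rule card_mono[rotated]) (use lp(1) in auto)
  then show "length A \<le> 30" using z1 A(1) by (simp add: zone_def distinct_card)
  have okc: "ok (Suc (Suc i)) lv L p = ok (Suc i) lv L p" if "p \<in> live nt" for p
    using tch that unfolding ok_def by (auto simp: less_Suc_eq)
  have core': "core (Suc (Suc i)) lv L nt nc (set A \<union> set [] \<union> {}) (set K) U2 tt tc"
    using core_mono[OF core_cong_k[OF core okc], of "set K" U2] U12 by simp
  have so': "sides_ok i (Suc (Suc i)) (set []) lv L nt"
    using so okc unfolding sides_ok_def by simp
  have cK': "covered_kid L nt K U2" using cK U12 unfolding covered_kid_def by blast
  \<comment> \<open>A changed cluster of level \<open>i + 2\<close> has a changed child. No such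
    child is live, because all of them were deleted; by \<open>kids_ok\<close> its parent has then
    been marked.\<close>
  have t': "\<forall>q\<in>live nt. lv q = Suc (Suc i) \<longrightarrow> L q \<inter> Ch \<noteq> {} \<longrightarrow> q \<in> set K"
  proof (intro ballI impI, rule ccontr)
    fix q assume q: "q \<in> live nt" "lv q = Suc (Suc i)" "L q \<inter> Ch \<noteq> {}" "q \<notin> set K"
    note sh = baseD(4)[OF b q(1)]
    have ne: "kd nt q \<noteq> []" using sh q unfolding shape_def by auto
    then obtain c where c: "c \<in> set (kd nt q)" "L c \<inter> Ch \<noteq> {}" using q(3) unfolding shape_Union[OF sh ne] by blast
    have "c \<in> live nt" using ko q c by (auto simp: kids_ok_def)
    moreover have "lv c = Suc i" using shape_kid(1)[OF sh c(1)] q by simp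
    ultimately show False using tch c by blast
  qed
  have Ar: "\<forall>p\<in>set A. p \<in> live nt \<and> lv p = i \<and> L p \<subseteq> U1" using A(2) by blast
  show "phase2 i U1 U2 N L (length A) n0 {} A [] K lv L nt nc tt tc"
    unfolding phase2_def using core' so' dK cK' t' A(1) Ar N n0 by (simp add: lonely_ok_def)
qed

lemma phase2_runs:
  assumes P: "phase2 i U1 U2 N L0 a n0 {} A B K lv L (ntab m) (ncnt m) (ttab m) (tcnt m)"
    and S: "surround i U1 U2 N L0"
  shows "runs (foreach A place (B, K)) m (\<lambda>s t m'. t \<le> 14 * length A + 1 \<and> frame m m' \<and> (\<exists>lv' L'.
     phase2 i U1 U2 N L0 a n0 {} [] (fst s) (snd s) lv' L' (ntab m') (ncnt m') (ttab m') (tcnt m')))"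
proof -
  let ?I = "\<lambda>Ar s m'. frame m m' \<and> (\<exists>lv' L'.
     phase2 i U1 U2 N L0 a n0 {} Ar (fst s) (snd s) lv' L' (ntab m') (ncnt m') (ttab m') (tcnt m'))"
  have "runs (foreach A place (B, K)) m (\<lambda>s t m'. t \<le> (13 + 1) * length A + 1 \<and> ?I [] s m')"
  proof (rule runs_foreach[where I = ?I])
    fix n Ar s m' assume a: "?I (n # Ar) s m'"
    obtain B1 K1 where s: "s = (B1, K1)" by (cases s)
    obtain lv' L' where P': "phase2 i U1 U2 N L0 a n0 {} (n # Ar) B1 K1 lv' L' (ntab m') (ncnt m') (ttab m') (tcnt m')"
      using a s by auto
    show "runs (place n s) m' (\<lambda>s' t m''. t \<le> 13 \<and> ?I Ar s' m'')"
      unfolding s by (rule runs_mono[OF place_runs[OF P' S]]) (use a frame_trans in blast)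
  next
    show "?I A (B, K) m" using P frame_refl by auto
  qed
  then show ?thesis by simp
qed

text \<open>Rewritten sides are exact, and those of own roots are left alone, as
  \<open>core_sides\<close> demands. Being transitive, the relation describes any number of
  refreshments.\<close>

definition better where
  "better i Or lv L nt nt' \<longleftrightarrow> live nt' = live nt \<and>
     (\<forall>q\<in>live nt. kd nt' q = kd nt q \<and> te nt' q = te nt q \<and> ww nt' q = ww nt q \<and> pa nt' q = pa nt q) \<and>
     (\<forall>q\<in>live nt. sd nt' q = sd nt q \<or> (lv q = Suc i \<and> strong lv L nt' q \<and> q \<notin> own (Suc (Suc i)) lv L nt Or))"

lemma better_refl: "better i Or lv L nt nt"
  by (simp add: better_def)

lemma strong_sd: "strong lv L nt p \<Longrightarrow> live nt' = live nt \<Longrightarrow> sd nt' p = sd nt p \<Longrightarrow> strong lv L nt' p"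
  by (simp add: strong_def)

lemma better_strong: "better i Or lv L nt nt' \<Longrightarrow> q \<in> live nt \<Longrightarrow> strong lv L nt q \<Longrightarrow> strong lv L nt' q"
  unfolding better_def using strong_sd by blast

lemma better_own:
  assumes "better i Or lv L nt nt'"
  shows "own k lv L nt' Or = own k lv L nt Or"
  using assms unfolding better_def own_def by auto

lemma better_trans:
  assumes a: "better i Or lv L nt nt'" and b: "better i Or lv L nt' nt''"
  shows "better i Or lv L nt nt''"
  unfolding better_def
  using a b better_own[OF a] better_strong[OF b] by (fastforce simp: better_def)

text \<open>What remains of \<open>phase2\<close> when all orphans are placed. On the new level a
  cluster is new, or its sides are already exact, or they are still weak with respect to the old
  clusters \<open>live nt - set B\<close>.\<close>

definition settling where
  "settling i U2 B K lv L nt nc tt tc \<longleftrightarrow>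
     core (Suc (Suc i)) lv L nt nc (set B) (set K) U2 tt tc \<and>
     (\<forall>p\<in>live nt. lv p \<le> i \<longrightarrow> strong lv L nt p) \<and>
     (\<forall>q\<in>live nt. lv q = Suc i \<longrightarrow> set (kd nt q) \<subseteq> live nt) \<and>
     (\<forall>p\<in>set B. lv p = Suc i) \<and>
     (\<forall>p\<in>live nt. lv p = Suc i \<longrightarrow> p \<in> set B \<or> strong lv L nt p \<or> weak lv L nt (set B) p)"

lemma settling_better:
  assumes s: "settling i U2 B K lv L nt nc tt tc" and bt: "better i (set B) lv L nt nt'"
  shows "settling i U2 B K lv L nt' nc tt tc"
proof -
  have l: "live nt' = live nt" and kd: "\<And>q. q \<in> live nt \<Longrightarrow> kd nt' q = kd nt q \<and> te nt' q = te nt q \<and> ww nt' q = ww nt q \<and> pa nt' q = pa nt q"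
    and sd: "\<And>q. q \<in> live nt \<Longrightarrow> sd nt' q = sd nt q \<or> (lv q = Suc i \<and> strong lv L nt' q \<and> q \<notin> own (Suc (Suc i)) lv L nt (set B))"
    using bt by (auto simp: better_def)
  have "core (Suc (Suc i)) lv L nt nc (set B) (set K) U2 tt tc" using s by (simp add: settling_def)
  then have "core (Suc (Suc i)) lv L nt' nc (set B) (set K) U2 tt tc"
  using core_sides[OF _ l kd] sd by (fastforce simp: own_def)
  moreover have "\<forall>p\<in>live nt'. lv p = Suc i \<longrightarrow> p \<in> set B \<or> strong lv L nt' p \<or> weak lv L nt' (set B) p"
  using s l sd strong_sd by (fastforce simp: settling_def weak_def)
  ultimately show ?thesis using s l kd better_strong[OF bt] unfolding settling_def by auto
qed

lemma settling_not_own: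
  assumes s: "settling i U2 B K lv L nt nc tt tc" and q: "q \<in> live nt" "lv q = Suc i \<or> lv q \<le> i"
    and xy: "x \<in> L q" "y \<in> R" "y \<notin> L q" "{x, y} \<in> E"
  shows "q \<notin> own (Suc (Suc i)) lv L nt (set B)"
proof
  assume o: "q \<in> own (Suc (Suc i)) lv L nt (set B)"
  have r: "roots (Suc (Suc i)) lv L nt (set B) tt tc" using s by (auto simp: settling_def core_def)
  obtain u a v b where sd: "sd nt q = ((Singular u, a), (Singular v, b))"
    using r o unfolding roots_def is_root_def by blast
  have "q \<notin> set B" using o by (simp add: own_def)
  then have "strong lv L nt q \<or> weak lv L nt (set B) q"
    using s q unfolding settling_def by blast
  then have "\<forall>x\<in>L q. \<forall>y\<in>R. {x, y} \<in> E \<longrightarrow> y \<in> L q" by (rule closed_root[OF sd])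
  then show False using xy by blast
qed

text \<open>The last claim supplies \<open>cov\<close> in \<open>update_sides_runs\<close>: a
  parentless cluster of level \<open>i\<close> would be an own root by now, and own roots have no
  regular neighbour.\<close>

lemma settling_level:
  assumes s: "settling i U2 B K lv L nt nc tt tc" and c: "c \<in> live nt" "lv c = i"
  shows "strong lv L nt c" "L c \<subseteq> R" "\<And>x y. x \<in> L c \<Longrightarrow> y \<in> R \<Longrightarrow> y \<notin> L c \<Longrightarrow> {x, y} \<in> E \<Longrightarrow> pa nt c \<noteq> None"
proof -
  show "strong lv L nt c" using s c by (simp add: settling_def)
  show "L c \<subseteq> R" using s c by (auto simp: settling_def core_def contents_def ok_def)
  show "pa nt c \<noteq> None" if "x \<in> L c" "y \<in> R" "y \<notin> L c" "{x, y} \<in> E" for x y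
  using s c settling_not_own[OF s c(1) _ that] by (fastforce simp: settling_def own_def ok_def)
qed

lemma settling_update_runs:
  assumes s: "settling i U2 B K lv L (ntab m) nc tt tc" and p: "p \<in> live (ntab m)" "lv p = Suc i"
    and no: "p \<notin> own (Suc (Suc i)) lv L (ntab m) (set B)"
  shows "runs (update_sides p) m (\<lambda>_ t m'. t \<le> 6 \<and> m' = m\<lparr>ntab := ntab m'\<rparr> \<and>
     better i (set B) lv L (ntab m) (ntab m') \<and> strong lv L (ntab m') p)"
proof -
  have b: "base lv L (ntab m) nc" using s by (auto simp: settling_def core_def)
  have k: "set (kd (ntab m) p) \<subseteq> live (ntab m)" using s p by (simp add: settling_def)
  note sl = settling_level[OF s]
  show ?thesis
  proof (rule runs_mono[OF update_sides_runs[OF b p k]])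
    show "strong lv L (ntab m) c \<and> L c \<subseteq> R" if "c \<in> live (ntab m)" "lv c = i" for c using sl[OF that] by blast
    show "pa (ntab m) c \<noteq> None" if "c \<in> live (ntab m)" "lv c = i" "x \<in> L c" "y \<in> R" "y \<notin> L c" "{x, y} \<in> E" for c x y
      using sl(3)[OF that] .
  next
    fix u :: unit and t m'
    assume a: "t \<le> 6 \<and> (\<exists>r s. ntab m p = Some r \<and> m' = m\<lparr>ntab := (ntab m)(p \<mapsto> r\<lparr>sides := s\<rparr>)\<rparr> \<and>
     sok (srep (live (ntab m)) lv L (lv p)) (L p) s)"
    then obtain r s where r: "ntab m p = Some r" "m' = m\<lparr>ntab := (ntab m)(p \<mapsto> r\<lparr>sides := s\<rparr>)\<rparr>"
      "sok (srep (live (ntab m)) lv L (lv p)) (L p) s" by blast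
    have l: "live (ntab m') = live (ntab m)" using r p by auto
    have sp: "strong lv L (ntab m') p" unfolding strong_def l using r by simp
    have "better i (set B) lv L (ntab m) (ntab m')"
      unfolding better_def l using r p no sp view_mem[OF r(1)] by auto
    then show "t \<le> 6 \<and> m' = m\<lparr>ntab := ntab m'\<rparr> \<and> better i (set B) lv L (ntab m) (ntab m') \<and> strong lv L (ntab m') p"
      using a sp r by simp
  qed
qed

lemma settle_nbr_runs:
  assumes s: "settling i U2 B K lv L (ntab m) nc tt tc"
    and q: "\<And>q. fst sd' = Cluster q \<Longrightarrow> q \<in> live (ntab m) \<and> lv q = Suc i \<and> q \<notin> own (Suc (Suc i)) lv L (ntab m) (set B)"
  shows "runs (settle_nbr sd') m (\<lambda>_ t m'. t \<le> 6 \<and> m' = m\<lparr>ntab := ntab m'\<rparr> \<and>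
     better i (set B) lv L (ntab m) (ntab m') \<and> (\<forall>q. fst sd' = Cluster q \<longrightarrow> strong lv L (ntab m') q))"
proof (cases "fst sd'")
  case (Singular v)
  then show ?thesis by (simp add: settle_nbr_def runs_simps better_refl)
next
  case (Cluster q)
  then show ?thesis
    using settling_update_runs[OF s, of q] q[OF Cluster] by (simp add: settle_nbr_def)
qed

lemma mem_ntab_trans: "m' = m\<lparr>ntab := ntab m'\<rparr> \<Longrightarrow> m'' = m'\<lparr>ntab := ntab m''\<rparr> \<Longrightarrow> m'' = m\<lparr>ntab := ntab m''\<rparr>"
  by (metis mem.update_convs(3) mem.surjective)

text \<open>The neighbours to be refreshed are read from the sides of \<open>p\<close> just made
  exact, so no neighbour is missed. The time is 1 + 6 + 1 + 6 + 6 units.\<close>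

lemma settle_runs:
  assumes s: "settling i U2 B K lv L (ntab m) nc tt tc" and p: "p \<in> live (ntab m)" "p \<in> set B"
  shows "runs (settle p u) m (\<lambda>_ t m'. t \<le> 20 \<and> m' = m\<lparr>ntab := ntab m'\<rparr> \<and>
     better i (set B) lv L (ntab m) (ntab m') \<and> strong lv L (ntab m') p \<and>
     (\<forall>q\<in>live (ntab m). lv q = Suc i \<longrightarrow> (\<exists>x\<in>L q. \<exists>y\<in>L p. {x, y} \<in> E) \<longrightarrow> strong lv L (ntab m') q))"
proof -
  have lvp: "lv p = Suc i" using s p by (simp add: settling_def)
  have no: "p \<notin> own (Suc (Suc i)) lv L (ntab m) (set B)" using p by (simp add: own_def)
  have b: "base lv L (ntab m) nc" and ct: "contents (Suc (Suc i)) lv L (ntab m)" using s by (auto simp: settling_def core_def)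
  have LR: "L q \<subseteq> R" if "q \<in> live (ntab m)" "lv q = Suc i" for q using ct that by (simp add: contents_def ok_def)
  obtain r0 where r0: "ntab m p = Some r0" using live_ex[OF p(1)] by blast
  show ?thesis
    unfolding settle_def
    apply (simp add: runs_bind runs_is_live r0)
    apply (rule runs_mono[OF settling_update_runs[OF s p(1) lvp no]])
    apply (elim conjE)
    subgoal for u1 t1 m1
    proof -
      assume t1: "t1 \<le> 6" and m1: "m1 = m\<lparr>ntab := ntab m1\<rparr>" and b1: "better i (set B) lv L (ntab m) (ntab m1)"
        and st1: "strong lv L (ntab m1) p"
      have s1: "settling i U2 B K lv L (ntab m1) nc tt tc" by (rule settling_better[OF s b1])
      have l1: "live (ntab m1) = live (ntab m)" using b1 by (simp add: better_def)
      obtain r where r: "ntab m1 p = Some r" using live_ex[of p "ntab m1"] p l1 by auto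
      have sr: "sides r = sd (ntab m1) p" using view_mem[OF r] by simp
      have nb: "q \<in> live (ntab m1) \<and> lv q = Suc i \<and> q \<notin> own (Suc (Suc i)) lv L (ntab m1) (set B)"
        if c: "fst (fst (sd (ntab m1) p)) = Cluster q \<or> fst (snd (sd (ntab m1) p)) = Cluster q" for q
      proof -
        obtain x y where xy: "x \<in> L p" "y \<in> L q" "y \<notin> L p" "{x, y} \<in> E" using strong_side(3)[OF st1 c] by blast
        have q: "q \<in> live (ntab m1)" "lv q = Suc i" using strong_side(1,2)[OF st1 c] lvp by auto
        have "L q \<inter> L p = {}" using baseD(8)[OF b, of q p] q p l1 lvp xy by auto
        then have "q \<notin> own (Suc (Suc i)) lv L (ntab m1) (set B)"
          using settling_not_own[OF s1 q(1), of y x] q xy LR[OF p(1) lvp] by (auto simp: insert_commute)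
        then show ?thesis using q by simp
      qed
      have nb1: "\<And>q. fst (fst (sd (ntab m1) p)) = Cluster q \<Longrightarrow> q \<in> live (ntab m1) \<and> lv q = Suc i \<and> q \<notin> own (Suc (Suc i)) lv L (ntab m1) (set B)"
        and nb2: "\<And>q. fst (snd (sd (ntab m1) p)) = Cluster q \<Longrightarrow> q \<in> live (ntab m1) \<and> lv q = Suc i \<and> q \<notin> own (Suc (Suc i)) lv L (ntab m1) (set B)"
        using nb by blast+
      have adj: "fst (fst (sd (ntab m1) p)) = Cluster q \<or> fst (snd (sd (ntab m1) p)) = Cluster q"
        if q: "q \<in> live (ntab m)" "lv q = Suc i" "q \<noteq> p" "x \<in> L q" "y \<in> L p" "{x, y} \<in> E" for q x y
      proof -
        have b1': "base lv L (ntab m1) nc" using s1 by (auto simp: settling_def core_def)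
        have disj: "L q \<inter> L p = {}" using baseD(8)[OF b q(1) p(1)] q lvp by auto
        obtain q' where q': "q' \<in> live (ntab m1)" "lv q' = lv p" "x \<in> L q'"
          "fst (fst (sd (ntab m1) p)) = Cluster q' \<or> fst (snd (sd (ntab m1) p)) = Cluster q'"
          using strong_nbr[OF b1' st1 q(5), of x] q disj LR[OF q(1,2)] by (auto simp: insert_commute)
        have "q' = q" using baseD(8)[OF b, of q' q] q' q l1 lvp by auto
        then show ?thesis using q' by simp
      qed
      show ?thesis
        apply (simp add: runs_bind runs_read_node r sr)
        apply (rule runs_mono[OF settle_nbr_runs[OF s1 nb1]], assumption)
        apply (elim conjE)
        subgoal for u2 t2 m2
        proof -
          assume t2: "t2 \<le> 6" and m2: "m2 = m1\<lparr>ntab := ntab m2\<rparr>" and b2: "better i (set B) lv L (ntab m1) (ntab m2)"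
            and st2: "\<forall>q. fst (fst (sd (ntab m1) p)) = Cluster q \<longrightarrow> strong lv L (ntab m2) q"
          have s2: "settling i U2 B K lv L (ntab m2) nc tt tc" by (rule settling_better[OF s1 b2])
          have l2: "live (ntab m2) = live (ntab m1)" using b2 by (simp add: better_def)
          have nb2': "\<And>q. fst (snd (sd (ntab m1) p)) = Cluster q \<Longrightarrow> q \<in> live (ntab m2) \<and> lv q = Suc i \<and> q \<notin> own (Suc (Suc i)) lv L (ntab m2) (set B)"
            using nb2 l2 better_own[OF b2] by auto
          show ?thesis
            apply (rule runs_mono[OF settle_nbr_runs[OF s2 nb2']], assumption)
            apply (elim conjE)
            subgoal for u3 t3 m3
            proof -
              assume t3: "t3 \<le> 6" and m3: "m3 = m2\<lparr>ntab := ntab m3\<rparr>" and b3: "better i (set B) lv L (ntab m2) (ntab m3)"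
                and st3: "\<forall>q. fst (snd (sd (ntab m1) p)) = Cluster q \<longrightarrow> strong lv L (ntab m3) q"
              have b13: "better i (set B) lv L (ntab m1) (ntab m3)" by (rule better_trans[OF b2 b3])
              have b03: "better i (set B) lv L (ntab m) (ntab m3)" by (rule better_trans[OF b1 b13])
              have sp: "strong lv L (ntab m3) p" using better_strong[OF b13 _ st1] p l1 by simp
              have "\<forall>q\<in>live (ntab m). lv q = Suc i \<longrightarrow> (\<exists>x\<in>L q. \<exists>y\<in>L p. {x, y} \<in> E) \<longrightarrow> strong lv L (ntab m3) q"
              using sp adj st2 st3 better_strong[OF b3] l1 l2 by fastforce
              moreover have "m3 = m\<lparr>ntab := ntab m3\<rparr>" using mem_ntab_trans m1 m2 m3 by blast
              ultimately show ?thesis using t1 t2 t3 b03 sp by simp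
            qed
            done
        qed
        done
    qed
    done
qed

lemma phase3_runs:
  assumes s: "settling i U2 B K lv L (ntab m) nc tt tc" and B: "set B \<subseteq> live (ntab m)"
  shows "runs (foreach B settle ()) m (\<lambda>_ t m'. t \<le> 21 * length B + 1 \<and> m' = m\<lparr>ntab := ntab m'\<rparr> \<and>
     better i (set B) lv L (ntab m) (ntab m') \<and> (\<forall>p\<in>set B. strong lv L (ntab m') p) \<and>
     (\<forall>p\<in>set B. \<forall>q\<in>live (ntab m). lv q = Suc i \<longrightarrow> (\<exists>x\<in>L q. \<exists>y\<in>L p. {x, y} \<in> E) \<longrightarrow> strong lv L (ntab m') q))"
proof -
  let ?I = "\<lambda>Br (u::unit) m'. m' = m\<lparr>ntab := ntab m'\<rparr> \<and> set Br \<subseteq> set B \<and>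
     better i (set B) lv L (ntab m) (ntab m') \<and> (\<forall>p\<in>set B - set Br. strong lv L (ntab m') p \<and>
       (\<forall>q\<in>live (ntab m). lv q = Suc i \<longrightarrow> (\<exists>x\<in>L q. \<exists>y\<in>L p. {x, y} \<in> E) \<longrightarrow> strong lv L (ntab m') q))"
  have "runs (foreach B settle ()) m (\<lambda>u t m'. t \<le> (20 + 1) * length B + 1 \<and> ?I [] u m')"
  proof (rule runs_foreach[where I = ?I])
    fix p Br u m' assume a: "?I (p # Br) u m'"
    have l: "live (ntab m') = live (ntab m)" using a by (simp add: better_def)
    have s': "settling i U2 B K lv L (ntab m') nc tt tc" by (rule settling_better[OF s]) (use a in simp)
    have p: "p \<in> live (ntab m')" "p \<in> set B" using a B l by auto
    show "runs (settle p u) m' (\<lambda>u t m''. t \<le> 20 \<and> ?I Br u m'')"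
    proof (rule runs_mono[OF settle_runs[OF s' p]], elim conjE, intro conjI)
      fix t m'' assume m'': "m'' = m'\<lparr>ntab := ntab m''\<rparr>" and b': "better i (set B) lv L (ntab m') (ntab m'')"
        and sp: "strong lv L (ntab m'') p"
        and q: "\<forall>q\<in>live (ntab m'). lv q = Suc i \<longrightarrow> (\<exists>x\<in>L q. \<exists>y\<in>L p. {x, y} \<in> E) \<longrightarrow> strong lv L (ntab m'') q"
      show "m'' = m\<lparr>ntab := ntab m''\<rparr>" using mem_ntab_trans a m'' by blast
      show "set Br \<subseteq> set B" using a by simp
      show "better i (set B) lv L (ntab m) (ntab m'')" using better_trans a b' by blast
      show "\<forall>p\<in>set B - set Br. strong lv L (ntab m'') p \<and>
       (\<forall>q\<in>live (ntab m). lv q = Suc i \<longrightarrow> (\<exists>x\<in>L q. \<exists>y\<in>L p. {x, y} \<in> E) \<longrightarrow> strong lv L (ntab m'') q)"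
      using sp q l a B better_strong[OF b'] by fastforce
    qed simp
  next
    show "?I B () m" by (simp add: better_refl)
  qed
  then show ?thesis by (rule runs_mono) auto
qed

end


section \<open>Completing a level\<close>

context arena
begin

text \<open>A cluster that was not refreshed has no new neighbour. Behind each of its exits to a
  regular vertex there is a cluster of level \<open>i\<close>, which has a parent; this parent is
  old, and then a weak side must name it.\<close>

lemma settled_strong:
  assumes s: "settling i U2 B K lv L nt nc tt tc" and p: "p \<in> live nt" "lv p = Suc i"
    and h: "strong lv L nt p \<or> (p \<notin> set B \<and> weak lv L nt (set B) p \<and> (\<forall>b\<in>set B. \<forall>x\<in>L p. \<forall>y\<in>L b. {x, y} \<notin> E))"
  shows "strong lv L nt p"
  using h
proof (elim disjE conjE)
  assume pB: "p \<notin> set B" and w: "weak lv L nt (set B) p" and nb: "\<forall>b\<in>set B. \<forall>x\<in>L p. \<forall>y\<in>L b. {x, y} \<notin> E"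
  have b: "base lv L nt nc" using s by (auto simp: settling_def core_def)
  have kl: "set (kd nt p) \<subseteq> live nt" using s p by (simp add: settling_def)
  note sh = baseD(4)[OF b p(1)]
  have ne: "kd nt p \<noteq> []" using sh p unfolding shape_def by auto
  show ?thesis unfolding strong_def
  proof (rule sok_mono[OF w[unfolded weak_def]])
    fix d s' assume d: "d \<in> out E (L p)" and wr: "wrep (live nt - set B) lv L (lv p) d s'"
    show "srep (live nt) lv L (lv p) d s'"
    proof (cases "fst s'")
      case (Singular u) then show ?thesis using wr by (simp add: srep_def wrep_def)
    next
      case (Cluster q)
      have y: "snd d \<in> R" and uq: "\<And>r. r \<in> live nt \<Longrightarrow> r \<notin> set B \<Longrightarrow> lv r = lv p \<Longrightarrow> snd d \<in> L r \<Longrightarrow> r = q"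
        and ws: "snd s' = W {fst d, snd d}" using wr Cluster by (auto simp: wrep_def)
      have xy: "fst d \<in> L p" "snd d \<notin> L p" "{fst d, snd d} \<in> E" using d by (auto simp: out_def)
      obtain c where c: "c \<in> set (kd nt p)" "fst d \<in> L c" using xy(1) unfolding shape_Union[OF sh ne] by blast
      have cl: "c \<in> live nt" "lv c = i" "L c \<subseteq> L p" using kl c shape_kid[OF sh c(1)] p by auto
      obtain c' where c': "c' \<in> live nt" "lv c' = i" "snd d \<in> L c'" "c' \<noteq> c"
        using strong_nbr[OF b settling_level(1)[OF s cl(1,2)] c(2) y _ xy(3)] cl xy by auto
      have "L c' \<inter> L c = {}" using baseD(8)[OF b c'(1) cl(1)] c' cl by auto
      then have "pa nt c' \<noteq> None"
        using settling_level(3)[OF s c'(1,2,3), of "fst d"] c(2) xy(3) settling_level(2)[OF s cl(1,2)]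
        by (auto simp: insert_commute)
      then obtain q' where q': "pa nt c' = Some q'" by auto
      have ql: "q' \<in> live nt" "lv q' = Suc i" "snd d \<in> L q'"
        using baseD(9)[OF b c'(1) q'] base_pa_lv[OF b c'(1) q'] c' by auto
      then have "q' \<notin> set B" using nb xy by blast
      then have "q' = q" using uq ql p by auto
      then show ?thesis using Cluster ql p ws by (simp add: srep_def)
    qed
  qed
qed

lemma settled_links:
  assumes s: "settling i U2 B K lv L nt nc tt tc"
    and str: "\<And>p. p \<in> live nt \<Longrightarrow> lv p = Suc i \<Longrightarrow> strong lv L nt p"
  shows "3 * card (links E L (level lv nt (Suc i))) \<le> 2 * card (links E L (level lv nt i))"
proof -
  have c: "core (Suc (Suc i)) lv L nt nc (set B) (set K) U2 tt tc" using s by (simp add: settling_def)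
  have b: "base lv L nt nc" and ct: "contents (Suc (Suc i)) lv L nt" and rg: "reg (Suc (Suc i)) lv L nt" using c by (auto simp: core_def)
  have kl: "set (kd nt q) \<subseteq> live nt" if "q \<in> live nt" "lv q = Suc i" for q using s that by (simp add: settling_def)
  let ?P = "{p \<in> level lv nt (Suc i). length (kd nt p) \<noteq> 1}"
  show ?thesis
  proof (rule links_shrink[OF E, where P = ?P])
    show "finite (level lv nt (Suc i))" using baseD(1)[OF b] by (auto simp: level_def)
    show "L c \<inter> L d = {}" if "c \<in> level lv nt j" "d \<in> level lv nt j" "c \<noteq> d" for c d j
      by (rule baseD(8)[OF b]) (use that in \<open>auto simp: level_def\<close>)
    show "L c \<inter> L d = {}" if "c \<in> level lv nt j" "d \<in> level lv nt j" "c \<noteq> d" for c d j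
      by (rule baseD(8)[OF b]) (use that in \<open>auto simp: level_def\<close>)
    show "card (out E (L d)) = 2" if "d \<in> level lv nt (Suc i)" for d
      using str[of d] that sok_card unfolding strong_def level_def by blast
    show "?P \<subseteq> level lv nt (Suc i)" by auto
  next
    fix p assume "p \<in> ?P"
    then have p: "p \<in> live nt" "lv p = Suc i" "length (kd nt p) \<noteq> 1" by (auto simp: level_def)
    obtain c d x y where cd: "kd nt p = [c, d]" "lv p = Suc (lv c)" "lv d = lv c" "L p = L c \<union> L d" "L c \<inter> L d = {}"
      "x \<in> L c" "y \<in> L d" "{x, y} \<in> E"
      using baseD(4)[OF b p(1), unfolded shape_def] p by auto
    have "c \<in> level lv nt i" "d \<in> level lv nt i" using kl[OF p(1,2)] cd p by (auto simp: level_def)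
    moreover have "c \<noteq> d" using cd by auto
    ultimately show "\<exists>c\<in>level lv nt i. \<exists>d\<in>level lv nt i. c \<noteq> d \<and> L p = L c \<union> L d \<and> (\<exists>x\<in>L c. \<exists>y\<in>L d. {x, y} \<in> E)"
      using cd by blast
  next
    fix p assume "p \<in> level lv nt (Suc i)"
    then have p: "p \<in> live nt" "lv p = Suc i" by (auto simp: level_def)
    note sh = baseD(4)[OF b p(1)]
    have ne: "kd nt p \<noteq> []" using sh p unfolding shape_def by auto
    have "set (kd nt p) \<subseteq> level lv nt i" using kl[OF p] shape_kid(1)[OF sh] p by (auto simp: level_def)
    then show "\<exists>K\<subseteq>level lv nt i. L p = \<Union>(L ` K)" using shape_Union[OF sh ne] by blast
  next
    fix p q x y assume a: "p \<in> level lv nt (Suc i)" "q \<in> level lv nt (Suc i)" "p \<noteq> q" "x \<in> L p" "y \<in> L q" "{x, y} \<in> E"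
    then show "p \<in> ?P \<or> q \<in> ?P"
      using regD[OF rg, of p q x y] by (auto simp: level_def ok_def)
  qed
qed

text \<open>\<open>U2\<close> is completed by siblings (\<open>S\<close>), a third enlargement to at
  most 38 clusters, and becomes a union of clusters of the next level. If s of these have one child
  and p have two, then s + 2p <= 38 and 2s <= 4 + 2p, hence s + p <= 26.\<close>

lemma settled_zone:
  assumes s: "settling i U2 B K lv L nt nc tt tc"
    and str: "\<And>p. p \<in> live nt \<Longrightarrow> lv p = Suc i \<Longrightarrow> strong lv L nt p"
    and z: "zone L (level lv nt i) U2 34"
  shows "\<exists>U. U2 \<subseteq> U \<and> zone L (level lv nt (Suc i)) U 26"
proof -
  have c: "core (Suc (Suc i)) lv L nt nc (set B) (set K) U2 tt tc" using s by (simp add: settling_def)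
  have b: "base lv L nt nc" and ct: "contents (Suc (Suc i)) lv L nt" and rg: "reg (Suc (Suc i)) lv L nt" using c by (auto simp: core_def)
  have kl: "set (kd nt q) \<subseteq> live nt" if "q \<in> live nt" "lv q = Suc i" for q using s that by (simp add: settling_def)
  let ?N = "level lv nt i" and ?N' = "level lv nt (Suc i)"
  have str0: "\<And>p. p \<in> live nt \<Longrightarrow> lv p = i \<Longrightarrow> strong lv L nt p" using s by (simp add: settling_def)
  have lp: "finite ?N" "\<And>c d. c \<in> ?N \<Longrightarrow> d \<in> ?N \<Longrightarrow> c \<noteq> d \<Longrightarrow> L c \<inter> L d = {}"
    "\<And>d. d \<in> ?N \<Longrightarrow> card (out E (L d)) = 2" "\<And>d. d \<in> ?N \<Longrightarrow> L d \<subseteq> R \<and> conn E (L d) \<and> L d \<noteq> {}"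
    using level_props[OF b ct less_SucI[OF lessI]] str0 by blast+
  have lp': "finite ?N'" "\<And>c d. c \<in> ?N' \<Longrightarrow> d \<in> ?N' \<Longrightarrow> c \<noteq> d \<Longrightarrow> L c \<inter> L d = {}"
    "\<And>d. d \<in> ?N' \<Longrightarrow> card (out E (L d)) = 2" "\<And>d. d \<in> ?N' \<Longrightarrow> L d \<subseteq> R \<and> conn E (L d) \<and> L d \<noteq> {}"
    using level_props[OF b ct lessI] str by blast+
  have kN: "c \<in> ?N" "pa nt c = Some p" if "p \<in> ?N'" "c \<in> set (kd nt p)" for p c
  proof -
    have p: "p \<in> live nt" "lv p = Suc i" using that by (auto simp: level_def)
    then have "c \<in> live nt" using kl that by auto
    then show "c \<in> ?N" "pa nt c = Some p"
      using shape_kid(1)[OF baseD(4)[OF b p(1)] that(2)] p baseD(11)[OF b p(1) that(2)] by (auto simp: level_def)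
  qed
  have sh: "shape lv L (kd nt p) p" and ne: "kd nt p \<noteq> []" if "p \<in> ?N'" for p
    using baseD(4)[OF b, of p] that unfolding level_def shape_def by auto
  have pU: "L p = \<Union>(L ` set (kd nt p))" if "p \<in> ?N'" for p by (rule shape_Union[OF sh[OF that] ne[OF that]])
  have sat2: "L d \<subseteq> U2 \<or> L d \<inter> U2 = {}" if "d \<in> ?N" for d using z that by (simp add: zone_def)
  define S where "S = {d \<in> ?N. L d \<inter> U2 = {} \<and> (\<exists>p\<in>?N'. d \<in> set (kd nt p) \<and> (\<exists>c\<in>set (kd nt p). L c \<subseteq> U2))}"
  have S: "S \<subseteq> {d \<in> ?N. near E U2 (L d)}"
  proof
    fix d assume "d \<in> S"
    then obtain p c where d: "d \<in> ?N" "L d \<inter> U2 = {}" "p \<in> ?N'" "d \<in> set (kd nt p)" "c \<in> set (kd nt p)" "L c \<subseteq> U2"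
      unfolding S_def by blast
    have "c \<noteq> d" using d lp(4)[OF d(1)] by auto
    have "\<exists>x\<in>L c. \<exists>y\<in>L d. {x, y} \<in> E"
      using sh[OF d(3), unfolded shape_def]
    proof (elim disjE exE conjE)
      fix c1 d1 assume k: "kd nt p = [c1, d1]" "\<exists>x\<in>L c1. \<exists>y\<in>L d1. {x, y} \<in> E"
      then obtain x y where xy: "x \<in> L c1" "y \<in> L d1" "{x, y} \<in> E" by blast
      moreover have "{y, x} \<in> E" using xy by (simp add: insert_commute)
      moreover have "(c = c1 \<and> d = d1) \<or> (c = d1 \<and> d = c1)" using k d \<open>c \<noteq> d\<close> by auto
      ultimately show ?thesis by blast
    qed (use d \<open>c \<noteq> d\<close> in auto)
    then show "d \<in> {d \<in> ?N. near E U2 (L d)}" using d unfolding near_def by blast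
  qed
  define U where "U = U2 \<union> \<Union>(L ` S)"
  have "zone L ?N U (34 + 4)" unfolding U_def
    by (rule zone_grow[OF z lp(1) _ _ _ S]) (use lp(2-4) in blast)+
  then have zU: "Ch \<inter> R \<subseteq> U" "U \<subseteq> R" "card (out E U) \<le> 4" "card {p \<in> ?N. L p \<inter> U \<noteq> {}} \<le> 38" "theta U"
    by (auto simp: zone_def)
  have SS: "d \<in> S" if "d \<in> ?N" "x \<in> L d" "e \<in> S" "x \<in> L e" for d e x
    using lp(2)[of d e] that by (auto simp: S_def)
  have sat: "L p \<subseteq> U \<or> L p \<inter> U = {}" if p: "p \<in> ?N'" for p
  proof (cases "\<exists>c\<in>set (kd nt p). L c \<inter> U2 \<noteq> {}")
    case True
    then obtain c where c: "c \<in> set (kd nt p)" "L c \<subseteq> U2" using sat2 kN[OF p] by blast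
    have "L d \<subseteq> U" if "d \<in> set (kd nt p)" for d
    using that c p sat2[OF kN(1)[OF p that]] kN(1)[OF p that] by (auto simp: S_def U_def)
    then show ?thesis using pU[OF p] by blast
  next
    case False
    have "L c \<inter> U = {}" if c: "c \<in> set (kd nt p)" for c
    proof -
      have "c \<notin> S"
      proof
        assume "c \<in> S"
        then obtain p' e where p': "p' \<in> ?N'" "c \<in> set (kd nt p')" "e \<in> set (kd nt p')" "L e \<subseteq> U2" unfolding S_def by blast
        have "p' = p" using kN(2)[OF p c] kN(2)[OF p'(1,2)] by simp
        then have "L e \<inter> U2 = {}" using False p' by blast
        then show False using p' lp(4)[OF kN(1)[OF p'(1,3)]] by blast
      qed
      then have "L c \<inter> \<Union>(L ` S) = {}" using SS[OF kN(1)[OF p c]] by blast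
      then show ?thesis using False c unfolding U_def by blast
    qed
    then show ?thesis using pU[OF p] by blast
  qed
  define Mm where "Mm = {p \<in> ?N'. L p \<inter> U \<noteq> {}}"
  define Sg where "Sg = {p \<in> Mm. length (kd nt p) = 1}"
  define Pr where "Pr = {p \<in> Mm. length (kd nt p) = 2}"
  have finM: "finite Mm" "finite Sg" "finite Pr" using lp'(1) by (auto simp: Mm_def Sg_def Pr_def)
  have len: "length (kd nt p) = 1 \<or> length (kd nt p) = 2" if "p \<in> ?N'" for p
    using sh[OF that] ne[OF that] unfolding shape_def by auto
  have MSP: "Mm = Sg \<union> Pr" "Sg \<inter> Pr = {}" using len by (auto simp: Sg_def Pr_def Mm_def)
  have 1: "2 * card Sg \<le> card (out E U) + 2 * card Pr"
  proof (rule singles_le_pairs[OF E finM(2,3), of L])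
    show "card (out E (L d)) = 2" if "d \<in> Sg \<union> Pr" for d using lp'(3) that MSP by (auto simp: Mm_def)
    show "L c \<inter> L d = {}" if "c \<in> Sg \<union> Pr" "d \<in> Sg \<union> Pr" "c \<noteq> d" for c d using lp'(2) that MSP by (auto simp: Mm_def)
    show "\<Union>(L ` Sg) \<subseteq> U" using sat by (auto simp: Sg_def Mm_def)
    fix p x y assume p: "p \<in> Sg" and xy: "(x, y) \<in> out E (L p)" "y \<in> U"
    have pN: "p \<in> live nt" "lv p = Suc i" "length (kd nt p) = 1" using p by (auto simp: Sg_def Mm_def level_def)
    have o: "x \<in> L p" "y \<notin> L p" "{x, y} \<in> E" using xy by (auto simp: out_def)
    obtain q where q: "q \<in> live nt" "lv q = lv p" "y \<in> L q" "q \<noteq> p"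
      using strong_nbr[OF b str[OF pN(1,2)] o(1) _ o(2,3)] xy zU by blast
    have "length (kd nt q) \<noteq> 1" using regD[OF rg pN(1) q(1), of x y] pN q o by (auto simp: ok_def)
    moreover have "q \<in> ?N'" using q pN by (auto simp: level_def)
    moreover then have "q \<in> Mm" using q xy by (auto simp: Mm_def)
    ultimately have "q \<in> Pr" using len by (auto simp: Pr_def)
    then show "\<exists>q\<in>Pr. y \<in> L q \<and> p \<noteq> q" using q by blast
  qed
  have "card (\<Union>p\<in>Mm. set (kd nt p)) = (\<Sum>p\<in>Mm. card (set (kd nt p)))"
  proof (rule card_UN_disjoint[OF finM(1)])
    show "\<forall>p\<in>Mm. \<forall>q\<in>Mm. p \<noteq> q \<longrightarrow> set (kd nt p) \<inter> set (kd nt q) = {}"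
    using ccontr kN(2) by (fastforce simp: Mm_def)
  qed auto
  also have "\<dots> = (\<Sum>p\<in>Mm. length (kd nt p))"
    by (rule sum.cong[OF refl], rule distinct_card, rule shape_distinct, rule sh) (auto simp: Mm_def)
  also have "\<dots> = (\<Sum>p\<in>Sg. length (kd nt p)) + (\<Sum>p\<in>Pr. length (kd nt p))"
    unfolding MSP(1) by (rule sum.union_disjoint[OF finM(2,3) MSP(2)])
  also have "\<dots> = card Sg + 2 * card Pr" by (simp add: Sg_def Pr_def)
  finally have 2: "card (\<Union>p\<in>Mm. set (kd nt p)) = card Sg + 2 * card Pr" .
  have "(\<Union>p\<in>Mm. set (kd nt p)) \<subseteq> {p \<in> ?N. L p \<inter> U \<noteq> {}}"
  using sat pU kN(1) lp(4) by (fastforce simp: Mm_def)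
  then have "card (\<Union>p\<in>Mm. set (kd nt p)) \<le> card {p \<in> ?N. L p \<inter> U \<noteq> {}}"
    by (rule card_mono[rotated]) (use lp(1) in auto)
  then have 3: "card Sg + 2 * card Pr \<le> 38" using 2 zU by simp
  have "card Mm = card Sg + card Pr" unfolding MSP(1) by (rule card_Un_disjoint[OF finM(2,3) MSP(2)])
  then have "card Mm \<le> 26" using 1 3 zU by linarith
  then have "zone L ?N' U 26" unfolding zone_def using zU sat by (simp add: Mm_def)
  moreover have "U2 \<subseteq> U" by (auto simp: U_def)
  ultimately show ?thesis by blast
qed

lemma stage_next:
  assumes P: "phase2 i U1 U2 N L0 a n0 {} [] B K lv L nt nc tt tc" and bt: "better i (set B) lv L nt nt'"
    and sB: "\<forall>p\<in>set B. strong lv L nt' p"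
    and nb: "\<forall>p\<in>set B. \<forall>q\<in>live nt. lv q = Suc i \<longrightarrow> (\<exists>x\<in>L q. \<exists>y\<in>L p. {x, y} \<in> E) \<longrightarrow> strong lv L nt' q"
    and z: "zone L0 N U2 34"
    and F: "card (links E L0 N) * 3 ^ i \<le> 2 ^ i * card {(x, y). x \<in> R \<and> y \<in> R \<and> {x, y} \<in> E}"
    and st: "settling i U2 B K lv L nt nc tt tc"
  shows "\<exists>U. stage (Suc i) B K lv L U nt' nc tt tc"
proof -
  note D = phase2D[OF P]
  have st': "settling i U2 B K lv L nt' nc tt tc" by (rule settling_better[OF st bt])
  have l: "live nt' = live nt" and kd: "\<And>q. q \<in> live nt \<Longrightarrow> kd nt' q = kd nt q \<and> pa nt' q = pa nt q"
    and sd: "\<And>q. q \<in> live nt \<Longrightarrow> sd nt' q = sd nt q \<or> (lv q = Suc i \<and> strong lv L nt' q)"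
    using bt by (auto simp: better_def)
  have lev: "level lv nt' j = level lv nt j" for j by (simp add: level_def l)
  have str: "strong lv L nt' p" if p: "p \<in> live nt'" "lv p = Suc i" for p
  using settled_strong[OF st' p] st' p sB nb l by (fastforce simp: settling_def)
  have NL: "L p = L0 p" if "p \<in> level lv nt' i" for p using D(11,12) that lev by blast
  have N: "level lv nt' i = N" using D(11) lev by simp
  have linksN: "links E L N = links E L0 N" using D(12) unfolding links_def by auto
  have zL: "zone L N U2 34"
  proof -
    have "{p \<in> N. L p \<inter> U2 \<noteq> {}} = {p \<in> N. L0 p \<inter> U2 \<noteq> {}}" using D(12) by auto
    then show ?thesis using z D(12) unfolding zone_def by simp
  qed
  obtain U where U: "U2 \<subseteq> U" "zone L (level lv nt' (Suc i)) U 26"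
    using settled_zone[OF st' str] zL N by auto
  have c': "core (Suc (Suc i)) lv L nt' nc (set B) (set K) U tt tc"
    by (rule core_mono[of _ _ _ _ _ _ "set K" U2]) (use st' U in \<open>auto simp: settling_def\<close>)
  have so: "sides_ok (Suc i) (Suc (Suc i)) {} lv L nt'"
    unfolding sides_ok_def
  proof (intro conjI ballI impI)
    fix p assume p: "p \<in> live nt'" "lv p \<le> Suc i"
    then show "strong lv L nt' p" using str[of p] st' by (cases "lv p = Suc i") (auto simp: settling_def)
  next
    fix p assume p: "p \<in> live nt'" "Suc i < lv p" "ok (Suc (Suc i)) lv L p"
    then have pl: "p \<in> live nt" "p \<notin> set B" using D(9) l by auto
    have "weak lv L nt (set B) p" using D(2) p pl unfolding sides_ok_def by simp
    \<comment> \<open>All new clusters have level \<open>Suc i\<close>, so for a cluster of a higher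
      level it makes no difference whether they are excluded.\<close>
    then show "weak lv L nt' {} p"
      by (rule weak_cong) (use sd[OF pl(1)] p l D(9) in auto)
  qed
  have cov: "covered_kid L nt' K U"
    unfolding covered_kid_def
  using D(4) l U(1) kd by (fastforce simp: covered_kid_def)
  have t': "\<forall>q\<in>live nt'. lv q = Suc (Suc i) \<longrightarrow> L q \<inter> Ch \<noteq> {} \<longrightarrow> q \<in> set K" using D(5) l by simp
  have B': "\<forall>p\<in>set B. p \<in> live nt' \<and> lv p = Suc i \<and> pa nt' p = None \<and> L p \<subseteq> U" using D(9) l kd U by fastforce
  have "3 * card (links E L (level lv nt' (Suc i))) \<le> 2 * card (links E L0 N)"
    using settled_links[OF st' str] N linksN by simp
  then have F3: "3 * card (links E L (level lv nt' (Suc i))) * 3 ^ i \<le> 2 * card (links E L0 N) * 3 ^ i" by (rule mult_right_mono) simp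
  have F': "card (links E L (level lv nt' (Suc i))) * 3 ^ Suc i \<le> 2 ^ Suc i * card {(x, y). x \<in> R \<and> y \<in> R \<and> {x, y} \<in> E}"
  proof -
    have "card (links E L (level lv nt' (Suc i))) * 3 ^ Suc i = 3 * card (links E L (level lv nt' (Suc i))) * 3 ^ i" by simp
    also have "\<dots> \<le> 2 * (card (links E L0 N) * 3 ^ i)" using F3 by simp
    also have "\<dots> \<le> 2 * (2 ^ i * card {(x, y). x \<in> R \<and> y \<in> R \<and> {x, y} \<in> E})" using F by (rule mult_left_mono) simp
    finally show ?thesis by simp
  qed
  show ?thesis
    unfolding stage_def using c' so D(3) cov t' D(8) B' U(2) F' by blast
qed

lemma phase2_settling:
  assumes P: "phase2 i U1 U2 N L0 a n0 {} [] B K lv L nt nc tt tc"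
  shows "settling i U2 B K lv L nt nc tt tc"
  using phase2D[OF P] by (auto simp: sides_ok_def ok_def settling_def)

section \<open>The propagation loop and its running time\<close>

definition mstage where
  "mstage i s m \<longleftrightarrow> (\<exists>lv L U. stage i (fst s) (snd s) lv L U (ntab m) (ncnt m) (ttab m) (tcnt m))"

text \<open>With a <= 30 orphans after the deletions and b <= a new clusters, the three loops cost
  13|K| + 1, 14a + 1 and 21b + 1, and the nodes with the newly ordered deletions exceed the old
  number of nodes by at most b. This gives 3 + (14 + 21 + 13) * 30 = 1443. The factor 13 is the
  price of one deletion with its iteration.\<close>

lemma level_step_runs:
  assumes S: "mstage i s m"
  shows "runs (level_step s) m (\<lambda>s' t m'. frame m m' \<and> mstage (Suc i) s' m' \<and>
     t + 13 * (length (snd s') + card (live (ntab m'))) \<le> 13 * (length (snd s) + card (live (ntab m))) + 1443)"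
proof -
  obtain A K where s: "s = (A, K)" by (cases s)
  obtain lv L U where S: "stage i A K lv L U (ntab m) (ncnt m) (ttab m) (tcnt m)" using S s by (auto simp: mstage_def)
  let ?N = "level lv (ntab m) i" and ?n = "card (live (ntab m))"
  let ?U1 = "grow E L ?N U"
  let ?U2 = "grow E L ?N ?U1"
  have z: "zone L ?N U 26" and F: "card (links E L ?N) * 3 ^ i \<le> 2 ^ i * card {(x, y). x \<in> R \<and> y \<in> R \<and> {x, y} \<in> E}"
    using S by (auto simp: stage_def)
  show ?thesis
    unfolding s level_step_def prod.case
    apply (simp only: runs_bind)
    apply (rule runs_mono[OF phase1_runs[OF S]], elim conjE)
    subgoal for s1 t1 m1
    proof -
      assume t1: "t1 \<le> 13 * length K + 1" and m1: "m1 = m\<lparr>ntab := ntab m1\<rparr>"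
        and P1: "phase1 i U ?N ?n [] (fst s1) (snd s1) lv L (ntab m1) (ncnt m) (ttab m) (tcnt m)"
      obtain A1 K1 where s1: "s1 = (A1, K1)" by (cases s1)
      have e1: "ncnt m1 = ncnt m" "ttab m1 = ttab m" "tcnt m1 = tcnt m" "frame m m1"
        using arg_cong[OF m1, of ncnt] arg_cong[OF m1, of ttab] arg_cong[OF m1, of tcnt]
          arg_cong[OF m1, of vtab] arg_cong[OF m1, of etab] arg_cong[OF m1, of ecnt] by (auto simp: frame_def)
      have P1': "phase1 i U ?N ?n [] A1 K1 lv L (ntab m1) (ncnt m1) (ttab m1) (tcnt m1)" using P1 e1 s1 by simp
      note P2 = phase2_init[OF P1' z F refl refl]
      show ?thesis unfolding s1 prod.case runs_bind
        apply (rule runs_mono[OF phase2_runs[OF P2(1,2)]], elim conjE exE)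
        subgoal for s2 t2 m2 lv' L'
        proof -
          assume t2: "t2 \<le> 14 * length A1 + 1" and fr2: "frame m1 m2"
            and P3: "phase2 i ?U1 ?U2 ?N L (length A1) ?n {} [] (fst s2) (snd s2) lv' L' (ntab m2) (ncnt m2) (ttab m2) (tcnt m2)"
          obtain B K2 where s2: "s2 = (B, K2)" by (cases s2)
          have P3': "phase2 i ?U1 ?U2 ?N L (length A1) ?n {} [] B K2 lv' L' (ntab m2) (ncnt m2) (ttab m2) (tcnt m2)"
            using P3 s2 by simp
          note st = phase2_settling[OF P3']
          have Bl: "set B \<subseteq> live (ntab m2)" using phase2D(9)[OF P3'] by auto
          have lB: "length B \<le> length A1" using phase2D(13)[OF P3'] by simp
          show ?thesis unfolding s2 prod.case runs_bind
            apply (rule runs_mono[OF phase3_runs[OF st Bl]], elim conjE)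
            subgoal for u3 t3 m3
            proof -
              assume t3: "t3 \<le> 21 * length B + 1" and m3: "m3 = m2\<lparr>ntab := ntab m3\<rparr>"
                and bt: "better i (set B) lv' L' (ntab m2) (ntab m3)" and sB: "\<forall>p\<in>set B. strong lv' L' (ntab m3) p"
                and nb: "\<forall>p\<in>set B. \<forall>q\<in>live (ntab m2). lv' q = Suc i \<longrightarrow> (\<exists>x\<in>L' q. \<exists>y\<in>L' p. {x, y} \<in> E) \<longrightarrow> strong lv' L' (ntab m3) q"
              have e3: "ncnt m3 = ncnt m2" "ttab m3 = ttab m2" "tcnt m3 = tcnt m2" "frame m2 m3"
                using arg_cong[OF m3, of ncnt] arg_cong[OF m3, of ttab] arg_cong[OF m3, of tcnt]
                  arg_cong[OF m3, of vtab] arg_cong[OF m3, of etab] arg_cong[OF m3, of ecnt] by (auto simp: frame_def)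
              obtain U' where "stage (Suc i) B K2 lv' L' U' (ntab m3) (ncnt m2) (ttab m2) (tcnt m2)"
                using stage_next[OF P3' bt sB nb P2(3) F st] by blast
              then have ms: "mstage (Suc i) (B, K2) m3" unfolding mstage_def using e3 by auto
              have fr: "frame m m3" using e1(4) fr2 e3(4) frame_trans by blast
              have "card (live (ntab m3)) = card (live (ntab m2))" using bt by (simp add: better_def)
              then have "t1 + (t2 + (t3 + 0)) + 13 * (length K2 + card (live (ntab m3))) \<le> 13 * (length K + card (live (ntab m))) + 1443"
                using t1 t2 t3 P2(4) lB phase2D(14)[OF P3'] by simp
              then show ?thesis using ms fr by (simp add: runs_ret)
            qed
            done
        qed
        done
    qed
    done
qed

text \<open>Without pending work the invariant can still climb. This lifts it from the level where
  the loop stopped to level \<open>H\<close>, where it speaks about the whole forest.\<close>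

lemma stage_idle:
  assumes S: "stage i [] [] lv L U nt nc tt tc"
  shows "\<exists>U'. stage (Suc i) [] [] lv L U' nt nc tt tc"
proof -
  let ?N = "level lv nt i"
  have z: "zone L ?N U 26" and F: "card (links E L ?N) * 3 ^ i \<le> 2 ^ i * card {(x, y). x \<in> R \<and> y \<in> R \<and> {x, y} \<in> E}"
    using S by (auto simp: stage_def)
  have sub: "U \<subseteq> grow E L ?N U" by (auto simp: grow_def)
  have "core (Suc i) lv L nt nc (set []) (set [] \<union> set []) (grow E L ?N U) tt tc"
    by (rule core_mono[of _ _ _ _ _ _ "set []" U]) (use S sub in \<open>auto simp: stage_def\<close>)
  then have P: "phase1 i U ?N (card (live nt)) [] [] [] lv L nt nc tt tc"
    using S unfolding phase1_def stage_def by (simp add: dirty_def covered_kid_def)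
  note P2 = phase2_init[OF P z F refl refl]
  show ?thesis
    using stage_next[OF P2(1) _ _ _ P2(3) F phase2_settling[OF P2(1)]] better_refl by auto
qed

lemma propagate_runs:
  assumes S: "stage 0 A K lv L U (ntab m) (ncnt m) (ttab m) (tcnt m)"
  shows "runs (propagate A K) m (\<lambda>_ t m'. frame m m' \<and> (\<exists>i\<ge>H. \<exists>lv L U. stage i [] [] lv L U (ntab m') (ncnt m') (ttab m') (tcnt m')) \<and>
     t + 13 * card (live (ntab m')) \<le> 13 * (length K + card (live (ntab m))) + 1444 * (H + 1) + 1)"
proof -
  let ?I = "\<lambda>i s m'. frame m m' \<and> mstage i s m'"
  let ?pot = "\<lambda>s m'. 13 * (length (snd s) + card (live (ntab m')))"
  have "runs (while_do (\<lambda>(A, K). A \<noteq> [] \<or> K \<noteq> []) level_step (A, K)) m (\<lambda>s' t m'.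
      \<not> (case s' of (A, K) \<Rightarrow> A \<noteq> [] \<or> K \<noteq> []) \<and> (\<exists>j. ?I j s' m') \<and>
      t + ?pot s' m' \<le> ?pot (A, K) m + (1443 + 1) * (H + 1 - 0) + 1)"
  proof (rule runs_while_do[where I = ?I])
    fix i s m' assume I: "?I i s m'" and b: "case s of (A, K) \<Rightarrow> A \<noteq> [] \<or> K \<noteq> []"
    obtain A' K' where s: "s = (A', K')" by (cases s)
    obtain lv L U where S': "stage i A' K' lv L U (ntab m') (ncnt m') (ttab m') (tcnt m')"
      using I s by (auto simp: mstage_def)
    \<comment> \<open>An orphan is a live node of level \<open>i\<close>; if only \<open>K\<close>
      is nonempty, \<open>dirty\<close> supplies \<open>Suc i \<le> H\<close>.\<close>
    have "i \<le> H"
    proof (cases "A' = []")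
      case True
      then obtain q where "q \<in> set K'" using b s by (cases K') auto
      then show ?thesis using S' by (auto simp: stage_def dirty_def)
    next
      case False
      then obtain p where "p \<in> set A'" by (cases A') auto
      then have "p \<in> live (ntab m')" "lv p = i" using S' by (auto simp: stage_def)
      moreover have "base lv L (ntab m') (ncnt m')" using S' by (auto simp: stage_def core_def)
      ultimately show ?thesis using baseD(5) by blast
    qed
    moreover have "runs (level_step s) m' (\<lambda>s' t m''. ?I (Suc i) s' m'' \<and> t + ?pot s' m'' \<le> ?pot s m' + 1443)"
      by (rule runs_mono[OF level_step_runs]) (use I frame_trans in auto)
    ultimately show "i \<le> H \<and> runs (level_step s) m' (\<lambda>s' t m''. ?I (Suc i) s' m'' \<and> t + ?pot s' m'' \<le> ?pot s m' + 1443)" by blast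
  next
    show "?I 0 (A, K) m" using S frame_refl by (auto simp: mstage_def)
  qed
  then show ?thesis
    unfolding propagate_def runs_bind
  proof (rule runs_mono, elim conjE exE)
    fix s t m' j assume e: "\<not> (case s of (A, K) \<Rightarrow> A \<noteq> [] \<or> K \<noteq> [])" and fr: "frame m m'" and st: "mstage j s m'"
      and t: "t + ?pot s m' \<le> ?pot (A, K) m + (1443 + 1) * (H + 1 - 0) + 1"
    have s: "s = ([], [])" using e by (cases s) auto
    obtain lv L U where "stage j [] [] lv L U (ntab m') (ncnt m') (ttab m') (tcnt m')" using st s by (auto simp: mstage_def)
    then have up: "\<exists>U. stage (j + n) [] [] lv L U (ntab m') (ncnt m') (ttab m') (tcnt m')" for n
      by (induction n) (use stage_idle in fastforce)+
    have "\<exists>i\<ge>H. \<exists>lv L U. stage i [] [] lv L U (ntab m') (ncnt m') (ttab m') (tcnt m')"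
      using up[of H] le_add2[of H j] by blast
    then show "runs (ret ()) m' (\<lambda>_ t' m''. frame m m'' \<and> (\<exists>i\<ge>H. \<exists>lv L U. stage i [] [] lv L U (ntab m'') (ncnt m'') (ttab m'') (tcnt m'')) \<and>
     t + t' + 13 * card (live (ntab m'')) \<le> 13 * (length K + card (live (ntab m))) + 1444 * (H + 1) + 1)"
      using fr t s by (simp add: runs_ret)
  qed
qed

end


lemma (in env) sok_map:
  assumes "sok rp X s" "\<And>d s. d \<in> out E X \<Longrightarrow> rp d s \<Longrightarrow> rp' d (g s)"
  shows "sok rp' X (map_prod g g s)"
  using assms unfolding sok_def by (metis fst_map_prod snd_map_prod insertI1 insertI2)

lemma (in env) base_change:
  assumes b: "base lv L nt nc" and R': "\<And>p. p \<in> live nt \<Longrightarrow> L p \<subseteq> R'"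
    and Z': "\<And>p x. (p, x) \<in> Z' \<Longrightarrow> p \<in> live nt \<and> lv p = 0 \<and> L p = {x}" and E': "E \<subseteq> E'"
  shows "env.base E' R' H Z' lv L nt nc"
  unfolding env.base_def
proof (intro conjI ballI allI impI)
  show "finite (live nt)" by (rule baseD(1)[OF b])
  show "p \<in> live nt" "lv p = 0" "L p = {x}" if "(p, x) \<in> Z'" for p x using Z'[OF that] by auto
  fix q assume q: "q \<in> live nt"
  show "q < nc" "lv q \<le> H" "L q \<noteq> {}" using baseD(2,5,6)[OF b q] by simp_all
  show "env.shape E' lv L (kd nt q) q" using baseD(4)[OF b q] E' unfolding env.shape_def by blast
  show "L q \<subseteq> R'" by (rule R'[OF q])
  show "c < nc" if "c \<in> set (kd nt q)" for c by (rule baseD(3)[OF b q that])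
  show "L q \<inter> L r = {}" if "r \<in> live nt" "lv q = lv r" "q \<noteq> r" for r by (rule baseD(8)[OF b q that])
  show "pa nt c = Some q" if "c \<in> set (kd nt q)" "c \<in> live nt" for c by (rule baseD(11)[OF b q that])
  fix r assume r: "pa nt q = Some r"
  show "r \<in> live nt" "q \<in> set (kd nt r)" by (rule baseD(9)[OF b q r], rule baseD(10)[OF b q r])
qed

section \<open>The regular forest\<close>

text \<open>The state at rest: \<open>core\<close> without any exceptions. No vertex counts as
  changed, the index \<open>Suc H\<close> makes every node \<open>ok\<close>, and the table itself
  serves as \<open>TT\<close>.\<close>

definition forest where
  "forest E W R H TE lv L nt nc tt tc \<longleftrightarrow>
     env.core E W R R {} H TE tt {} (Suc H) lv L nt nc {} {} {} tt tc \<and> (\<forall>p\<in>live nt. env.strong E W R lv L nt p)"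

definition trees :: "(nat \<Rightarrow> node option) \<Rightarrow> nat set" where
  "trees nt = {p \<in> live nt. pa nt p = None}"

lemma forestD:
  assumes F: "forest E W R H TE lv L nt nc tt tc"
  shows "env.base E R H {} lv L nt nc"
    "\<And>p. p \<in> live nt \<Longrightarrow> env.strong E W R lv L nt p"
    "\<And>p. p \<in> live nt \<Longrightarrow> L p \<subseteq> R \<and> conn E (L p) \<and> ww nt p = env.inner E W (L p)"
    "\<And>p q x y. p \<in> live nt \<Longrightarrow> q \<in> live nt \<Longrightarrow> p \<noteq> q \<Longrightarrow> lv p = lv q \<Longrightarrow> length (kd nt p) = 1 \<Longrightarrow> length (kd nt q) = 1 \<Longrightarrow>
       x \<in> L p \<Longrightarrow> y \<in> L q \<Longrightarrow> {x, y} \<notin> E"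
    "\<And>p. p \<in> trees nt \<Longrightarrow> env.is_root TE lv nt tt p"
    "inj_on (te nt) (trees nt)" "dom tt = TE \<union> {t. Some t \<in> te nt ` trees nt}" "\<And>t. t \<in> dom tt \<Longrightarrow> t < tc"
    "\<And>q c. q \<in> live nt \<Longrightarrow> c \<in> set (kd nt q) \<Longrightarrow> c \<in> live nt"
proof -
  have c: "env.core E W R R {} H TE tt {} (Suc H) lv L nt nc {} {} {} tt tc" using F by (simp add: forest_def)
  show b: "env.base E R H {} lv L nt nc" using c by (simp add: env.core_def)
  show "\<And>p. p \<in> live nt \<Longrightarrow> env.strong E W R lv L nt p" using F by (simp add: forest_def)
  have ok: "env.ok {} (Suc H) lv L p" for p by (simp add: env.ok_def)
  show "\<And>p. p \<in> live nt \<Longrightarrow> L p \<subseteq> R \<and> conn E (L p) \<and> ww nt p = env.inner E W (L p)"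
    using c ok by (simp add: env.core_def env.contents_def)
  show "{x, y} \<notin> E" if "p \<in> live nt" "q \<in> live nt" "p \<noteq> q" "lv p = lv q" "length (kd nt p) = 1" "length (kd nt q) = 1"
    "x \<in> L p" "y \<in> L q" for p q x y
  proof -
    have "env.reg E {} (Suc H) lv L nt" using c by (simp add: env.core_def)
    then show ?thesis using env.regD ok that by blast
  qed
  have own: "env.own {} (Suc H) lv L nt {} = trees nt" using ok by (auto simp: env.own_def trees_def)
  have r: "env.roots {} TE tt (Suc H) lv L nt {} tt tc" using c by (simp add: env.core_def)
  show "\<And>p. p \<in> trees nt \<Longrightarrow> env.is_root TE lv nt tt p" "inj_on (te nt) (trees nt)"
    "dom tt = TE \<union> {t. Some t \<in> te nt ` trees nt}" "\<And>t. t \<in> dom tt \<Longrightarrow> t < tc"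
    using r unfolding env.roots_def own by auto
  show "\<And>q c. q \<in> live nt \<Longrightarrow> c \<in> set (kd nt q) \<Longrightarrow> c \<in> live nt"
    using c by (simp add: env.core_def env.kids_ok_def)
qed

lemma (in arena) stage_forest:
  assumes S: "stage i [] [] lv L U nt nc tt tc" and i: "H \<le> i"
  shows "forest E W R H TE lv L nt nc tt tc" "\<And>t. t \<in> TE \<Longrightarrow> tt t = TT t"
    "\<And>p x. (p, x) \<in> Z \<Longrightarrow> p \<in> live nt \<and> lv p = 0 \<and> L p = {x}"
proof -
  have c: "core (Suc i) lv L nt nc {} {} U tt tc" and so: "sides_ok i (Suc i) {} lv L nt" using S by (auto simp: stage_def)
  have b: "base lv L nt nc" and ct: "contents (Suc i) lv L nt" and rg: "reg (Suc i) lv L nt" and r: "roots (Suc i) lv L nt {} tt tc"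
    and ko: "kids_ok L nt {} U" using c by (auto simp: core_def)
  show "\<And>p x. (p, x) \<in> Z \<Longrightarrow> p \<in> live nt \<and> lv p = 0 \<and> L p = {x}" by (rule baseD(12)[OF b])
  have okl: "ok (Suc i) lv L p" if "p \<in> live nt" for p using baseD(5)[OF b that] i by (simp add: ok_def)
  have ok': "env.ok {} (Suc H) lv L p" for p by (simp add: env.ok_def)
  show "\<And>t. t \<in> TE \<Longrightarrow> tt t = TT t" using r by (simp add: roots_def)
  have "\<forall>p\<in>live nt. strong lv L nt p" using so baseD(5)[OF b] i unfolding sides_ok_def by (meson le_trans)
  moreover have "env.base E R H {} lv L nt nc"
    by (rule base_change[OF b]) (use ct okl in \<open>simp_all add: contents_def\<close>)
  moreover have "env.contents E W R {} (Suc H) lv L nt" using ct okl unfolding contents_def env.contents_def by simp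
  moreover have "env.reg E {} (Suc H) lv L nt" using rg okl unfolding reg_def env.reg_def by simp
  moreover have "env.own {} (Suc H) lv L nt {} = own (Suc i) lv L nt {}" using ok' okl by (auto simp: own_def env.own_def)
  then have "env.roots {} TE tt (Suc H) lv L nt {} tt tc" using r unfolding roots_def env.roots_def by simp
  moreover have "env.kids_ok R L nt {} {}" using ko unfolding kids_ok_def env.kids_ok_def by simp
  ultimately show "forest E W R H TE lv L nt nc tt tc" unfolding forest_def env.core_def by simp
qed

lemma up_live: "p \<in> live (ntab m) \<Longrightarrow> up m p = (case pa (ntab m) p of None \<Rightarrow> p | Some q \<Rightarrow> q)"
  using live_ex[of p "ntab m"] view_mem(1)[of m p] by (auto simp: up_def split: option.splits)

lemma forest_up:
  assumes F: "forest E W R H TE lv L (ntab m) nc tt tc" and l: "l \<in> live (ntab m)" "lv l = 0" "L l = {x}"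
  shows "p \<in> live (ntab m) \<Longrightarrow> x \<in> L p \<Longrightarrow> (up m ^^ lv p) l = p"
proof (induction "lv p" arbitrary: p)
  case 0
  note b = forestD(1)[OF F]
  have "p = l" using env.baseD(8)[OF b 0(2) l(1)] 0 l by auto
  then show ?case using l by simp
next
  case (Suc k)
  note b = forestD(1)[OF F]
  have sh: "env.shape E lv L (kd (ntab m) p) p" by (rule env.baseD(4)[OF b Suc(3)])
  have ne: "kd (ntab m) p \<noteq> []" using sh Suc(2) unfolding env.shape_def by auto
  obtain c where c: "c \<in> set (kd (ntab m) p)" "x \<in> L c" using Suc(4) unfolding env.shape_Union[OF sh ne] by blast
  have cl: "c \<in> live (ntab m)" using forestD(9)[OF F Suc(3) c(1)] .
  have lc: "lv p = Suc (lv c)" by (rule env.shape_kid(1)[OF sh c(1)])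
  have "(up m ^^ lv c) l = c" using Suc(1)[of c] Suc(2) lc cl c by simp
  moreover have "pa (ntab m) c = Some p" by (rule env.baseD(11)[OF b Suc(3) c(1) cl])
  ultimately show ?case using lc up_live[OF cl] by simp
qed

lemma up_tree: "p \<in> trees (ntab m) \<Longrightarrow> (up m ^^ n) p = p"
  by (induction n) (auto simp: trees_def up_live)

text \<open>Disjointness in \<open>base\<close> only concerns clusters of equal level. For roots of
  different levels: both are reached by going up from the leaf of \<open>x\<close>, and
  \<open>up\<close> does not move beyond the lower one.\<close>

lemma forest_tree_unique:
  fixes m :: mem
  assumes F: "forest E W R H TE lv L (ntab m) nc tt tc" and l: "l \<in> live (ntab m)" "lv l = 0" "L l = {x}"
    and p: "p \<in> trees (ntab m)" "x \<in> L p" and q: "q \<in> trees (ntab m)" "x \<in> L q"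
  shows "p = q"
proof -
  have *: "r = s" if r: "r \<in> trees (ntab m)" "x \<in> L r" and s: "s \<in> trees (ntab m)" "x \<in> L s" and le: "lv r \<le> lv s" for r s
  proof -
    have 1: "(up m ^^ lv r) l = r" "(up m ^^ lv s) l = s" using forest_up[OF F l] r s by (auto simp: trees_def)
    have "(up m ^^ lv s) l = (up m ^^ (lv s - lv r)) ((up m ^^ lv r) l)"
      using le by (metis comp_apply funpow_add le_add_diff_inverse2)
    then show ?thesis using 1 up_tree[OF r(1)] by simp
  qed
  show ?thesis using *[OF p q] *[OF q p] by (cases "lv p \<le> lv q") auto
qed

lemma forest_tree_closed:
  assumes F: "forest E W R H TE lv L nt nc tt tc" and p: "p \<in> trees nt" and xy: "x \<in> L p" "y \<in> R" "{x, y} \<in> E"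
  shows "y \<in> L p"
  using xy forestD(5)[OF F p] p forestD(2)[OF F] env.sok_dart by (fastforce simp: out_def env.is_root_def trees_def env.strong_def env.srep_def)

text \<open>Two tables are needed because in a merge the walk also takes place when sides have
  already been edited. Parents and root entries are still those of \<open>m0\<close>, and only these
  are read.\<close>

lemma topological_edge_of_runs:
  assumes F: "forest E W R H TE lv L (ntab m0) nc tt tc" and p: "p \<in> live (ntab m0)"
    and m: "live (ntab m0) \<subseteq> live (ntab m)" "\<And>q. q \<in> live (ntab m0) \<Longrightarrow> pa (ntab m) q = pa (ntab m0) q \<and> te (ntab m) q = te (ntab m0) q"
  shows "runs (topological_edge_of p) m (\<lambda>t' t m'. m' = m \<and> t \<le> 2 * H + 4 \<and>
     (\<exists>r\<in>trees (ntab m0). L p \<subseteq> L r \<and> te (ntab m0) r = Some t'))"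
proof -
  note b = forestD(1)[OF F]
  obtain r where r: "ntab m p = Some r" using live_ex[OF subsetD[OF m(1) p]] by blast
  let ?I = "\<lambda>i s m'. m' = m \<and> (\<exists>q\<in>live (ntab m0). ntab m q = Some s \<and> L p \<subseteq> L q \<and> lv q = i)"
  have W: "runs (while_do (\<lambda>r. parent r \<noteq> None) (\<lambda>r. read_node (the (parent r))) r) m (\<lambda>s t m'.
      \<not> parent s \<noteq> None \<and> (\<exists>j. ?I j s m') \<and> t + 0 \<le> 0 + (1 + 1) * (H + 1 - lv p) + 1)"
  proof (rule runs_while_do[where I = ?I and pot = "\<lambda>_ _. 0"])
    fix i s m' assume I: "?I i s m'" and "parent s \<noteq> None"
    then obtain q q' where q: "q \<in> live (ntab m0)" "ntab m q = Some s" "L p \<subseteq> L q" "lv q = i" "parent s = Some q'" by auto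
    have pq: "pa (ntab m0) q = Some q'" using m(2)[OF q(1)] view_mem(1)[OF q(2)] q by simp
    have q': "q' \<in> live (ntab m0)" "lv q' = Suc i" "L p \<subseteq> L q'" "lv q \<le> H"
      using env.baseD(9)[OF b q(1) pq] env.base_pa_lv[OF b q(1) pq] q env.baseD(5)[OF b q(1)] by auto
    obtain r' where r': "ntab m q' = Some r'" using live_ex[OF subsetD[OF m(1) q'(1)]] by blast
    show "i \<le> H \<and> runs (read_node (the (parent s))) m' (\<lambda>s' t m''. ?I (Suc i) s' m'' \<and> t + 0 \<le> 0 + 1)"
      using q q' r' I by (auto simp: runs_read_node)
  next
    show "?I (lv p) r m" using p r by auto
  qed
  show ?thesis
    unfolding topological_edge_of_def runs_bind runs_read_node
    apply (intro exI[of _ r] conjI r)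
    apply (rule runs_mono[OF W], elim conjE exE bexE)
    subgoal for s t m' j q
    proof -
      assume a: "\<not> parent s \<noteq> None" "t + 0 \<le> 0 + (1 + 1) * (H + 1 - lv p) + 1" "m' = m" "q \<in> live (ntab m0)" "ntab m q = Some s" "L p \<subseteq> L q"
      have "pa (ntab m) q = None" using view_mem(1)[OF a(5)] a(1) by simp
      then have q: "q \<in> trees (ntab m0)" using m(2)[OF a(4)] a(4) by (simp add: trees_def)
      obtain t' where "te (ntab m0) q = Some t'" using forestD(5)[OF F q] unfolding env.is_root_def by blast
      moreover have "top_edge s = te (ntab m0) q" using view_mem(5)[OF a(5)] m(2)[OF a(4)] by simp
      ultimately show ?thesis using q a by (auto simp: runs_ret)
    qed
    done
qed

text \<open>At the start the region consists of the changed vertices that are regular now. The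
  bounds on exits and on \<open>card Ch\<close> are those of \<open>zone\<close>; the actual
  \<open>Ch\<close> is a vertex with its two neighbours.\<close>

lemma (in arena) stage_start:
  assumes b: "base lv L nt nc"
    and ct: "\<And>p. p \<in> live nt \<Longrightarrow> L p \<inter> Ch = {} \<or> lv p = 0 \<Longrightarrow> L p \<subseteq> R \<and> conn E (L p) \<and> ww nt p = inner (L p)"
    and rg: "\<And>p q x y. p \<in> live nt \<Longrightarrow> q \<in> live nt \<Longrightarrow> p \<noteq> q \<Longrightarrow> lv p = lv q \<Longrightarrow> length (kd nt p) = 1 \<Longrightarrow> length (kd nt q) = 1 \<Longrightarrow>
       x \<in> L p \<Longrightarrow> y \<in> L q \<Longrightarrow> {x, y} \<notin> E"
    and r: "roots (Suc 0) lv L nt (set A) tt tc"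
    and kids: "\<And>q c. q \<in> live nt \<Longrightarrow> c \<in> set (kd nt q) \<Longrightarrow> c \<notin> live nt \<Longrightarrow> q \<in> set K \<and> L c \<inter> R = {}"
    and str: "\<And>p. p \<in> live nt \<Longrightarrow> lv p = 0 \<Longrightarrow> strong lv L nt p"
    and wk: "\<And>p. p \<in> live nt \<Longrightarrow> 0 < lv p \<Longrightarrow> L p \<inter> Ch = {} \<Longrightarrow> weak lv L nt {} p"
    and K: "\<And>q. q \<in> set K \<Longrightarrow> q \<in> live nt \<and> lv q = Suc 0 \<and> (\<exists>c\<in>set (kd nt q). L c \<subseteq> Ch)"
    and tch: "\<And>q c. q \<in> live nt \<Longrightarrow> lv q = Suc 0 \<Longrightarrow> c \<in> set (kd nt q) \<Longrightarrow> L c \<inter> Ch \<noteq> {} \<Longrightarrow> q \<in> set K"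
    and A: "distinct A" "\<And>p. p \<in> set A \<Longrightarrow> p \<in> live nt \<and> lv p = 0 \<and> pa nt p = None \<and> L p \<subseteq> Ch"
    and o: "card (out E (Ch \<inter> R)) \<le> 4" "finite Ch" "card Ch \<le> 26"
  shows "stage 0 A K lv L (Ch \<inter> R) nt nc tt tc"
proof -
  have sing: "\<exists>x. L p = {x}" if "p \<in> live nt" "lv p = 0" for p
    using baseD(4)[OF b that(1)] that(2) unfolding shape_def by auto
  have c: "core (Suc 0) lv L nt nc (set A) (set K) (Ch \<inter> R) tt tc"
    unfolding core_def
  proof (intro conjI b r)
    show "contents (Suc 0) lv L nt" using ct unfolding contents_def ok_def by blast
    show "reg (Suc 0) lv L nt" using rg unfolding reg_def by blast
    show "kids_ok L nt (set K) (Ch \<inter> R)" using kids unfolding kids_ok_def by blast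
  qed
  have so: "sides_ok 0 (Suc 0) {} lv L nt" using str wk unfolding sides_ok_def ok_def by auto
  have dK: "dirty lv nc (Suc 0) K" using K baseD(2)[OF b] H1 unfolding dirty_def by auto
  have cK: "covered_kid L nt K (Ch \<inter> R)" using K unfolding covered_kid_def by blast
  have t: "\<forall>q\<in>live nt. lv q = Suc 0 \<longrightarrow> L q \<inter> Ch \<noteq> {} \<longrightarrow> q \<in> set K"
  proof (intro ballI impI)
    fix q assume q: "q \<in> live nt" "lv q = Suc 0" "L q \<inter> Ch \<noteq> {}"
    note sh = baseD(4)[OF b q(1)]
    have ne: "kd nt q \<noteq> []" using sh q unfolding shape_def by auto
    then obtain c where "c \<in> set (kd nt q)" "L c \<inter> Ch \<noteq> {}" using q(3) unfolding shape_Union[OF sh ne] by blast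
    then show "q \<in> set K" using tch q by blast
  qed
  have z: "zone L (level lv nt 0) (Ch \<inter> R) 26"
    unfolding zone_def
  proof (intro conjI)
    show "theta (Ch \<inter> R)" unfolding theta_def by blast
    show "\<forall>p\<in>level lv nt 0. L p \<subseteq> Ch \<inter> R \<or> L p \<inter> (Ch \<inter> R) = {}" using sing unfolding level_def by fastforce
    let ?M = "{p \<in> level lv nt 0. L p \<inter> (Ch \<inter> R) \<noteq> {}}"
    have inj: "inj_on (\<lambda>p. the_elem (L p)) ?M"
    proof (rule inj_onI, rule ccontr)
      fix p q assume pq: "p \<in> ?M" "q \<in> ?M" "the_elem (L p) = the_elem (L q)" "p \<noteq> q"
      have "L p \<inter> L q = {}" using baseD(8)[OF b, of p q] pq by (auto simp: level_def)
      moreover obtain x y where "L p = {x}" "L q = {y}" using sing[of p] sing[of q] pq by (auto simp: level_def)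
      ultimately show False using pq by simp
    qed
    have "(\<lambda>p. the_elem (L p)) ` ?M \<subseteq> Ch"
    using sing by (fastforce simp: level_def)
    then have "card ?M \<le> card Ch" using card_inj_on_le[OF inj] o by blast
    then show "card ?M \<le> 26" using o by simp
  qed (use o in auto)
  have "links E L (level lv nt 0) \<subseteq> {(x, y). x \<in> R \<and> y \<in> R \<and> {x, y} \<in> E}"
  using ct by (auto simp: links_def level_def)
  moreover have "finite {(x, y). x \<in> R \<and> y \<in> R \<and> {x, y} \<in> E}"
    by (rule finite_subset[of _ "R \<times> R"]) (use finR in auto)
  ultimately have F: "card (links E L (level lv nt 0)) * 3 ^ 0 \<le> 2 ^ 0 * card {(x, y). x \<in> R \<and> y \<in> R \<and> {x, y} \<in> E}"
    using card_mono by fastforce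
  have A2: "\<forall>p\<in>set A. p \<in> live nt \<and> lv p = 0 \<and> pa nt p = None \<and> L p \<subseteq> Ch \<inter> R" using A(2) ct by blast
  show ?thesis unfolding stage_def using c so dK cK t A(1) A2 z F by blast
qed


section \<open>The complete invariant\<close>

definition eset :: "edge \<Rightarrow> nat set" where
  "eset re = {fst (eends re), snd (eends re)}"

text \<open>The part of the invariant that concerns the graph only. It does not depend on which
  vertices are regular and survives all work on the forest (\<open>gm_cong\<close>).\<close>

definition gm :: "nat set set \<Rightarrow> (nat set \<Rightarrow> real) \<Rightarrow> nat set \<Rightarrow> mem \<Rightarrow> bool" where
  "gm E W V m \<longleftrightarrow> dom (vtab m) = V \<and> (\<forall>e\<in>E. e \<subseteq> V) \<and>
     (\<forall>k re. etab m k = Some re \<longrightarrow> k < ecnt m \<and> fst (eends re) \<noteq> snd (eends re) \<and> eset re \<in> E \<and> ewt re = W (eset re)) \<and>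
     (\<forall>k k' re re'. etab m k = Some re \<longrightarrow> etab m k' = Some re' \<longrightarrow> eset re = eset re' \<longrightarrow> k = k') \<and>
     (\<forall>e\<in>E. \<exists>k re. etab m k = Some re \<and> eset re = e) \<and>
     (\<forall>v rv. vtab m v = Some rv \<longrightarrow> distinct (inc rv) \<and> set (inc rv) = {k. \<exists>re. etab m k = Some re \<and> v \<in> eset re})"

lemma gmD:
  assumes "gm E W V m"
  shows "dom (vtab m) = V" "e \<in> E \<Longrightarrow> e \<subseteq> V"
    "etab m k = Some re \<Longrightarrow> k < ecnt m \<and> fst (eends re) \<noteq> snd (eends re) \<and> eset re \<in> E \<and> ewt re = W (eset re)"
    "etab m k = Some re \<Longrightarrow> etab m k' = Some re' \<Longrightarrow> eset re = eset re' \<Longrightarrow> k = k'"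
    "e \<in> E \<Longrightarrow> \<exists>k re. etab m k = Some re \<and> eset re = e"
    "vtab m v = Some rv \<Longrightarrow> distinct (inc rv) \<and> set (inc rv) = {k. \<exists>re. etab m k = Some re \<and> v \<in> eset re}"
  using assms unfolding gm_def by meson+

text \<open>\<open>etop\<close> is left out, since it is set and cleared when an edge becomes or
  ceases to be a topological edge by itself.\<close>

definition same_edges :: "mem \<Rightarrow> mem \<Rightarrow> bool" where
  "same_edges m m' \<longleftrightarrow> ecnt m' = ecnt m \<and>
     (\<forall>k. map_option (\<lambda>r. (eends r, ewt r)) (etab m' k) = map_option (\<lambda>r. (eends r, ewt r)) (etab m k))"

lemma same_edgesD:
  assumes "same_edges m m'"
  shows "etab m k = Some re \<Longrightarrow> \<exists>re'. etab m' k = Some re' \<and> eends re' = eends re \<and> ewt re' = ewt re"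
    and "etab m' k = Some re' \<Longrightarrow> \<exists>re. etab m k = Some re \<and> eends re' = eends re \<and> ewt re' = ewt re"
proof -
  have *: "map_option (\<lambda>r. (eends r, ewt r)) (etab m' k) = map_option (\<lambda>r. (eends r, ewt r)) (etab m k)"
    using assms by (simp add: same_edges_def)
  show "etab m k = Some re \<Longrightarrow> \<exists>re'. etab m' k = Some re' \<and> eends re' = eends re \<and> ewt re' = ewt re"
    using * by (cases "etab m' k") auto
  show "etab m' k = Some re' \<Longrightarrow> \<exists>re. etab m k = Some re \<and> eends re' = eends re \<and> ewt re' = ewt re"
    using * by (cases "etab m k") auto
qed

lemma gm_cong:
  assumes g: "gm E W V m" and s: "same_edges m m'" and d: "dom (vtab m') = dom (vtab m)"
    and i: "\<And>v rv'. vtab m' v = Some rv' \<Longrightarrow> \<exists>rv. vtab m v = Some rv \<and> inc rv' = inc rv"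
  shows "gm E W V m'"
proof -
  note sd = same_edgesD[OF s]
  have es: "eset r = eset r'" if "eends r = eends r'" for r r' using that by (simp add: eset_def)
  have 1: "{k. \<exists>re. etab m' k = Some re \<and> v \<in> eset re} = {k. \<exists>re. etab m k = Some re \<and> v \<in> eset re}" for v
    using sd es by (metis (no_types, lifting))
  have 2: "k < ecnt m' \<and> fst (eends re) \<noteq> snd (eends re) \<and> eset re \<in> E \<and> ewt re = W (eset re)" if k: "etab m' k = Some re" for k re
  proof -
    obtain re0 where r: "etab m k = Some re0" "eends re = eends re0" "ewt re = ewt re0" using sd(2)[OF k] by blast
    then show ?thesis using g s es[OF r(2)] by (simp add: gm_def same_edges_def)
  qed
  have 3: "k = k'" if a: "etab m' k = Some re" "etab m' k' = Some re'" "eset re = eset re'" for k k' re re'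
  by (metis sd(2)[OF a(1)] sd(2)[OF a(2)] es a(3) gmD(4)[OF g])
  have 4: "\<exists>k re. etab m' k = Some re \<and> eset re = e" if "e \<in> E" for e
  proof -
    obtain k re where "etab m k = Some re" "eset re = e" using gmD(5)[OF g \<open>e \<in> E\<close>] by blast
    then show ?thesis using sd(1) es by metis
  qed
  have 5: "distinct (inc rv) \<and> set (inc rv) = {k. \<exists>re. etab m' k = Some re \<and> v \<in> eset re}" if "vtab m' v = Some rv" for v rv
    unfolding 1 using i[OF that] g unfolding gm_def by auto
  have 6: "dom (vtab m') = V" "\<forall>e\<in>E. e \<subseteq> V" using g d by (simp_all add: gm_def)
  show ?thesis unfolding gm_def
  proof (intro conjI)
    show "dom (vtab m') = V" by (rule 6(1))
    show "\<forall>e\<in>E. e \<subseteq> V" by (rule 6(2))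
    show "\<forall>k re. etab m' k = Some re \<longrightarrow> k < ecnt m' \<and> fst (eends re) \<noteq> snd (eends re) \<and> eset re \<in> E \<and> ewt re = W (eset re)"
      using 2 by blast
    show "\<forall>k k' re re'. etab m' k = Some re \<longrightarrow> etab m' k' = Some re' \<longrightarrow> eset re = eset re' \<longrightarrow> k = k'" using 3 by blast
    show "\<forall>e\<in>E. \<exists>k re. etab m' k = Some re \<and> eset re = e" using 4 by blast
    show "\<forall>v rv. vtab m' v = Some rv \<longrightarrow> distinct (inc rv) \<and> set (inc rv) = {k. \<exists>re. etab m' k = Some re \<and> v \<in> eset re}"
      using 5 by blast
  qed
qed

lemma gm_inc_length:
  assumes g: "gm E W V m" and v: "vtab m v = Some rv"
  shows "length (inc rv) = card {e \<in> E. v \<in> e}"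
proof -
  let ?f = "\<lambda>k. eset (the (etab m k))"
  have s: "distinct (inc rv)" "set (inc rv) = {k. \<exists>re. etab m k = Some re \<and> v \<in> eset re}" using g v by (auto simp: gm_def)
  have "bij_betw ?f (set (inc rv)) {e \<in> E. v \<in> e}"
    unfolding bij_betw_def
  proof
    show "inj_on ?f (set (inc rv))"
    proof (rule inj_onI)
      fix k k' assume "k \<in> set (inc rv)" "k' \<in> set (inc rv)" and e: "?f k = ?f k'"
      then obtain re re' where "etab m k = Some re" "etab m k' = Some re'" using s by auto
      then show "k = k'" using g e unfolding gm_def by fastforce
    qed
    show "?f ` set (inc rv) = {e \<in> E. v \<in> e}"
    proof
      show "?f ` set (inc rv) \<subseteq> {e \<in> E. v \<in> e}" unfolding s using g by (auto simp: gm_def)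
      show "{e \<in> E. v \<in> e} \<subseteq> ?f ` set (inc rv)"
      proof
        fix e assume e: "e \<in> {e \<in> E. v \<in> e}"
        then obtain k re where k: "etab m k = Some re" "eset re = e" using gmD(5)[OF g, of e] by blast
        then have "k \<in> set (inc rv)" using s e by auto
        then show "e \<in> ?f ` set (inc rv)" using k by force
      qed
    qed
  qed
  then have "card (set (inc rv)) = card {e \<in> E. v \<in> e}" by (rule bij_betw_same_card)
  then show ?thesis using distinct_card[OF s(1)] by simp
qed

definition vn :: "nat set \<Rightarrow> (nat \<Rightarrow> nat) \<Rightarrow> (nat \<Rightarrow> nat set) \<Rightarrow> mem \<Rightarrow> bool" where
  "vn R lv L m \<longleftrightarrow> (\<forall>v rv. vtab m v = Some rv \<longrightarrow>
     (if v \<in> R then \<exists>l\<in>live (ntab m). vnode rv = Some l \<and> lv l = 0 \<and> L l = {v} else vnode rv = None))"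

definition direct :: "mem \<Rightarrow> nat set \<Rightarrow> nat set" where
  "direct m R = {k. \<exists>re. etab m k = Some re \<and> eset re \<inter> R = {}}"

definition tops :: "mem \<Rightarrow> nat set \<Rightarrow> nat set" where
  "tops m Q = {t. \<exists>k\<in>Q. \<exists>re. etab m k = Some re \<and> etop re = Some t}"

definition dirs :: "mem \<Rightarrow> nat set \<Rightarrow> bool" where
  "dirs m Q \<longleftrightarrow>
     (\<forall>k\<in>Q. \<exists>re t. etab m k = Some re \<and> etop re = Some t \<and> ttab m t = Some \<lparr> tends = eends re, twt = ewt re \<rparr>) \<and>
     (\<forall>k\<in>Q. \<forall>k'\<in>Q. \<forall>re re'. etab m k = Some re \<longrightarrow> etab m k' = Some re' \<longrightarrow> etop re = etop re' \<longrightarrow> k = k')"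

text \<open>The invariant between operations. \<open>R\<close> is a parameter because during an edge
  insertion both ends are treated as singular, whatever their degrees are.\<close>

definition full where
  "full E W V R H m \<longleftrightarrow> gm E W V m \<and> R \<subseteq> V \<and> dirs m (direct m R) \<and> (\<exists>lv L. vn R lv L m \<and>
     forest E W R H (tops m (direct m R)) lv L (ntab m) (ncnt m) (ttab m) (tcnt m))"

text \<open>What the proof needs to know about the graph alone. It is inherited by smaller sets
  \<open>R\<close> (\<open>sound_subset\<close>), which covers the intermediate states of an edge
  insertion.\<close>

definition sound where
  "sound E R H \<longleftrightarrow> simple_edges E \<and> finite R \<and> acyclic_on E R \<and> 1 \<le> H \<and>
     card {(x, y). x \<in> R \<and> y \<in> R \<and> {x, y} \<in> E} * 2 ^ H < 3 ^ H \<and> (\<forall>v\<in>R. card {e \<in> E. v \<in> e} = 2)"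

lemma sound_subset:
  assumes "sound E R H" "R' \<subseteq> R"
  shows "sound E R' H"
proof -
  let ?F = "\<lambda>R. {(x, y). x \<in> R \<and> y \<in> R \<and> {x, y} \<in> E}"
  have "finite (?F R)" by (rule finite_subset[of _ "R \<times> R"]) (use assms in \<open>auto simp: sound_def\<close>)
  moreover have "?F R' \<subseteq> ?F R" using assms(2) by blast
  ultimately have "card (?F R') \<le> card (?F R)" by (rule card_mono)
  then have "card (?F R') * 2 ^ H \<le> card (?F R) * 2 ^ H" by simp
  then have "card (?F R') * 2 ^ H < 3 ^ H" using assms(1) unfolding sound_def by linarith
  moreover have "acyclic_on E R'" using assms unfolding sound_def acyclic_on_def by blast
  ultimately show ?thesis using assms finite_subset unfolding sound_def by blast
qed

text \<open>The table of topological edges in the middle of a split or merge: \<open>Q\<close> are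
  the edges that are topological by themselves at this moment, \<open>RT\<close> the numbers
  belonging to trees not yet hit, with the entries of the table \<open>tt0\<close> from the
  start.\<close>

definition ttok where
  "ttok m Q RT tt0 \<longleftrightarrow> dirs m Q \<and> dom (ttab m) = tops m Q \<union> RT \<and> tops m Q \<inter> RT = {} \<and>
     (\<forall>t\<in>RT. ttab m t = tt0 t) \<and> (\<forall>t\<in>dom (ttab m). t < tcnt m)"

lemma ttok_cong:
  assumes "ttok m Q RT tt0" "etab m' = etab m" "ttab m' = ttab m" "tcnt m' = tcnt m"
  shows "ttok m' Q RT tt0"
  using assms unfolding ttok_def dirs_def tops_def by simp

lemma ttok_free_root:
  assumes k: "ttok m Q RT tt0" and t: "t \<notin> tops m Q"
  shows "ttok (m\<lparr>ttab := (ttab m)(t := None)\<rparr>) Q (RT - {t}) tt0"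
  using k t by (fastforce simp: tops_def dirs_def ttok_def)

lemma ttok_new_direct:
  assumes k: "ttok m Q RT tt0" and e: "etab m e = Some re" "e \<notin> Q"
  shows "ttok (m\<lparr>ttab := (ttab m)(tcnt m \<mapsto> \<lparr> tends = eends re, twt = ewt re \<rparr>), tcnt := Suc (tcnt m),
     etab := (etab m)(e \<mapsto> re\<lparr>etop := Some (tcnt m)\<rparr>)\<rparr>) (insert e Q) RT tt0"
proof -
  let ?m = "m\<lparr>ttab := (ttab m)(tcnt m \<mapsto> \<lparr> tends = eends re, twt = ewt re \<rparr>), tcnt := Suc (tcnt m),
     etab := (etab m)(e \<mapsto> re\<lparr>etop := Some (tcnt m)\<rparr>)\<rparr>"
  have lt: "t < tcnt m" if "t \<in> tops m Q \<union> RT" for t using k that unfolding ttok_def by blast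
  have et: "etab ?m k' = etab m k'" if "k' \<in> Q" for k' using that e by auto
  have tp: "tops ?m (insert e Q) = insert (tcnt m) (tops m Q)" using e(2) by (auto simp: tops_def)
  have "dirs ?m (insert e Q)"
    unfolding dirs_def
  proof (intro conjI ballI allI impI)
    fix k' assume k': "k' \<in> insert e Q"
    show "\<exists>re t'. etab ?m k' = Some re \<and> etop re = Some t' \<and> ttab ?m t' = Some \<lparr> tends = eends re, twt = ewt re \<rparr>"
    using k' k by (fastforce simp: ttok_def dirs_def tops_def)
  next
    fix k1 k2 r1 r2 assume a: "k1 \<in> insert e Q" "k2 \<in> insert e Q" "etab ?m k1 = Some r1" "etab ?m k2 = Some r2" "etop r1 = etop r2"
    have old: "etop r \<noteq> Some (tcnt m)" if "k' \<in> Q" "etab m k' = Some r" for k' r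
    proof
      assume "etop r = Some (tcnt m)"
      then have "tcnt m \<in> tops m Q" using that unfolding tops_def by blast
      then show False using lt by blast
    qed
    show "k1 = k2"
    using a old et k by (fastforce simp: ttok_def dirs_def)
  qed
  then show ?thesis unfolding ttok_def tp using k lt[of "tcnt m"] unfolding ttok_def
    by (auto simp: less_Suc_eq)
qed

lemma ttok_free_direct:
  assumes k: "ttok m Q RT tt0" and e: "etab m e = Some re" "e \<in> Q" "etop re = Some t"
  shows "ttok (m\<lparr>ttab := (ttab m)(t := None), etab := (etab m)(e \<mapsto> re\<lparr>etop := None\<rparr>)\<rparr>) (Q - {e}) RT tt0"
proof -
  let ?m = "m\<lparr>ttab := (ttab m)(t := None), etab := (etab m)(e \<mapsto> re\<lparr>etop := None\<rparr>)\<rparr>"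
  have d: "dirs m Q" using k by (simp add: ttok_def)
  have other: "etop r \<noteq> Some t" if "k' \<in> Q" "k' \<noteq> e" "etab m k' = Some r" for k' r
    using d e that unfolding dirs_def by metis
  have et: "etab ?m k' = etab m k'" if "k' \<noteq> e" for k' using that by simp
  have tp: "tops ?m (Q - {e}) = tops m Q - {t}"
  using other e by (auto simp: tops_def)
  have "dirs ?m (Q - {e})"
    unfolding dirs_def
  proof (intro conjI ballI allI impI)
    fix k' assume k': "k' \<in> Q - {e}"
    then obtain r t' where r: "etab m k' = Some r" "etop r = Some t'" "ttab m t' = Some \<lparr> tends = eends r, twt = ewt r \<rparr>"
      using d unfolding dirs_def by blast
    then have "t' \<noteq> t" using other k' by auto
    then show "\<exists>re t'. etab ?m k' = Some re \<and> etop re = Some t' \<and> ttab ?m t' = Some \<lparr> tends = eends re, twt = ewt re \<rparr>"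
      using r k' by simp
  next
    fix k1 k2 r1 r2 assume a: "k1 \<in> Q - {e}" "k2 \<in> Q - {e}" "etab ?m k1 = Some r1" "etab ?m k2 = Some r2" "etop r1 = etop r2"
    then show "k1 = k2" using d et unfolding dirs_def by (metis DiffD1 DiffD2 insertI1)
  qed
  moreover have "t \<in> tops m Q" using e unfolding tops_def by blast
  ultimately show ?thesis using k unfolding ttok_def tp by auto
qed

definition rts where
  "rts nt L P = {t. \<exists>p\<in>trees nt. L p \<inter> P = {} \<and> te nt p = Some t}"

text \<open>No case distinction whether the tree of \<open>x\<close> has been hit before: removing
  its edge number a second time changes nothing. Two trees cannot lose the same number because
  \<open>te\<close> is injective on roots.\<close>

lemma rts_insert:
  fixes m :: mem
  assumes F: "forest E W R H TE lv L (ntab m) nc tt tc" and l: "l \<in> live (ntab m)" "lv l = 0" "L l = {x}"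
    and r: "r \<in> trees (ntab m)" "x \<in> L r" "te (ntab m) r = Some t"
  shows "rts (ntab m) L (insert x P) = rts (ntab m) L P - {t}"
proof -
  have "L p \<inter> insert x P = {} \<longleftrightarrow> L p \<inter> P = {} \<and> p \<noteq> r" if "p \<in> trees (ntab m)" for p
    using forest_tree_unique[OF F l that _ r(1,2)] r by auto
  moreover have "te (ntab m) p \<noteq> Some t" if "p \<in> trees (ntab m)" "p \<noteq> r" for p
    using inj_onD[OF forestD(6)[OF F], of p r] that r by auto
  ultimately show ?thesis unfolding rts_def using r(3) by force
qed

lemma full_ttok:
  assumes d: "dirs m (direct m R)" and F: "forest E W R H (tops m (direct m R)) lv L (ntab m) nc (ttab m) (tcnt m)"
  shows "ttok m (direct m R) (rts (ntab m) L {}) (ttab m)"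
  using forestD(5)[OF F] d forestD(7,8)[OF F] by (fastforce simp: rts_def env.is_root_def ttok_def)

lemma new_direct_runs:
  "etab m e = Some re \<Longrightarrow> runs (new_direct e) m Q \<longleftrightarrow> Q () 3 (m\<lparr>ttab := (ttab m)(tcnt m \<mapsto> \<lparr> tends = eends re, twt = ewt re \<rparr>),
     tcnt := Suc (tcnt m), etab := (etab m)(e \<mapsto> re\<lparr>etop := Some (tcnt m)\<rparr>)\<rparr>)"
  by (simp add: new_direct_def runs_simps numeral_3_eq_3)

text \<open>The common end of splitting and merging. \<open>Z\<close> carries the pointers from
  vertices to leaves through the propagation. The constant is 40 = 13 * 3 + 1, for at most three
  marked clusters.\<close>

lemma finish_propagate:
  assumes ar: "arena E R Rx Ch H" and Z: "Z = {(l, x). \<exists>rv. vtab m x = Some rv \<and> vnode rv = Some l \<and> x \<in> R}"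
    and S: "arena.stage E W R Rx Ch H (tops m (direct m R)) (ttab m) Z 0 A K lv L U (ntab m) (ncnt m) (ttab m) (tcnt m)"
    and g: "gm E W V m" and RV: "R \<subseteq> V" and d: "dirs m (direct m R)"
    and v: "\<And>v rv. vtab m v = Some rv \<Longrightarrow> if v \<in> R then vnode rv \<noteq> None else vnode rv = None"
    and K: "length K \<le> 3"
  shows "runs (propagate A K) m (\<lambda>_ t m'. full E W V R H m' \<and>
     t + 13 * card (live (ntab m')) \<le> 13 * card (live (ntab m)) + 1444 * (H + 1) + 40)"
proof -
  interpret arena E W R Rx Ch H "tops m (direct m R)" "ttab m" Z using ar .
  show ?thesis
  proof (rule runs_mono[OF propagate_runs[OF S]], elim conjE exE bexE)
    fix t m' i lv' L' U' assume fr: "frame m m'" and i: "H \<le> i"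
      and st: "stage i [] [] lv' L' U' (ntab m') (ncnt m') (ttab m') (tcnt m')"
      and t: "t + 13 * card (live (ntab m')) \<le> 13 * (length K + card (live (ntab m))) + 1444 * (H + 1) + 1"
    note sf = stage_forest[OF st i]
    have e: "etab m' = etab m" "vtab m' = vtab m" "ecnt m' = ecnt m" using fr by (auto simp: frame_def)
    have dr: "direct m' R = direct m R" by (simp add: direct_def e)
    have tp: "tops m' (direct m R) = tops m (direct m R)" by (simp add: tops_def e)
    have g': "gm E W V m'" by (rule gm_cong[OF g]) (use e in \<open>auto simp: same_edges_def\<close>)
    have d': "dirs m' (direct m' R)"
      unfolding dr dirs_def e
    using d sf(2) by (fastforce simp: dirs_def tops_def)
    have "vn R lv' L' m'"
      unfolding vn_def e
    proof (intro allI impI)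
      fix v rv assume a: "vtab m v = Some rv"
      show "if v \<in> R then \<exists>l\<in>live (ntab m'). vnode rv = Some l \<and> lv' l = 0 \<and> L' l = {v} else vnode rv = None"
      using v[OF a] a Z sf(3) by fastforce
    qed
    then have "full E W V R H m'" unfolding full_def using g' RV d' sf(1) unfolding dr tp by blast
    then show "full E W V R H m' \<and> t + 13 * card (live (ntab m')) \<le> 13 * card (live (ntab m)) + 1444 * (H + 1) + 40"
      using t K by simp
  qed
qed


lemma vnD:
  assumes "vn R lv L m" "vtab m v = Some rv"
  shows "v \<in> R \<Longrightarrow> \<exists>l\<in>live (ntab m). vnode rv = Some l \<and> lv l = 0 \<and> L l = {v}" "v \<notin> R \<Longrightarrow> vnode rv = None"
  using assms unfolding vn_def by (metis (full_types))+

section \<open>Splitting and merging\<close>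

lemma degree_two:
  assumes g: "gm E W V m" and v: "v \<in> V" "card {e \<in> E. v \<in> e} = 2"
  obtains rv e1 e2 re1 re2 u1 u2 where "vtab m v = Some rv" "inc rv = [e1, e2]" "e1 \<noteq> e2"
    "etab m e1 = Some re1" "eset re1 = {v, u1}" "other_end v re1 = u1" "u1 \<noteq> v" "u1 \<in> V"
    "etab m e2 = Some re2" "eset re2 = {v, u2}" "other_end v re2 = u2" "u2 \<noteq> v" "u2 \<in> V"
    "u1 \<noteq> u2" "\<forall>y. {v, y} \<in> E \<longleftrightarrow> y = u1 \<or> y = u2" "\<forall>k re. etab m k = Some re \<longrightarrow> v \<in> eset re \<longrightarrow> k = e1 \<or> k = e2"
proof -
  obtain rv where rv: "vtab m v = Some rv" using gmD(1)[OF g] v by blast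
  have "length (inc rv) = 2" using gm_inc_length[OF g rv] v by simp
  then obtain e1 e2 where inc: "inc rv = [e1, e2]" by (auto simp: length_Suc_conv numeral_2_eq_2)
  have s: "distinct (inc rv)" "set (inc rv) = {k. \<exists>re. etab m k = Some re \<and> v \<in> eset re}" using gmD(6)[OF g rv] by auto
  have e12: "e1 \<noteq> e2" using s inc by auto
  have ex: "\<exists>re u. etab m k = Some re \<and> eset re = {v, u} \<and> other_end v re = u \<and> u \<noteq> v \<and> u \<in> V" if ki: "k \<in> set (inc rv)" for k
  using s ki gmD(3)[OF g] gmD(2)[OF g] by (fastforce simp: eset_def other_end_def)
  obtain re1 u1 where 1: "etab m e1 = Some re1" "eset re1 = {v, u1}" "other_end v re1 = u1" "u1 \<noteq> v" "u1 \<in> V"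
    using ex[of e1] inc by auto
  obtain re2 u2 where 2: "etab m e2 = Some re2" "eset re2 = {v, u2}" "other_end v re2 = u2" "u2 \<noteq> v" "u2 \<in> V"
    using ex[of e2] inc by auto
  have u12: "u1 \<noteq> u2" using gmD(4)[OF g 1(1) 2(1)] 1 2 e12 by auto
  have k: "k = e1 \<or> k = e2" if "etab m k = Some re" "v \<in> eset re" for k re using s inc that by auto
  have y: "{v, y} \<in> E \<longleftrightarrow> y = u1 \<or> y = u2" for y
  proof
    assume "{v, y} \<in> E"
    then obtain k re where kr: "etab m k = Some re" "eset re = {v, y}" using gmD(5)[OF g] by blast
    have "v \<in> eset re" using kr(2) by simp
    then have "k = e1 \<or> k = e2" by (rule k[OF kr(1)])
    then have "re = re1 \<or> re = re2" using kr(1) 1(1) 2(1) by auto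
    then have "{v, y} = {v, u1} \<or> {v, y} = {v, u2}" using kr(2) 1(2) 2(2) by metis
    then show "y = u1 \<or> y = u2" using 1(4) 2(4) by (auto simp: doubleton_eq_iff)
  next
    assume "y = u1 \<or> y = u2"
    then show "{v, y} \<in> E" using gmD(3)[OF g 1(1)] gmD(3)[OF g 2(1)] 1 2 by auto
  qed
  show thesis by (rule that[OF rv inc e12 1 2 u12]) (use y k in blast)+
qed

definition resides :: "nbr \<Rightarrow> nbr \<Rightarrow> side \<Rightarrow> side" where
  "resides x y = apfst (\<lambda>z. if z = x then y else z)"

lemma replace_nbr_resides: "replace_nbr x y r = r\<lparr>sides := map_prod (resides x y) (resides x y) (sides r)\<rparr>"
  by (simp add: replace_nbr_def resides_def)

text \<open>A leaf is never a root, since \<open>is_root\<close> asks for a positive level; hence it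
  has a parent, even if its vertex is alone on its path.\<close>

lemma forest_leaf:
  assumes F: "forest E W R H TE lv L nt nc tt tc" and c: "c \<in> live nt" "lv c = 0"
  shows "kd nt c = []" "\<exists>x\<in>R. L c = {x}" "\<exists>q\<in>live nt. pa nt c = Some q \<and> lv q = Suc 0 \<and> c \<in> set (kd nt q)" "ww nt c = env.inner E W (L c)"
proof -
  note b = forestD(1)[OF F]
  note sh = env.baseD(4)[OF b c(1)]
  show "kd nt c = []" using sh c(2) unfolding env.shape_def by auto
  show "\<exists>x\<in>R. L c = {x}" using sh c(2) forestD(3)[OF F c(1)] unfolding env.shape_def by auto
  show "ww nt c = env.inner E W (L c)" using forestD(3)[OF F c(1)] by simp
  have "pa nt c \<noteq> None"
  proof
    assume "pa nt c = None"
    then have "c \<in> trees nt" using c by (simp add: trees_def)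
    then show False using forestD(5)[OF F, of c] c(2) unfolding env.is_root_def by simp
  qed
  then obtain q where q: "pa nt c = Some q" by auto
  then show "\<exists>q\<in>live nt. pa nt c = Some q \<and> lv q = Suc 0 \<and> c \<in> set (kd nt q)"
    using env.baseD(9,10)[OF b c(1) q] env.base_pa_lv(1)[OF b c(1) q] c by auto
qed

text \<open>Compares the current table with the one before the split or merge: \<open>P\<close> are
  the neighbours handled so far, and on the sides of their leaves \<open>g\<close> exchanges the
  names of the vertex and of its leaf.\<close>

definition edited where
  "edited lv L g P nt nt' p \<longleftrightarrow> kd nt' p = kd nt p \<and> ww nt' p = ww nt p \<and> te nt' p = te nt p \<and> pa nt' p = pa nt p \<and>
     sd nt' p = (if lv p = (0::nat) \<and> L p \<subseteq> P then map_prod g g (sd nt p) else sd nt p)"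

definition marked where
  "marked lv L P nt K \<longleftrightarrow> (\<forall>q\<in>set K. q \<in> live nt \<and> lv q = Suc 0 \<and> (\<exists>c\<in>set (kd nt q). L c \<subseteq> P)) \<and>
     (\<forall>c\<in>live nt. lv c = 0 \<longrightarrow> L c \<subseteq> P \<longrightarrow> (\<exists>q\<in>set K. pa nt c = Some q))"

lemma markedD:
  assumes "marked lv L P nt K"
  shows "q \<in> set K \<Longrightarrow> q \<in> live nt \<and> lv q = Suc 0 \<and> (\<exists>c\<in>set (kd nt q). L c \<subseteq> P)"
    and "c \<in> live nt \<Longrightarrow> lv c = 0 \<Longrightarrow> L c \<subseteq> P \<Longrightarrow> \<exists>q\<in>set K. pa nt c = Some q"
  using assms unfolding marked_def by blast+

context
  fixes E W R H TE lv L nt nc tt tc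
  assumes F: "forest E W R H TE lv L nt nc tt tc"
begin

lemma leaf_unique:
  assumes "n \<in> live nt" "lv n = 0" "L n = {u}" "c \<in> live nt" "lv c = 0" "u \<in> L c"
  shows "c = n"
  using env.baseD(8)[OF forestD(1)[OF F] assms(4,1)] assms by auto

lemma edited_skip:
  assumes "u \<notin> R" "p \<in> live nt" "edited lv L g P nt nt' p"
  shows "edited lv L g (insert u P) nt nt' p"
proof -
  have "(lv p = 0 \<and> L p \<subseteq> insert u P) = (lv p = 0 \<and> L p \<subseteq> P)" using forest_leaf(2)[OF F assms(2)] assms(1) by auto
  then show ?thesis using assms(3) by (simp add: edited_def)
qed

lemma marked_skip:
  assumes "u \<notin> R" "marked lv L P nt K"
  shows "marked lv L (insert u P) nt K"
  unfolding marked_def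
proof (intro conjI ballI impI)
  fix c assume c: "c \<in> live nt" "lv c = 0" "L c \<subseteq> insert u P"
  then have "L c \<subseteq> P" using forest_leaf(2)[OF F c(1,2)] assms(1) by auto
  then show "\<exists>q\<in>set K. pa nt c = Some q" by (rule markedD(2)[OF assms(2) c(1,2)])
qed (use markedD(1)[OF assms(2)] in blast)+

lemma edited_leaf:
  assumes n: "n \<in> live nt" "lv n = 0" "L n = {u}" and r: "nt' n = Some r" and u: "u \<notin> P"
    and p: "p \<in> live nt" and ed: "edited lv L (resides x y) P nt nt' p"
  shows "edited lv L (resides x y) (insert u P) nt (nt'(n \<mapsto> replace_nbr x y r)) p"
proof (cases "p = n")
  case True
  then show ?thesis using ed n u view_Some[of nt' n r, OF r] by (simp add: edited_def replace_nbr_resides)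
next
  case False
  then have "(lv p = 0 \<and> L p \<subseteq> insert u P) = (lv p = 0 \<and> L p \<subseteq> P)" using leaf_unique[OF n p] by blast
  then show ?thesis using ed False by (simp add: edited_def)
qed

lemma marked_leaf:
  assumes n: "n \<in> live nt" "lv n = 0" "L n = {u}" and mk: "marked lv L P nt K"
  shows "marked lv L (insert u P) nt (push_opt (pa nt n) K)"
proof -
  obtain q where q: "q \<in> live nt" "pa nt n = Some q" "lv q = Suc 0" "n \<in> set (kd nt q)" using forest_leaf(3)[OF F n(1,2)] by blast
  show ?thesis
    unfolding marked_def
  proof (intro conjI ballI impI)
    fix q' assume "q' \<in> set (push_opt (pa nt n) K)"
    then have "q' = q \<or> q' \<in> set K" using q by (auto simp: set_push_opt)
    moreover have "L n \<subseteq> insert u P" using n(3) by simp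
    ultimately show "q' \<in> live nt" "lv q' = Suc 0" "\<exists>c\<in>set (kd nt q'). L c \<subseteq> insert u P" using markedD(1)[OF mk] q by blast+
  next
    fix c assume c: "c \<in> live nt" "lv c = 0" "L c \<subseteq> insert u P"
    show "\<exists>q\<in>set (push_opt (pa nt n) K). pa nt c = Some q"
    proof (cases "c = n")
      case True then show ?thesis using q by (simp add: set_push_opt)
    next
      case False
      then have "L c \<subseteq> P" using leaf_unique[OF n c(1,2)] c(3) by blast
      then show ?thesis using markedD(2)[OF mk c(1,2)] by (auto simp: set_push_opt)
    qed
  qed
qed

text \<open>A tree that avoids \<open>P\<close> has kept its root record and its entry in the edge
  table, while the edges of all other trees are gone. So \<open>roots\<close> holds again when the
  trees that were hit no longer count as own.\<close>

lemma roots_keep: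
  assumes tt: "dom tt' = TE' \<union> rts nt L P" "TE' \<inter> rts nt L P = {}" "\<And>t. t \<in> rts nt L P \<Longrightarrow> tt' t = tt t" "\<And>t. t \<in> dom tt' \<Longrightarrow> t < tc'"
    and own: "env.own Ch (Suc 0) lv' L' nt' Or = {p \<in> trees nt. L p \<inter> P = {}}"
    and same: "\<And>p. p \<in> live nt \<Longrightarrow> L p \<inter> P = {} \<Longrightarrow> 0 < lv p \<Longrightarrow>
       lv' p = lv p \<and> sd nt' p = sd nt p \<and> ww nt' p = ww nt p \<and> te nt' p = te nt p"
  shows "env.roots Ch TE' tt' (Suc 0) lv' L' nt' Or tt' tc'"
proof -
  let ?O = "{p \<in> trees nt. L p \<inter> P = {}}"
  have O: "lv' p = lv p \<and> sd nt' p = sd nt p \<and> ww nt' p = ww nt p \<and> te nt' p = te nt p \<and> 0 < lv p" if "p \<in> ?O" for p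
  proof -
    have "0 < lv p" using forestD(5)[OF F, of p] that unfolding env.is_root_def by blast
    then show ?thesis using same[of p] that by (simp add: trees_def)
  qed
  show ?thesis
    unfolding env.roots_def own
  proof (intro conjI ballI)
    fix p assume p: "p \<in> ?O"
    obtain u a v b t where sp: "sd nt p = ((Singular u, a), (Singular v, b))" "te nt p = Some t"
      "tt t = Some \<lparr> tends = (u, v), twt = ww nt p + a + b \<rparr>"
      using forestD(5)[OF F, of p] p unfolding env.is_root_def by blast
    have tr: "t \<in> rts nt L P" using p sp unfolding rts_def by blast
    then have "t \<notin> TE'" using tt(2) by blast
    then show "env.is_root TE' lv' nt' tt' p" using sp O[OF p] tt(3)[OF tr] by (auto simp: env.is_root_def)
  next
    have "inj_on (te nt) ?O" using forestD(6)[OF F] by (rule inj_on_subset) auto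
    then show "inj_on (te nt') ?O" using O by (simp add: inj_on_def)
  next
    have "te nt' ` ?O = te nt ` ?O" by (rule image_cong[OF refl]) (use O in blast)
    moreover have "rts nt L P = {t. Some t \<in> te nt ` ?O}" unfolding rts_def by force
    ultimately show "dom tt' = TE' \<union> {t. Some t \<in> te nt' ` ?O}" using tt(1) by simp
  qed (use tt(4) in auto)
qed

end

section \<open>Splitting a tree at a vertex that becomes singular\<close>

lemma make_singular_runs:
  assumes F0: "full E W V R H m" and so: "sound E R H" and v: "v \<in> V"
  shows "runs (make_singular v) m (\<lambda>_ t m'. full E W V (R - {v}) H m' \<and>
     t + 13 * card (live (ntab m')) \<le> 13 * card (live (ntab m)) + 1446 * (H + 1) + 70)"
proof (cases "v \<in> R")
  case False
  have g: "gm E W V m" using F0 by (simp add: full_def)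
  obtain rv where rv: "vtab m v = Some rv" using gmD(1)[OF g] v by blast
  have "vnode rv = None" using F0 rv False unfolding full_def vn_def by auto
  moreover have "R - {v} = R" using False by simp
  ultimately show ?thesis using F0 rv by (simp add: make_singular_def runs_simps split: list.split)
next
  case vR: True
  let ?nt = "ntab m"
  obtain lv L where vnm: "vn R lv L m" and F: "forest E W R H (tops m (direct m R)) lv L ?nt (ncnt m) (ttab m) (tcnt m)"
    and g: "gm E W V m" and RV: "R \<subseteq> V" and drs: "dirs m (direct m R)"
    using F0 unfolding full_def by blast
  note b = forestD(1)[OF F]
  have deg: "card {e \<in> E. v \<in> e} = 2" using so vR by (simp add: sound_def)
  obtain rv e1 e2 re1 re2 u1 u2 where rv: "vtab m v = Some rv" "inc rv = [e1, e2]" "e1 \<noteq> e2"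
    and r1: "etab m e1 = Some re1" "eset re1 = {v, u1}" "other_end v re1 = u1" "u1 \<noteq> v" "u1 \<in> V"
    and r2: "etab m e2 = Some re2" "eset re2 = {v, u2}" "other_end v re2 = u2" "u2 \<noteq> v" "u2 \<in> V"
    and u12: "u1 \<noteq> u2" and nbv0: "\<forall>y. {v, y} \<in> E \<longleftrightarrow> y = u1 \<or> y = u2"
    and kv0: "\<forall>k re. etab m k = Some re \<longrightarrow> v \<in> eset re \<longrightarrow> k = e1 \<or> k = e2"
    by (rule degree_two[OF g v deg])
  have nbv: "\<And>y. {v, y} \<in> E \<longleftrightarrow> y = u1 \<or> y = u2"
    and kv: "\<And>k re. etab m k = Some re \<Longrightarrow> v \<in> eset re \<Longrightarrow> k = e1 \<or> k = e2" using nbv0 kv0 by blast+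
  obtain l where l: "vnode rv = Some l" "l \<in> live ?nt" "lv l = 0" "L l = {v}"
    using vnD(1)[OF vnm rv(1) vR] by blast
  have nbv': "{y, v} \<in> E \<longleftrightarrow> y = u1 \<or> y = u2" for y using nbv[of y] by (simp add: insert_commute)
  have leafeq: "p = l" if "p \<in> live ?nt" "lv p = 0" "v \<in> L p" for p
    using env.baseD(8)[OF b that(1) l(2)] that l by auto
  define g' where "g' = resides (Cluster l) (Singular v)"
  define oth where "oth k = other_end v (the (etab m k))" for k
  have oth: "oth e1 = u1" "oth e2 = u2" using r1 r2 by (auto simp: oth_def)
  define SI where "SI P K m' \<longleftrightarrow>
    vtab m' = (vtab m)(v \<mapsto> rv\<lparr>vnode := None\<rparr>) \<and> ncnt m' = ncnt m \<and> same_edges m m' \<and>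
    live (ntab m') = live ?nt - {l} \<and>
    (\<forall>p\<in>live (ntab m'). edited lv L g' P ?nt (ntab m') p) \<and>
    ttok m' (direct m R \<union> {k \<in> {e1, e2}. oth k \<in> P - R}) (rts ?nt L {v}) (ttab m) \<and>
    marked lv L (insert v P) ?nt K \<and> length K \<le> 1 + card P" for P K m'
  have step: "runs (split_off v l e K) m' (\<lambda>K' t m''. t \<le> 5 \<and> SI (insert u P) K' m'')"
    if S: "SI P K m'" and e: "etab m e = Some re" "eset re = {v, u}" "other_end v re = u" "u \<noteq> v" "u \<in> V" "e = e1 \<or> e = e2" "oth e = u"
      and uP: "u \<notin> P" "finite P" and oe: "\<And>k. k = e1 \<or> k = e2 \<Longrightarrow> oth k = u \<Longrightarrow> k = e" for P K m' e re u
  proof -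
    have S1: "vtab m' = (vtab m)(v \<mapsto> rv\<lparr>vnode := None\<rparr>)" "ncnt m' = ncnt m" "same_edges m m'" "live (ntab m') = live ?nt - {l}"
      and S2: "\<And>p. p \<in> live (ntab m') \<Longrightarrow> edited lv L g' P ?nt (ntab m') p"
      and S3: "ttok m' (direct m R \<union> {k \<in> {e1, e2}. oth k \<in> P - R}) (rts ?nt L {v}) (ttab m)"
      and S4: "marked lv L (insert v P) ?nt K" and S6: "length K \<le> 1 + card P"
      using S unfolding SI_def by blast+
    obtain re' where re': "etab m' e = Some re'" "eends re' = eends re" "ewt re' = ewt re" using same_edgesD(1)[OF S1(3) e(1)] by blast
    have oth': "other_end v re' = u" unfolding e(3)[symmetric] other_end_def re'(2) by (rule refl)
    obtain ru where ru: "vtab m u = Some ru" using gmD(1)[OF g] e by blast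
    have ru': "vtab m' u = Some ru" using S1 ru e by simp
    have cardP: "card (insert u P) = Suc (card P)" using uP by simp
    show ?thesis
    proof (cases "u \<in> R")
      case False
      then have vnu: "vnode ru = None" by (rule vnD(2)[OF vnm ru])
      let ?m = "m'\<lparr>ttab := (ttab m')(tcnt m' \<mapsto> \<lparr> tends = eends re', twt = ewt re' \<rparr>), tcnt := Suc (tcnt m'), etab := (etab m')(e \<mapsto> re'\<lparr>etop := Some (tcnt m')\<rparr>)\<rparr>"
      have enot: "e \<notin> direct m R \<union> {k \<in> {e1, e2}. oth k \<in> P - R}"
        using e uP vR unfolding direct_def by auto
      have Qeq: "insert e (direct m R \<union> {k \<in> {e1, e2}. oth k \<in> P - R}) = direct m R \<union> {k \<in> {e1, e2}. oth k \<in> insert u P - R}"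
      proof -
        have "{k \<in> {e1, e2}. oth k \<in> insert u P - R} = insert e {k \<in> {e1, e2}. oth k \<in> P - R}"
          using e(6,7) oe False by blast
        then show ?thesis by simp
      qed
      have "SI (insert u P) K ?m"
        unfolding SI_def
      proof (intro conjI)
        show "ttok ?m (direct m R \<union> {k \<in> {e1, e2}. oth k \<in> insert u P - R}) (rts ?nt L {v}) (ttab m)"
          unfolding Qeq[symmetric] by (rule ttok_new_direct[OF S3 re'(1) enot])
        show "same_edges m ?m" using S1(3) re' e(1) by (auto simp: same_edges_def)
        show "\<forall>p\<in>live (ntab ?m). edited lv L g' (insert u P) ?nt (ntab ?m) p"
          using edited_skip[OF F False _ S2] S1(4) by simp
        show "marked lv L (insert v (insert u P)) ?nt K" using marked_skip[OF F False S4] by (simp add: insert_commute)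
      qed (use S1 S6 cardP in auto)
      then show ?thesis
        by (simp add: split_off_def runs_bind runs_ret runs_read_edge runs_read_vertex re' oth' ru' vnu new_direct_runs[OF re'(1)])
    next
      case uR: True
      obtain n where n: "vnode ru = Some n" "n \<in> live ?nt" "lv n = 0" "L n = {u}" using vnD(1)[OF vnm ru uR] by blast
      have nl: "n \<noteq> l" using n l e by auto
      have n': "n \<in> live (ntab m')" using S1 n nl by simp
      obtain r where r: "ntab m' n = Some r" using live_ex[OF n'] by blast
      let ?m = "m'\<lparr>ntab := (ntab m')(n \<mapsto> replace_nbr (Cluster l) (Singular v) r)\<rparr>"
      have pr: "parent r = pa ?nt n" using view_mem(1)[OF r] S2[OF n'] by (simp add: edited_def)
      have Qeq: "direct m R \<union> {k \<in> {e1, e2}. oth k \<in> insert u P - R} = direct m R \<union> {k \<in> {e1, e2}. oth k \<in> P - R}" using uR by auto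
      have "SI (insert u P) (push_opt (parent r) K) ?m"
        unfolding SI_def
      proof (intro conjI)
        show "ttok ?m (direct m R \<union> {k \<in> {e1, e2}. oth k \<in> insert u P - R}) (rts ?nt L {v}) (ttab m)"
          unfolding Qeq by (rule ttok_cong[OF S3]) auto
        show "same_edges m ?m" using S1(3) by (simp add: same_edges_def)
        show "live (ntab ?m) = live ?nt - {l}" using S1(4) n' by auto
        show "\<forall>p\<in>live (ntab ?m). edited lv L g' (insert u P) ?nt (ntab ?m) p"
        proof
          fix p assume "p \<in> live (ntab ?m)"
          then have p: "p \<in> live (ntab m')" "p \<in> live ?nt" using n' S1(4) by auto
          show "edited lv L g' (insert u P) ?nt (ntab ?m) p"
            using edited_leaf[OF F n(2,3,4) r uP(1) p(2) S2[OF p(1), unfolded g'_def]] by (simp add: g'_def)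
        qed
        show "marked lv L (insert v (insert u P)) ?nt (push_opt (parent r) K)"
          using marked_leaf[OF F n(2,3,4) S4] unfolding pr by (simp add: insert_commute)
        show "length (push_opt (parent r) K) \<le> 1 + card (insert u P)" using length_push_opt[of "parent r" K] S6 cardP by simp
      qed (use S1 in auto)
      then show ?thesis
        by (simp add: split_off_def runs_simps re' oth' ru' n(1) r)
    qed
  qed
  obtain rl where rl: "?nt l = Some rl" using live_ex[OF l(2)] by blast
  obtain q0 where q0: "q0 \<in> live ?nt" "pa ?nt l = Some q0" "lv q0 = Suc 0" "l \<in> set (kd ?nt q0)" using forest_leaf(3)[OF F l(2,3)] by blast
  have prl: "parent rl = Some q0" using view_mem(1)[OF rl] q0 by simp
  define R' where "R' = R - {v}"
  let ?Ch = "{v, u1, u2}"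
  have so': "sound E R' H" by (rule sound_subset[OF so]) (auto simp: R'_def)
  have ar: "arena E R' R ?Ch H"
  proof
    show "simple_edges E" "finite R'" "acyclic_on E R'" "1 \<le> H" "card {(x, y). x \<in> R' \<and> y \<in> R' \<and> {x, y} \<in> E} * 2 ^ H < 3 ^ H"
      using so' by (auto simp: sound_def)
    show "R' \<subseteq> R" by (auto simp: R'_def)
    show "y \<in> ?Ch" if "x \<in> R - R'" "y \<in> R'" "{x, y} \<in> E" for x y using that nbv[of y] vR by (auto simp: R'_def)
  qed
  have final: "runs (propagate [] K) m' (\<lambda>_ t m''. full E W V R' H m'' \<and>
     t + 13 * card (live (ntab m'')) \<le> 13 * card (live (ntab m')) + 1444 * (H + 1) + 40)" if S: "SI {u2, u1} K m'" for K m'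
  proof -
    have S1: "vtab m' = (vtab m)(v \<mapsto> rv\<lparr>vnode := None\<rparr>)" "ncnt m' = ncnt m" "same_edges m m'" "live (ntab m') = live ?nt - {l}"
      and S2: "\<And>p. p \<in> live (ntab m') \<Longrightarrow> edited lv L g' {u2, u1} ?nt (ntab m') p"
      and S3: "ttok m' (direct m R \<union> {k \<in> {e1, e2}. oth k \<in> {u2, u1} - R}) (rts ?nt L {v}) (ttab m)"
      and S4: "marked lv L (insert v {u2, u1}) ?nt K" and S6: "length K \<le> 1 + card {u2, u1}"
      using S unfolding SI_def by blast+
    note S2 = S2[unfolded edited_def] and S5 = markedD(2)[OF S4] and S4 = markedD(1)[OF S4]
    let ?nt' = "ntab m'"
    have Q: "direct m R \<union> {k \<in> {e1, e2}. oth k \<in> {u2, u1} - R} = direct m' R'"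
    proof (intro equalityI subsetI)
      fix k assume "k \<in> direct m R \<union> {k \<in> {e1, e2}. oth k \<in> {u2, u1} - R}"
      then have "\<exists>re. etab m k = Some re \<and> eset re \<inter> R' = {}"
        using r1 r2 oth unfolding direct_def R'_def by auto
      then show "k \<in> direct m' R'" using same_edgesD(1)[OF S1(3), of k] unfolding direct_def eset_def by force
    next
      fix k assume "k \<in> direct m' R'"
      then obtain re where re: "etab m k = Some re" "eset re \<inter> R' = {}"
        using same_edgesD(2)[OF S1(3), of k] unfolding direct_def eset_def by force
      show "k \<in> direct m R \<union> {k \<in> {e1, e2}. oth k \<in> {u2, u1} - R}"
      proof (cases "v \<in> eset re")
        case False then show ?thesis using re unfolding direct_def R'_def by auto
      next
        case True
        then have "(k = e1 \<and> re = re1) \<or> (k = e2 \<and> re = re2)" using kv[OF re(1)] re(1) r1 r2 by auto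
        then show ?thesis using re(2) r1 r2 oth unfolding R'_def by auto
      qed
    qed
    let ?TE = "tops m' (direct m' R')"
    define Z where "Z = {(l, x). \<exists>rv. vtab m' x = Some rv \<and> vnode rv = Some l \<and> x \<in> R'}"
    have tt: "dirs m' (direct m' R')" "dom (ttab m') = ?TE \<union> rts ?nt L {v}" "?TE \<inter> rts ?nt L {v} = {}"
      "\<And>t. t \<in> rts ?nt L {v} \<Longrightarrow> ttab m' t = ttab m t" "\<And>t. t \<in> dom (ttab m') \<Longrightarrow> t < tcnt m'"
      using S3 unfolding Q ttok_def by auto
    interpret a: arena E W R' R ?Ch H ?TE "ttab m'" Z by (rule ar)
    have b': "a.base lv L ?nt' (ncnt m')"
    proof -
      have kl: "kd ?nt l = []" by (rule forest_leaf(1)[OF F l(2,3)])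
      have "env.base E R H {} lv L ?nt' (ncnt m)"
        by (rule env.base_delete[OF b l(2) S1(4)]) (use S2 kl in auto)
      moreover have "L p \<subseteq> R" if "p \<in> live ?nt'" for p using forestD(3)[OF F, of p] that S1(4) by auto
      moreover have "p \<in> live ?nt' \<and> lv p = 0 \<and> L p = {x}" if px: "(p, x) \<in> Z" for p x
      proof -
        obtain rx where rx: "vtab m' x = Some rx" "vnode rx = Some p" "x \<in> R'" using px unfolding Z_def by blast
        then have "x \<noteq> v" "x \<in> R" "vtab m x = Some rx" using S1(1) by (auto simp: R'_def)
        then have "p \<in> live ?nt \<and> lv p = 0 \<and> L p = {x}" using vnD(1)[OF vnm, of x rx] rx by auto
        then show ?thesis using S1(4) l \<open>x \<noteq> v\<close> by auto
      qed
      ultimately show ?thesis unfolding S1(2) by (rule env.base_change) auto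
    qed
    have live0: "p \<in> live ?nt" "p \<noteq> l" if "p \<in> live ?nt'" for p using that S1(4) by auto
    have fl: "\<exists>x\<in>R. L c = {x}" if "c \<in> live ?nt" "lv c = 0" for c by (rule forest_leaf(2)[OF F that])
    have away: "y \<in> R \<longleftrightarrow> y \<in> R'" if "x \<notin> ?Ch" "{x, y} \<in> E" for x y using that nbv'[of x] by (auto simp: R'_def)
    have vnL: "v \<notin> L p" if "p \<in> live ?nt'" "L p \<inter> ?Ch = {} \<or> lv p = 0" for p
      using that leafeq[OF live0(1)[OF that(1)]] live0(2)[OF that(1)] by auto
    \<comment> \<open>A tree that contains a neighbour of \<open>v\<close> contains
      \<open>v\<close>, being closed in the old \<open>R\<close>. So the tree of \<open>v\<close> is
      the only one that meets \<open>?Ch\<close>.\<close>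
    have treeCh: "L p \<inter> ?Ch = {} \<longleftrightarrow> L p \<inter> {v} = {}" if "p \<in> trees ?nt" for p
    proof -
      have "v \<in> L p" if "u1 \<in> L p \<or> u2 \<in> L p"
        using that forest_tree_closed[OF F \<open>p \<in> trees ?nt\<close>, of u1 v] forest_tree_closed[OF F \<open>p \<in> trees ?nt\<close>, of u2 v] vR nbv' by blast
      then show ?thesis by auto
    qed
    have own: "a.own (Suc 0) lv L ?nt' {} = {p \<in> trees ?nt. L p \<inter> {v} = {}}"
    proof (intro equalityI subsetI)
      fix p assume p: "p \<in> a.own (Suc 0) lv L ?nt' {}"
      then have p': "p \<in> live ?nt'" "p \<in> trees ?nt" using live0 S2 by (auto simp: a.own_def trees_def)
      have "0 < lv p" using forestD(5)[OF F p'(2)] unfolding env.is_root_def by blast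
      then have "L p \<inter> ?Ch = {}" using p by (auto simp: a.own_def a.ok_def)
      then show "p \<in> {p \<in> trees ?nt. L p \<inter> {v} = {}}" using p' by auto
    next
      fix p assume p: "p \<in> {p \<in> trees ?nt. L p \<inter> {v} = {}}"
      then have "p \<noteq> l" using l by auto
      then have p': "p \<in> live ?nt'" using p S1(4) by (auto simp: trees_def)
      then show "p \<in> a.own (Suc 0) lv L ?nt' {}" using p treeCh[of p] S2[OF p'] by (auto simp: a.own_def a.ok_def trees_def)
    qed
    have rts: "a.roots (Suc 0) lv L ?nt' (set []) (ttab m') (tcnt m')"
      unfolding list.set
    proof (rule roots_keep[OF F tt(2-5) own])
      fix p assume p: "p \<in> live ?nt" "0 < lv p"
      then have "p \<in> live ?nt'" using S1(4) l by auto
      then show "lv p = lv p \<and> sd ?nt' p = sd ?nt p \<and> ww ?nt' p = ww ?nt p \<and> te ?nt' p = te ?nt p" using S2 p by simp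
    qed
    have st: "a.stage 0 [] K lv L (?Ch \<inter> R') ?nt' (ncnt m') (ttab m') (tcnt m')"
    proof (rule a.stage_start[OF b' _ _ rts])
      fix p assume p: "p \<in> live ?nt'" "L p \<inter> ?Ch = {} \<or> lv p = 0"
      show "L p \<subseteq> R' \<and> conn E (L p) \<and> ww ?nt' p = a.inner (L p)"
        using forestD(3)[OF F live0(1)[OF p(1)]] vnL[OF p] S2[OF p(1)] by (auto simp: R'_def)
    next
      fix p q x y assume "p \<in> live ?nt'" "q \<in> live ?nt'" "p \<noteq> q" "lv p = lv q" "length (kd ?nt' p) = 1" "length (kd ?nt' q) = 1"
       "x \<in> L p" "y \<in> L q"
      then show "{x, y} \<notin> E" using forestD(4)[OF F live0(1) live0(1), of p q x y] S2 by auto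
    next
      fix q c assume q: "q \<in> live ?nt'" "c \<in> set (kd ?nt' q)" "c \<notin> live ?nt'"
      have "c \<in> set (kd ?nt q)" using q S2 by auto
      then have "c \<in> live ?nt" using forestD(9)[OF F live0(1)[OF q(1)]] by blast
      then have cl: "c = l" using q(3) S1(4) by auto
      have "pa ?nt l = Some q" using env.baseD(11)[OF b live0(1)[OF q(1)], of l] \<open>c \<in> set (kd ?nt q)\<close> cl l by auto
      then have "q \<in> set K" using S5[OF l(2,3)] l(4) by auto
      then show "q \<in> set K \<and> L c \<inter> R' = {}" using cl l by (auto simp: R'_def)
    next
      fix p assume p: "p \<in> live ?nt'" "lv p = 0"
      obtain x where x: "L p = {x}" "x \<in> R" using fl[OF live0(1)[OF p(1)] p(2)] by blast
      have xv: "x \<noteq> v" using vnL[OF p(1)] p x by auto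
      have old: "env.sok E (env.srep W R (live ?nt) lv L 0) {x} (sd ?nt p)"
        using forestD(2)[OF F live0(1)[OF p(1)]] p x unfolding env.strong_def by simp
      show "a.strong lv L ?nt' p"
      proof (cases "x \<in> {u2, u1}")
        case True
        then have sp: "sd ?nt' p = map_prod g' g' (sd ?nt p)" using S2[OF p(1)] p x by auto
        show ?thesis unfolding a.strong_def p(2) x(1) sp
        proof (rule a.sok_map[OF old])
          fix d s assume d: "d \<in> out E {x}" "env.srep W R (live ?nt) lv L 0 d s"
          show "a.srep (live ?nt') lv L 0 d (g' s)"
          proof (cases "fst s")
            case (Singular u)
            then show ?thesis using d(2) by (auto simp: env.srep_def env.srep_def g'_def resides_def R'_def)
          next
            case (Cluster q)
            then have q: "q \<in> live ?nt" "lv q = 0" "snd d \<in> L q" "snd s = W {fst d, snd d}" using d(2) by (auto simp: env.srep_def)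
            show ?thesis
            proof (cases "q = l")
              case True then show ?thesis using Cluster q l by (auto simp: env.srep_def g'_def resides_def R'_def)
            next
              case False then show ?thesis using Cluster q S1(4) by (auto simp: env.srep_def g'_def resides_def)
            qed
          qed
        qed
      next
        case False
        then have xC: "x \<notin> ?Ch" using xv by auto
        have sp: "sd ?nt' p = sd ?nt p" using S2[OF p(1)] x False by auto
        show ?thesis unfolding a.strong_def p(2) x(1) sp
        proof (rule a.sok_mono[OF old])
          fix d s assume d: "d \<in> out E {x}" "env.srep W R (live ?nt) lv L 0 d s"
          have dx: "fst d = x" "{x, snd d} \<in> E" using d(1) by (auto simp: out_def)
          show "a.srep (live ?nt') lv L 0 d s"
          proof (cases "fst s")
            case (Singular u)
            then show ?thesis using d(2) by (auto simp: env.srep_def env.srep_def R'_def)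
          next
            case (Cluster q)
            then have q: "q \<in> live ?nt" "lv q = 0" "snd d \<in> L q" "snd s = W {fst d, snd d}" using d(2) by (auto simp: env.srep_def)
            have "q \<noteq> l"
            proof
              assume "q = l"
              then have "snd d = v" using q(3) l(4) by simp
              then show False using dx(2) xC nbv'[of x] by simp
            qed
            then show ?thesis using Cluster q S1(4) by (auto simp: env.srep_def)
          qed
        qed
      qed
    next
      fix p assume p: "p \<in> live ?nt'" "0 < lv p" "L p \<inter> ?Ch = {}"
      have sp: "sd ?nt' p = sd ?nt p" using S2[OF p(1)] p by auto
      have old: "env.sok E (env.srep W R (live ?nt) lv L (lv p)) (L p) (sd ?nt p)"
        using forestD(2)[OF F live0(1)[OF p(1)]] unfolding env.strong_def by simp
      show "a.weak lv L ?nt' {} p" unfolding a.weak_def sp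
      proof (rule a.sok_mono[OF old])
        fix d s assume d: "d \<in> out E (L p)" "env.srep W R (live ?nt) lv L (lv p) d s"
        have dx: "fst d \<notin> ?Ch" "{fst d, snd d} \<in> E" using d(1) p(3) by (auto simp: out_def)
        show "a.wrep (live ?nt' - {}) lv L (lv p) d s"
        proof (cases "fst s")
          case (Singular u)
          then show ?thesis using d(2) by (auto simp: env.srep_def env.wrep_def R'_def)
        next
          case (Cluster q)
          then have q: "q \<in> live ?nt" "lv q = lv p" "snd d \<in> L q" "snd s = W {fst d, snd d}" using d(2) by (auto simp: env.srep_def)
          have "snd d \<in> R" using forestD(3)[OF F q(1)] q by auto
          then have "snd d \<in> R'" using away[OF dx] by simp
          moreover have "r = q" if "r \<in> live ?nt'" "lv r = lv p" "snd d \<in> L r" for r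
            using env.baseD(8)[OF b live0(1)[OF that(1)] q(1)] that q by auto
          ultimately show ?thesis using Cluster q by (auto simp: env.wrep_def)
        qed
      qed
    next
      fix q assume q: "q \<in> set K"
      then have "q \<in> live ?nt" "lv q = Suc 0" "\<exists>c\<in>set (kd ?nt q). L c \<subseteq> insert v {u2, u1}" using S4[OF q] by auto
      moreover then have ql: "q \<in> live ?nt'" using S1(4) l by auto
      ultimately show "q \<in> live ?nt' \<and> lv q = Suc 0 \<and> (\<exists>c\<in>set (kd ?nt' q). L c \<subseteq> ?Ch)" using S2[OF ql] by auto
    next
      fix q c assume q: "q \<in> live ?nt'" "lv q = Suc 0" "c \<in> set (kd ?nt' q)" "L c \<inter> ?Ch \<noteq> {}"
      have cq: "c \<in> set (kd ?nt q)" using q S2 by auto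
      have cl: "c \<in> live ?nt" using forestD(9)[OF F live0(1)[OF q(1)] cq] .
      have lc: "lv c = 0" using env.shape_kid(1)[OF env.baseD(4)[OF b live0(1)[OF q(1)]] cq] q by simp
      have "L c \<subseteq> insert v {u2, u1}" using fl[OF cl lc] q(4) by auto
      moreover have "pa ?nt c = Some q" by (rule env.baseD(11)[OF b live0(1)[OF q(1)] cq cl])
      ultimately show "q \<in> set K" using S5[OF cl lc] by auto
    next
      have two: "card (out E {u}) = 2" if uR: "u \<in> R" for u
      proof -
        obtain ru where ru: "vtab m u = Some ru" using gmD(1)[OF g] RV uR by blast
        obtain n where n: "n \<in> live ?nt" "L n = {u}" using vnD(1)[OF vnm ru \<open>u \<in> R\<close>] by blast
        show ?thesis using env.sok_card forestD(2)[OF F n(1)] n(2) unfolding env.strong_def by metis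
      qed
      \<comment> \<open>The region consists of at most two vertices with two exits each. This is the
        origin of the bound 4 in \<open>zone\<close>.\<close>
      have "out E (?Ch \<inter> R') \<subseteq> (\<Union>u\<in>{u1, u2} \<inter> R. out E {u})" by (auto simp: out_def R'_def)
      then have "card (out E (?Ch \<inter> R')) \<le> card (\<Union>u\<in>{u1, u2} \<inter> R. out E {u})"
        by (rule card_mono[rotated]) (use finite_out[OF a.E] in auto)
      also have "\<dots> \<le> (\<Sum>u\<in>{u1, u2} \<inter> R. card (out E {u}))" by (rule card_UN_le) auto
      also have "\<dots> \<le> (\<Sum>u\<in>{u1, u2}. 2)" by (rule order_trans[OF sum_mono[of _ _ "\<lambda>_. 2"] sum_mono2]) (use two in auto)
      also have "\<dots> \<le> 4" using u12 by simp
      finally show "card (out E (?Ch \<inter> R')) \<le> 4" .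
      show "card ?Ch \<le> 26" using card_length[of "[v, u1, u2]"] by simp
    qed auto
    show ?thesis
    proof (rule finish_propagate[OF ar Z_def st])
      show "gm E W V m'"
        by (rule gm_cong[OF g S1(3)]) (use S1(1) rv in \<open>auto split: if_splits\<close>)
      show "R' \<subseteq> V" using RV by (auto simp: R'_def)
      show "dirs m' (direct m' R')" by (rule tt(1))
      show "length K \<le> 3" using S6 u12 by simp
      show "if w \<in> R' then vnode rw \<noteq> None else vnode rw = None" if "vtab m' w = Some rw" for w rw
        using that S1(1) vnD[OF vnm, of w rw] unfolding R'_def by (cases "w = v") auto
    qed
  qed
  show ?thesis unfolding R'_def[symmetric]
    apply (simp add: make_singular_def runs_bind[of "read_vertex v"] runs_read_vertex rv l(1))
    apply (simp only: runs_bind)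
    apply (rule runs_mono[OF topological_edge_of_runs[OF F l(2) subset_refl]], simp)
    apply (elim conjE bexE)
    subgoal for t0 tm m0 r0
    proof -
      assume m0: "m0 = m" and tm: "tm \<le> 2 * H + 4" and r0: "r0 \<in> trees ?nt" "L l \<subseteq> L r0" "te ?nt r0 = Some t0"
      let ?m3 = "m\<lparr>ttab := (ttab m)(t0 := None), ntab := ?nt(l := None), vtab := (vtab m)(v \<mapsto> rv\<lparr>vnode := None\<rparr>)\<rparr>"
      have k0: "ttok m (direct m R) (rts ?nt L {}) (ttab m)" by (rule full_ttok[OF drs F])
      have t0r: "t0 \<in> rts ?nt L {}" using r0 unfolding rts_def by auto
      have t0n: "t0 \<notin> tops m (direct m R)" using k0 t0r unfolding ttok_def by blast
      have rv': "rts ?nt L {v} = rts ?nt L {} - {t0}" by (rule rts_insert[OF F l(2,3,4) r0(1) _ r0(3)]) (use r0 l in auto)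
      have "ttok ?m3 (direct m R \<union> {k \<in> {e1, e2}. oth k \<in> {} - R}) (rts ?nt L {v}) (ttab m)"
      proof -
        have e0: "direct m R \<union> {k \<in> {e1, e2}. oth k \<in> {} - R} = direct m R" by simp
        show ?thesis unfolding rv' e0 by (rule ttok_cong[OF ttok_free_root[OF k0 t0n]]) auto
      qed
      moreover have ne: "L p \<noteq> {}" if "p \<in> live ?nt" for p by (rule env.baseD(6)[OF b that])
      moreover have "marked lv L {} ?nt []" using ne by (simp add: marked_def)
      then have "marked lv L {v} ?nt (push_opt (Some q0) [])" using marked_leaf[OF F l(2,3,4)] q0(2) by metis
      ultimately have SI0: "SI {} (push_opt (Some q0) []) ?m3"
        unfolding SI_def by (auto simp: same_edges_def push_opt_def edited_def)
      have t: "runs (split_off v l e1 (push_opt (Some q0) [])) ?m3 (\<lambda>K' t m''. t \<le> 5 \<and> SI {u1} K' m'')"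
        by (rule step[OF SI0 r1(1,2,3,4,5)]) (use oth u12 in auto)
      have cl: "card (live (?nt(l := None))) = card (live ?nt) - 1" "card (live ?nt) \<ge> 1"
        using l(2) env.baseD(1)[OF b] by (auto simp: Suc_le_eq card_gt_0_iff)
      show ?thesis
        apply (simp only: m0 runs_free_tedge runs_read_node runs_free_node runs_write_vertex)
        apply (simp add: rl prl)
        apply (rule runs_mono[OF t], elim conjE)
        subgoal for K1 t1 m1
          apply (rule runs_mono[OF step[OF _ r2(1,2,3,4,5)], of "{u1}"])
          apply assumption
          using oth u12 apply auto[5]
          apply (elim conjE)
          subgoal for K2 t2 m2
            apply (rule runs_mono[OF final], assumption)
            subgoal premises pr for u3 t3 m3
            proof -
              have "live (ntab m2) = live ?nt - {l}" using pr unfolding SI_def by blast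
              then have "card (live (ntab m2)) \<le> card (live ?nt)" using cl by simp
              then show ?thesis using pr tm by simp
            qed
            done
          done
        done
    qed
    done
qed


section \<open>Merging at a vertex of degree two\<close>

lemma make_regular_runs:
  assumes F0: "full E W V R H m" and v: "v \<in> V" "v \<notin> R"
    and R': "R' = (if card {e \<in> E. v \<in> e} = 2 then insert v R else R)" and so: "sound E R' H"
  shows "runs (make_regular v) m (\<lambda>_ t m'. full E W V R' H m' \<and>
     t + 13 * card (live (ntab m')) \<le> 13 * card (live (ntab m)) + 1448 * (H + 1) + 90)"
proof (cases "card {e \<in> E. v \<in> e} = 2")
  case False
  have g: "gm E W V m" using F0 by (simp add: full_def)
  obtain rv where rv: "vtab m v = Some rv" using gmD(1)[OF g] v by blast
  have "length (inc rv) \<noteq> 2" using gm_inc_length[OF g rv] False by simp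
  then have "(case (inc rv, vnode rv) of ([e1, e2], None) \<Rightarrow> f e1 e2 | _ \<Rightarrow> ret ()) = ret ()" for f
    by (auto split: list.split option.split)
  then show ?thesis using F0 rv False R' by (simp add: make_regular_def runs_bind runs_read_vertex runs_ret)
next
  case deg: True
  have R': "R' = insert v R" using R' deg by simp
  let ?nt = "ntab m"
  obtain lv L where vnm: "vn R lv L m" and F: "forest E W R H (tops m (direct m R)) lv L ?nt (ncnt m) (ttab m) (tcnt m)"
    and g: "gm E W V m" and RV: "R \<subseteq> V" and drs: "dirs m (direct m R)"
    using F0 unfolding full_def by blast
  note b = forestD(1)[OF F]
  obtain rv e1 e2 re1 re2 u1 u2 where rv: "vtab m v = Some rv" "inc rv = [e1, e2]" "e1 \<noteq> e2"
    and r1: "etab m e1 = Some re1" "eset re1 = {v, u1}" "other_end v re1 = u1" "u1 \<noteq> v" "u1 \<in> V"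
    and r2: "etab m e2 = Some re2" "eset re2 = {v, u2}" "other_end v re2 = u2" "u2 \<noteq> v" "u2 \<in> V"
    and u12: "u1 \<noteq> u2" and nbv0: "\<forall>y. {v, y} \<in> E \<longleftrightarrow> y = u1 \<or> y = u2"
    and kv0: "\<forall>k re. etab m k = Some re \<longrightarrow> v \<in> eset re \<longrightarrow> k = e1 \<or> k = e2"
    by (rule degree_two[OF g v(1) deg])
  have nbv: "\<And>y. {v, y} \<in> E \<longleftrightarrow> y = u1 \<or> y = u2"
    and kv: "\<And>k re. etab m k = Some re \<Longrightarrow> v \<in> eset re \<Longrightarrow> k = e1 \<or> k = e2" using nbv0 kv0 by blast+
  have vnv: "vnode rv = None" by (rule vnD(2)[OF vnm rv(1) v(2)])
  have nbv': "{y, v} \<in> E \<longleftrightarrow> y = u1 \<or> y = u2" for y using nbv[of y] by (simp add: insert_commute)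
  define l where "l = ncnt m"
  have ll: "l \<notin> live ?nt" using env.baseD(2)[OF b, of l] by (auto simp: l_def)
  define g' where "g' = resides (Singular v) (Cluster l)"
  define oth where "oth k = other_end v (the (etab m k))" for k
  have oth: "oth e1 = u1" "oth e2 = u2" using r1 r2 by (auto simp: oth_def)
  have fl: "\<exists>x\<in>R. L c = {x}" if "c \<in> live ?nt" "lv c = 0" for c by (rule forest_leaf(2)[OF F that])
  have k0: "ttok m (direct m R) (rts ?nt L {}) (ttab m)" by (rule full_ttok[OF drs F])
  \<comment> \<open>The invariant of the two calls of \<open>join\<close>. Here edges at
    \<open>v\<close> cease to be topological by themselves. The inclusion between the two
    \<open>tops\<close> guarantees that the edge number freed for a tree belongs to none of the
    remaining ones.\<close>
  define JI where "JI P K m' \<longleftrightarrow>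
    vtab m' = vtab m \<and> ncnt m' = Suc l \<and> same_edges m m' \<and> live (ntab m') = insert l (live ?nt) \<and>
    (\<forall>p\<in>live ?nt. edited lv L g' P ?nt (ntab m') p) \<and>
    ttok m' (direct m R - {k \<in> {e1, e2}. oth k \<in> P}) (rts ?nt L P) (ttab m) \<and>
    tops m' (direct m R - {k \<in> {e1, e2}. oth k \<in> P}) \<subseteq> tops m (direct m R) \<and>
    marked lv L P ?nt K \<and> length K \<le> card P" for P K m'
  define sp where "sp s u \<longleftrightarrow> snd s = W {v, u} \<and>
     (if u \<in> R then \<exists>n\<in>live ?nt. fst s = Cluster n \<and> lv n = 0 \<and> L n = {u} else fst s = Singular u)" for s u
  have step: "runs (join v l e K) m' (\<lambda>s t m''. t \<le> 2 * H + 9 \<and> sp (fst s) u \<and> JI (insert u P) (snd s) m'')"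
    if S: "JI P K m'" and e: "etab m e = Some re" "eset re = {v, u}" "other_end v re = u" "u \<noteq> v" "u \<in> V" "e = e1 \<or> e = e2" "oth e = u"
      and uP: "u \<notin> P" "finite P" and oe: "\<And>k. k = e1 \<or> k = e2 \<Longrightarrow> oth k = u \<Longrightarrow> k = e" for P K m' e re u
  proof -
    let ?Q = "direct m R - {k \<in> {e1, e2}. oth k \<in> P}" and ?Q' = "direct m R - {k \<in> {e1, e2}. oth k \<in> insert u P}"
    have S1: "vtab m' = vtab m" "ncnt m' = Suc l" "same_edges m m'" "live (ntab m') = insert l (live ?nt)"
      and S2: "\<And>p. p \<in> live ?nt \<Longrightarrow> edited lv L g' P ?nt (ntab m') p"
      and S3: "ttok m' ?Q (rts ?nt L P) (ttab m)" "tops m' ?Q \<subseteq> tops m (direct m R)"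
      and S4: "marked lv L P ?nt K" and S6: "length K \<le> card P"
      using S unfolding JI_def by blast+
    obtain re' where re': "etab m' e = Some re'" "eends re' = eends re" "ewt re' = ewt re" using same_edgesD(1)[OF S1(3) e(1)] by blast
    have oth': "other_end v re' = u" unfolding e(3)[symmetric] other_end_def re'(2) by (rule refl)
    have we: "ewt re' = W {v, u}" using gmD(3)[OF g e(1)] e(2) re' by simp
    obtain ru where ru: "vtab m u = Some ru" using gmD(1)[OF g] e by blast
    have ru': "vtab m' u = Some ru" using S1 ru by simp
    have cardP: "card (insert u P) = Suc (card P)" using uP by simp
    have Qe: "?Q' = ?Q - {e}" using e(6,7) oe by blast
    show ?thesis
    proof (cases "u \<in> R")
      case False
      have vnu: "vnode ru = None" by (rule vnD(2)[OF vnm ru False])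
      have eQ: "e \<in> ?Q" using e uP v(2) False unfolding direct_def by auto
      have "dirs m' ?Q" using S3(1) by (simp add: ttok_def)
      then obtain r' t where "etab m' e = Some r'" "etop r' = Some t" using eQ unfolding dirs_def by blast
      then have t: "etop re' = Some t" using re' by simp
      let ?m = "m'\<lparr>ttab := (ttab m')(t := None), etab := (etab m')(e \<mapsto> re'\<lparr>etop := None\<rparr>)\<rparr>"
      have rt: "rts ?nt L (insert u P) = rts ?nt L P"
      proof -
        have "L p \<inter> insert u P = {} \<longleftrightarrow> L p \<inter> P = {}" if "p \<in> trees ?nt" for p
          using forestD(3)[OF F, of p] that False by (auto simp: trees_def)
        then show ?thesis unfolding rts_def by blast
      qed
      have tp: "tops ?m (?Q - {e}) \<subseteq> tops m' ?Q" by (auto simp: tops_def)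
      have "JI (insert u P) K ?m"
        unfolding JI_def
      proof (intro conjI)
        show "ttok ?m ?Q' (rts ?nt L (insert u P)) (ttab m)"
          unfolding Qe rt by (rule ttok_free_direct[OF S3(1) re'(1) eQ t])
        show "tops ?m ?Q' \<subseteq> tops m (direct m R)" unfolding Qe using tp S3(2) by blast
        show "same_edges m ?m" using S1(3) re' e(1) by (auto simp: same_edges_def)
        show "\<forall>p\<in>live ?nt. edited lv L g' (insert u P) ?nt (ntab ?m) p" using edited_skip[OF F False _ S2] by simp
        show "marked lv L (insert u P) ?nt K" by (rule marked_skip[OF F False S4])
      qed (use S1 S6 cardP in auto)
      then show ?thesis using we False
        by (simp add: join_def runs_simps re' oth' ru' vnu t sp_def)
    next
      case uR: True
      obtain n where n: "vnode ru = Some n" "n \<in> live ?nt" "lv n = 0" "L n = {u}" using vnD(1)[OF vnm ru uR] by blast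
      have n': "n \<in> live (ntab m')" using S1 n by simp
      obtain r where r: "ntab m' n = Some r" using live_ex[OF n'] by blast
      have pr: "parent r = pa ?nt n" using view_mem(1)[OF r] S2[OF n(2)] by (simp add: edited_def)
      have QQ: "?Q' = ?Q"
      proof -
        have "e \<notin> direct m R" using e uR unfolding direct_def by auto
        then show ?thesis unfolding Qe by blast
      qed
      have sub: "live ?nt \<subseteq> live (ntab m')" using S1 by auto
      have same: "\<And>q. q \<in> live ?nt \<Longrightarrow> pa (ntab m') q = pa ?nt q \<and> te (ntab m') q = te ?nt q" using S2 by (simp add: edited_def)
      have main: "JI (insert u P) (push_opt (parent r) K) (m'\<lparr>ttab := (ttab m')(t := None), ntab := (ntab m')(n \<mapsto> replace_nbr (Singular v) (Cluster l) r)\<rparr>)"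
        if t: "r0 \<in> trees ?nt" "L n \<subseteq> L r0" "te ?nt r0 = Some t" for t r0
      proof -
        let ?m = "m'\<lparr>ttab := (ttab m')(t := None), ntab := (ntab m')(n \<mapsto> replace_nbr (Singular v) (Cluster l) r)\<rparr>"
        have rt: "rts ?nt L (insert u P) = rts ?nt L P - {t}" by (rule rts_insert[OF F n(2,3,4) t(1) _ t(3)]) (use t n in auto)
        have "t \<in> rts ?nt L {}" using t unfolding rts_def by auto
        then have tn: "t \<notin> tops m' ?Q" using k0 S3(2) unfolding ttok_def by blast
        have tp: "tops ?m ?Q = tops m' ?Q" by (simp add: tops_def)
        show ?thesis
          unfolding JI_def
        proof (intro conjI)
          show "ttok ?m ?Q' (rts ?nt L (insert u P)) (ttab m)"
            unfolding rt QQ by (rule ttok_cong[OF ttok_free_root[OF S3(1) tn]]) auto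
          show "tops ?m ?Q' \<subseteq> tops m (direct m R)" unfolding QQ tp by (rule S3(2))
          show "same_edges m ?m" using S1(3) by (simp add: same_edges_def)
          show "live (ntab ?m) = insert l (live ?nt)" using S1(4) n' by auto
          show "\<forall>p\<in>live ?nt. edited lv L g' (insert u P) ?nt (ntab ?m) p"
            using edited_leaf[OF F n(2,3,4) r uP(1) _ S2[unfolded g'_def]] by (simp add: g'_def)
          show "marked lv L (insert u P) ?nt (push_opt (parent r) K)" unfolding pr by (rule marked_leaf[OF F n(2,3,4) S4])
          show "length (push_opt (parent r) K) \<le> card (insert u P)" using length_push_opt[of "parent r" K] S6 cardP by simp
        qed (use S1 in auto)
      qed
      show ?thesis
        apply (simp add: join_def runs_bind[of "read_edge e"] runs_bind[of "read_vertex u"] runs_read_edge runs_read_vertex re' oth' ru' n(1))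
        apply (simp only: runs_bind)
        apply (rule runs_mono[OF topological_edge_of_runs[OF F n(2) sub same]], assumption)
        apply (elim conjE bexE)
        subgoal for t tm m0 r0
          using main[of r0 t] uR n we re'(3) by (auto simp: runs_simps r sp_def)
        done
    qed
  qed
  let ?Ch = "{v, u1, u2}"
  have ar: "arena E R' R' ?Ch H"
  proof
    show "simple_edges E" "finite R'" "acyclic_on E R'" "1 \<le> H" "card {(x, y). x \<in> R' \<and> y \<in> R' \<and> {x, y} \<in> E} * 2 ^ H < 3 ^ H"
      using so by (auto simp: sound_def)
  qed auto
  have final: "runs (propagate [l] K) m'' (\<lambda>_ t m3. full E W V R' H m3 \<and>
     t + 13 * card (live (ntab m3)) \<le> 13 * card (live (ntab m'')) + 1444 * (H + 1) + 40)"
    if S: "JI {u2, u1} K m'" and s12: "sp s1 u1" "sp s2 u2"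
      and m'': "m'' = m'\<lparr>ntab := (ntab m')(l \<mapsto> \<lparr> parent = None, kids = [], sides = (s1, s2), wt = 0, top_edge = None \<rparr>),
        vtab := (vtab m')(v \<mapsto> rv\<lparr>vnode := Some l\<rparr>)\<rparr>" for K m' m'' s1 s2
  proof -
    let ?Q = "direct m R - {k \<in> {e1, e2}. oth k \<in> {u2, u1}}"
    have S1: "vtab m' = vtab m" "ncnt m' = Suc l" "same_edges m m'" "live (ntab m') = insert l (live ?nt)"
      and S2: "\<And>p. p \<in> live ?nt \<Longrightarrow> edited lv L g' {u2, u1} ?nt (ntab m') p"
      and S3: "ttok m' ?Q (rts ?nt L {u2, u1}) (ttab m)"
      and S4: "marked lv L {u2, u1} ?nt K" and S6: "length K \<le> card {u2, u1}"
      using S unfolding JI_def by blast+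
    note S2 = S2[unfolded edited_def] and S5 = markedD(2)[OF S4] and S4 = markedD(1)[OF S4]
    let ?nt' = "ntab m''"
    have T1: "vtab m'' = (vtab m)(v \<mapsto> rv\<lparr>vnode := Some l\<rparr>)" "ncnt m'' = Suc l" "same_edges m m''"
      using m'' S1 by (auto simp: same_edges_def)
    have T4: "live ?nt' = insert l (live ?nt)" using m'' S1 by auto
    have T2: "kd ?nt' p = kd ?nt p \<and> ww ?nt' p = ww ?nt p \<and> te ?nt' p = te ?nt p \<and> pa ?nt' p = pa ?nt p \<and>
       sd ?nt' p = (if lv p = 0 \<and> L p \<subseteq> {u2, u1} then map_prod g' g' (sd ?nt p) else sd ?nt p)" if "p \<in> live ?nt" for p
    proof -
      have "p \<noteq> l" using that ll by auto
      then show ?thesis using S2[OF that] m'' by simp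
    qed
    have T5: "kd ?nt' l = []" "ww ?nt' l = 0" "pa ?nt' l = None" "sd ?nt' l = (s1, s2)" using m'' by auto
    have Q: "?Q = direct m'' R'"
    proof (intro equalityI subsetI)
      fix k assume k: "k \<in> ?Q"
      then obtain re where re: "etab m k = Some re" "eset re \<inter> R = {}" unfolding direct_def by blast
      have "k \<noteq> e1" "k \<noteq> e2" using k oth by auto
      then have "v \<notin> eset re" using kv[OF re(1)] by blast
      then have "eset re \<inter> R' = {}" using re(2) unfolding R' by auto
      then show "k \<in> direct m'' R'" using same_edgesD(1)[OF T1(3) re(1)] unfolding direct_def eset_def by force
    next
      fix k assume "k \<in> direct m'' R'"
      then obtain re where re: "etab m k = Some re" "eset re \<inter> R' = {}"
        using same_edgesD(2)[OF T1(3), of k] unfolding direct_def eset_def by force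
      then have "v \<notin> eset re" unfolding R' by auto
      then have "k \<noteq> e1" "k \<noteq> e2" using re r1 r2 by auto
      then show "k \<in> ?Q" using re unfolding direct_def R' by auto
    qed
    let ?TE = "tops m'' (direct m'' R')" and ?RT = "rts ?nt L {u2, u1}"
    define Z where "Z = {(l, x). \<exists>rv. vtab m'' x = Some rv \<and> vnode rv = Some l \<and> x \<in> R'}"
    have "ttok m'' ?Q ?RT (ttab m)" by (rule ttok_cong[OF S3]) (use m'' in auto)
    then have tt: "dirs m'' (direct m'' R')" "dom (ttab m'') = ?TE \<union> ?RT" "?TE \<inter> ?RT = {}"
      "\<And>t. t \<in> ?RT \<Longrightarrow> ttab m'' t = ttab m t" "\<And>t. t \<in> dom (ttab m'') \<Longrightarrow> t < tcnt m''"
      unfolding Q ttok_def by auto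
    interpret a: arena E W R' R' ?Ch H ?TE "ttab m''" Z by (rule ar)
    define lv' where "lv' = lv(l := 0)"
    define L' where "L' = L(l := {v})"
    have gl: "lv' l = 0" "L' l = {v}" and gp: "\<And>p. p \<noteq> l \<Longrightarrow> lv' p = lv p \<and> L' p = L p" by (auto simp: lv'_def L'_def)
    have gd: "lv' p = lv p" "L' p = L p" "p \<noteq> l" if "p \<in> live ?nt" for p using gp[of p] that ll by auto
    have LR: "L p \<subseteq> R" if "p \<in> live ?nt" for p using forestD(3)[OF F that] by simp
    have kdl: "c \<in> live ?nt" if "p \<in> live ?nt" "c \<in> set (kd ?nt p)" for p c using forestD(9)[OF F that] .
    have b': "a.base lv' L' ?nt' (ncnt m'')"
    proof -
      have "env.base E R' H {} lv L ?nt l" unfolding l_def by (rule env.base_change[OF b]) (use LR R' in auto)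
      then have b1: "env.base E R' H {} lv' L' ?nt' (Suc l)"
      proof (rule env.base_add[OF _ T4 _ _ T5(3,1) _ lv'_def L'_def])
        show "a.shape lv' L' [] l" using gl by (simp add: a.shape_def)
        show "{v} \<inter> L q = {}" if "q \<in> live ?nt" for q using LR[OF that] v(2) by auto
      qed (use T2 R' in auto)
      have Zp: "p \<in> live ?nt' \<and> lv' p = 0 \<and> L' p = {x}" if px: "(p, x) \<in> Z" for p x
      proof -
        obtain rx where rx: "vtab m'' x = Some rx" "vnode rx = Some p" "x \<in> R'" using px unfolding Z_def by blast
        show ?thesis
        proof (cases "x = v")
          case True then show ?thesis using rx T1(1) gl T4 by auto
        next
          case False
          then have "p \<in> live ?nt \<and> lv p = 0 \<and> L p = {x}" using vnD(1)[OF vnm, of x rx] rx T1(1) R' by auto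
          then show ?thesis using gd[of p] T4 by auto
        qed
      qed
      show ?thesis unfolding T1(2) by (rule env.base_change[OF b1 env.baseD(7)[OF b1]]) (use Zp in blast)+
    qed
    have own: "a.own (Suc 0) lv' L' ?nt' (set [l]) = {p \<in> trees ?nt. L p \<inter> {u2, u1} = {}}"
    using T4 T2 forestD(5)[OF F] gd LR v(2) by (fastforce simp: a.own_def trees_def env.is_root_def a.ok_def)
    have rts: "a.roots (Suc 0) lv' L' ?nt' (set [l]) (ttab m'') (tcnt m'')"
      by (rule roots_keep[OF F tt(2-5) own]) (use T2 gd in auto)
    have outv: "out E {v} = {(v, u1), (v, u2)}"
      using nbv r1(4) r2(4) by (auto simp: out_def)
    have st: "a.stage 0 [l] K lv' L' (?Ch \<inter> R') ?nt' (ncnt m'') (ttab m'') (tcnt m'')"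
    proof (rule a.stage_start[OF b' _ _ rts])
      fix p assume p: "p \<in> live ?nt'" "L' p \<inter> ?Ch = {} \<or> lv' p = 0"
      show "L' p \<subseteq> R' \<and> conn E (L' p) \<and> ww ?nt' p = a.inner (L' p)"
      proof (cases "p = l")
        case True
        have ev: "{e \<in> E. e \<subseteq> {v}} = {}" using a.E unfolding simple_edges_def by auto
        have "a.inner {v} = 0" unfolding a.inner_def ev by simp
        then show ?thesis using True gl T5 R' conn_singleton by simp
      next
        case False
        then have pl: "p \<in> live ?nt" using p T4 by simp
        then show ?thesis using forestD(3)[OF F pl] T2[OF pl] gd[OF pl] R' by auto
      qed
    next
      fix p q x y assume a: "p \<in> live ?nt'" "q \<in> live ?nt'" "p \<noteq> q" "lv' p = lv' q" "length (kd ?nt' p) = 1" "length (kd ?nt' q) = 1"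
       "x \<in> L' p" "y \<in> L' q"
      have "p \<in> live ?nt" "q \<in> live ?nt" using a T4 T5 by auto
      then show "{x, y} \<notin> E" using forestD(4)[OF F, of p q x y] a T2 gd by auto
    next
      fix q c assume q: "q \<in> live ?nt'" "c \<in> set (kd ?nt' q)" "c \<notin> live ?nt'"
      have "q \<noteq> l" using q(2) T5(1) by auto
      then have "q \<in> live ?nt" using q(1) T4 by simp
      then have "c \<in> live ?nt'" using kdl[of q c] q T2 T4 by auto
      then show "q \<in> set K \<and> L' c \<inter> R' = {}" using q by simp
    next
      fix p assume p: "p \<in> live ?nt'" "lv' p = 0"
      show "a.strong lv' L' ?nt' p"
      proof (cases "p = l")
        case True
        have srep: "env.srep W R' (live ?nt') lv' L' 0 (v, u) s" if su: "sp s u" "u \<noteq> v" for s u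
        proof (cases "u \<in> R")
          case True
          then obtain n where "n \<in> live ?nt" "fst s = Cluster n" "lv n = 0" "L n = {u}" "snd s = W {v, u}" using su(1) unfolding sp_def by auto
          then show ?thesis using T4 gd[of n] by (simp add: env.srep_def)
        next
          case False
          then have "fst s = Singular u" "snd s = W {v, u}" using su(1) unfolding sp_def by auto
          then show ?thesis using False su(2) R' by (simp add: env.srep_def)
        qed
        show ?thesis unfolding a.strong_def True gl T5
          by (rule a.sokI[OF _ outv srep[OF s12(1) r1(4)] srep[OF s12(2) r2(4)]]) (use u12 in simp)
      next
        case False
        then have pl: "p \<in> live ?nt" "lv p = 0" using p T4 gp[of p] by auto
        obtain x where x: "L p = {x}" "x \<in> R" using fl[OF pl] by blast
        have Lx: "L' p = {x}" using gd[OF pl(1)] x by simp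
        have old: "env.sok E (env.srep W R (live ?nt) lv L 0) {x} (sd ?nt p)"
          using forestD(2)[OF F pl(1)] pl x unfolding env.strong_def by simp
        show ?thesis
        proof (cases "x \<in> {u2, u1}")
          case True
          then have sp': "sd ?nt' p = map_prod g' g' (sd ?nt p)" using T2[OF pl(1)] pl x by auto
          show ?thesis unfolding a.strong_def p(2) Lx sp'
          proof (rule a.sok_map[OF old])
            fix d s assume d: "d \<in> out E {x}" "env.srep W R (live ?nt) lv L 0 d s"
            show "a.srep (live ?nt') lv' L' 0 d (g' s)"
            proof (cases "fst s")
              case (Singular u)
              show ?thesis
              using Singular d(2) T4 gl R' by (auto simp: env.srep_def g'_def resides_def)
            next
              case (Cluster q)
              then have "q \<in> live ?nt" "lv q = 0" "snd d \<in> L q" "snd s = W {fst d, snd d}" using d(2) by (auto simp: env.srep_def)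
              then show ?thesis using Cluster T4 gd[of q] by (auto simp: env.srep_def g'_def resides_def)
            qed
          qed
        next
          case False
          have xC: "x \<notin> ?Ch" using False x v(2) by auto
          have sp': "sd ?nt' p = sd ?nt p" using T2[OF pl(1)] x False by auto
          show ?thesis unfolding a.strong_def p(2) Lx sp'
          proof (rule a.sok_mono[OF old])
            fix d s assume d: "d \<in> out E {x}" "env.srep W R (live ?nt) lv L 0 d s"
            have dx: "fst d = x" "{x, snd d} \<in> E" using d(1) by (auto simp: out_def)
            have dv: "snd d \<noteq> v"
            proof
              assume "snd d = v"
              then show False using dx(2) xC nbv'[of x] by simp
            qed
            show "a.srep (live ?nt') lv' L' 0 d s"
            proof (cases "fst s")
              case (Singular u)
              then show ?thesis using d(2) dv R' by (auto simp: env.srep_def)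
            next
              case (Cluster q)
              then have "q \<in> live ?nt" "lv q = 0" "snd d \<in> L q" "snd s = W {fst d, snd d}" using d(2) by (auto simp: env.srep_def)
              then show ?thesis using Cluster T4 gd[of q] by (auto simp: env.srep_def)
            qed
          qed
        qed
      qed
    next
      fix p assume p: "p \<in> live ?nt'" "0 < lv' p" "L' p \<inter> ?Ch = {}"
      have pl: "p \<in> live ?nt" using p gl T4 by auto
      have lp: "lv' p = lv p" "L' p = L p" using gd[OF pl] by auto
      have sp': "sd ?nt' p = sd ?nt p" using T2[OF pl] p lp by auto
      have old: "env.sok E (env.srep W R (live ?nt) lv L (lv p)) (L p) (sd ?nt p)"
        using forestD(2)[OF F pl] unfolding env.strong_def by simp
      show "a.weak lv' L' ?nt' {} p" unfolding a.weak_def sp' lp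
      proof (rule a.sok_mono[OF old])
        fix d s assume d: "d \<in> out E (L p)" "env.srep W R (live ?nt) lv L (lv p) d s"
        have dp: "fst d \<in> L p" "{fst d, snd d} \<in> E" using d(1) by (auto simp: out_def)
        have dx: "fst d \<notin> ?Ch" "{fst d, snd d} \<in> E" using dp p(3) unfolding lp(2) by blast+
        have dv: "snd d \<noteq> v"
        proof
          assume "snd d = v"
          then show False using dx nbv'[of "fst d"] by simp
        qed
        show "a.wrep (live ?nt' - {}) lv' L' (lv p) d s"
        proof (cases "fst s")
          case (Singular u)
          then show ?thesis using d(2) dv R' by (auto simp: env.srep_def env.wrep_def)
        next
          case (Cluster q)
          then have q: "q \<in> live ?nt" "lv q = lv p" "snd d \<in> L q" "snd s = W {fst d, snd d}" using d(2) by (auto simp: env.srep_def)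
          have "snd d \<in> R'" using LR[OF q(1)] q R' by auto
          moreover have "r = q" if "r \<in> live ?nt'" "lv' r = lv p" "snd d \<in> L' r" for r
          proof -
            have "r \<noteq> l" using that gl dv by auto
            then have "r \<in> live ?nt" using that T4 by simp
            then show ?thesis using env.baseD(8)[OF b _ q(1), of r] gd[of r] that q by auto
          qed
          ultimately show ?thesis using Cluster q by (auto simp: env.wrep_def)
        qed
      qed
    next
      fix q assume q: "q \<in> set K"
      then obtain c where c: "q \<in> live ?nt" "lv q = Suc 0" "c \<in> set (kd ?nt q)" "L c \<subseteq> {u2, u1}" using S4[OF q] by blast
      have "L' c \<subseteq> ?Ch" using gd[OF kdl[OF c(1,3)]] c(4) by auto
      then show "q \<in> live ?nt' \<and> lv' q = Suc 0 \<and> (\<exists>c\<in>set (kd ?nt' q). L' c \<subseteq> ?Ch)" using c T2[OF c(1)] T4 gd[OF c(1)] by auto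
    next
      fix q c assume q: "q \<in> live ?nt'" "lv' q = Suc 0" "c \<in> set (kd ?nt' q)" "L' c \<inter> ?Ch \<noteq> {}"
      have ql: "q \<in> live ?nt" using q gl T4 by auto
      have cq: "c \<in> set (kd ?nt q)" using q T2[OF ql] by auto
      have cl: "c \<in> live ?nt" by (rule kdl[OF ql cq])
      have lc: "lv c = 0" using env.shape_kid(1)[OF env.baseD(4)[OF b ql] cq] q gd[OF ql] by simp
      have "L c \<subseteq> {u2, u1}" using fl[OF cl lc] q(4) gd[OF cl] v(2) by auto
      moreover have "pa ?nt c = Some q" by (rule env.baseD(11)[OF b ql cq cl])
      ultimately show "q \<in> set K" using S5[OF cl lc] by auto
    next
      fix p assume "p \<in> set [l]"
      then show "p \<in> live ?nt' \<and> lv' p = 0 \<and> pa ?nt' p = None \<and> L' p \<subseteq> ?Ch" using T4 T5 gl by auto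
    next
      define Nn where "Nn = {n \<in> live ?nt. lv n = 0 \<and> L n \<subseteq> {u1, u2}}"
      have finN: "finite Nn" using env.baseD(1)[OF b] by (auto simp: Nn_def)
      have NnL: "n \<in> live ?nt" "\<exists>u. L n = {u} \<and> (u = u1 \<or> u = u2)" if "n \<in> Nn" for n
        using that fl[of n] unfolding Nn_def by auto
      have "?Ch \<inter> R' = {v} \<union> \<Union>(L ` Nn)"
      proof
        show "{v} \<union> \<Union>(L ` Nn) \<subseteq> ?Ch \<inter> R'" using LR R' unfolding Nn_def by auto
        show "?Ch \<inter> R' \<subseteq> {v} \<union> \<Union>(L ` Nn)"
        proof
          fix x assume x: "x \<in> ?Ch \<inter> R'"
          show "x \<in> {v} \<union> \<Union>(L ` Nn)"
          proof (cases "x = v")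
            case False
            then have xR: "x \<in> R" using x R' by auto
            obtain rx where rx: "vtab m x = Some rx" using gmD(1)[OF g] RV xR by blast
            obtain n where "n \<in> live ?nt" "lv n = 0" "L n = {x}" using vnD(1)[OF vnm rx xR] by blast
            then show ?thesis using x False unfolding Nn_def by auto
          qed simp
        qed
      qed
      \<comment> \<open>The regular neighbours are added to \<open>{v}\<close> one exit at a time,
        so by \<open>expand_out\<close> the region has no more exits than \<open>v\<close>
        alone.\<close>
      moreover have "card (out E ({v} \<union> \<Union>(L ` Nn))) \<le> card (out E {v}) \<and> card Nn \<le> card (out E {v})"
      proof (rule expand_out[OF a.E finN])
        fix d assume d: "d \<in> Nn"
        obtain u where u: "L d = {u}" "u = u1 \<or> u = u2" using NnL(2)[OF d] by blast
        have "card (out E (L d)) = 2" using env.sok_card forestD(2)[OF F NnL(1)[OF d]] unfolding env.strong_def by blast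
        moreover have "u \<noteq> v" "{v, u} \<in> E" using u r1(4) r2(4) nbv by auto
        ultimately show "L d \<inter> {v} = {} \<and> card (out E (L d)) = 2 \<and> (\<exists>x\<in>{v}. \<exists>y\<in>L d. {x, y} \<in> E)" using u by auto
      next
        fix c d assume "c \<in> Nn" "d \<in> Nn" "c \<noteq> d"
        then show "L c \<inter> L d = {}" using env.baseD(8)[OF b, of c d] unfolding Nn_def by auto
      qed
      moreover have "card (out E {v}) \<le> 4" unfolding outv using u12 by simp
      ultimately show "card (out E (?Ch \<inter> R')) \<le> 4" by simp
      show "card ?Ch \<le> 26" using card_length[of "[v, u1, u2]"] by simp
    qed auto
    show ?thesis
    proof (rule finish_propagate[OF ar Z_def st])
      show "gm E W V m''"
        by (rule gm_cong[OF g T1(3)]) (use T1(1) rv in \<open>auto split: if_splits\<close>)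
      show "R' \<subseteq> V" using RV R' v by auto
      show "dirs m'' (direct m'' R')" by (rule tt(1))
      show "length K \<le> 3" using S6 u12 by simp
      show "if w \<in> R' then vnode rw \<noteq> None else vnode rw = None" if "vtab m'' w = Some rw" for w rw
        using that T1(1) vnD[OF vnm, of w rw] R' by (cases "w = v") auto
    qed
  qed
  define nd where "nd = \<lparr> parent = None, kids = [], sides = ((Singular v, 0 :: real), (Singular v, 0)), wt = 0, top_edge = None \<rparr>"
  let ?m0 = "m\<lparr>ntab := ?nt(l \<mapsto> nd), ncnt := Suc l\<rparr>"
  have ne: "L p \<noteq> {}" if "p \<in> live ?nt" for p using env.baseD(6)[OF b that] .
  have "ttok ?m0 (direct m R - {k \<in> {e1, e2}. oth k \<in> {}}) (rts ?nt L {}) (ttab m)"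
    by (rule ttok_cong[where m = m]) (use k0 in auto)
  moreover have "tops ?m0 (direct m R - {k \<in> {e1, e2}. oth k \<in> {}}) \<subseteq> tops m (direct m R)" by (simp add: tops_def)
  ultimately have J0: "JI {} [] ?m0"
    unfolding JI_def using ll ne by (auto simp: same_edges_def edited_def marked_def)
  have t1: "runs (join v l e1 []) ?m0 (\<lambda>s t m''. t \<le> 2 * H + 9 \<and> sp (fst s) u1 \<and> JI {u1} (snd s) m'')"
    by (rule step[OF J0 r1(1,2,3,4,5)]) (use oth u12 in auto)
  show ?thesis
    apply (simp add: make_regular_def runs_bind[of "read_vertex v"] runs_read_vertex rv vnv)
    apply (simp only: runs_bind runs_new_node nd_def[symmetric] l_def[symmetric])
    apply (rule runs_mono[OF t1], elim conjE)
    subgoal for s1 tm1 m1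
      apply (cases s1)
      apply (simp only: prod.case runs_bind fst_conv snd_conv)
      apply (rule runs_mono[OF step[OF _ r2(1,2,3,4,5)], of "{u1}"])
      apply assumption
      using oth u12 apply auto[5]
      apply (elim conjE)
      subgoal for x1 K1 s2 tm2 m2
        apply (cases s2)
        apply (simp only: prod.case runs_bind fst_conv snd_conv runs_write_node runs_write_vertex)
        apply (rule runs_mono[OF final])
        apply assumption
        apply assumption
        apply assumption
        apply simp
        subgoal premises pr for x2 K2 u3 t3 m3
        using pr ll env.baseD(1)[OF b] by (auto simp: JI_def)
        done
      done
    done
qed


text \<open>Both ends are singular, so the edge meets no cluster: exits, inner weights and
  adjacencies stay as they are. This is why an insertion first makes both ends singular.\<close>

lemma forest_add_edge:
  assumes F: "forest E W R H TE lv L nt nc tt tc" and xy: "x \<notin> R" "y \<notin> R" "{x, y} \<notin> E"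
    and E': "E' = insert {x, y} E" and W': "W' = W({x, y} := w)" and tt': "tt' = tt(tc \<mapsto> T)"
  shows "forest E' W' R H (insert tc TE) lv L nt nc tt' (Suc tc)"
proof -
  note b = forestD(1)[OF F]
  have LR: "L p \<subseteq> R" if "p \<in> live nt" for p using forestD(3)[OF F that] by simp
  have edge: "{a, c} \<in> E' \<longleftrightarrow> {a, c} \<in> E" if "a \<in> R" for a c
    using that xy E' by (auto simp: doubleton_eq_iff)
  have out: "out E' X = out E X" if "X \<subseteq> R" for X using edge that by (auto simp: out_def)
  have W: "W' {a, c} = W {a, c}" if "a \<in> R" for a c using that xy W' by (auto simp: doubleton_eq_iff)
  have str: "env.strong E' W' R lv L nt p" if p: "p \<in> live nt" for p
  proof -
    have "env.sok E (env.srep W' R (live nt) lv L (lv p)) (L p) (sd nt p)"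
    proof (rule env.sok_mono)
      show "env.sok E (env.srep W R (live nt) lv L (lv p)) (L p) (sd nt p)" using forestD(2)[OF F p] by (simp add: env.strong_def)
      fix d s assume d: "d \<in> out E (L p)" "env.srep W R (live nt) lv L (lv p) d s"
      have "fst d \<in> R" using d(1) LR[OF p] by (auto simp: out_def)
      then show "env.srep W' R (live nt) lv L (lv p) d s" using d(2) W by (simp add: env.srep_def)
    qed
    then show ?thesis unfolding env.strong_def env.sok_def out[OF LR[OF p]] .
  qed
  have EE: "E \<subseteq> E'" using E' by auto
  have b': "env.base E' R H {} lv L nt nc" by (rule env.base_change[OF b LR _ EE]) auto
  have conn: "conn E' (L p)" if "p \<in> live nt" for p
    using forestD(3)[OF F that] EE unfolding conn_def by (metis subsetD)
  have inner: "env.inner E' W' (L p) = env.inner E W (L p)" if "p \<in> live nt" for p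
  proof -
    have 1: "{e. e \<in> E' \<and> e \<subseteq> L p} = {e. e \<in> E \<and> e \<subseteq> L p}" using LR[OF that] xy E' by auto
    show ?thesis unfolding env.inner_def 1
      by (rule sum.cong[OF refl]) (use LR[OF that] xy W' in auto)
  qed
  have ok: "env.ok {} (Suc H) lv L p" for p by (simp add: env.ok_def)
  have own: "env.own {} (Suc H) lv L nt {} = trees nt" using ok by (auto simp: env.own_def trees_def)
  have tlt: "t < tc" if "t \<in> dom tt" for t using forestD(8)[OF F that] .
  have r: "env.roots {} (insert tc TE) tt' (Suc H) lv L nt {} tt' (Suc tc)"
    unfolding env.roots_def own
  proof (intro conjI ballI)
    fix p assume p: "p \<in> trees nt"
    obtain u a v c t where sp: "0 < lv p" "sd nt p = ((Singular u, a), (Singular v, c))" "te nt p = Some t" "t \<notin> TE"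
        "tt t = Some \<lparr> tends = (u, v), twt = ww nt p + a + c \<rparr>"
      using forestD(5)[OF F p] unfolding env.is_root_def by blast
    moreover have "t \<noteq> tc" using tlt[of t] sp by auto
    ultimately show "env.is_root (insert tc TE) lv nt tt' p" using tt' by (simp add: env.is_root_def)
  next
    show "dom tt' = insert tc TE \<union> {t. Some t \<in> te nt ` trees nt}" using forestD(7)[OF F] tt' by auto
    show "t < Suc tc" if "t \<in> dom tt'" for t using that tlt[of t] tt' by (auto simp: less_Suc_eq split: if_splits)
  qed (use forestD(6)[OF F] in auto)
  have rg: "env.reg E' {} (Suc H) lv L nt"
    unfolding env.reg_def
  using forestD(4)[OF F] edge LR by fastforce
  have "env.contents E' W' R {} (Suc H) lv L nt"
    using forestD(3)[OF F] conn inner unfolding env.contents_def by simp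
  moreover have "env.kids_ok R L nt {} {}" using forestD(9)[OF F] unfolding env.kids_ok_def by blast
  ultimately show ?thesis using b' rg r str unfolding forest_def env.core_def by blast
qed

lemma add_edge_runs:
  assumes F0: "full E W V R H m" and xy: "x \<in> V" "y \<in> V" "x \<noteq> y" "x \<notin> R" "y \<notin> R" "{x, y} \<notin> E"
  shows "runs (do {
     e \<leftarrow> new_edge \<lparr> eends = (x, y), ewt = w, etop = None \<rparr>;
     add_incidence x e;
     add_incidence y e;
     new_direct e }) m (\<lambda>_ t m'. full (insert {x, y} E) (W({x, y} := w)) V R H m' \<and> t \<le> 8 \<and> ntab m' = ntab m)"
proof -
  obtain lv L where vnm: "vn R lv L m" and F: "forest E W R H (tops m (direct m R)) lv L (ntab m) (ncnt m) (ttab m) (tcnt m)"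
    and g: "gm E W V m" and RV: "R \<subseteq> V" and drs: "dirs m (direct m R)"
    using F0 unfolding full_def by blast
  obtain rx where rx: "vtab m x = Some rx" using gmD(1)[OF g] xy by blast
  obtain ry where ry: "vtab m y = Some ry" using gmD(1)[OF g] xy by blast
  let ?e = "ecnt m"
  have enew: "etab m ?e = None" using gmD(3)[OF g, of ?e] by (cases "etab m ?e") auto
  let ?vt = "(vtab m)(x \<mapsto> rx\<lparr>inc := ?e # inc rx\<rparr>, y \<mapsto> ry\<lparr>inc := ?e # inc ry\<rparr>)"
  let ?m1 = "m\<lparr>etab := (etab m)(?e \<mapsto> \<lparr> eends = (x, y), ewt = w, etop = None \<rparr>), ecnt := Suc ?e, vtab := ?vt\<rparr>"
  define re where "re = \<lparr> eends = (x, y), ewt = w, etop = Some (tcnt m) \<rparr>"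
  define m2 where "m2 = m\<lparr>etab := (etab m)(?e \<mapsto> re), ecnt := Suc ?e, vtab := ?vt,
     ttab := (ttab m)(tcnt m \<mapsto> \<lparr> tends = (x, y), twt = w \<rparr>), tcnt := Suc (tcnt m)\<rparr>"
  have run: "runs (do {
     e \<leftarrow> new_edge \<lparr> eends = (x, y), ewt = w, etop = None \<rparr>;
     add_incidence x e;
     add_incidence y e;
     new_direct e }) m (\<lambda>_ t m'. t \<le> 8 \<and> m' = m2)"
    using xy(3) by (simp add: runs_simps add_incidence_def new_direct_def rx ry m2_def re_def)
  have ese: "eset re = {x, y}" by (simp add: eset_def re_def)
  have et: "etab m2 k = (if k = ?e then Some re else etab m k)" for k by (simp add: m2_def)
  have old: "k \<noteq> ?e" "eset r \<in> E" "eset r \<noteq> {x, y}" if "etab m k = Some r" for k r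
    using gmD(3)[OF g that] xy(6) by auto
  have g2: "gm (insert {x, y} E) (W({x, y} := w)) V m2"
    unfolding gm_def
  proof (intro conjI)
    show "dom (vtab m2) = V" using gmD(1)[OF g] rx ry by (auto simp: m2_def)
    show "\<forall>e\<in>insert {x, y} E. e \<subseteq> V" using gmD(2)[OF g] xy by auto
    show "\<forall>k r. etab m2 k = Some r \<longrightarrow> k < ecnt m2 \<and> fst (eends r) \<noteq> snd (eends r) \<and> eset r \<in> insert {x, y} E \<and> ewt r = (W({x, y} := w)) (eset r)"
    proof (intro allI impI)
      fix k r assume k: "etab m2 k = Some r"
      show "k < ecnt m2 \<and> fst (eends r) \<noteq> snd (eends r) \<and> eset r \<in> insert {x, y} E \<and> ewt r = (W({x, y} := w)) (eset r)"
      proof (cases "k = ?e")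
        case True
        then have "r = re" using k et by simp
        then show ?thesis using True xy(3) ese by (simp add: m2_def re_def)
      next
        case False
        then have k': "etab m k = Some r" using k et by simp
        then show ?thesis using gmD(3)[OF g k'] old[OF k'] by (auto simp: m2_def)
      qed
    qed
    show "\<forall>k k' r r'. etab m2 k = Some r \<longrightarrow> etab m2 k' = Some r' \<longrightarrow> eset r = eset r' \<longrightarrow> k = k'"
    proof (intro allI impI)
      fix k k' r r' assume a: "etab m2 k = Some r" "etab m2 k' = Some r'" "eset r = eset r'"
      then show "k = k'" using gmD(4)[OF g, of k r k' r'] old(3)[of k r] old(3)[of k' r'] ese unfolding et by (auto split: if_splits)
    qed
    show "\<forall>e\<in>insert {x, y} E. \<exists>k r. etab m2 k = Some r \<and> eset r = e"
    using et ese gmD(5)[OF g] old(1) by fastforce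
    show "\<forall>v rv. vtab m2 v = Some rv \<longrightarrow> distinct (inc rv) \<and> set (inc rv) = {k. \<exists>r. etab m2 k = Some r \<and> v \<in> eset r}"
    using rx ry gmD(6)[OF g] enew ese by (auto simp: m2_def)
  qed
  have dr: "direct m2 R = insert ?e (direct m R)" "?e \<notin> direct m R"
    unfolding direct_def et using ese xy(4,5) enew by auto
  let ?m0 = "m\<lparr>etab := (etab m)(?e \<mapsto> \<lparr> eends = (x, y), ewt = w, etop = None \<rparr>)\<rparr>"
  have "ttok m (direct m R) (rts (ntab m) L {}) (ttab m)" by (rule full_ttok[OF drs F])
  then have t0: "ttok ?m0 (direct m R) (rts (ntab m) L {}) (ttab m)"
  using dr(2) by (fastforce simp: tops_def ttok_def dirs_def)
  have "ttok m2 (direct m2 R) (rts (ntab m) L {}) (ttab m)"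
    unfolding dr(1)
    by (rule ttok_cong[OF ttok_new_direct[OF t0 _ dr(2), of "\<lparr> eends = (x, y), ewt = w, etop = None \<rparr>"]])
      (auto simp: m2_def re_def)
  then have d2: "dirs m2 (direct m2 R)" by (simp add: ttok_def)
  have tp: "tops m2 (direct m2 R) = insert (tcnt m) (tops m (direct m R))"
  proof -
    have "etab m2 k = etab m k" if "k \<in> direct m R" for k using et[of k] that dr(2) by auto
    then have "tops m2 (direct m R) = tops m (direct m R)" unfolding tops_def by simp
    moreover have "tops m2 (insert ?e Q) = insert (tcnt m) (tops m2 Q)" for Q
      unfolding tops_def using et[of ?e] by (auto simp: re_def)
    ultimately show ?thesis using dr(1) by simp
  qed
  have F2: "forest (insert {x, y} E) (W({x, y} := w)) R H (tops m2 (direct m2 R)) lv L (ntab m2) (ncnt m2) (ttab m2) (tcnt m2)"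
    unfolding tp using forest_add_edge[OF F xy(4,5,6) refl refl refl] by (simp add: m2_def)
  have v2: "vn R lv L m2"
    unfolding vn_def
  using rx ry vnD[OF vnm] by (auto simp: m2_def)
  have "full (insert {x, y} E) (W({x, y} := w)) V R H m2" unfolding full_def using g2 RV d2 v2 F2 by blast
  then show ?thesis by (intro runs_mono[OF run]) (auto simp: m2_def)
qed

text \<open>The constant: 2 * 1446 + 2 * 1448 = 5788 for the parts proportional to
  \<open>H + 1\<close>, and 70 + 70 + 8 + 90 + 90 = 328 for the rest, together below 6200.\<close>

lemma insert_edge_runs:
  assumes F0: "full E W V R H m" and so: "sound E R H" and xy: "x \<in> V" "y \<in> V" "x \<noteq> y" "{x, y} \<notin> E"
    and R: "R = {v \<in> V. card {e \<in> E. v \<in> e} = 2}"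
    and E': "E' = insert {x, y} E" and R': "R' = {v \<in> V. card {e \<in> E'. v \<in> e} = 2}" and so': "sound E' R' H"
  shows "runs (insert_edge x y w) m (\<lambda>_ t m'. full E' (W({x, y} := w)) V R' H m' \<and>
     t + 13 * card (live (ntab m')) \<le> 13 * card (live (ntab m)) + 6200 * (H + 1))"
proof -
  \<comment> \<open>The vertices treated as regular after each stage. With the old edges these sets
    lie in \<open>R\<close>, with the new ones \<open>R1\<close> and \<open>R2\<close> lie in
    \<open>R'\<close>, so that \<open>sound_subset\<close> applies throughout.\<close>
  define R0 where "R0 = R - {x} - {y}"
  define R1 where "R1 = (if card {e \<in> E'. x \<in> e} = 2 then insert x R0 else R0)"
  define R2 where "R2 = (if card {e \<in> E'. y \<in> e} = 2 then insert y R1 else R1)"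
  have "{e \<in> E'. v \<in> e} = {e \<in> E. v \<in> e}" if "v \<noteq> x" "v \<noteq> y" for v using that E' by auto
  then have c: "card {e \<in> E'. v \<in> e} = card {e \<in> E. v \<in> e}" if "v \<noteq> x" "v \<noteq> y" for v using that by simp
  have R2: "R2 = R'"
  proof (rule set_eqI)
    fix v show "v \<in> R2 \<longleftrightarrow> v \<in> R'"
      using xy c[of v] unfolding R2_def R1_def R0_def R R' by (cases "v = x"; cases "v = y") auto
  qed
  have R12: "R1 \<subseteq> R'" unfolding R2[symmetric] R2_def by auto
  have y1: "y \<notin> R1" "x \<notin> R0" "y \<notin> R0" unfolding R1_def R0_def using xy by auto
  have so1: "sound E (R - {x}) H" by (rule sound_subset[OF so]) auto
  have so2: "sound E' R1 H" by (rule sound_subset[OF so' R12])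
  have so3: "sound E' R2 H" using so' R2 by simp
  let ?add = "do {
    e \<leftarrow> new_edge \<lparr> eends = (x, y), ewt = w, etop = None \<rparr>;
    add_incidence x e;
    add_incidence y e;
    new_direct e }"
  let ?Q = "\<lambda>t m'. full E' (W({x, y} := w)) V R' H m' \<and> t + 13 * card (live (ntab m')) \<le> 13 * card (live (ntab m)) + 6200 * (H + 1)"
  have seq: "runs (insert_edge x y w) m Q \<longleftrightarrow> runs (make_singular x) m (\<lambda>_ t1 m1. runs (make_singular y) m1 (\<lambda>_ t2 m2.
      runs ?add m2 (\<lambda>_ t3 m3. runs (make_regular x) m3 (\<lambda>_ t4 m4. runs (make_regular y) m4 (\<lambda>u t5 m5.
          Q u (t1 + t2 + t3 + t4 + t5) m5)))))" for Q
    by (simp add: insert_edge_def runs_bind add.assoc)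
  show ?thesis
    unfolding seq
  proof (rule runs_mono[OF make_singular_runs[OF F0 so xy(1)]], elim conjE)
    fix t1 :: nat and m1 assume f1: "full E W V (R - {x}) H m1"
      and c1: "t1 + 13 * card (live (ntab m1)) \<le> 13 * card (live (ntab m)) + 1446 * (H + 1) + 70"
    show "runs (make_singular y) m1 (\<lambda>_ t2 m2.
      runs ?add m2 (\<lambda>_ t3 m3. runs (make_regular x) m3 (\<lambda>_ t4 m4. runs (make_regular y) m4 (\<lambda>_ t5 m5. ?Q (t1 + t2 + t3 + t4 + t5) m5))))"
    proof (rule runs_mono[OF make_singular_runs[OF f1 so1 xy(2)]], elim conjE)
      fix t2 :: nat and m2 assume "full E W V (R - {x} - {y}) H m2"
        and c2: "t2 + 13 * card (live (ntab m2)) \<le> 13 * card (live (ntab m1)) + 1446 * (H + 1) + 70"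
      then have f2: "full E W V R0 H m2" by (simp add: R0_def)
      show "runs ?add m2 (\<lambda>_ t3 m3. runs (make_regular x) m3 (\<lambda>_ t4 m4. runs (make_regular y) m4 (\<lambda>_ t5 m5. ?Q (t1 + t2 + t3 + t4 + t5) m5)))"
      proof (rule runs_mono[OF add_edge_runs[OF f2 xy(1,2,3) y1(2,3) xy(4)]], elim conjE)
        fix t3 :: nat and m3 :: mem assume f3: "full (insert {x, y} E) (W({x, y} := w)) V R0 H m3" and c3: "t3 \<le> 8" "ntab m3 = ntab m2"
        note f3 = f3[folded E']
        show "runs (make_regular x) m3 (\<lambda>_ t4 m4. runs (make_regular y) m4 (\<lambda>_ t5 m5. ?Q (t1 + t2 + t3 + t4 + t5) m5))"
        proof (rule runs_mono[OF make_regular_runs[OF f3 xy(1) y1(2) R1_def so2]], elim conjE)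
          fix t4 :: nat and m4 assume f4: "full E' (W({x, y} := w)) V R1 H m4"
            and c4: "t4 + 13 * card (live (ntab m4)) \<le> 13 * card (live (ntab m3)) + 1448 * (H + 1) + 90"
          show "runs (make_regular y) m4 (\<lambda>_ t5 m5. ?Q (t1 + t2 + t3 + t4 + t5) m5)"
            by (rule runs_mono[OF make_regular_runs[OF f4 xy(2) y1(1) R2_def so3]])
              (use R2 c1 c2 c3 c4 in auto)
        qed
      qed
    qed
  qed
qed


section \<open>Regular paths\<close>

lemma path_edges_nth: "i < length (path_edges p) \<Longrightarrow> path_edges p ! i = {p ! i, p ! Suc i}"
  and length_path_edges: "length (path_edges p) = length p - 1"
  by (auto simp: path_edges_def nth_tl)

lemma set_path_edges: "set (path_edges p) = {{p ! i, p ! Suc i} | i. Suc i < length p}"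
proof -
  have "set (path_edges p) = {path_edges p ! i | i. i < length (path_edges p)}" by (auto simp: set_conv_nth)
  also have "\<dots> = {{p ! i, p ! Suc i} | i. Suc i < length p}"
    using path_edges_nth length_path_edges[of p] by (metis (no_types, lifting) less_diff_conv plus_1_eq_Suc add.commute)
  finally show ?thesis .
qed

lemma distinct_path_edges:
  "distinct (path_edges p) \<longleftrightarrow> (\<forall>i j. Suc i < length p \<longrightarrow> Suc j < length p \<longrightarrow> {p ! i, p ! Suc i} = {p ! j, p ! Suc j} \<longrightarrow> i = j)"
proof -
  have *: "i < length (path_edges p) \<longleftrightarrow> Suc i < length p" for i using length_path_edges[of p] by linarith
  have "distinct (path_edges p) \<longleftrightarrow> (\<forall>i j. Suc i < length p \<longrightarrow> Suc j < length p \<longrightarrow> path_edges p ! i = path_edges p ! j \<longrightarrow> i = j)"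
    unfolding distinct_conv_nth * by blast
  then show ?thesis using path_edges_nth[of _ p] * by auto
qed

lemma interior_nth: "i < length (interior p) \<Longrightarrow> interior p ! i = p ! Suc i"
  and length_interior: "length (interior p) = length p - 2"
  by (auto simp: interior_def nth_butlast nth_tl)

lemma set_interior: "set (interior p) = {p ! i | i. 0 < i \<and> Suc i < length p}"
proof -
  have "set (interior p) = {p ! Suc i | i. Suc (Suc i) < length p}"
    unfolding set_conv_nth using interior_nth[of _ p] length_interior[of p] by (auto; metis Suc_less_eq2 less_diff_conv add_2_eq_Suc')
  also have "\<dots> = {p ! i | i. 0 < i \<and> Suc i < length p}"
    by (auto; metis Suc_pred)
  finally show ?thesis .
qed

lemma regular_path_nth:
  assumes "regular_path G p"
  shows "2 \<le> length p" "\<And>i. Suc i < length p \<Longrightarrow> {p ! i, p ! Suc i} \<in> edges G"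
    "\<And>i j. Suc i < length p \<Longrightarrow> Suc j < length p \<Longrightarrow> {p ! i, p ! Suc i} = {p ! j, p ! Suc j} \<Longrightarrow> i = j"
    "p ! 0 \<in> singulars G" "p ! (length p - 1) \<in> singulars G" "\<And>i. 0 < i \<Longrightarrow> Suc i < length p \<Longrightarrow> p ! i \<in> regulars G"
proof -
  note d = assms[unfolded regular_path_def]
  show l: "2 \<le> length p" using d by blast
  show "\<And>i. Suc i < length p \<Longrightarrow> {p ! i, p ! Suc i} \<in> edges G" using d unfolding set_path_edges by blast
  show "\<And>i j. Suc i < length p \<Longrightarrow> Suc j < length p \<Longrightarrow> {p ! i, p ! Suc i} = {p ! j, p ! Suc j} \<Longrightarrow> i = j"
    using d unfolding distinct_path_edges by blast
  have ne: "p \<noteq> []" using l by auto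
  show "p ! 0 \<in> singulars G" "p ! (length p - 1) \<in> singulars G" using d hd_conv_nth[OF ne] last_conv_nth[OF ne] by auto
  show "\<And>i. 0 < i \<Longrightarrow> Suc i < length p \<Longrightarrow> p ! i \<in> regulars G" using d unfolding set_interior by blast
qed

lemma finite_regulars:
  assumes "simple_edges (edges G)"
  shows "finite (regulars G)"
proof (rule finite_subset)
  show "regulars G \<subseteq> \<Union>(edges G)"
  proof
    fix v assume "v \<in> regulars G"
    then have "{e \<in> edges G. v \<in> e} \<noteq> {}" by (intro notI) (simp add: regulars_def incident_def)
    then show "v \<in> \<Union>(edges G)" by blast
  qed
  show "finite (\<Union>(edges G))" using assms by (auto simp: simple_edges_def)
qed

lemma two_edges:
  assumes "x \<in> regulars G" "e1 \<in> edges G" "x \<in> e1" "e2 \<in> edges G" "x \<in> e2" "e1 \<noteq> e2" "e \<in> edges G" "x \<in> e"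
  shows "e = e1 \<or> e = e2"
proof -
  have "card {e \<in> edges G. x \<in> e} = 2" using assms(1) by (simp add: regulars_def incident_def)
  then obtain a b where "{e \<in> edges G. x \<in> e} = {a, b}" by (auto simp: card_2_iff)
  moreover have "e1 \<in> {e \<in> edges G. x \<in> e}" "e2 \<in> {e \<in> edges G. x \<in> e}" "e \<in> {e \<in> edges G. x \<in> e}" using assms by auto
  ultimately show ?thesis using assms(6) by auto
qed

lemma simple_edge_end: "simple_edges E \<Longrightarrow> e \<in> E \<Longrightarrow> y \<in> e \<Longrightarrow> \<exists>w. e = {y, w} \<and> w \<noteq> y"
  unfolding simple_edges_def by (metis insertE insert_commute singletonD)

definition trail :: "nat set set \<Rightarrow> nat set \<Rightarrow> nat \<Rightarrow> nat list \<Rightarrow> bool" where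
  "trail E X u p \<longleftrightarrow> 2 \<le> length p \<and> distinct p \<and> p ! 0 = u \<and> set (tl p) \<subseteq> X \<and>
     (\<forall>i. Suc i < length p \<longrightarrow> {p ! i, p ! Suc i} \<in> E)"

lemma trailD:
  assumes "trail E X u p"
  shows "2 \<le> length p" "distinct p" "p ! 0 = u" "set (tl p) \<subseteq> X" "\<And>i. Suc i < length p \<Longrightarrow> {p ! i, p ! Suc i} \<in> E"
    "\<And>i. 0 < i \<Longrightarrow> i < length p \<Longrightarrow> p ! i \<in> X" "set p \<subseteq> insert u X"
    "\<And>i j. i < length p \<Longrightarrow> j < length p \<Longrightarrow> p ! i = p ! j \<Longrightarrow> i = j"
proof -
  show *: "2 \<le> length p" "distinct p" "p ! 0 = u" "set (tl p) \<subseteq> X" "\<And>i. Suc i < length p \<Longrightarrow> {p ! i, p ! Suc i} \<in> E"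
    using assms by (auto simp: trail_def)
  show "p ! i \<in> X" if "0 < i" "i < length p" for i
  proof -
    have "tl p ! (i - 1) \<in> set (tl p)" using that by (intro nth_mem) simp
    then show ?thesis using *(4) that by (auto simp: nth_tl)
  qed
  show "set p \<subseteq> insert u X" using * by (cases p) auto
  show "\<And>i j. i < length p \<Longrightarrow> j < length p \<Longrightarrow> p ! i = p ! j \<Longrightarrow> i = j" using *(2) by (simp add: nth_eq_iff_index_eq)
qed

text \<open>Since \<open>X\<close> is finite there is a longest trail. Its last vertex has a second
  edge, to \<open>w\<close>. If \<open>w\<close> were in \<open>X\<close>, it would either prolong
  the trail or be an earlier vertex of it with three edges.\<close>

lemma maximal_trail:
  assumes s: "simple_edges (edges G)" and X: "X \<subseteq> regulars G" and x: "x \<in> X" "u \<notin> X" "{u, x} \<in> edges G"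
  shows "\<exists>p k w. trail (edges G) X u p \<and> Suc (Suc k) = length p \<and> {p ! Suc k, w} \<in> edges G \<and> w \<notin> X \<and> w \<noteq> p ! k"
proof -
  let ?E = "edges G" and ?t = "trail (edges G) X u"
  have fX: "finite X" by (rule finite_subset[OF X finite_regulars[OF s]])
  have t0: "?t [u, x]" unfolding trail_def using x by auto
  have "length p < Suc (Suc (card X))" if "?t p" for p
  proof -
    have "length (tl p) \<le> card X" using card_mono[OF fX trailD(4)[OF that]] trailD(2)[OF that] by (metis distinct_card distinct_tl)
    then show ?thesis by simp
  qed
  then have "\<forall>p. ?t p \<longrightarrow> length p < Suc (Suc (card X))" by blast
  from ex_has_greatest_nat[where f = length, OF t0 this]
  obtain p where p: "?t p" and mx: "\<And>q. ?t q \<Longrightarrow> length q \<le> length p" by blast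
  note P = trailD[OF p]
  let ?n = "length p"
  define k where "k = ?n - 2"
  have k: "Suc (Suc k) = ?n" using P(1) by (simp add: k_def)
  define y where "y = p ! Suc k"
  have yX: "y \<in> X" using P(6)[of "Suc k"] k by (simp add: y_def)
  have e1: "{p ! k, y} \<in> ?E" using P(5)[of k] k by (simp add: y_def)
  have "card {e \<in> ?E. y \<in> e} = 2" using yX X by (auto simp: regulars_def incident_def)
  moreover have "{p ! k, y} \<in> {e \<in> ?E. y \<in> e}" using e1 by auto
  ultimately have "\<exists>a. {e \<in> ?E. y \<in> e} = {a, {p ! k, y}} \<and> a \<noteq> {p ! k, y}" by (rule card_2_other)
  then obtain e2 where e2: "e2 \<in> ?E" "y \<in> e2" "e2 \<noteq> {p ! k, y}" by blast
  obtain w where w: "e2 = {y, w}" "w \<noteq> y" using simple_edge_end[OF s e2(1,2)] by blast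
  have wk: "w \<noteq> p ! k" using e2(3) w by (auto simp: insert_commute)
  have wE: "{y, w} \<in> ?E" using e2 w by simp
  have "w \<notin> X"
  proof
    assume wX: "w \<in> X"
    show False
    proof (cases "w \<in> set p")
      case False
      have "{(p @ [w]) ! i, (p @ [w]) ! Suc i} \<in> ?E" if "Suc i < length (p @ [w])" for i
      proof (cases "Suc i < ?n")
        case True then show ?thesis using P(5) by (simp add: nth_append)
      next
        case False
        then have "i = Suc k" using that k by simp
        then show ?thesis using wE k by (simp add: nth_append y_def)
      qed
      moreover have "p \<noteq> []" using P(1) by auto
      ultimately have "?t (p @ [w])" using P(1-4) False wX unfolding trail_def by (auto simp: nth_append)
      then show False using mx[of "p @ [w]"] by simp
    next
      case True
      then obtain j where j: "j < ?n" "w = p ! j" by (auto simp: in_set_conv_nth)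
      have "j \<noteq> 0" using j(2) wX x(2) P(3) by (intro notI) simp
      moreover have "j \<noteq> k" "j \<noteq> Suc k" using j(2) wk w(2) by (auto simp: y_def)
      ultimately have jk: "Suc (j - 1) = j" "j < k" using j k by auto
      have f: "{p ! (j - 1), p ! j} \<in> ?E" "{p ! j, p ! Suc j} \<in> ?E" using P(5)[of "j - 1"] P(5)[of j] jk k by auto
      have d: "p ! Suc j \<noteq> y" "p ! (j - 1) \<noteq> y" "p ! (j - 1) \<noteq> p ! Suc j"
        using P(8)[of "Suc j" "Suc k"] P(8)[of "j - 1" "Suc k"] P(8)[of "j - 1" "Suc j"] jk k unfolding y_def by linarith+
      then have ne: "{p ! (j - 1), p ! j} \<noteq> {p ! j, p ! Suc j}" by (metis doubleton_eq_iff)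
      have "{y, w} = {p ! (j - 1), p ! j} \<or> {y, w} = {p ! j, p ! Suc j}"
        by (rule two_edges[of w, OF _ f(1) _ f(2) _ ne wE]) (use j wX X in auto)
      then show False using d j w(2) by (auto simp: doubleton_eq_iff)
    qed
  qed
  then show ?thesis using p k wE wk unfolding y_def by blast
qed

text \<open>For the vertex set of a tree these are the edges of its regular path, so a topological
  edge of the simplification can be named without choosing a path.\<close>

definition touching :: "nat set set \<Rightarrow> nat set \<Rightarrow> nat set set" where
  "touching E X = {e \<in> E. e \<inter> X \<noteq> {}}"

definition closed_in :: "nat set set \<Rightarrow> nat set \<Rightarrow> nat set \<Rightarrow> bool" where
  "closed_in E R X \<longleftrightarrow> X \<subseteq> R \<and> (\<forall>x\<in>X. \<forall>y\<in>R. {x, y} \<in> E \<longrightarrow> y \<in> X)"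

locale regular_graph =
  fixes G :: wgraph
  assumes simple: "simple_edges (edges G)" and verts: "\<And>e. e \<in> edges G \<Longrightarrow> e \<subseteq> verts G"
    and acyc: "acyclic_on (edges G) (regulars G)"
begin

abbreviation "E \<equiv> edges G"
abbreviation "R \<equiv> regulars G"

lemma no_loop: "{x, x} \<notin> E"
  using simple unfolding simple_edges_def by (metis doubleton_eq_iff insert_absorb2)

text \<open>From a common vertex the path stays in \<open>X\<close> in both directions until it
  reaches its singular ends, as \<open>X\<close> is closed. Its end edges use up both exits of
  \<open>X\<close>, so the rest of \<open>X\<close> has no exit and is empty by acyclicity.\<close>

lemma path_covers:
  assumes p: "regular_path G p" and X: "closed_in E R X" "card (out E X) = 2" and ne: "set (interior p) \<inter> X \<noteq> {}"
  shows "set (interior p) = X" "set (path_edges p) = touching E X"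
proof -
  note P = regular_path_nth[OF p]
  let ?n = "length p"
  have cl: "y \<in> X" if "x \<in> X" "y \<in> R" "{x, y} \<in> E" for x y using X(1) that unfolding closed_in_def by blast
  have XR: "X \<subseteq> R" using X(1) by (simp add: closed_in_def)
  have sR: "s \<notin> X" if "s \<in> singulars G" for s using that XR by (auto simp: singulars_def)
  have R: "p ! i \<in> R" if "0 < i" "Suc i < ?n" for i by (rule P(6)[OF that])
  obtain i0 where i0: "0 < i0" "Suc i0 < ?n" "p ! i0 \<in> X" using ne unfolding set_interior by blast
  have up: "p ! (i0 + k) \<in> X" if "Suc (i0 + k) < ?n" for k
    using that
  proof (induction k)
    case (Suc k)
    then show ?case using cl[of "p ! (i0 + k)" "p ! Suc (i0 + k)"] P(2)[of "i0 + k"] R[of "Suc (i0 + k)"] by simp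
  qed (use i0 in simp)
  have down: "p ! (i0 - k) \<in> X" if "k < i0" for k
    using that
  proof (induction k)
    case (Suc k)
    define j where "j = i0 - Suc k"
    have j: "Suc j = i0 - k" "0 < j" "Suc (Suc j) < Suc ?n" using Suc i0 by (auto simp: j_def)
    have "p ! Suc j \<in> X" using Suc j by simp
    moreover have "{p ! Suc j, p ! j} \<in> E" using P(2)[of j] j i0 Suc by (simp add: insert_commute)
    moreover have "p ! j \<in> R" using R[of j] j i0 Suc by simp
    ultimately show ?case using cl j_def by blast
  qed (use i0 in simp)
  have inX: "p ! i \<in> X" if "0 < i" "Suc i < ?n" for i
  proof (cases "i0 \<le> i")
    case True then show ?thesis using up[of "i - i0"] that by simp
  next
    case False then show ?thesis using down[of "i0 - i"] that by simp
  qed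
  have n3: "2 < ?n" using i0 by simp
  define z where "z = ?n - 2"
  have z: "0 < z" "Suc z = ?n - 1" "Suc (Suc z) = ?n" using n3 by (auto simp: z_def)
  have o1: "(p ! 1, p ! 0) \<in> out E X" using P(2)[of 0] inX[of 1] sR[OF P(4)] n3 by (auto simp: out_def insert_commute)
  have o2: "(p ! z, p ! Suc z) \<in> out E X" using P(2)[of z] inX[of z] sR[OF P(5)] z by (auto simp: out_def)
  have o12: "(p ! 1, p ! 0) \<noteq> (p ! z, p ! Suc z)"
  proof
    assume "(p ! 1, p ! 0) = (p ! z, p ! Suc z)"
    then have "{p ! 0, p ! Suc 0} = {p ! z, p ! Suc z}" by auto
    then have "0 = z" using P(3)[of 0 z] n3 z by simp
    then show False using z by simp
  qed
  have oX: "out E X = {(p ! 1, p ! 0), (p ! z, p ! Suc z)}"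
    using card_2_other[OF X(2) o1] o2 o12 by auto
  have ed: "e = {p ! (i - 1), p ! i} \<or> e = {p ! i, p ! Suc i}" if i: "0 < i" "Suc i < ?n" and e: "e \<in> E" "p ! i \<in> e" for i e
  proof (rule two_edges[OF R[OF i] _ _ _ _ _ e])
    have i': "Suc (i - 1) = i" using i by simp
    show "{p ! (i - 1), p ! i} \<in> E" using P(2)[of "i - 1"] i i' by simp
    show "{p ! i, p ! Suc i} \<in> E" using P(2)[of i] i by simp
    show "{p ! (i - 1), p ! i} \<noteq> {p ! i, p ! Suc i}"
    proof
      assume "{p ! (i - 1), p ! i} = {p ! i, p ! Suc i}"
      then have "{p ! (i - 1), p ! Suc (i - 1)} = {p ! i, p ! Suc i}" using i' by simp
      then have "i - 1 = i" using P(3)[of "i - 1" i] i i' by simp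
      then show False using i by simp
    qed
  qed auto
  have subX: "set (interior p) \<subseteq> X" unfolding set_interior using inX by blast
  \<comment> \<open>An edge from the rest to an interior vertex of the path would be one of the two
    path edges there, and its other end would be interior or singular.\<close>
  have "out E (X - set (interior p)) = {}"
  proof (rule ccontr)
    assume "out E (X - set (interior p)) \<noteq> {}"
    then obtain y w where y: "y \<in> X" "y \<notin> set (interior p)" "{y, w} \<in> E" "w \<notin> X - set (interior p)" by (auto simp: out_def)
    show False
    proof (cases "w \<in> X")
      case False
      then have "(y, w) \<in> out E X" using y by (auto simp: out_def)
      then have "y = p ! 1 \<or> y = p ! z" unfolding oX by auto
      moreover have "p ! 1 \<in> set (interior p)" "p ! z \<in> set (interior p)" unfolding set_interior using n3 z by auto
      ultimately show False using y by auto
    next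
      case True
      then have "w \<in> set (interior p)" using y by simp
      then obtain i where i: "0 < i" "Suc i < ?n" "w = p ! i" unfolding set_interior by blast
      have "{y, w} = {p ! (i - 1), p ! i} \<or> {y, w} = {p ! i, p ! Suc i}" using ed[OF i(1,2) y(3)] i(3) by blast
      then have "y = p ! (i - 1) \<or> y = p ! Suc i" using i(3) no_loop[of y] y(3) by (auto simp: doubleton_eq_iff)
      then obtain j where j: "y = p ! j" "j < ?n" using i by (metis Suc_lessD less_imp_diff_less)
      show False
      proof (cases "0 < j \<and> Suc j < ?n")
        case True then show False using j y(2) unfolding set_interior by blast
      next
        case False
        then have "j = 0 \<or> j = ?n - 1" using j by linarith
        then have "y \<in> singulars G" using j P(4,5) by auto
        then show False using sR y(1) by blast
      qed
    qed
  qed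
  moreover have "X - set (interior p) \<subseteq> R" using XR by blast
  ultimately have "X - set (interior p) = {}" using acyc unfolding acyclic_on_def by blast
  then show eq: "set (interior p) = X" using subX by blast
  show "set (path_edges p) = touching E X"
  proof
    show "set (path_edges p) \<subseteq> touching E X"
    proof
      fix e assume "e \<in> set (path_edges p)"
      then obtain i where i: "e = {p ! i, p ! Suc i}" "Suc i < ?n" unfolding set_path_edges by blast
      have "e \<inter> X \<noteq> {}"
      proof (cases "i = 0")
        case True then show ?thesis using i inX[of 1] n3 by auto
      next
        case False then show ?thesis using i inX[of i] by auto
      qed
      then show "e \<in> touching E X" using i P(2) unfolding touching_def by blast
    qed
    show "touching E X \<subseteq> set (path_edges p)"
    proof
      fix e assume "e \<in> touching E X"
      then obtain x where x: "e \<in> E" "x \<in> e" "x \<in> X" unfolding touching_def by blast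
      then have "x \<in> set (interior p)" using eq by simp
      then obtain i where i: "0 < i" "Suc i < ?n" "x = p ! i" unfolding set_interior by blast
      have "e = {p ! (i - 1), p ! i} \<or> e = {p ! i, p ! Suc i}" using ed[OF i(1,2) x(1)] x(2) i(3) by blast
      then have "\<exists>j. e = {p ! j, p ! Suc j} \<and> Suc j < ?n"
        using i by (metis Suc_diff_1 Suc_lessD)
      then show "e \<in> set (path_edges p)" unfolding set_path_edges by blast
    qed
  qed
qed

text \<open>Enter \<open>X\<close> through the exit and follow a maximal trail until it leaves
  \<open>X\<close>. Both ends are singular because \<open>X\<close> is closed in \<open>R\<close>.
  They may coincide, so distinctness has to be checked for the edges.\<close>

lemma exists_path:
  assumes X: "closed_in E R X" and d: "(x, u) \<in> out E X"
  shows "\<exists>p. regular_path G p \<and> set (interior p) \<inter> X \<noteq> {}"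
proof -
  have XR: "X \<subseteq> R" using X by (simp add: closed_in_def)
  have xu: "x \<in> X" "u \<notin> X" "{x, u} \<in> E" "{u, x} \<in> E" using d by (auto simp: out_def insert_commute)
  have sing: "s \<in> singulars G" if "y \<in> X" "s \<notin> X" "{y, s} \<in> E" for y s
    using X that verts[OF that(3)] unfolding closed_in_def singulars_def by auto
  obtain p k w where p: "trail E X u p" and k: "Suc (Suc k) = length p" and w: "{p ! Suc k, w} \<in> E" "w \<notin> X" "w \<noteq> p ! k"
    using maximal_trail[OF simple XR xu(1,2,4)] by blast
  note P = trailD[OF p]
  let ?p = "p @ [w]"
  have yX: "p ! Suc k \<in> X" using P(6)[of "Suc k"] k by simp
  have edges': "{?p ! i, ?p ! Suc i} \<in> E" if "Suc i < length ?p" for i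
  proof (cases "Suc i < length p")
    case True then show ?thesis using P(5) by (simp add: nth_append)
  next
    case False
    then have "i = Suc k" using that k by simp
    then show ?thesis using w(1) k[symmetric] by (simp add: nth_append)
  qed
  \<comment> \<open>Two equal edges would share the vertex \<open>p ! j\<close>, hence be
    consecutive, and the path would turn back. Distinctness of the trail excludes this, and at the
    last edge \<open>w \<noteq> p ! k\<close>.\<close>
  have *: False if h: "i < j" "Suc j < length ?p" "{?p ! i, ?p ! Suc i} = {?p ! j, ?p ! Suc j}" for i j
  proof -
    have a: "?p ! i = p ! i" "?p ! Suc i = p ! Suc i" "?p ! j = p ! j" using h by (auto simp: nth_append)
    have "p ! j = p ! i \<or> p ! j = p ! Suc i" using h(3) a by (metis doubleton_eq_iff)
    then have j: "j = Suc i" using P(8)[of j i] P(8)[of j "Suc i"] h by auto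
    then have "?p ! Suc j = p ! i" using h(3) a by (metis doubleton_eq_iff)
    moreover have "i = k" if "\<not> Suc j < length p" using that h j k by simp
    ultimately show False using P(8)[of "Suc j" i] h j w(3) by (cases "Suc j < length p") (auto simp: nth_append)
  qed
  have intr: "interior ?p = tl p" using P(1) by (cases p) (auto simp: interior_def)
  have "regular_path G ?p"
    unfolding regular_path_def
  proof (intro conjI)
    show "2 \<le> length ?p" using P(1) by simp
    show "set (path_edges ?p) \<subseteq> E" unfolding set_path_edges using edges' by blast
    show "distinct (path_edges ?p)" unfolding distinct_path_edges using * by (metis linorder_neqE_nat)
    show "distinct (interior ?p)" unfolding intr using P(2) by (rule distinct_tl)
    have "p \<noteq> []" using P(1) by auto
    then show "hd ?p \<in> singulars G" using sing[OF xu(1,2,3)] P(3) by (simp add: hd_append hd_conv_nth)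
    show "last ?p \<in> singulars G" using sing[OF yX w(2,1)] by simp
    show "set (interior ?p) \<subseteq> R" unfolding intr using P(4) XR by blast
  qed
  moreover have "p ! Suc k \<in> set (tl p)" using k by (auto simp: in_set_conv_nth nth_tl intro!: exI[of _ k])
  ultimately show ?thesis using intr yX by (intro exI[of _ ?p]) auto
qed

end


section \<open>Reading off the simplification and the multilevel partition\<close>

text \<open>A relation is more convenient than a function because the correspondence between edge
  numbers and edge sets is given by cases; totality and uniqueness on both sides make it a
  bijection.\<close>

lemma same_multigraphI:
  assumes "mverts H = mverts K" "\<And>e. e \<in> medges H \<Longrightarrow> \<exists>s. r e s" "\<And>s. s \<in> medges K \<Longrightarrow> \<exists>e. r e s"
    and r: "\<And>e s. r e s \<Longrightarrow> e \<in> medges H \<and> s \<in> medges K \<and> mends K s = mends H e \<and> mweight K s = mweight H e"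
    and f: "\<And>e s s'. r e s \<Longrightarrow> r e s' \<Longrightarrow> s = s'" and i: "\<And>e e' s. r e s \<Longrightarrow> r e' s \<Longrightarrow> e = e'"
  shows "same_multigraph H K"
proof -
  have "\<forall>e\<in>medges H. \<exists>s. r e s" using assms(2) by blast
  from bchoice[OF this] obtain g where g: "\<And>e. e \<in> medges H \<Longrightarrow> r e (g e)" by blast
  have "bij_betw g (medges H) (medges K)"
    unfolding bij_betw_def
  proof
    show "inj_on g (medges H)" by (rule inj_onI) (metis g i)
    show "g ` medges H = medges K"
    proof
      show "g ` medges H \<subseteq> medges K" using g r by blast
      show "medges K \<subseteq> g ` medges H"
      using assms(3) r f g by fastforce
    qed
  qed
  then show ?thesis unfolding same_multigraph_def using assms(1) g r by blast
qed

locale stored_forest = regular_graph +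
  fixes m :: mem and H :: nat and lv :: "nat \<Rightarrow> nat" and L :: "nat \<Rightarrow> nat set"
  assumes gm: "gm E (weight G) (verts G) m" and dirs: "dirs m (direct m R)" and vn: "vn R lv L m"
    and F: "forest E (weight G) R H (tops m (direct m R)) lv L (ntab m) (ncnt m) (ttab m) (tcnt m)"
begin

abbreviation "nt \<equiv> ntab m"

definition leaf :: "nat \<Rightarrow> nat" where
  "leaf v = the (vnode (the (vtab m v)))"

definition tp :: "nat \<Rightarrow> nat \<Rightarrow> nat" where
  "tp n v = (up m ^^ n) (leaf v)"

text \<open>The positions reached from the leaves by \<open>n\<close> steps of \<open>up\<close>: a
  root of a low tree is a fixed point and stands for itself on all higher levels.\<close>

definition Nd :: "nat \<Rightarrow> nat set" where
  "Nd n = {p \<in> live nt. lv p = n \<or> p \<in> trees nt \<and> lv p \<le> n}"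

lemmas fb = forestD(1)[OF F]

lemma leaf: "v \<in> R \<Longrightarrow> leaf v \<in> live nt" "v \<in> R \<Longrightarrow> lv (leaf v) = 0" "v \<in> R \<Longrightarrow> L (leaf v) = {v}"
proof -
  have "leaf v \<in> live nt \<and> lv (leaf v) = 0 \<and> L (leaf v) = {v}" if v: "v \<in> R"
  using v gmD(1)[OF gm] vnD(1)[OF vn _ v] by (fastforce simp: regulars_def leaf_def)
  then show "v \<in> R \<Longrightarrow> leaf v \<in> live nt" "v \<in> R \<Longrightarrow> lv (leaf v) = 0" "v \<in> R \<Longrightarrow> L (leaf v) = {v}" by auto
qed

lemma LR: "p \<in> live nt \<Longrightarrow> L p \<subseteq> R"
  using forestD(3)[OF F] by blast

lemma L_ne: "p \<in> live nt \<Longrightarrow> \<exists>v\<in>R. v \<in> L p"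
  using LR[of p] env.baseD(6)[OF fb, of p] by blast

lemma kid_level:
  assumes "q \<in> live nt" "p \<in> set (kd nt q)"
  shows "lv q = Suc (lv p)" "L p \<subseteq> L q"
proof -
  have "lv q = Suc (lv p) \<and> L p \<subseteq> L q"
    using env.baseD(4)[OF fb assms(1)] unfolding env.shape_def
  using assms(2) by fastforce
  then show "lv q = Suc (lv p)" "L p \<subseteq> L q" by simp_all
qed

lemma up_Nd:
  assumes "p \<in> Nd n"
  shows "up m p \<in> Nd (Suc n)" "L p \<subseteq> L (up m p)"
proof -
  have p: "p \<in> live nt" "lv p \<le> n" using assms by (auto simp: Nd_def)
  have "up m p \<in> Nd (Suc n) \<and> L p \<subseteq> L (up m p)"
  proof (cases "pa nt p")
    case None
    then have "p \<in> trees nt" "up m p = p" using p by (auto simp: trees_def up_live)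
    then show ?thesis using p by (simp add: Nd_def)
  next
    case (Some q)
    then have u: "up m p = q" "lv p = n" using p assms by (auto simp: up_live Nd_def trees_def)
    have q: "q \<in> live nt" "p \<in> set (kd nt q)" using env.baseD(9,10)[OF fb p(1) Some] by auto
    then show ?thesis using kid_level[OF q] u by (simp add: Nd_def)
  qed
  then show "up m p \<in> Nd (Suc n)" "L p \<subseteq> L (up m p)" by auto
qed

lemma tp_Nd:
  assumes "v \<in> R"
  shows "tp n v \<in> Nd n" "v \<in> L (tp n v)"
proof -
  have "tp n v \<in> Nd n \<and> v \<in> L (tp n v)"
  proof (induction n)
    case 0 show ?case using leaf[OF assms] by (simp add: tp_def Nd_def)
  next
    case (Suc n)
    have "tp (Suc n) v = up m (tp n v)" by (simp add: tp_def)
    then show ?case using up_Nd[of "tp n v" n] Suc by auto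
  qed
  then show "tp n v \<in> Nd n" "v \<in> L (tp n v)" by auto
qed

lemma tp_unique:
  assumes p: "p \<in> Nd n" "v \<in> L p"
  shows "tp n v = p"
proof -
  have l: "p \<in> live nt" "lv p \<le> n" using p by (auto simp: Nd_def)
  then have "v \<in> R" using LR p by blast
  from forest_up[OF F leaf[OF this] l(1) p(2)] have u: "(up m ^^ lv p) (leaf v) = p" .
  show ?thesis
  proof (cases "lv p = n")
    case True then show ?thesis using u by (simp add: tp_def)
  next
    case False
    then have t: "p \<in> trees nt" using p by (simp add: Nd_def)
    have "tp n v = (up m ^^ (n - lv p)) ((up m ^^ lv p) (leaf v))"
      unfolding tp_def using l(2) by (metis comp_apply funpow_add le_add_diff_inverse2)
    then show ?thesis using u up_tree[OF t] by simp
  qed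
qed

lemma Nd_eq: "p \<in> Nd n \<Longrightarrow> q \<in> Nd n \<Longrightarrow> v \<in> L p \<Longrightarrow> v \<in> L q \<Longrightarrow> p = q"
  using tp_unique by metis

lemma Nd_live: "p \<in> Nd n \<Longrightarrow> p \<in> live nt"
  by (simp add: Nd_def)

lemma L_inj: "p \<in> Nd n \<Longrightarrow> q \<in> Nd n \<Longrightarrow> L p = L q \<Longrightarrow> p = q"
  using Nd_eq L_ne[OF Nd_live] by metis

text \<open>The index is shifted because leaves have level 0 in \<open>lv\<close>, whereas
  \<open>stored_level\<close> starts with their parents.\<close>

lemma stored_level_eq: "stored_level G m i = L ` Nd (Suc i)"
proof -
  have c: "{w \<in> R. stored_cluster m i w = stored_cluster m i v} = L (tp (Suc i) v)" if v: "v \<in> R" for v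
  proof -
    have sc: "stored_cluster m i w = tp (Suc i) w" for w unfolding stored_cluster_def tp_def leaf_def ..
    have "w \<in> R \<and> tp (Suc i) w = tp (Suc i) v \<longleftrightarrow> w \<in> L (tp (Suc i) v)" for w
      using tp_Nd[OF v, of "Suc i"] tp_Nd(2)[of w "Suc i"] tp_unique[of "tp (Suc i) v" "Suc i" w] LR[OF Nd_live, of "tp (Suc i) v" "Suc i"]
      by (metis subsetD)
    then show ?thesis unfolding sc by blast
  qed
  have "stored_level G m i = {L (tp (Suc i) v) | v. v \<in> R}" unfolding stored_level_def using c by (metis (no_types, lifting))
  also have "\<dots> = L ` Nd (Suc i)"
  using tp_Nd(1) L_ne Nd_live tp_unique by fastforce
  finally show ?thesis .
qed

lemma partition_Nd: "partition_on R (L ` Nd n)"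
proof (rule partition_onI)
  show "\<Union> (L ` Nd n) = R"
  using LR[OF Nd_live] tp_Nd by fastforce
  show "disjnt X Y" if "X \<in> L ` Nd n" "Y \<in> L ` Nd n" "X \<noteq> Y" for X Y
  proof -
    obtain p q where p: "p \<in> Nd n" "X = L p" and q: "q \<in> Nd n" "Y = L q" using \<open>X \<in> L ` Nd n\<close> \<open>Y \<in> L ` Nd n\<close> by blast
    then show ?thesis unfolding disjnt_def using Nd_eq[OF p(1) q(1)] \<open>X \<noteq> Y\<close> by blast
  qed
  show "{} \<notin> L ` Nd n" using L_ne[OF Nd_live] by (metis empty_iff imageE)
qed

lemma tree_closed: "p \<in> trees nt \<Longrightarrow> closed_in E R (L p)"
  unfolding closed_in_def using forest_tree_closed[OF F] LR[of p] by (auto simp: trees_def)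

text \<open>Roots have no regular neighbour. So of two adjacent members of \<open>Nd n\<close>
  neither is a low root standing for itself, and the regularity of the forest applies at level
  \<open>n\<close>.\<close>

lemma not_joined:
  assumes p: "p \<in> Nd n" and q: "q \<in> Nd n" and "p \<noteq> q" and e: "x \<in> L p" "y \<in> L q" "{x, y} \<in> E"
  shows "lv p = n" "lv q = n" "length (kd nt p) \<noteq> 1 \<or> length (kd nt q) \<noteq> 1"
proof -
  have R: "x \<in> R" "y \<in> R" using e LR Nd_live[OF p] Nd_live[OF q] by blast+
  have "p \<notin> trees nt"
  proof
    assume "p \<in> trees nt"
    then have "y \<in> L p" using tree_closed e R unfolding closed_in_def by blast
    then show False using Nd_eq[OF p q] e \<open>p \<noteq> q\<close> by blast
  qed
  then show lp: "lv p = n" using p by (simp add: Nd_def)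
  have "q \<notin> trees nt"
  proof
    assume "q \<in> trees nt"
    moreover have "{y, x} \<in> E" using e by (simp add: insert_commute)
    ultimately have "x \<in> L q" using tree_closed e R unfolding closed_in_def by blast
    then show False using Nd_eq[OF p q] e \<open>p \<noteq> q\<close> by blast
  qed
  then show lq: "lv q = n" using q by (simp add: Nd_def)
  show "length (kd nt p) \<noteq> 1 \<or> length (kd nt q) \<noteq> 1"
    using forestD(4)[OF F Nd_live[OF p] Nd_live[OF q] \<open>p \<noteq> q\<close>, of x y] lp lq e by auto
qed

lemma tree_level: "p \<in> trees nt \<Longrightarrow> 0 < lv p"
  using forestD(5)[OF F] unfolding env.is_root_def by blast

lemma shape_pos:
  assumes "p \<in> live nt" "lv p = Suc n"
  obtains (single) c where "kd nt p = [c]" "c \<in> live nt" "lv c = n" "L p = L c"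
  | (pair) c d x y where "kd nt p = [c, d]" "c \<in> live nt" "d \<in> live nt" "lv c = n" "lv d = n" "L p = L c \<union> L d" "L c \<inter> L d = {}"
     "x \<in> L c" "y \<in> L d" "{x, y} \<in> E"
proof -
  have k: "c \<in> live nt" if "c \<in> set (kd nt p)" for c by (rule forestD(9)[OF F assms(1) that])
  show thesis using env.baseD(4)[OF fb assms(1)] unfolding env.shape_def
  using single k assms(2) pair by auto
qed

lemma level_zero: "regular_partition (vertex_adj G) R (L ` Nd (Suc 0))"
proof -
  have Nd1: "p \<in> live nt" "lv p = Suc 0" if "p \<in> Nd (Suc 0)" for p
    using that tree_level[of p] by (auto simp: Nd_def)
  have leafL: "\<exists>v. L c = {v}" if "c \<in> live nt" "lv c = 0" for c
    using forest_leaf(2)[OF F that] by blast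
  have sh: "(length (kd nt p) = 1 \<and> (\<exists>v. L p = {v})) \<or> (\<exists>v w. L p = {v, w} \<and> v \<noteq> w \<and> {v, w} \<in> E)" if p: "p \<in> Nd (Suc 0)" for p
  proof (cases rule: shape_pos[OF Nd1[OF p]])
    case (1 c)
    then show ?thesis using leafL[of c] by auto
  next
    case (2 c d x y)
    obtain v where "L c = {v}" using leafL 2 by blast
    moreover obtain w where "L d = {w}" using leafL 2 by blast
    ultimately show ?thesis using 2 by (intro disjI2 exI[of _ v] exI[of _ w]) auto
  qed
  show ?thesis
    unfolding regular_partition_def
  proof (intro conjI ballI impI)
    show "partition_on R (L ` Nd (Suc 0))" by (rule partition_Nd)
    fix C assume C: "C \<in> L ` Nd (Suc 0)"
    then obtain p where p: "p \<in> Nd (Suc 0)" "C = L p" by blast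
    show "finite C" "card C \<le> 2" using sh[OF p(1)] p(2) by (auto simp: card_insert_if)
    show "vertex_adj G a b" if "a \<in> C" "b \<in> C" "a \<noteq> b" for a b
      using sh[OF p(1)] p(2) that by (auto simp: vertex_adj_def insert_commute)
    fix D a b assume D: "D \<in> L ` Nd (Suc 0)" and ab: "a \<in> C" "b \<in> D" "vertex_adj G a b"
    obtain q where q: "q \<in> Nd (Suc 0)" "D = L q" using D by blast
    show "C = D \<or> card C = 2 \<or> card D = 2"
    using not_joined(3)[OF p(1) q(1)] ab sh[OF p(1)] sh[OF q(1)] p(2) q(2) by (auto simp: vertex_adj_def)
  qed
qed

text \<open>The children of \<open>p\<close> as seen by \<open>up\<close>, so that a root below
  level \<open>n + 1\<close> forms a block on its own.\<close>

definition block :: "nat \<Rightarrow> nat \<Rightarrow> nat set" where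
  "block n p = {c \<in> Nd n. up m c = p}"

lemma block_iff: "p \<in> Nd (Suc n) \<Longrightarrow> c \<in> Nd n \<Longrightarrow> v \<in> L c \<Longrightarrow> c \<in> block n p \<longleftrightarrow> v \<in> L p"
  unfolding block_def using up_Nd[of c n] Nd_eq[of "up m c" "Suc n" p v] by blast

lemma block_low:
  assumes p: "p \<in> Nd (Suc n)" and "lv p \<noteq> Suc n"
  shows "block n p = {p}"
proof -
  have pn: "p \<in> Nd n" using assms by (auto simp: Nd_def)
  have "c = p" if c: "c \<in> block n p" for c
  proof -
    have cn: "c \<in> Nd n" using c by (simp add: block_def)
    obtain v where v: "v \<in> L c" using L_ne[OF Nd_live[OF cn]] by blast
    then have "v \<in> L p" using block_iff[OF p cn v] c by simp
    then show ?thesis using Nd_eq[OF cn pn v] by simp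
  qed
  moreover obtain v where "v \<in> L p" using L_ne[OF Nd_live[OF p]] by blast
  then have "p \<in> block n p" using block_iff[OF p pn] by simp
  ultimately show ?thesis by blast
qed

lemma block_high:
  assumes p: "p \<in> Nd (Suc n)" and l: "lv p = Suc n"
  shows "block n p = set (kd nt p)"
proof -
  have pl: "p \<in> live nt" by (rule Nd_live[OF p])
  have "c \<in> block n p" if "c \<in> set (kd nt p)" for c
  using forestD(9)[OF F pl that] kid_level(1)[OF pl that] l env.baseD(11)[OF fb pl that] by (auto simp: block_def Nd_def up_live)
  moreover have "c \<in> set (kd nt p)" if "c \<in> block n p" for c
  proof (cases "pa nt c")
    case None
    then show ?thesis using that l by (auto simp: block_def Nd_def up_live)
  next
    case (Some q)
    have "c \<in> live nt" using that by (auto simp: block_def Nd_def)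
    then show ?thesis using env.baseD(10)[OF fb _ Some] Some that by (auto simp: block_def up_live)
  qed
  ultimately show ?thesis by blast
qed

lemma block_cases:
  assumes p: "p \<in> Nd (Suc n)"
  shows "(\<exists>c. block n p = {c} \<and> (lv p = Suc n \<longrightarrow> length (kd nt p) = 1)) \<or>
    (\<exists>c d x y. block n p = {c, d} \<and> card {L c, L d} = 2 \<and> x \<in> L c \<and> y \<in> L d \<and> {x, y} \<in> E)"
proof (cases "lv p = Suc n")
  case False
  then show ?thesis using block_low[OF p] by blast
next
  case True
  show ?thesis
  proof (cases rule: shape_pos[OF Nd_live[OF p] True])
    case (1 c) then show ?thesis using block_high[OF p True] by auto
  next
    case (2 c d x y)
    then have "block n p = {c, d}" "L c \<noteq> L d" using block_high[OF p True] by auto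
    then have "block n p = {c, d}" "card {L c, L d} = 2" by auto
    then show ?thesis using 2 by blast
  qed
qed

text \<open>A block is a pair, an only child, or a low root. Low roots have no neighbours by
  \<open>not_joined\<close>, so regularity has to be checked only for true clusters of level
  \<open>n + 1\<close>.\<close>

lemma level_step_partition:
  "\<exists>Q. regular_partition (cluster_adj G) (L ` Nd n) Q \<and> L ` Nd (Suc n) = \<Union> ` Q"
proof -
  define Q where "Q = (\<lambda>p. L ` block n p) ` Nd (Suc n)"
  have un: "\<Union> (L ` block n p) = L p" if p: "p \<in> Nd (Suc n)" for p
  using block_iff[OF p] LR[OF Nd_live[OF p]] tp_Nd by (fastforce simp: block_def)
  have "regular_partition (cluster_adj G) (L ` Nd n) Q"
    unfolding regular_partition_def
  proof (intro conjI ballI impI)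
    show "partition_on (L ` Nd n) Q"
    proof (rule partition_onI)
      show "\<Union> Q = L ` Nd n"
      proof
        show "\<Union> Q \<subseteq> L ` Nd n" unfolding Q_def block_def by blast
        show "L ` Nd n \<subseteq> \<Union> Q" unfolding Q_def block_def using up_Nd(1) by blast
      qed
      show "{} \<notin> Q"
      using block_cases by (fastforce simp: Q_def)
      show "disjnt C D" if C: "C \<in> Q" and D: "D \<in> Q" and ne: "C \<noteq> D" for C D
      proof -
        obtain p where p: "p \<in> Nd (Suc n)" "C = L ` block n p" using C unfolding Q_def by blast
        obtain q where q: "q \<in> Nd (Suc n)" "D = L ` block n q" using D unfolding Q_def by blast
        have "c = d" if "c \<in> block n p" "d \<in> block n q" "L c = L d" for c d
          using L_inj[of c n d] that by (simp add: block_def)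
        moreover have "block n p \<inter> block n q = {}" using ne p q by (auto simp: block_def)
        ultimately show ?thesis unfolding disjnt_def p(2) q(2) by blast
      qed
    qed
    fix C assume "C \<in> Q"
    then obtain p where p: "p \<in> Nd (Suc n)" "C = L ` block n p" unfolding Q_def by blast
    show "finite C" "card C \<le> 2" using block_cases[OF p(1)] p(2) by auto
    show "cluster_adj G a b" if ab: "a \<in> C" "b \<in> C" "a \<noteq> b" for a b
    proof -
      obtain c d x y where cd: "block n p = {c, d}" "x \<in> L c" "y \<in> L d" "{x, y} \<in> E"
        using block_cases[OF p(1)]
      proof (elim disjE exE conjE)
        fix c assume "block n p = {c}"
        then have False using ab p(2) by simp
        then show thesis ..
      qed
      then have "a = L c \<and> b = L d \<or> a = L d \<and> b = L c" using ab p(2) by auto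
      moreover have "{y, x} \<in> E" using cd by (simp add: insert_commute)
      ultimately show ?thesis using ab cd unfolding cluster_adj_def vertex_adj_def by metis
    qed
    fix D a b assume "D \<in> Q" and ab: "a \<in> C" "b \<in> D" "cluster_adj G a b"
    then obtain q where q: "q \<in> Nd (Suc n)" "D = L ` block n q" unfolding Q_def by blast
    obtain c d where c: "c \<in> block n p" "a = L c" and d: "d \<in> block n q" "b = L d" using ab p q by blast
    obtain x y where xy: "x \<in> L c" "y \<in> L d" "{x, y} \<in> E" using ab(3) c d unfolding cluster_adj_def vertex_adj_def by blast
    have "x \<in> L p" "y \<in> L q" using un[OF p(1)] un[OF q(1)] c d xy by blast+
    then have *: "p \<noteq> q \<Longrightarrow> lv p = Suc n \<and> lv q = Suc n \<and> (length (kd nt p) \<noteq> 1 \<or> length (kd nt q) \<noteq> 1)"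
      using not_joined[OF p(1) q(1)] xy(3) by blast
    have two: "card (L ` block n p') = 2" if "p' \<in> Nd (Suc n)" "lv p' = Suc n" "length (kd nt p') \<noteq> 1" for p'
      using block_cases[OF that(1)] that(2,3) by auto
    show "C = D \<or> card C = 2 \<or> card D = 2"
      using * two[OF p(1)] two[OF q(1)] p(2) q(2) by metis
  qed
  moreover have "L ` Nd (Suc n) = \<Union> ` Q" unfolding Q_def image_image using un by simp
  ultimately show ?thesis by blast
qed

lemma tree_out:
  assumes "p \<in> trees nt"
  obtains x1 u x2 v t where "(x1, u) \<noteq> (x2, v)" "out E (L p) = {(x1, u), (x2, v)}" "u \<notin> R" "v \<notin> R" "te nt p = Some t"
    "t \<notin> tops m (direct m R)"
    "ttab m t = Some \<lparr> tends = (u, v), twt = env.inner E (weight G) (L p) + weight G {x1, u} + weight G {x2, v} \<rparr>"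
proof -
  have pl: "p \<in> live nt" using assms by (simp add: trees_def)
  obtain u a v b t where r: "sd nt p = ((Singular u, a), (Singular v, b))" "te nt p = Some t" "t \<notin> tops m (direct m R)"
    "ttab m t = Some \<lparr> tends = (u, v), twt = ww nt p + a + b \<rparr>"
    using forestD(5)[OF F assms] unfolding env.is_root_def by blast
  have "env.strong E (weight G) R lv L nt p" by (rule forestD(2)[OF F pl])
  then obtain d1 d2 where d: "d1 \<noteq> d2" "out E (L p) = {d1, d2}"
    "env.srep (weight G) R (live nt) lv L (lv p) d1 (Singular u, a)" "env.srep (weight G) R (live nt) lv L (lv p) d2 (Singular v, b)"
    unfolding env.strong_def env.sok_def r(1) by auto
  obtain x1 u1 x2 v2 where e: "d1 = (x1, u1)" "d2 = (x2, v2)" by (metis surj_pair)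
  have s: "u1 = u" "u \<notin> R" "a = weight G {x1, u}" "v2 = v" "v \<notin> R" "b = weight G {x2, v}"
    using d(3,4) unfolding e env.srep_def by auto
  have "ww nt p = env.inner E (weight G) (L p)" using forestD(3)[OF F pl] by simp
  then show thesis using that[of x1 u x2 v t] d(1,2) r s unfolding e by simp
qed

text \<open>Existence comes from \<open>exists_path\<close>. By \<open>path_covers\<close> a single
  common vertex already identifies the path with the tree.\<close>

lemma tree_path:
  assumes p: "p \<in> trees nt"
  shows "\<exists>q. regular_path G q \<and> set (interior q) = L p \<and> set (path_edges q) = touching E (L p)"
    and "regular_path G q \<Longrightarrow> set (interior q) \<inter> L p \<noteq> {} \<Longrightarrow> set (interior q) = L p \<and> set (path_edges q) = touching E (L p)"
proof -
  obtain x1 u x2 v t where o: "(x1, u) \<noteq> (x2, v)" "out E (L p) = {(x1, u), (x2, v)}" by (rule tree_out[OF p])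
  have c: "card (out E (L p)) = 2" using o by auto
  show 1: "regular_path G q \<Longrightarrow> set (interior q) \<inter> L p \<noteq> {} \<Longrightarrow> set (interior q) = L p \<and> set (path_edges q) = touching E (L p)" for q
    using path_covers[OF _ tree_closed[OF p] c] by blast
  have "(x1, u) \<in> out E (L p)" using o by simp
  from exists_path[OF tree_closed[OF p] this] 1
  show "\<exists>q. regular_path G q \<and> set (interior q) = L p \<and> set (path_edges q) = touching E (L p)" by blast
qed

text \<open>No node lies above level \<open>H\<close>, so one level higher only roots are
  left.\<close>

lemma Nd_top: "Nd (Suc H) = trees nt"
  using env.baseD(5)[OF fb] by (fastforce simp: Nd_def trees_def)

lemma forest_stored: "stores_regular_forest G m"
proof -
  have "regular_multilevel_partition G H (stored_level G m)"
    unfolding regular_multilevel_partition_def stored_level_eq using level_zero level_step_partition by blast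
  moreover have "stored_level G m H = {set (interior p) | p. regular_path G p \<and> interior p \<noteq> []}"
    unfolding stored_level_eq Nd_top
  proof (intro set_eqI iffI)
    fix X assume "X \<in> L ` trees nt"
    then obtain p where p: "p \<in> trees nt" "X = L p" by blast
    obtain q where q: "regular_path G q" "set (interior q) = L p" using tree_path(1)[OF p(1)] by blast
    have "L p \<noteq> {}" using L_ne[of p] p by (auto simp: trees_def)
    then have "interior q \<noteq> []" using q by auto
    then show "X \<in> {set (interior p) | p. regular_path G p \<and> interior p \<noteq> []}" using q p by blast
  next
    fix X assume "X \<in> {set (interior p) | p. regular_path G p \<and> interior p \<noteq> []}"
    then obtain q where q: "regular_path G q" "interior q \<noteq> []" "X = set (interior q)" by blast
    then obtain v where v: "v \<in> set (interior q)" by (meson last_in_set)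
    then have vR: "v \<in> R" using q(1) unfolding regular_path_def by blast
    have "tp (Suc H) v \<in> trees nt" "v \<in> L (tp (Suc H) v)" using tp_Nd[OF vR, of "Suc H"] Nd_top by auto
    then show "X \<in> L ` trees nt" using tree_path(2)[OF _ q(1)] v q(3) by blast
  qed
  ultimately show ?thesis unfolding stores_regular_forest_def by blast
qed

definition represents :: "nat \<Rightarrow> nat set set \<Rightarrow> bool" where
  "represents t S \<longleftrightarrow> (\<exists>p\<in>trees nt. te nt p = Some t \<and> S = touching E (L p)) \<or>
     (\<exists>k\<in>direct m R. \<exists>re. etab m k = Some re \<and> etop re = Some t \<and> S = {eset re})"

text \<open>The added facts separate the two cases from both sides: edge numbers by membership in
  \<open>tops\<close>, edge sets by whether they meet a regular vertex.\<close>

lemma representsE: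
  assumes "represents t S"
  obtains (tree) p where "p \<in> trees nt" "te nt p = Some t" "S = touching E (L p)" "t \<notin> tops m (direct m R)" "\<exists>e\<in>S. e \<inter> R \<noteq> {}"
  | (direct) k re where "k \<in> direct m R" "etab m k = Some re" "etop re = Some t" "S = {eset re}" "t \<in> tops m (direct m R)" "eset re \<inter> R = {}"
  using assms unfolding represents_def
proof (elim disjE bexE exE conjE)
  fix p assume p: "p \<in> trees nt" "te nt p = Some t" "S = touching E (L p)"
  obtain x1 u x2 v t' where o: "out E (L p) = {(x1, u), (x2, v)}" "te nt p = Some t'" "t' \<notin> tops m (direct m R)" by (rule tree_out[OF p(1)])
  have "(x1, u) \<in> out E (L p)" using o by simp
  then have "{x1, u} \<in> E" "x1 \<in> L p" by (auto simp: out_def)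
  moreover have "x1 \<in> R" using LR[of p] p(1) \<open>x1 \<in> L p\<close> by (auto simp: trees_def)
  ultimately have "{x1, u} \<in> S" "{x1, u} \<inter> R \<noteq> {}" using p(3) by (auto simp: touching_def)
  then have "\<exists>e\<in>S. e \<inter> R \<noteq> {}" by (rule bexI[rotated])
  moreover have "t \<notin> tops m (direct m R)" using o(2,3) p(2) by simp
  ultimately show thesis using tree[OF p] by blast
next
  fix k re assume k: "k \<in> direct m R" "etab m k = Some re" "etop re = Some t" "S = {eset re}"
  have "t \<in> tops m (direct m R)" using k unfolding tops_def by blast
  moreover have "eset re \<inter> R = {}" using k(1,2) by (auto simp: direct_def)
  ultimately show thesis using direct[OF k] by simp
qed

lemma represents_fun:
  assumes "represents t S" "represents t S'"
  shows "S = S'"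
  using assms(1)
proof (cases rule: representsE)
  case (tree p)
  note p = this
  show ?thesis using assms(2)
  proof (cases rule: representsE)
    case (tree p')
    then show ?thesis using inj_onD[OF forestD(6)[OF F], of p p'] p by simp
  qed (use p in simp)
next
  case (direct k re)
  note k = this
  show ?thesis using assms(2)
  proof (cases rule: representsE)
    case (direct k' re')
    then have "k = k'" using dirs k(1,2,3) unfolding dirs_def by metis
    then show ?thesis using direct(2,4) k(2,4) by simp
  qed (use k in simp)
qed

text \<open>For two trees with the same edge set: an exit edge has just one regular end, which must
  therefore lie in both trees. For single edges the one-to-one storage of edges decides.\<close>

lemma represents_inj:
  assumes "represents t S" "represents t' S"
  shows "t = t'"
  using assms(1)
proof (cases rule: representsE)
  case (tree p)
  note p = this
  show ?thesis using assms(2)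
  proof (cases rule: representsE)
    case (tree p')
    obtain x1 u x2 v t' where o: "out E (L p) = {(x1, u), (x2, v)}" "u \<notin> R" by (rule tree_out[OF p(1)])
    have "(x1, u) \<in> out E (L p)" using o by simp
    then have x: "x1 \<in> L p" "{x1, u} \<in> touching E (L p)" by (auto simp: out_def touching_def)
    have "u \<notin> L p'" using o(2) LR[of p'] tree(1) by (auto simp: trees_def)
    moreover have "{x1, u} \<in> touching E (L p')" using x(2) p(3) tree(3) by simp
    ultimately have "x1 \<in> L p'" by (auto simp: touching_def)
    then have "p = p'" using Nd_eq[of p "Suc H" p' x1] p(1) tree(1) x(1) unfolding Nd_top by simp
    then show ?thesis using p tree by simp
  qed (use p in auto)
next
  case (direct k re)
  note k = this
  show ?thesis using assms(2)
  proof (cases rule: representsE)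
    case (direct k' re')
    have "eset re = eset re'" using k(4) direct(4) by simp
    then have "k = k'" by (rule gmD(4)[OF gm k(2) direct(2)])
    then show ?thesis using direct(2,3) k(2,3) by simp
  qed (use k(4,6) in auto)
qed

lemma direct_ends:
  assumes "k \<in> direct m R" "etab m k = Some re"
  obtains a b where "eends re = (a, b)" "eset re = {a, b}" "a \<noteq> b" "{a, b} \<in> E" "a \<in> singulars G" "b \<in> singulars G" "ewt re = weight G {a, b}"
proof -
  obtain a b where ab: "eends re = (a, b)" by (cases "eends re")
  have e: "eset re = {a, b}" using ab by (simp add: eset_def)
  have g: "a \<noteq> b" "{a, b} \<in> E" "ewt re = weight G {a, b}" using gmD(3)[OF gm assms(2)] ab e by auto
  moreover have "a \<notin> R" "b \<notin> R" using assms e by (auto simp: direct_def)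
  moreover have "a \<in> verts G" "b \<in> verts G" using verts[OF g(2)] by auto
  ultimately show thesis using that ab e by (auto simp: singulars_def)
qed

lemma simplification_stored: "same_multigraph (stored_simplification m) (simplification G)"
proof (rule same_multigraphI[where r = represents])
  show "mverts (stored_simplification m) = mverts (simplification G)"
  proof (rule set_eqI)
    fix v
    have "v \<in> verts G \<longleftrightarrow> (\<exists>rv. vtab m v = Some rv)" using gmD(1)[OF gm] by blast
    moreover have "vnode rv = None \<longleftrightarrow> v \<notin> R" if "vtab m v = Some rv" for rv using vnD[OF vn that] by auto
    ultimately show "v \<in> mverts (stored_simplification m) \<longleftrightarrow> v \<in> mverts (simplification G)"
      by (auto simp: stored_simplification_def simplification_def singulars_def)
  qed
next
  fix t assume "t \<in> medges (stored_simplification m)"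
  then have "t \<in> dom (ttab m)" by (simp add: stored_simplification_def)
  then have "t \<in> tops m (direct m R) \<or> (\<exists>p\<in>trees nt. te nt p = Some t)" using forestD(7)[OF F] by force
  then show "\<exists>S. represents t S" unfolding represents_def tops_def by blast
next
  fix S assume "S \<in> medges (simplification G)"
  then obtain q where q: "regular_path G q" "S = set (path_edges q)" by (auto simp: simplification_def)
  show "\<exists>t. represents t S"
  proof (cases "interior q = []")
    case True
    have l: "2 \<le> length q" by (rule regular_path_nth(1)[OF q(1)])
    have "length q = 2" using length_interior[of q] True l by simp
    then obtain a b where ab: "q = [a, b]" by (auto simp: numeral_2_eq_2 length_Suc_conv)
    then have S: "S = {{a, b}}" and e: "{a, b} \<in> E" "{a, b} \<inter> R = {}" using q by (auto simp: path_edges_def regular_path_def singulars_def)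
    obtain k re where k: "etab m k = Some re" "eset re = {a, b}" using gmD(5)[OF gm e(1)] by blast
    then have d: "k \<in> direct m R" using e by (simp add: direct_def)
    then obtain t where "etop re = Some t" using dirs k unfolding dirs_def by (metis option.inject)
    then show ?thesis unfolding represents_def using S k d by metis
  next
    case False
    then obtain v where v: "v \<in> set (interior q)" by (meson last_in_set)
    then have vR: "v \<in> R" using q(1) unfolding regular_path_def by blast
    let ?p = "tp (Suc H) v"
    have p: "?p \<in> trees nt" "v \<in> L ?p" using tp_Nd[OF vR, of "Suc H"] Nd_top by auto
    then have "S = touching E (L ?p)" using tree_path(2)[OF p(1) q(1)] v q(2) by blast
    moreover obtain t where "te nt ?p = Some t" by (rule tree_out[OF p(1)])
    ultimately show ?thesis unfolding represents_def using p(1) by blast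
  qed
next
  fix t S assume "represents t S"
  then show "t \<in> medges (stored_simplification m) \<and> S \<in> medges (simplification G) \<and>
    mends (simplification G) S = mends (stored_simplification m) t \<and> mweight (simplification G) S = mweight (stored_simplification m) t"
  proof (cases rule: representsE)
    case (tree p)
    obtain x1 u x2 v t' where o: "(x1, u) \<noteq> (x2, v)" "out E (L p) = {(x1, u), (x2, v)}" "u \<notin> R" "v \<notin> R" "te nt p = Some t'"
      "ttab m t' = Some \<lparr> tends = (u, v), twt = env.inner E (weight G) (L p) + weight G {x1, u} + weight G {x2, v} \<rparr>"
      by (rule tree_out[OF tree(1)])
    have t: "t' = t" using o(5) tree(2) by simp
    let ?X = "L p"
    have XR: "?X \<subseteq> R" using LR tree(1) by (simp add: trees_def)
    have d: "(x1, u) \<in> out E ?X" "(x2, v) \<in> out E ?X" using o by auto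
    then have d': "x1 \<in> ?X" "{x1, u} \<in> E" "x2 \<in> ?X" "{x2, v} \<in> E" by (auto simp: out_def)
    have uv: "u \<in> singulars G" "v \<in> singulars G" using verts[OF d'(2)] verts[OF d'(4)] o(3,4) by (auto simp: singulars_def)
    \<comment> \<open>An edge that touches the tree is one of its two exits or lies inside. Both the
      ends and the weight of the topological edge are read off from this.\<close>
    have tX: "e = {x1, u} \<or> e = {x2, v} \<or> e \<subseteq> ?X" if e: "e \<in> E" "e \<inter> ?X \<noteq> {}" for e
    proof -
      obtain x where x: "x \<in> e" "x \<in> ?X" using e(2) by blast
      then obtain y where y: "e = {x, y}" using simple e(1) unfolding simple_edges_def by (metis insertE insert_commute singletonD)
      show ?thesis
      proof (cases "y \<in> ?X")
        case False
        then have "(x, y) \<in> out E ?X" using x y e by (auto simp: out_def)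
        then show ?thesis using o(2) y by auto
      qed (use x y in auto)
    qed
    have "\<Union>S \<inter> singulars G = {u, v}"
    proof
      show "{u, v} \<subseteq> \<Union>S \<inter> singulars G" using uv d' tree(3) by (auto simp: touching_def)
      show "\<Union>S \<inter> singulars G \<subseteq> {u, v}"
      proof
        fix y assume "y \<in> \<Union>S \<inter> singulars G"
        then obtain e where e: "e \<in> E" "e \<inter> ?X \<noteq> {}" "y \<in> e" "y \<notin> R" using tree(3) by (auto simp: touching_def singulars_def)
        then show "y \<in> {u, v}" using tX[OF e(1,2)] XR d' by auto
      qed
    qed
    moreover have "(\<Sum>e\<in>S. weight G e) = env.inner E (weight G) ?X + weight G {x1, u} + weight G {x2, v}"
    proof -
      let ?I = "{e. e \<in> E \<and> e \<subseteq> ?X}"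
      have u: "u \<notin> ?X" "v \<notin> ?X" using o(3,4) XR by auto
      have emp: "e \<noteq> {}" if "e \<in> E" for e using simple that unfolding simple_edges_def by blast
      have "S = insert {x1, u} (insert {x2, v} ?I)"
      proof (rule set_eqI)
        fix e show "e \<in> S \<longleftrightarrow> e \<in> insert {x1, u} (insert {x2, v} ?I)"
          unfolding tree(3) touching_def using tX[of e] d' emp[of e] by auto
      qed
      moreover have "{x1, u} \<notin> insert {x2, v} ?I" "{x2, v} \<notin> ?I" using u o(1) d' by (auto simp: doubleton_eq_iff)
      moreover have "finite ?I" using simple by (simp add: simple_edges_def)
      ultimately show ?thesis unfolding env.inner_def by simp
    qed
    moreover have "S \<in> medges (simplification G)" using tree_path(1)[OF tree(1)] tree(3) by (auto simp: simplification_def)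
    moreover have "t \<in> dom (ttab m)" using o(6) t by blast
    ultimately show ?thesis using o(6) t by (simp add: simplification_def stored_simplification_def)
  next
    case (direct k re)
    obtain a b where ab: "eends re = (a, b)" "eset re = {a, b}" "a \<noteq> b" "{a, b} \<in> E" "a \<in> singulars G" "b \<in> singulars G" "ewt re = weight G {a, b}"
      by (rule direct_ends[OF direct(1,2)])
    have tt: "ttab m t = Some \<lparr> tends = eends re, twt = ewt re \<rparr>" using dirs direct unfolding dirs_def by (metis option.inject)
    have "regular_path G [a, b]" using ab by (simp add: regular_path_def path_edges_def interior_def)
    moreover have "set (path_edges [a, b]) = S" using direct ab by (simp add: path_edges_def)
    ultimately have "S \<in> medges (simplification G)" unfolding simplification_def by auto
    then show ?thesis using tt ab direct by (auto simp: simplification_def stored_simplification_def)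
  qed
qed (fact represents_fun represents_inj)+

end


section \<open>Processing a sequence of updates\<close>

text \<open>A nonempty set \<open>X\<close> of regular vertices without exits contains a cycle: a
  maximal trail from \<open>u\<close> inside \<open>X - {u}\<close> must continue to
  \<open>u\<close>, as there is no other way on. The new edge does not lead back to the predecessor,
  so the cycle has at least three vertices.\<close>

lemma acyclic_on_regulars:
  assumes s: "simple_edges (edges G)" and nc: "\<nexists>c. regular_cycle G c"
  shows "acyclic_on (edges G) (regulars G)"
  unfolding acyclic_on_def
proof (intro allI impI notI)
  let ?E = "edges G"
  fix X assume X: "X \<subseteq> regulars G" "X \<noteq> {}" "out ?E X = {}"
  have cl: "b \<in> X" if "a \<in> X" "{a, b} \<in> ?E" for a b using X(3) that by (auto simp: out_def)
  obtain u where u: "u \<in> X" using X(2) by blast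
  then have "card {e \<in> ?E. u \<in> e} = 2" using X(1) by (auto simp: regulars_def incident_def)
  then have "{e \<in> ?E. u \<in> e} \<noteq> {}" by (intro notI) simp
  then obtain x where x: "{u, x} \<in> ?E" "x \<noteq> u" using simple_edge_end[OF s, of _ u] by blast
  have "\<exists>p k w. trail ?E (X - {u}) u p \<and> Suc (Suc k) = length p \<and> {p ! Suc k, w} \<in> ?E \<and> w \<notin> X - {u} \<and> w \<noteq> p ! k"
    by (rule maximal_trail[OF s _ _ _ x(1)]) (use X(1) x cl[OF u x(1)] in auto)
  then obtain p k w where p: "trail ?E (X - {u}) u p" and k: "Suc (Suc k) = length p"
    and w: "{p ! Suc k, w} \<in> ?E" "w \<notin> X - {u}" "w \<noteq> p ! k" by blast
  note P = trailD[OF p]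
  have "p ! Suc k \<in> X" using P(6)[of "Suc k"] k by auto
  then have wu: "w = u" using cl[OF _ w(1)] w(2) by blast
  then have k0: "k \<noteq> 0" using w(3) P(3) by (cases k) auto
  have ne: "p \<noteq> []" using P(1) by auto
  have "regular_cycle G p"
    unfolding regular_cycle_def
  proof (intro conjI)
    show "3 \<le> length p" using k k0 by simp
    show "distinct p" by (rule P(2))
    show "set p \<subseteq> regulars G" using P(7) u X(1) by blast
    show "set (path_edges (p @ [hd p])) \<subseteq> ?E"
      unfolding set_path_edges
    proof (intro subsetI, elim CollectE exE conjE)
      fix e i assume i: "e = {(p @ [hd p]) ! i, (p @ [hd p]) ! Suc i}" "Suc i < length (p @ [hd p])"
      show "e \<in> ?E"
      proof (cases "Suc i < length p")
        case True then show ?thesis using i P(5) by (simp add: nth_append)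
      next
        case False
        then have "i = Suc k" using i(2) k by simp
        then show ?thesis using w(1) wu i(1) k[symmetric] P(3) ne by (simp add: nth_append hd_conv_nth)
      qed
    qed
  qed
  then show False using nc by blast
qed

definition graph_ok :: "wgraph \<Rightarrow> nat \<Rightarrow> bool" where
  "graph_ok G n \<longleftrightarrow> finite (verts G) \<and> card (verts G) \<le> n \<and> simple_edges (edges G) \<and> (\<forall>e\<in>edges G. e \<subseteq> verts G) \<and>
     (\<nexists>c. regular_cycle G c)"

lemma graph_of_take_Suc:
  "i < length us \<Longrightarrow> graph_of (take (Suc i) us) = apply_update (us ! i) (graph_of (take i us))"
  by (simp add: graph_of_def take_Suc_conv_app_nth)

lemma graph_ok:
  assumes "admissible us"
  shows "i \<le> length us \<Longrightarrow> graph_ok (graph_of (take i us)) i"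
proof (induction i)
  case 0
  have "\<not> regular_cycle empty_graph c" for c
    unfolding regular_cycle_def regulars_def empty_graph_def by auto
  then show ?case by (simp add: graph_ok_def graph_of_def) (simp add: empty_graph_def simple_edges_def)
next
  case (Suc i)
  let ?G = "graph_of (take i us)"
  have ok: "graph_ok ?G i" using Suc by simp
  have v: "valid_update ?G (us ! i)" "\<nexists>c. regular_cycle (graph_of (take (Suc i) us)) c"
    using assms Suc.prems unfolding admissible_def by (meson Suc_le_eq)+
  have g: "graph_of (take (Suc i) us) = apply_update (us ! i) ?G" using Suc.prems by (simp add: graph_of_take_Suc)
  show ?case
  proof (cases "us ! i")
    case (InsVertex x)
    then show ?thesis using ok v unfolding graph_ok_def g by (auto simp: card_insert_if)
  next
    case (InsEdge x y w)
    have "simple_edges (insert {x, y} (edges ?G))" using ok v(1) InsEdge by (auto simp: graph_ok_def simple_edges_def)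
    then show ?thesis using ok v InsEdge unfolding graph_ok_def g by auto
  qed
qed

lemma card_adjacent_pairs:
  assumes f: "finite R" and d: "\<forall>v\<in>R. card {e \<in> E. v \<in> e} = 2"
  shows "card {(x, y). x \<in> R \<and> y \<in> R \<and> {x, y} \<in> E} \<le> 2 * card R"
proof -
  have "{(x, y). x \<in> R \<and> y \<in> R \<and> {x, y} \<in> E} = Sigma R (\<lambda>x. {y \<in> R. {x, y} \<in> E})" by auto
  then have "card {(x, y). x \<in> R \<and> y \<in> R \<and> {x, y} \<in> E} = (\<Sum>x\<in>R. card {y \<in> R. {x, y} \<in> E})" using f by simp
  also have "\<dots> \<le> (\<Sum>x\<in>R. 2)"
  proof (rule sum_mono)
    fix x assume x: "x \<in> R"
    have "inj_on (\<lambda>y. {x, y}) {y \<in> R. {x, y} \<in> E}" by (rule inj_onI) (metis doubleton_eq_iff)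
    moreover have "(\<lambda>y. {x, y}) ` {y \<in> R. {x, y} \<in> E} \<subseteq> {e \<in> E. x \<in> e}" by auto
    moreover have "finite {e \<in> E. x \<in> e}" by (rule card_ge_0_finite) (use d x in simp)
    ultimately have "card {y \<in> R. {x, y} \<in> E} \<le> card {e \<in> E. x \<in> e}" by (intro card_inj_on_le)
    then show "card {y \<in> R. {x, y} \<in> E} \<le> 2" using d x by simp
  qed
  finally show ?thesis by simp
qed

text \<open>Each regular vertex has at most two regular neighbours, so there are at most
  \<open>2 * l\<close> adjacent pairs after any number \<open>n \<le> l\<close> of updates. One
  \<open>H\<close> serves the whole sequence.\<close>

lemma sound_regulars:
  assumes g: "graph_ok G n" and n: "n \<le> l" and H: "1 \<le> H" "2 * l * 2 ^ H < 3 ^ H"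
  shows "sound (edges G) (regulars G) H"
proof -
  have s: "simple_edges (edges G)" and f: "finite (verts G)" and c: "card (verts G) \<le> n" using g by (auto simp: graph_ok_def)
  have deg: "\<forall>v\<in>regulars G. card {e \<in> edges G. v \<in> e} = 2" by (simp add: regulars_def incident_def)
  have fR: "finite (regulars G)" by (rule finite_regulars[OF s])
  have "card (regulars G) \<le> card (verts G)" by (rule card_mono[OF f]) (auto simp: regulars_def)
  then have "card {(x, y). x \<in> regulars G \<and> y \<in> regulars G \<and> {x, y} \<in> edges G} \<le> 2 * l"
    using card_adjacent_pairs[OF fR deg] c n by linarith
  then have "card {(x, y). x \<in> regulars G \<and> y \<in> regulars G \<and> {x, y} \<in> edges G} * 2 ^ H \<le> 2 * l * 2 ^ H" by (rule mult_right_mono) simp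
  then have "card {(x, y). x \<in> regulars G \<and> y \<in> regulars G \<and> {x, y} \<in> edges G} * 2 ^ H < 3 ^ H" using H(2) by linarith
  moreover have "acyclic_on (edges G) (regulars G)" using acyclic_on_regulars[OF s] g by (simp add: graph_ok_def)
  ultimately show ?thesis unfolding sound_def using s fR deg H(1) by blast
qed

abbreviation "holds G H m \<equiv> full (edges G) (weight G) (verts G) (regulars G) H m"

lemma holds_empty: "holds empty_graph H empty_mem"
proof -
  have R: "regulars empty_graph = {}" by (simp add: regulars_def empty_graph_def)
  have "gm {} W {} empty_mem" for W by (simp add: gm_def empty_mem_def)
  moreover have d: "direct empty_mem {} = {}" by (simp add: direct_def empty_mem_def)
  moreover have "live (ntab empty_mem) = {}" "ttab empty_mem = Map.empty" by (simp_all add: live_def empty_mem_def)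
  then have "forest {} W {} H {} lv L (ntab empty_mem) (ncnt empty_mem) (ttab empty_mem) (tcnt empty_mem)" for W lv L
    by (simp add: forest_def env.core_def env.base_def env.contents_def env.reg_def env.roots_def env.own_def env.kids_ok_def)
  moreover have "vn {} lv L empty_mem" for lv L by (simp add: vn_def empty_mem_def)
  moreover have "tops empty_mem {} = {}" "dirs empty_mem {}" by (simp_all add: tops_def dirs_def)
  ultimately show ?thesis unfolding R full_def by (simp add: empty_graph_def)
qed

lemma insert_vertex_holds:
  assumes F: "holds G H m" and v: "v \<notin> verts G"
  shows "holds (apply_update (InsVertex v) G) H (m\<lparr>vtab := (vtab m)(v \<mapsto> \<lparr> inc = [], vnode = None \<rparr>)\<rparr>)"
proof -
  let ?m = "m\<lparr>vtab := (vtab m)(v \<mapsto> \<lparr> inc = [], vnode = None \<rparr>)\<rparr>"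
  let ?R = "regulars G"
  obtain lv L where g: "gm (edges G) (weight G) (verts G) m" and d: "dirs m (direct m ?R)" and vn: "vn ?R lv L m"
    and f: "forest (edges G) (weight G) ?R H (tops m (direct m ?R)) lv L (ntab m) (ncnt m) (ttab m) (tcnt m)"
    using F unfolding full_def by blast
  have noe: "v \<notin> e" if "e \<in> edges G" for e using gmD(2)[OF g that] v by blast
  then have "incident G v = {}" by (auto simp: incident_def)
  then have deg: "card (incident G v) \<noteq> 2" by simp
  have "incident (apply_update (InsVertex v) G) x = incident G x" for x by (simp add: incident_def)
  then have R: "regulars (apply_update (InsVertex v) G) = ?R" using deg by (auto simp: regulars_def)
  have vR: "v \<notin> ?R" using v by (simp add: regulars_def)
  have "gm (edges G) (weight G) (insert v (verts G)) ?m"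
    unfolding gm_def
  proof (intro conjI allI impI ballI)
    show "dom (vtab ?m) = insert v (verts G)" using gmD(1)[OF g] by simp
    show "e \<subseteq> insert v (verts G)" if "e \<in> edges G" for e using gmD(2)[OF g that] by blast
    fix k re assume "etab ?m k = Some re"
    then have k: "etab m k = Some re" by simp
    show "k < ecnt ?m" "fst (eends re) \<noteq> snd (eends re)" "eset re \<in> edges G" "ewt re = weight G (eset re)" using gmD(3)[OF g k] by simp_all
    show "k = k'" if "etab ?m k' = Some re'" "eset re = eset re'" for k' re' using gmD(4)[OF g k, of k' re'] that by simp
  next
    show "\<exists>k re. etab ?m k = Some re \<and> eset re = e" if "e \<in> edges G" for e using gmD(5)[OF g that] by simp
    fix x rv assume rv: "vtab ?m x = Some rv"
    show "distinct (inc rv)" "set (inc rv) = {k. \<exists>re. etab ?m k = Some re \<and> x \<in> eset re}"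
      using gmD(6)[OF g, of x rv] gmD(3)[OF g] noe rv by (auto split: if_splits)
  qed
  moreover have "vn ?R lv L ?m" using vn vR unfolding vn_def by auto
  moreover have "direct ?m ?R = direct m ?R" "tops ?m Q = tops m Q" "dirs ?m Q = dirs m Q" for Q by (simp_all add: direct_def tops_def dirs_def)
  moreover have "?R \<subseteq> verts G" by (auto simp: regulars_def)
  ultimately show ?thesis unfolding full_def R using d f by auto
qed

lemma process_runs:
  assumes F: "holds G H m" and s: "sound (edges G) (regulars G) H" and v: "valid_update G u"
    and s': "sound (edges (apply_update u G)) (regulars (apply_update u G)) H"
  shows "runs (process u s0) m (\<lambda>_ t m'. holds (apply_update u G) H m' \<and>
     t + 13 * card (live (ntab m')) \<le> 13 * card (live (ntab m)) + 6200 * (H + 1))"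
proof (cases u)
  case (InsVertex x)
  have n: "x \<notin> verts G" using v InsVertex by simp
  show ?thesis using insert_vertex_holds[OF F n] unfolding InsVertex by (simp add: runs_simps)
next
  case (InsEdge x y w)
  have R: "regulars G = {v \<in> verts G. card {e \<in> edges G. v \<in> e} = 2}" by (simp add: regulars_def incident_def)
  have u: "edges (apply_update u G) = insert {x, y} (edges G)" "weight (apply_update u G) = (weight G)({x, y} := w)"
    "verts (apply_update u G) = verts G" using InsEdge by simp_all
  have R': "regulars (apply_update u G) = {v \<in> verts G. card {e \<in> edges (apply_update u G). v \<in> e} = 2}"
    unfolding regulars_def incident_def u(3) ..
  have xy: "x \<in> verts G" "y \<in> verts G" "x \<noteq> y" "{x, y} \<notin> edges G" using v InsEdge by simp_all
  from insert_edge_runs[OF F s xy R u(1) R' s', of w] show ?thesis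
    unfolding u(2,3)[symmetric] by (simp only: InsEdge process.simps u(2,3))
qed

text \<open>The potential \<open>13 * card (live (ntab m))\<close> telescopes over the updates. It
  is 0 for the empty memory, so the amortised bounds add up to a bound on the actual time.\<close>

lemma foreach_process_runs:
  assumes adm: "admissible us" and H: "1 \<le> H" "2 * length us * 2 ^ H < 3 ^ H"
  shows "i \<le> length us \<Longrightarrow> holds (graph_of (take i us)) H m \<Longrightarrow>
    runs (foreach (drop i us) process ()) m (\<lambda>_ t m'. holds (graph_of us) H m' \<and>
      t + 13 * card (live (ntab m')) \<le> 13 * card (live (ntab m)) + (6200 * (H + 1) + 1) * (length us - i) + 1)"
proof (induction "length us - i" arbitrary: i m)
  case 0
  then have "i = length us" by simp
  then show ?case using 0 by (simp add: runs_simps)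
next
  case (Suc d)
  have i: "i < length us" using Suc(2) by simp
  have dr: "drop i us = us ! i # drop (Suc i) us" using i by (simp add: Cons_nth_drop_Suc)
  have so: "sound (edges (graph_of (take j us))) (regulars (graph_of (take j us))) H" if "j \<le> length us" for j
    by (rule sound_regulars[OF graph_ok[OF adm that] that H])
  have v: "valid_update (graph_of (take i us)) (us ! i)" using adm i by (simp add: admissible_def)
  have g: "graph_of (take (Suc i) us) = apply_update (us ! i) (graph_of (take i us))" by (rule graph_of_take_Suc[OF i])
  have run: "runs (process (us ! i) ()) m (\<lambda>_ t m'. holds (graph_of (take (Suc i) us)) H m' \<and>
     t + 13 * card (live (ntab m')) \<le> 13 * card (live (ntab m)) + 6200 * (H + 1))"
    unfolding g by (rule process_runs[OF Suc.prems(2) so v so[of "Suc i", unfolded g]]) (use i in auto)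
  have IH: "runs (foreach (drop (Suc i) us) process ()) m' (\<lambda>_ t m''. holds (graph_of us) H m'' \<and>
      t + 13 * card (live (ntab m'')) \<le> 13 * card (live (ntab m')) + (6200 * (H + 1) + 1) * d + 1)"
    if "holds (graph_of (take (Suc i) us)) H m'" for m'
  proof -
    have d: "d = length us - Suc i" using Suc.hyps(2) by simp
    show ?thesis using Suc.hyps(1)[OF d _ that] i unfolding d by simp
  qed
  have "runs (foreach (drop i us) process ()) m (\<lambda>_ t m'. holds (graph_of us) H m' \<and>
      t + 13 * card (live (ntab m')) \<le> 13 * card (live (ntab m)) + (6200 * (H + 1) + 1) * Suc d + 1)"
    unfolding dr foreach.simps runs_bind runs_tick
  proof (rule runs_mono[OF run], elim conjE)
    fix x :: unit and t m' assume h: "holds (graph_of (take (Suc i) us)) H m'"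
      and c: "t + 13 * card (live (ntab m')) \<le> 13 * card (live (ntab m)) + 6200 * (H + 1)"
    show "runs (foreach (drop (Suc i) us) process x) m' (\<lambda>_ t' m''. holds (graph_of us) H m'' \<and>
       1 + (t + t') + 13 * card (live (ntab m'')) \<le> 13 * card (live (ntab m)) + (6200 * (H + 1) + 1) * Suc d + 1)"
      using IH[OF h] c by (auto elim!: runs_mono)
  qed
  then show ?case unfolding Suc.hyps(2)[symmetric] .
qed

lemma holds_stored:
  assumes F: "holds G H m" and g: "graph_ok G n"
  shows "same_multigraph (stored_simplification m) (simplification G)" "stores_regular_forest G m"
proof -
  obtain lv L where gm: "gm (edges G) (weight G) (verts G) m" and d: "dirs m (direct m (regulars G))" and vn: "vn (regulars G) lv L m"
    and f: "forest (edges G) (weight G) (regulars G) H (tops m (direct m (regulars G))) lv L (ntab m) (ncnt m) (ttab m) (tcnt m)"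
    using F unfolding full_def by blast
  interpret stored_forest G m H lv L
    by unfold_locales (use gm d vn f g acyclic_on_regulars in \<open>auto simp: graph_ok_def\<close>)
  show "same_multigraph (stored_simplification m) (simplification G)" "stores_regular_forest G m"
    by (rule simplification_stored forest_stored)+
qed

text \<open>The inequality \<open>2 * l * 2 ^ H < 3 ^ H\<close> asks for (3/2)^H > 2l. The argument
  \<open>2 * l + 1\<close> makes it strict, and the last summand also yields
  \<open>1 \<le> H\<close>.\<close>

definition height :: "nat \<Rightarrow> nat" where
  "height l = nat \<lceil>log (3 / 2) (2 * real l + 1)\<rceil> + 1"

lemma height_power: "2 * l * 2 ^ height l < (3::nat) ^ height l"
proof -
  let ?x = "log (3 / 2) (2 * real l + 1)"
  have "?x \<le> real (height l)" unfolding height_def by linarith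
  then have "(3 / 2) powr ?x \<le> (3 / 2) powr real (height l)" by (rule powr_mono) simp
  then have "2 * real l + 1 \<le> (3 / 2) ^ height l" by (simp add: powr_realpow)
  then have "(2 * real l + 1) * 2 ^ height l \<le> 3 ^ height l" by (simp add: power_divide pos_le_divide_eq)
  moreover have "2 * real l * 2 ^ height l < (2 * real l + 1) * 2 ^ height l" by simp
  ultimately have "2 * real l * 2 ^ height l < 3 ^ height l" by linarith
  then have "real (2 * l * 2 ^ height l) < real (3 ^ height l)" by simp
  then show ?thesis using of_nat_less_iff by blast
qed

lemma ln_ge_half:
  fixes x :: real
  assumes "2 \<le> x"
  shows "1 / 2 \<le> ln x"
proof -
  have "ln (1 / 2) \<le> 1 / 2 - (1::real)" by (rule ln_le_minus_one) simp
  then have "1 / 2 \<le> ln (2::real)" using ln_inverse[of "2 :: real"] by simp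
  also have "ln 2 \<le> ln x" using assms by simp
  finally show ?thesis .
qed

text \<open>From 2l + 1 <= l^3 and ln (3/2) >= 1/3 the logarithm to base 3/2 is at most 9 ln l.
  Rounding up and the last summand of \<open>height\<close> add at most 2, which is at most 4 ln l
  because ln l >= 1/2.\<close>

lemma height_bound:
  assumes "2 \<le> l"
  shows "real (height l) \<le> 13 * ln (real l)"
proof -
  let ?n = "ln (real l)"
  have l: "2 \<le> real l" using assms by simp
  have n: "1 / 2 \<le> ?n" by (rule ln_ge_half[OF l])
  have "2 * real l + 1 \<le> real l ^ 3"
  proof -
    have "4 * real l \<le> real l ^ 3" using mult_mono[OF mult_mono[OF l l] order_refl, of "real l"] l by (simp add: power3_eq_cube mult.commute)
    then show ?thesis using l by linarith
  qed
  then have "ln (2 * real l + 1) \<le> ln (real l ^ 3)" using l by (subst ln_le_cancel_iff) auto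
  then have a: "ln (2 * real l + 1) \<le> 3 * ?n" using l by (simp add: ln_realpow)
  have "ln (2 / 3) \<le> 2 / 3 - (1::real)" by (rule ln_le_minus_one) simp
  then have b: "1 / 3 \<le> ln (3 / 2 :: real)" using ln_inverse[of "3 / 2 :: real"] by simp
  have "ln (2 * real l + 1) \<le> 9 * ?n * (1 / 3)" using a by simp
  also have "\<dots> \<le> 9 * ?n * ln (3 / 2)" by (rule mult_left_mono[OF b]) (use n in simp)
  finally have "log (3 / 2) (2 * real l + 1) \<le> 9 * ?n" unfolding log_def using b by (simp add: divide_le_eq)
  moreover have "0 \<le> log (3 / 2) (2 * real l + 1)" using l by simp
  ultimately have "real (height l) \<le> 9 * ?n + 2" unfolding height_def by linarith
  then show ?thesis using n by linarith
qed

definition time_bound :: "nat \<Rightarrow> real" where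
  "time_bound l = real ((6200 * (height l + 1) + 1) * l + 1)"

text \<open>The constant: 6200 * 13 = 80600 from the height, and the remaining 6202 is at most 12404
  ln l since ln l >= 1/2; the sum 93004 is rounded up.\<close>

lemma time_bound_bigo: "time_bound \<in> O(\<lambda>l. real l * ln (real l))"
proof (rule bigoI[of _ 100000])
  show "\<forall>\<^sub>F l in sequentially. norm (time_bound l) \<le> 100000 * norm (real l * ln (real l))"
    using eventually_ge_at_top[of 2]
  proof eventually_elim
    case (elim l)
    let ?n = "ln (real l)"
    have l: "2 \<le> real l" using elim by simp
    have n: "1 / 2 \<le> ?n" by (rule ln_ge_half[OF l])
    have "6200 * (real (height l) + 1) + 2 \<le> 6200 * (13 * ?n + 1) + 2" using height_bound[OF elim] by simp
    also have "\<dots> \<le> 100000 * ?n" using n by (simp add: algebra_simps)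
    finally have "6200 * (real (height l) + 1) + 2 \<le> 100000 * ?n" .
    then have "real l * (6200 * (real (height l) + 1) + 2) \<le> real l * (100000 * ?n)" by (rule mult_left_mono) simp
    moreover have "time_bound l \<le> real l * (6200 * (real (height l) + 1) + 2)" using l by (simp add: time_bound_def algebra_simps)
    moreover have "0 \<le> time_bound l" by (simp add: time_bound_def)
    moreover have "0 \<le> real l * ?n" using l n by simp
    ultimately show ?case by simp
  qed
qed

theorem theorem2:
  shows "\<exists>T :: nat \<Rightarrow> real.
    T \<in> O(\<lambda>l. real l * ln (real l)) \<and>
    (\<forall>us. admissible us \<longrightarrow>
      (\<exists>t m. topology_tree_algorithm us empty_mem = Some ((), t, m) \<and>
        real t \<le> T (length us) \<and>
        same_multigraph (stored_simplification m) (simplification (graph_of us)) \<and>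
        stores_regular_forest (graph_of us) m))"
proof (intro exI[of _ time_bound] conjI allI impI)
  show "time_bound \<in> O(\<lambda>l. real l * ln (real l))" by (rule time_bound_bigo)
  fix us assume adm: "admissible us"
  let ?H = "height (length us)"
  have H: "1 \<le> ?H" by (simp add: height_def)
  have "holds (graph_of (take 0 us)) ?H empty_mem" using holds_empty by (simp add: graph_of_def)
  from foreach_process_runs[OF adm H height_power _ this]
  have "runs (topology_tree_algorithm us) empty_mem (\<lambda>_ t m'. holds (graph_of us) ?H m' \<and> t \<le> (6200 * (?H + 1) + 1) * length us + 1)"
    unfolding topology_tree_algorithm_def by (auto elim!: runs_mono simp: empty_mem_def live_def)
  then obtain t m where r: "topology_tree_algorithm us empty_mem = Some ((), t, m)" "holds (graph_of us) ?H m"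
    "t \<le> (6200 * (?H + 1) + 1) * length us + 1" unfolding runs_def by auto
  have "graph_ok (graph_of us) (length us)" using graph_ok[OF adm, of "length us"] by simp
  note st = holds_stored[OF r(2) this]
  have "real t \<le> time_bound (length us)" unfolding time_bound_def using r(3) by (rule of_nat_mono)
  then show "\<exists>t m. topology_tree_algorithm us empty_mem = Some ((), t, m) \<and> real t \<le> time_bound (length us) \<and>
      same_multigraph (stored_simplification m) (simplification (graph_of us)) \<and> stores_regular_forest (graph_of us) m"
    using r(1) st by blast
qed


end
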